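(* Let $n\ge 2$, $N\in\mathbb{N}=\{1,2,\dots\}$, and let $\frac{n-2}{n-1}\le p<\infty$ (when $n=2$ this is to be read as $0<p<\infty$). Then $$\beta(N,p)=\min_{j:\,0\le j\le N} b_{j,N}(p),$$ where $$b_{0,N}(p):=-1-(N-1)p,\qquad b_{j,N}(p):=\max\{-1-(N+j-1)p,\ -n-(N-j-n+1)p\}\quad (j=1,\dots,N).$$ In particular, when $n\ge 3$, $$\beta(N,p)=\begin{cases}-1-Np, & \text{if } \frac{n-2}{n-1}\le p<\frac{n-1}{n},\\[2pt] -n-(N-n)p, & \text{if } \frac{n-1}{n}\le p<1,\\[2pt] -1-(N-1)p, & \text{if } p\ge 1.\end{cases}$$
   Context: $\mathbb{B}$ is the open unit ball of $\mathbb{R}^n$. A function $u:\mathbb{B}\to\mathbb{C}$ is $N$-harmonic (polyharmonic of order $N$) if it is $2N$ times continuously differentiable and $\Delta^N u=0$ in $\mathbb{B}$; $\mathrm{PH}_N(\mathbb{B})$ denotes the linear space of all $N$-harmonic functions on $\mathbb{B}$. For $0<p<\infty$ and $\alpha\in\mathbb{R}$, $L^p_\alpha(\mathbb{B})$ is the space of measurable $f:\mathbb{B}\to\mathbb{C}$ with $\int_{\mathbb{B}}|f(x)|^p\,[\mathrm{dist}(x,\partial\mathbb{B})]^\alpha\,dV(x)<\infty$, where $dV$ is Lebesgue measure. For a Borel measurable $u:\mathbb{B}\to\mathbb{C}$ put $\beta_p(u):=\inf\{\alpha\in\mathbb{R}: u\in L^p_\alpha(\mathbb{B})\}$ (with $\beta_p(u):=+\infty$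 if $u\notin L^p_\alpha(\mathbb{B})$ for every $\alpha\in\mathbb{R}$). The critical integrability type is $\beta(N,p):=\inf\{\beta_p(u): u\in\mathrm{PH}_N(\mathbb{B})\setminus\{0\}\}$. *)

theory Defs
  imports "HOL-Analysis.Analysis"
begin

text \<open>
  Functions on the open unit ball are represented by total functions on the ambient space;
  none of the notions below depends on the values outside \<^term>\<open>ball 0 1\<close>.
\<close>

definition dir_deriv ::
  "'a::euclidean_space \<Rightarrow> ('a \<Rightarrow> complex) \<Rightarrow> 'a \<Rightarrow> complex" where
  "dir_deriv v f x = frechet_derivative f (at x) v"

text \<open>
  Intended for open \<open>S\<close> only, since derivatives are taken with respect to the full
  neighbourhood filter.
\<close>

primrec continuously_differentiable_on ::
  "nat \<Rightarrow> ('a::euclidean_space \<Rightarrow> complex) \<Rightarrow> 'a set \<Rightarrow> bool" where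
  "continuously_differentiable_on 0 f S \<longleftrightarrow> continuous_on S f"
| "continuously_differentiable_on (Suc k) f S \<longleftrightarrow>
     (\<forall>x\<in>S. f differentiable (at x)) \<and>
     (\<forall>b\<in>Basis. continuously_differentiable_on k (dir_deriv b f) S)"

definition laplacian :: "('a::euclidean_space \<Rightarrow> complex) \<Rightarrow> 'a \<Rightarrow> complex" where
  "laplacian f x = (\<Sum>b\<in>Basis. dir_deriv b (dir_deriv b f) x)"

definition polyharmonic :: "nat \<Rightarrow> ('a::euclidean_space \<Rightarrow> complex) set" where
  "polyharmonic N =
     {u. continuously_differentiable_on (2 * N) u (ball 0 1) \<and>
         (\<forall>x\<in>ball 0 1. (laplacian ^^ N) u x = 0)}"

definition weighted_Lp :: "real \<Rightarrow> real \<Rightarrow> ('a::euclidean_space \<Rightarrow> complex) set" where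
  "weighted_Lp p \<alpha> =
     {f. f \<in> borel_measurable (lebesgue_on (ball 0 1)) \<and>
         (\<integral>\<^sup>+ x. ennreal (norm (f x) powr p * infdist x (frontier (ball 0 1)) powr \<alpha>)
            \<partial>lebesgue_on (ball 0 1)) < \<infinity>}"

text \<open>In \<^typ>\<open>ereal\<close> the infimum of the empty set is \<open>\<infinity>\<close>, as required here.\<close>

definition integrability_type :: "real \<Rightarrow> ('a::euclidean_space \<Rightarrow> complex) \<Rightarrow> ereal" where
  "integrability_type p u = Inf (ereal ` {\<alpha>. u \<in> weighted_Lp p \<alpha>})"

text \<open>
  The type argument is the ambient Euclidean space. The zero element of the space of
  \<open>N\<close>-harmonic functions is any function that vanishes on the ball.
\<close>

definition critical_integrability_type ::
  "'a::euclidean_space itself \<Rightarrow> nat \<Rightarrow> real \<Rightarrow> ereal" where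
  "critical_integrability_type _ N p =
     Inf (integrability_type p `
       {u :: 'a \<Rightarrow> complex. u \<in> polyharmonic N \<and> (\<exists>x\<in>ball 0 1. u x \<noteq> 0)})"

definition b_exponent :: "nat \<Rightarrow> nat \<Rightarrow> nat \<Rightarrow> real \<Rightarrow> real" where
  "b_exponent n j N p =
     (if j = 0 then - 1 - (real N - 1) * p
      else max (- 1 - (real N + real j - 1) * p)
               (- real n - (real N - real j - real n + 1) * p))"

end

theory Submission
  imports Defs "HOL-Real_Asymp.Real_Asymp"
begin

text \<open>
  Write \<open>n\<close> for the dimension, \<open>w = 1 - |x|\<^sup>2\<close> and \<open>d = 1 - |x|\<close>. By Pizzetti's expansion the moments of an
  \<open>N\<close>-harmonic \<open>u\<close> against powers of \<open>\<rho> - |x|\<^sup>2\<close> times solid harmonics are polynomials in \<open>\<rho>\<close> up to a power;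
  if \<open>|u| d\<^sup>\<gamma>\<close> is integrable for some \<open>\<gamma> < -1\<close>, they vanish at \<open>\<rho> = 1\<close> to an order that forces
  \<open>u = w v\<close> with \<open>v\<close> of order \<open>N - 1\<close>. For \<open>p > 1\<close>, Young's inequality lets one divide \<open>N\<close> times as soon as
  \<open>\<alpha> < -1 - (N-1)p\<close>, so \<open>u = 0\<close>. For \<open>p \<le> 1\<close>, a mean value inequality turns \<open>u \<in> L\<^sup>p\<^sub>\<alpha>\<close> into a growth bound
  and then into weighted \<open>L\<^sup>1\<close> integrability, so that \<open>u = w^(N-j) v\<close> with \<open>j\<close> least possible; the remaining factor
  \<open>v\<close> of order \<open>j\<close> lies below the exponent \<open>-1 - (2j-1)p\<close>. Every derivative costs one power of \<open>d\<close>, and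
  \<open>\<Delta>^(j-1) v\<close> is harmonic with \<open>p\<close>-th power of its gradient subharmonic and integrable against \<open>d\<close> to a
  power below \<open>-1\<close>; hence it is zero, and \<open>v = 0\<close> by induction on \<open>j\<close>.

  The bounds are attained by \<open>w^(N-1)\<close> and by \<open>w^(N+j-1) |x - e|^(2-n-2j)\<close> with \<open>|e| = 1\<close>. The latter arise
  from the Poisson kernel, the case \<open>j = N = 1\<close>, by repeated application of \<open>f \<mapsto> w (x \<bullet> \<nabla>f)\<close>, which raises
  the order by at most one.
\<close>

section \<open>Smooth functions and the Laplacian\<close>

text \<open>All integrals are Lebesgue integrals over the ball: the weights (\<rho> - |x|^2)_+^a
  stand in for spheres, so neither surface measure nor polar coordinates occur. Passing from u to u
  / w then becomes a first-order linear differential equation in \<rho>. The threshold -1 for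
  \<gamma> appears because it makes the second differences of the moments with step t near \<rho> =
  1 of size o(t^2).

  The maximum in \<open>b_exponent\<close> comes from an alternative. For p <= 1 the growth bound
  gives the L^1 exponent \<gamma> = (\<alpha> + n)/p - n, and k divisions by w require \<gamma> <
  -k. If j is least, failure of one more division reads \<alpha> >= -n - (N - j - n + 1) p, which is
  the second entry; so an \<alpha> below the maximum lies below the first entry -1 - (N + j - 1) p,
  and the N - j divisions turn this into the bound -1 - (2 j - 1) p for the remaining factor. The
  lower bound on p is the Stein-Weiss exponent for powers of the gradient of a harmonic
  function.\<close>

abbreviation Ck :: "nat \<Rightarrow> ('a::euclidean_space \<Rightarrow> complex) \<Rightarrow> 'a set \<Rightarrow> bool" where
  "Ck \<equiv> continuously_differentiable_on"

section \<open>Locality of derivatives and of the classes \<open>Ck\<close>\<close>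

lemma dir_deriv_eq: "(f has_derivative f') (at x) \<Longrightarrow> dir_deriv b f x = f' b"
  unfolding dir_deriv_def using frechet_derivative_at by metis

lemma has_derivative_cong_open:
  assumes "open S" "x \<in> S" "\<And>y. y \<in> S \<Longrightarrow> f y = g y"
  shows "(f has_derivative f') (at x) \<longleftrightarrow> (g has_derivative f') (at x)"
  using assms by (metis has_derivative_transform_within_open)

text \<open>Valid also at points where f is not differentiable: \<open>frechet_derivative\<close> is
  a choice that depends only on the predicate \<open>has_derivative\<close>, and this predicate sees
  only the germ at x. The congruence can therefore be iterated through \<open>laplacian ^^ N\<close>
  with no regularity in hand.\<close>

lemma dir_deriv_cong:
  assumes "open S" "x \<in> S" "\<And>y. y \<in> S \<Longrightarrow> f y = g y"
  shows "dir_deriv b f x = dir_deriv b g x"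
  unfolding dir_deriv_def frechet_derivative_def
  using has_derivative_cong_open[OF assms] by simp

lemma differentiable_cong_open:
  assumes "open S" "x \<in> S" "\<And>y. y \<in> S \<Longrightarrow> f y = g y"
  shows "f differentiable at x \<longleftrightarrow> g differentiable at x"
  unfolding differentiable_def using has_derivative_cong_open[OF assms] by simp

lemma laplacian_cong:
  assumes "open S" "x \<in> S" "\<And>y. y \<in> S \<Longrightarrow> f y = g y"
  shows "laplacian f x = laplacian g x"
  unfolding laplacian_def
  by (intro sum.cong refl dir_deriv_cong[OF assms(1,2)] dir_deriv_cong[OF assms(1)]) (use assms in auto)

lemma laplacian_pow_cong:
  assumes "open S" "x \<in> S" "\<And>y. y \<in> S \<Longrightarrow> f y = g y"
  shows "(laplacian ^^ N) f x = (laplacian ^^ N) g x"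
  using assms(2)
proof (induction N arbitrary: x)
  case 0 then show ?case using assms by simp
next
  case (Suc N)
  show ?case unfolding funpow.simps o_def by (rule laplacian_cong[OF assms(1) Suc.prems Suc.IH])
qed

lemma Ck_cong:
  assumes "open S" "Ck k f S" "\<And>y. y \<in> S \<Longrightarrow> f y = g y"
  shows "Ck k g S"
  using assms(2,3)
proof (induction k arbitrary: f g)
  case 0 then show ?case using continuous_on_cong by fastforce
next
  case (Suc k)
  have "\<forall>x\<in>S. g differentiable at x"
    using Suc.prems(1) differentiable_cong_open[OF assms(1) _ Suc.prems(2)] by simp
  moreover have "Ck k (dir_deriv b g) S" if "b \<in> Basis" for b
  proof (rule Suc.IH[of "dir_deriv b f"])
    show "Ck k (dir_deriv b f) S" using Suc.prems(1) that by simp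
    show "dir_deriv b f y = dir_deriv b g y" if "y \<in> S" for y
      by (rule dir_deriv_cong[OF assms(1) that Suc.prems(2)])
  qed
  ultimately show ?case by simp
qed

lemma Ck_subset: "Ck k f S \<Longrightarrow> T \<subseteq> S \<Longrightarrow> Ck k f T"
  by (induction k arbitrary: f) (auto intro: continuous_on_subset)

lemma Ck_continuous: "Ck k f S \<Longrightarrow> continuous_on S f"
  by (cases k) (simp_all add: continuous_at_imp_continuous_on differentiable_imp_continuous_within)

lemma Ck_Suc_imp: "Ck (Suc k) f S \<Longrightarrow> Ck k f S"
proof (induction k arbitrary: f)
  case 0 then show ?case using Ck_continuous[OF 0] by simp
next
  case (Suc k)
  have "Ck k (dir_deriv b f) S" if "b \<in> Basis" for b
    by (rule Suc.IH) (use Suc.prems that in simp)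
  moreover have "\<forall>x\<in>S. f differentiable at x" using Suc.prems by simp
  ultimately show ?case by simp
qed

lemma Ck_le: "Ck k f S \<Longrightarrow> j \<le> k \<Longrightarrow> Ck j f S"
  by (induction k) (auto simp: le_Suc_eq dest: Ck_Suc_imp simp del: continuously_differentiable_on.simps)

lemma Ck_differentiable: "Ck k f S \<Longrightarrow> 1 \<le> k \<Longrightarrow> x \<in> S \<Longrightarrow> f differentiable at x"
  by (cases k) auto

lemma Ck_dir_deriv: "Ck (Suc k) f S \<Longrightarrow> b \<in> Basis \<Longrightarrow> Ck k (dir_deriv b f) S"
  by simp

lemma Ck_Un_open:
  assumes "open S" "open T" "Ck k f S" "Ck k f T" shows "Ck k f (S \<union> T)"
  using assms(3,4)
  by (induction k arbitrary: f) (auto intro: continuous_on_open_Un assms)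

text \<open>The derivatives in \<open>Ck\<close> refer to full neighbourhoods of single points, so
  smoothness can be checked on small balls, which is where convolution formulas are
  available.\<close>

lemma Ck_local:
  assumes "\<And>x. x \<in> S \<Longrightarrow> \<exists>T. open T \<and> x \<in> T \<and> Ck k f T"
  shows "Ck k f S"
  using assms
proof (induction k arbitrary: f)
  case 0
  have "isCont f x" if "x \<in> S" for x
    using 0[OF that] by (auto simp: continuous_on_eq_continuous_at)
  then show ?case by (simp add: continuous_at_imp_continuous_on)
next
  case (Suc k)
  have "Ck k (dir_deriv b f) S" if "b \<in> Basis" for b
  proof (rule Suc.IH)
    show "\<exists>T. open T \<and> x \<in> T \<and> Ck k (dir_deriv b f) T" if "x \<in> S" for x
      using Suc.prems[OF that] \<open>b \<in> Basis\<close> by auto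
  qed
  moreover have "f differentiable at x" if "x \<in> S" for x
    using Suc.prems[OF that] by auto
  ultimately show ?case by simp
qed

section \<open>Calculus rules for \<open>dir_deriv\<close> and \<open>Ck\<close>\<close>

lemma dir_deriv_has: "f differentiable at x \<Longrightarrow> (f has_derivative (\<lambda>v. dir_deriv v f x)) (at x)"
  unfolding dir_deriv_def by (simp add: frechet_derivative_works)

lemma dir_deriv_const [simp]: "dir_deriv b (\<lambda>x. c) = (\<lambda>x. 0)"
  by (rule ext, rule dir_deriv_eq[where f' = "\<lambda>_. 0"]) simp

lemma dir_deriv_add:
  "f differentiable at x \<Longrightarrow> g differentiable at x \<Longrightarrow>
    dir_deriv b (\<lambda>x. f x + g x) x = dir_deriv b f x + dir_deriv b g x"
  by (rule dir_deriv_eq[OF has_derivative_add[OF dir_deriv_has dir_deriv_has]])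

lemma dir_deriv_diff:
  "f differentiable at x \<Longrightarrow> g differentiable at x \<Longrightarrow>
    dir_deriv b (\<lambda>x. f x - g x) x = dir_deriv b f x - dir_deriv b g x"
  by (rule dir_deriv_eq[OF has_derivative_diff[OF dir_deriv_has dir_deriv_has]])

lemma dir_deriv_mult:
  "f differentiable at x \<Longrightarrow> g differentiable at x \<Longrightarrow>
    dir_deriv b (\<lambda>x. f x * g x) x = f x * dir_deriv b g x + dir_deriv b f x * g x"
  by (rule dir_deriv_eq[OF has_derivative_mult[OF dir_deriv_has dir_deriv_has]])

lemma dir_deriv_cmult:
  "f differentiable at x \<Longrightarrow> dir_deriv b (\<lambda>x. c * f x) x = c * dir_deriv b f x"
  using dir_deriv_mult[of "\<lambda>_. c" x f b] by simp

lemma dir_deriv_sum: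
  "(\<And>i. i \<in> I \<Longrightarrow> f i differentiable at x) \<Longrightarrow>
    dir_deriv b (\<lambda>x. \<Sum>i\<in>I. f i x) x = (\<Sum>i\<in>I. dir_deriv b (f i) x)"
  by (rule dir_deriv_eq[OF has_derivative_sum[OF dir_deriv_has]])

lemma Ck_const [simp]: "Ck k (\<lambda>x. c) S"
  by (induction k arbitrary: c) auto

lemma Ck_add:
  assumes "open S" "Ck k f S" "Ck k g S" shows "Ck k (\<lambda>x. f x + g x) S"
  using assms(2,3)
proof (induction k arbitrary: f g)
  case 0 then show ?case by (simp add: continuous_on_add)
next
  case (Suc k)
  then have *: "\<forall>x\<in>S. f differentiable at x" "\<forall>x\<in>S. g differentiable at x" by auto
  have "Ck k (dir_deriv b (\<lambda>x. f x + g x)) S" if b: "b \<in> Basis" for b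
  proof (rule Ck_cong[OF assms(1)])
    show "Ck k (\<lambda>x. dir_deriv b f x + dir_deriv b g x) S"
      by (rule Suc.IH) (use Suc.prems b in auto)
  qed (use * dir_deriv_add in metis)
  then show ?case using * by (auto intro: differentiable_add)
qed

lemma Ck_mult:
  assumes "open S" "Ck k f S" "Ck k g S" shows "Ck k (\<lambda>x. f x * g x) S"
  using assms(2,3)
proof (induction k arbitrary: f g)
  case 0 then show ?case by (simp add: continuous_on_mult)
next
  case (Suc k)
  then have *: "\<forall>x\<in>S. f differentiable at x" "\<forall>x\<in>S. g differentiable at x" by auto
  have "Ck k (dir_deriv b (\<lambda>x. f x * g x)) S" if b: "b \<in> Basis" for b
  proof (rule Ck_cong[OF assms(1)])
    show "Ck k (\<lambda>x. f x * dir_deriv b g x + dir_deriv b f x * g x) S"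
      by (intro Ck_add assms Suc.IH Ck_Suc_imp[OF Suc.prems(1)] Ck_Suc_imp[OF Suc.prems(2)] Ck_dir_deriv[OF Suc.prems(1) b] Ck_dir_deriv[OF Suc.prems(2) b])
  qed (use * dir_deriv_mult in metis)
  then show ?case using * by (auto intro: differentiable_mult)
qed

lemma Ck_cmult: "open S \<Longrightarrow> Ck k f S \<Longrightarrow> Ck k (\<lambda>x. c * f x) S"
  by (rule Ck_mult) auto

lemma Ck_minus: "open S \<Longrightarrow> Ck k f S \<Longrightarrow> Ck k (\<lambda>x. - f x) S"
  using Ck_cmult[of S k f "-1"] by simp

lemma Ck_diff: "open S \<Longrightarrow> Ck k f S \<Longrightarrow> Ck k g S \<Longrightarrow> Ck k (\<lambda>x. f x - g x) S"
  using Ck_add[of S k f "\<lambda>x. - g x"] Ck_minus by fastforce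

lemma Ck_sum:
  assumes "open S" "\<And>i. i \<in> I \<Longrightarrow> Ck k (f i) S" shows "Ck k (\<lambda>x. \<Sum>i\<in>I. f i x) S"
  using assms(2) by (induction I rule: infinite_finite_induct) (auto intro: Ck_add assms(1))

lemma Ck_power: "open S \<Longrightarrow> Ck k f S \<Longrightarrow> Ck k (\<lambda>x. f x ^ j) S"
  by (induction j) (auto intro: Ck_mult)

lemma has_derivative_inner_of_real:
  "((\<lambda>x. complex_of_real (x \<bullet> c)) has_derivative (\<lambda>v. of_real (v \<bullet> c))) (at x)"
  by (auto intro!: derivative_eq_intros)

lemma dir_deriv_inner [simp]: "dir_deriv b (\<lambda>x. complex_of_real (x \<bullet> c)) = (\<lambda>x. of_real (b \<bullet> c))"
  by (rule ext) (rule dir_deriv_eq[OF has_derivative_inner_of_real])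

lemma Ck_inner [simp]: "Ck k (\<lambda>x. complex_of_real (x \<bullet> c)) S"
  by (cases k) (auto intro!: continuous_intros differentiableI has_derivative_inner_of_real)

lemma has_derivative_nsq:
  "((\<lambda>x. complex_of_real ((x - c) \<bullet> (x - c))) has_derivative (\<lambda>v. of_real (2 * (v \<bullet> (x - c))))) (at x)"
  by (auto intro!: derivative_eq_intros ext simp: inner_commute)

lemma dir_deriv_nsq:
  "dir_deriv b (\<lambda>x. complex_of_real ((x - c) \<bullet> (x - c))) = (\<lambda>x. 2 * (of_real (x \<bullet> b) - of_real (c \<bullet> b)))"
  by (rule ext) (subst dir_deriv_eq[OF has_derivative_nsq], simp add: inner_commute inner_diff_left inner_diff_right)

lemma Ck_nsq:
  assumes "open S" shows "Ck k (\<lambda>x. complex_of_real ((x - c) \<bullet> (x - c))) S"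
proof (cases k)
  case 0 then show ?thesis by (auto intro!: continuous_intros)
next
  case (Suc j)
  have "Ck j (\<lambda>x. 2 * (of_real (x \<bullet> b) - of_real (c \<bullet> b))) S" for b
    by (intro Ck_cmult Ck_diff assms) auto
  then show ?thesis using Suc
    by (simp add: dir_deriv_nsq) (auto intro!: differentiableI has_derivative_nsq)
qed

lemma has_derivative_compose_real:
  fixes \<gamma> :: "'a::euclidean_space \<Rightarrow> real"
  assumes "(\<lambda>x. complex_of_real (\<gamma> x)) differentiable at x" "(\<phi> has_real_derivative d) (at (\<gamma> x))"
  shows "((\<lambda>x. complex_of_real (\<phi> (\<gamma> x))) has_derivative
           (\<lambda>v. of_real d * dir_deriv v (\<lambda>x. of_real (\<gamma> x)) x)) (at x)"
proof -
  have 1: "((\<lambda>x. complex_of_real (\<gamma> x)) has_derivative (\<lambda>v. dir_deriv v (\<lambda>x. of_real (\<gamma> x)) x)) (at x)"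
    by (rule dir_deriv_has[OF assms(1)])
  have 2: "(\<gamma> has_derivative (\<lambda>v. Re (dir_deriv v (\<lambda>x. of_real (\<gamma> x)) x))) (at x)"
    using has_derivative_Re[OF 1] by simp
  \<comment> \<open>The imaginary part of the embedded function is constantly 0, so its derivative
    vanishes; hence the directional derivatives of \<gamma> are real and the real chain rule can be
    lifted back.\<close>
  have "((\<lambda>x. Im (complex_of_real (\<gamma> x))) has_derivative (\<lambda>v. Im (dir_deriv v (\<lambda>x. of_real (\<gamma> x)) x))) (at x)"
    by (rule has_derivative_Im[OF 1])
  then have "((\<lambda>x. 0::real) has_derivative (\<lambda>v. Im (dir_deriv v (\<lambda>x. of_real (\<gamma> x)) x))) (at x)" by simp
  then have "(\<lambda>v. Im (dir_deriv v (\<lambda>x. of_real (\<gamma> x)) x)) = (\<lambda>v. 0)"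
    using has_derivative_unique has_derivative_const by blast
  then have im: "complex_of_real (Re (dir_deriv v (\<lambda>x. of_real (\<gamma> x)) x)) = dir_deriv v (\<lambda>x. of_real (\<gamma> x)) x" for v
    by (simp add: complex_eq_iff fun_eq_iff)
  have "((\<lambda>x. \<phi> (\<gamma> x)) has_derivative (\<lambda>v. d * Re (dir_deriv v (\<lambda>x. of_real (\<gamma> x)) x))) (at x)"
    using diff_chain_at[OF 2 assms(2)[unfolded has_field_derivative_def]] by (simp add: o_def mult.commute)
  from has_derivative_of_real[OF this, where 'a=complex]
  show ?thesis by (simp add: im)
qed

lemma dir_deriv_compose_real:
  assumes "(\<lambda>x. complex_of_real (\<gamma> x)) differentiable at x" "(\<phi> has_real_derivative d) (at (\<gamma> x))"
  shows "dir_deriv b (\<lambda>x. complex_of_real (\<phi> (\<gamma> x))) x = of_real d * dir_deriv b (\<lambda>x. of_real (\<gamma> x)) x"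
  by (rule dir_deriv_eq[OF has_derivative_compose_real[OF assms]])

text \<open>The exponent is generalised in the induction because each derivative produces the power
  q - 1 times a derivative of \<gamma>.\<close>

lemma Ck_powr:
  fixes \<gamma> :: "'a::euclidean_space \<Rightarrow> real"
  assumes "open S" "Ck k (\<lambda>x. complex_of_real (\<gamma> x)) S" "\<And>x. x \<in> S \<Longrightarrow> \<gamma> x > 0"
  shows "Ck k (\<lambda>x. complex_of_real (\<gamma> x powr q)) S"
  using assms(2)
proof (induction k arbitrary: q)
  case 0
  have "continuous_on S \<gamma>" using continuous_on_Re[of S "\<lambda>x. complex_of_real (\<gamma> x)"] 0 by simp
  then have "continuous_on S (\<lambda>x. \<gamma> x powr q)"
    by (rule continuous_on_powr) (use assms(3) in \<open>force+\<close>)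
  then show ?case by (auto intro: continuous_intros)
next
  case (Suc k)
  have d: "(\<lambda>x. complex_of_real (\<gamma> x)) differentiable at x" if "x \<in> S" for x using Suc.prems that by auto
  have e: "((\<lambda>t. t powr q) has_real_derivative (q * \<gamma> x powr (q - 1))) (at (\<gamma> x))" if "x \<in> S" for x
    using assms(3)[OF that] by (auto intro!: derivative_eq_intros)
  have "Ck k (dir_deriv b (\<lambda>x. complex_of_real (\<gamma> x powr q))) S" if b: "b \<in> Basis" for b
  proof (rule Ck_cong[OF assms(1)])
    show "Ck k (\<lambda>x. (q * complex_of_real (\<gamma> x powr (q - 1))) * dir_deriv b (\<lambda>x. complex_of_real (\<gamma> x)) x) S"
      by (intro Ck_mult Ck_cmult assms(1) Suc.IH Ck_Suc_imp[OF Suc.prems]) (use Suc.prems b in auto)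
  qed (subst dir_deriv_compose_real[OF d e], auto)
  then show ?case
    using has_derivative_compose_real[OF d e] by (auto simp: differentiable_def)
qed

section \<open>Chain rule, product rule and linearity of the Laplacian\<close>

lemma laplacian_compose_real:
  fixes \<gamma> :: "'a::euclidean_space \<Rightarrow> real"
  assumes "open S" "Ck 2 (\<lambda>x. complex_of_real (\<gamma> x)) S" "x \<in> S"
    and 1: "\<And>y. y \<in> S \<Longrightarrow> (\<phi> has_real_derivative \<phi>' (\<gamma> y)) (at (\<gamma> y))"
    and 2: "(\<phi>' has_real_derivative c) (at (\<gamma> x))"
  shows "laplacian (\<lambda>x. complex_of_real (\<phi> (\<gamma> x))) x =
     of_real (\<phi>' (\<gamma> x)) * laplacian (\<lambda>x. of_real (\<gamma> x)) x +
     of_real c * (\<Sum>b\<in>Basis. (dir_deriv b (\<lambda>x. of_real (\<gamma> x)) x)\<^sup>2)"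
proof -
  let ?G = "\<lambda>x. complex_of_real (\<gamma> x)"
  have d: "?G differentiable at y" if "y \<in> S" for y using assms(2) that by (auto simp: numeral_2_eq_2)
  have d2: "dir_deriv b ?G differentiable at x" if "b \<in> Basis" for b
    using assms(2,3) that by (auto simp: numeral_2_eq_2)
  have "dir_deriv b (dir_deriv b (\<lambda>x. complex_of_real (\<phi> (\<gamma> x)))) x =
      of_real (\<phi>' (\<gamma> x)) * dir_deriv b (dir_deriv b ?G) x + of_real c * (dir_deriv b ?G x)\<^sup>2"
    if b: "b \<in> Basis" for b
  proof -
    have "dir_deriv b (dir_deriv b (\<lambda>x. complex_of_real (\<phi> (\<gamma> x)))) x
       = dir_deriv b (\<lambda>x. of_real (\<phi>' (\<gamma> x)) * dir_deriv b ?G x) x"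
      by (rule dir_deriv_cong[OF assms(1,3)]) (rule dir_deriv_compose_real[OF d 1])
    also have "\<dots> = of_real (\<phi>' (\<gamma> x)) * dir_deriv b (dir_deriv b ?G) x
         + dir_deriv b (\<lambda>x. of_real (\<phi>' (\<gamma> x))) x * dir_deriv b ?G x"
      using has_derivative_compose_real[OF d[OF assms(3)] 2]
      by (intro dir_deriv_mult d2 b) (auto simp: differentiable_def)
    finally show ?thesis by (simp add: dir_deriv_compose_real[OF d[OF assms(3)] 2] power2_eq_square)
  qed
  then show ?thesis by (simp add: laplacian_def sum.distrib sum_distrib_left)
qed

lemma Ck2D:
  assumes "Ck 2 f S" "x \<in> S"
  shows "f differentiable at x" "b \<in> Basis \<Longrightarrow> dir_deriv b f differentiable at x"
  using assms by (auto simp: numeral_2_eq_2)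

lemma laplacian_mult:
  assumes "open S" "Ck 2 f S" "Ck 2 g S" "x \<in> S"
  shows "laplacian (\<lambda>x. f x * g x) x = f x * laplacian g x + laplacian f x * g x
     + 2 * (\<Sum>b\<in>Basis. dir_deriv b f x * dir_deriv b g x)"
proof -
  note f = Ck2D[OF assms(2)] and g = Ck2D[OF assms(3)]
  have "dir_deriv b (dir_deriv b (\<lambda>x. f x * g x)) x = f x * dir_deriv b (dir_deriv b g) x
     + dir_deriv b (dir_deriv b f) x * g x + 2 * (dir_deriv b f x * dir_deriv b g x)"
    if b: "b \<in> Basis" for b
  proof -
    have "dir_deriv b (dir_deriv b (\<lambda>x. f x * g x)) x
       = dir_deriv b (\<lambda>x. f x * dir_deriv b g x + dir_deriv b f x * g x) x"
      by (rule dir_deriv_cong[OF assms(1,4)]) (rule dir_deriv_mult[OF f(1) g(1)])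
    also have "\<dots> = dir_deriv b (\<lambda>x. f x * dir_deriv b g x) x + dir_deriv b (\<lambda>x. dir_deriv b f x * g x) x"
      by (intro dir_deriv_add differentiable_mult f g assms b)
    finally show ?thesis
      by (simp add: dir_deriv_mult[OF f(1)[OF assms(4)] g(2)[OF assms(4) b]]
        dir_deriv_mult[OF f(2)[OF assms(4) b] g(1)[OF assms(4)]])
  qed
  then show ?thesis by (simp add: laplacian_def sum.distrib sum_distrib_left sum_distrib_right)
qed

lemma laplacian_add:
  assumes "open S" "Ck 2 f S" "Ck 2 g S" "x \<in> S"
  shows "laplacian (\<lambda>x. f x + g x) x = laplacian f x + laplacian g x"
proof -
  note f = Ck2D[OF assms(2)] and g = Ck2D[OF assms(3)]
  have "dir_deriv b (dir_deriv b (\<lambda>x. f x + g x)) x = dir_deriv b (dir_deriv b f) x + dir_deriv b (dir_deriv b g) x"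
    if b: "b \<in> Basis" for b
  proof -
    have "dir_deriv b (dir_deriv b (\<lambda>x. f x + g x)) x = dir_deriv b (\<lambda>x. dir_deriv b f x + dir_deriv b g x) x"
      by (rule dir_deriv_cong[OF assms(1,4)]) (rule dir_deriv_add[OF f(1) g(1)])
    then show ?thesis
      by (simp add: dir_deriv_add[OF f(2)[OF assms(4) b] g(2)[OF assms(4) b]])
  qed
  then show ?thesis by (simp add: laplacian_def sum.distrib)
qed

lemma laplacian_const [simp]: "laplacian (\<lambda>x. c) x = 0"
  by (simp add: laplacian_def)

lemma laplacian_cmult:
  assumes "open S" "Ck 2 f S" "x \<in> S"
  shows "laplacian (\<lambda>x. c * f x) x = c * laplacian f x"
  using laplacian_mult[of S "\<lambda>_. c" f x] assms by simp

lemma laplacian_diff: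
  assumes "open S" "Ck 2 f S" "Ck 2 g S" "x \<in> S"
  shows "laplacian (\<lambda>x. f x - g x) x = laplacian f x - laplacian g x"
  using laplacian_add[OF assms(1,2) Ck_cmult[OF assms(1,3), of "-1"] assms(4)]
    laplacian_cmult[OF assms(1,3,4), of "-1"] by simp

lemma laplacian_sum:
  assumes "open S" "\<And>i. i \<in> I \<Longrightarrow> Ck 2 (f i) S" "x \<in> S"
  shows "laplacian (\<lambda>x. \<Sum>i\<in>I. f i x) x = (\<Sum>i\<in>I. laplacian (f i) x)"
  using assms(2)
  by (induction I rule: infinite_finite_induct) (auto simp: laplacian_add[OF assms(1) _ Ck_sum[OF assms(1)] assms(3)])

lemma Ck_laplacian: "open S \<Longrightarrow> Ck (Suc (Suc k)) f S \<Longrightarrow> Ck k (laplacian f) S"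
  unfolding laplacian_def[abs_def] by (rule Ck_sum) auto

lemma Ck_laplacian_pow: "open S \<Longrightarrow> Ck (2 * N + k) f S \<Longrightarrow> Ck k ((laplacian ^^ N) f) S"
proof (induction N arbitrary: f k)
  case (Suc N)
  have "Ck k ((laplacian ^^ N) (laplacian f)) S"
    by (rule Suc.IH[OF Suc.prems(1)], rule Ck_laplacian) (use Suc.prems in simp_all)
  then show ?case by (simp add: funpow_Suc_right del: funpow.simps)
qed simp

lemma laplacian_nsq: "laplacian (\<lambda>x::'a::euclidean_space. complex_of_real ((x - c) \<bullet> (x - c))) x = 2 * of_nat DIM('a)"
proof -
  have "dir_deriv b (\<lambda>x. 2 * (of_real (x \<bullet> b) - of_real (c \<bullet> b))) x = 2" if "b \<in> Basis" for b
    by (rule dir_deriv_eq[where f' = "\<lambda>v. 2 * of_real (v \<bullet> b)", THEN trans]) (use that in \<open>auto intro!: derivative_eq_intros\<close>)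
  then show ?thesis by (simp add: laplacian_def dir_deriv_nsq)
qed

section \<open>Second-order differences and the symmetry of mixed derivatives\<close>

lemma dir_deriv_line:
  assumes "f differentiable at (x + t *\<^sub>R v)"
  shows "((\<lambda>t. f (x + t *\<^sub>R v)) has_vector_derivative dir_deriv v f (x + t *\<^sub>R v)) (at t)"
proof -
  have "((\<lambda>t. x + t *\<^sub>R v) has_derivative (\<lambda>s. s *\<^sub>R v)) (at t)"
    by (auto intro!: derivative_eq_intros)
  from diff_chain_at[OF this dir_deriv_has[OF assms]]
  have "((\<lambda>t. f (x + t *\<^sub>R v)) has_derivative (\<lambda>s. dir_deriv (s *\<^sub>R v) f (x + t *\<^sub>R v))) (at t)"
    by (simp add: o_def)
  moreover have "dir_deriv (s *\<^sub>R v) f (x + t *\<^sub>R v) = s *\<^sub>R dir_deriv v f (x + t *\<^sub>R v)" for s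
    unfolding dir_deriv_def using linear_frechet_derivative[OF assms] by (simp add: linear_scale)
  ultimately show ?thesis by (simp add: has_vector_derivative_def)
qed

lemma dir_deriv_linear_basis:
  assumes "f differentiable at x"
  shows "dir_deriv v f x = (\<Sum>b\<in>Basis. of_real (v \<bullet> b) * dir_deriv b f x)"
proof -
  have l: "linear (frechet_derivative f (at x))" using linear_frechet_derivative[OF assms] .
  have "frechet_derivative f (at x) v = frechet_derivative f (at x) (\<Sum>b\<in>Basis. (v \<bullet> b) *\<^sub>R b)"
    by (simp add: euclidean_representation)
  also have "\<dots> = (\<Sum>b\<in>Basis. (v \<bullet> b) *\<^sub>R frechet_derivative f (at x) b)"
    by (simp add: linear_sum[OF l] linear_scale[OF l])
  finally show ?thesis by (simp add: dir_deriv_def scaleR_conv_of_real)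
qed

text \<open>Two applications of the mean value theorem to the second-order difference.\<close>

lemma mixed_difference:
  fixes f :: "'a::euclidean_space \<Rightarrow> complex"
  assumes f: "\<And>y. y \<in> ball x e \<Longrightarrow> f differentiable at y \<and> dir_deriv a f differentiable at y"
    and L: "linear L" "bounded_linear (L :: complex \<Rightarrow> real)"
    and h: "0 < h" "2 * h < e" and ab: "norm a = 1" "norm b = 1"
  shows "\<exists>y\<in>ball x e. L (f (x + h *\<^sub>R a + h *\<^sub>R b)) - L (f (x + h *\<^sub>R a)) - L (f (x + h *\<^sub>R b)) + L (f x)
     = h * h * L (dir_deriv b (dir_deriv a f) y)"
proof -
  have mem: "x + s *\<^sub>R a + t *\<^sub>R b \<in> ball x e" if "0 \<le> s" "s \<le> h" "0 \<le> t" "t \<le> h" for s t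
  proof -
    have "norm (s *\<^sub>R a + t *\<^sub>R b) \<le> s + t" using norm_triangle_ineq[of "s *\<^sub>R a" "t *\<^sub>R b"] that ab by simp
    moreover have "dist x (x + s *\<^sub>R a + t *\<^sub>R b) = norm (s *\<^sub>R a + t *\<^sub>R b)"
      by (metis add.assoc dist_add_cancel dist_norm norm_minus_cancel add_diff_cancel_left' dist_commute)
    ultimately show ?thesis using that h by simp
  qed
  let ?\<phi> = "\<lambda>s. L (f ((x + h *\<^sub>R b) + s *\<^sub>R a)) - L (f (x + s *\<^sub>R a))"
  have D: "(?\<phi> has_real_derivative (L (dir_deriv a f ((x + h *\<^sub>R b) + s *\<^sub>R a)) - L (dir_deriv a f (x + s *\<^sub>R a)))) (at s)"
    if "0 \<le> s" "s \<le> h" for s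
    unfolding has_real_derivative_iff_has_vector_derivative
    by (intro has_vector_derivative_diff bounded_linear.has_vector_derivative[OF L(2)] dir_deriv_line)
      (use mem[of s h] mem[of s 0] that f h in \<open>auto simp: algebra_simps\<close>)
  obtain s where s: "0 < s" "s < h" "?\<phi> h - ?\<phi> 0 = h * (L (dir_deriv a f ((x + h *\<^sub>R b) + s *\<^sub>R a)) - L (dir_deriv a f (x + s *\<^sub>R a)))"
    using MVT2[of 0 h ?\<phi>, OF h(1) D] by auto
  let ?\<psi> = "\<lambda>t. L (dir_deriv a f ((x + s *\<^sub>R a) + t *\<^sub>R b))"
  have D2: "(?\<psi> has_real_derivative (L (dir_deriv b (dir_deriv a f) ((x + s *\<^sub>R a) + t *\<^sub>R b)))) (at t)"
    if "0 \<le> t" "t \<le> h" for t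
    unfolding has_real_derivative_iff_has_vector_derivative
    by (intro bounded_linear.has_vector_derivative[OF L(2)] dir_deriv_line)
      (use mem[of s t] that f h s in \<open>auto simp: algebra_simps\<close>)
  obtain t where t: "0 < t" "t < h" "?\<psi> h - ?\<psi> 0 = h * L (dir_deriv b (dir_deriv a f) ((x + s *\<^sub>R a) + t *\<^sub>R b))"
    using MVT2[of 0 h ?\<psi>, OF h(1) D2] by auto
  show ?thesis
  proof (rule bexI)
    show "(x + s *\<^sub>R a) + t *\<^sub>R b \<in> ball x e" by (rule mem) (use s t in auto)
    have eq: "?\<phi> h - ?\<phi> 0 = h * (?\<psi> h - ?\<psi> 0)" using s(3) by (simp add: algebra_simps)
    show "L (f (x + h *\<^sub>R a + h *\<^sub>R b)) - L (f (x + h *\<^sub>R a)) - L (f (x + h *\<^sub>R b)) + L (f x)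
     = h * h * L (dir_deriv b (dir_deriv a f) ((x + s *\<^sub>R a) + t *\<^sub>R b))"
      using eq unfolding t(3) by (simp add: algebra_simps)
  qed
qed

text \<open>Schwarz's theorem. The second-order difference is symmetric in a and b, so two
  applications of \<open>mixed_difference\<close> equate the two mixed derivatives at points y and z
  near x, and continuity transports the equality to x. The mean value theorem needs real values,
  hence the functional L, instantiated with Re and Im.\<close>

lemma dir_deriv_commute:
  fixes f :: "'a::euclidean_space \<Rightarrow> complex"
  assumes "open S" "Ck 2 f S" "x \<in> S" and ab: "a \<in> Basis" "b \<in> Basis"
  shows "dir_deriv a (dir_deriv b f) x = dir_deriv b (dir_deriv a f) x"
proof -
  have main: "L (dir_deriv a (dir_deriv b f) x) = L (dir_deriv b (dir_deriv a f) x)"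
    if L: "linear L" "bounded_linear L" for L :: "complex \<Rightarrow> real"
  proof (rule ccontr)
    define F where "F = (\<lambda>y. L (dir_deriv a (dir_deriv b f) y))"
    define G where "G = (\<lambda>y. L (dir_deriv b (dir_deriv a f) y))"
    assume "\<not> ?thesis"
    then have ne: "F x \<noteq> G x" by (simp add: F_def G_def)
    define \<epsilon> where "\<epsilon> = dist (F x) (G x) / 2"
    have "\<epsilon> > 0" using ne by (simp add: \<epsilon>_def)
    have "continuous_on S F" "continuous_on S G" unfolding F_def G_def
      using assms(2) ab
      by (auto simp: numeral_2_eq_2 intro!: bounded_linear.continuous_on[OF L(2)])
    then have "isCont F x" "isCont G x" using assms(1,3) by (auto simp: continuous_on_eq_continuous_at)
    then have "eventually (\<lambda>y. dist (F y) (F x) < \<epsilon>) (nhds x)" "eventually (\<lambda>y. dist (G y) (G x) < \<epsilon>) (nhds x)"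
      using \<open>\<epsilon> > 0\<close> unfolding continuous_within tendsto_iff
      by (auto simp: eventually_at_filter elim!: eventually_mono)
    moreover have "eventually (\<lambda>y. y \<in> S) (nhds x)" using assms(1,3) by (simp add: eventually_nhds) blast
    ultimately have "eventually (\<lambda>y. dist (F y) (F x) < \<epsilon> \<and> dist (G y) (G x) < \<epsilon> \<and> y \<in> S) (nhds x)"
      by eventually_elim auto
    then obtain e where e: "e > 0" "\<And>y. y \<in> ball x e \<Longrightarrow> dist (F y) (F x) < \<epsilon> \<and> dist (G y) (G x) < \<epsilon> \<and> y \<in> S"
      by (auto simp: eventually_nhds_metric dist_commute)
    define h where "h = e / 4"
    have h: "0 < h" "2 * h < e" using e by (auto simp: h_def)
    have n: "norm a = 1" "norm b = 1" using ab by auto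
    note fd = Ck2D[OF assms(2)]
    obtain y where y: "y \<in> ball x e" "L (f (x + h *\<^sub>R a + h *\<^sub>R b)) - L (f (x + h *\<^sub>R a)) - L (f (x + h *\<^sub>R b)) + L (f x) = h * h * G y"
      using mixed_difference[of x e f a L h b, OF _ L h n] fd e(2) ab unfolding G_def by blast
    obtain z where z: "z \<in> ball x e" "L (f (x + h *\<^sub>R b + h *\<^sub>R a)) - L (f (x + h *\<^sub>R b)) - L (f (x + h *\<^sub>R a)) + L (f x) = h * h * F z"
      using mixed_difference[of x e f b L h a, OF _ L h n(2,1)] fd e(2) ab unfolding F_def by blast
    have "h * h * F z = h * h * G y" unfolding y(2)[symmetric] z(2)[symmetric] by (simp add: add_ac)
    then have "F z = G y" using h by simp
    then have "dist (F x) (G x) < 2 * \<epsilon>"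
      using e(2)[OF y(1)] e(2)[OF z(1)] dist_triangle2[of "F x" "G x" "F z"] by (simp add: dist_commute)
    then show False by (simp add: \<epsilon>_def)
  qed
  show ?thesis
    using main[OF bounded_linear.linear bounded_linear_Re] main[OF bounded_linear.linear bounded_linear_Im]
    by (simp add: complex_eq_iff bounded_linear_Re bounded_linear_Im)
qed

lemma laplacian_dir_deriv:
  assumes "open S" "Ck 3 f S" "x \<in> S" "b \<in> Basis"
  shows "laplacian (dir_deriv b f) x = dir_deriv b (laplacian f) x"
proof -
  have 2: "Ck 2 f S" using Ck_le[OF assms(2)] by simp
  have c2: "Ck 2 (dir_deriv c f) S" if "c \<in> Basis" for c
    using assms(2) that by (simp add: numeral_3_eq_3 numeral_2_eq_2)
  have "dir_deriv c (dir_deriv c (dir_deriv b f)) x = dir_deriv b (dir_deriv c (dir_deriv c f)) x"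
    if c: "c \<in> Basis" for c
  proof -
    have "dir_deriv c (dir_deriv c (dir_deriv b f)) x = dir_deriv c (dir_deriv b (dir_deriv c f)) x"
      by (rule dir_deriv_cong[OF assms(1,3)]) (rule dir_deriv_commute[OF assms(1) 2 _ c assms(4)])
    also have "\<dots> = dir_deriv b (dir_deriv c (dir_deriv c f)) x"
      by (rule dir_deriv_commute[OF assms(1) c2[OF c] assms(3) c assms(4)])
    finally show ?thesis .
  qed
  moreover have "dir_deriv b (laplacian f) x = (\<Sum>c\<in>Basis. dir_deriv b (dir_deriv c (dir_deriv c f)) x)"
    unfolding laplacian_def[abs_def]
    by (rule dir_deriv_sum) (use c2 assms(3) Ck2D in blast)
  ultimately show ?thesis unfolding laplacian_def by simp
qed

section \<open>Integrals against truncated radial powers\<close>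

lemma cs_uniformly_continuous:
  fixes f :: "'a::euclidean_space \<Rightarrow> complex"
  assumes "continuous_on UNIV f" "\<And>x. norm x > R \<Longrightarrow> f x = 0" "e > 0"
  shows "\<exists>d>0. \<forall>x y. dist x y < d \<longrightarrow> dist (f x) (f y) < e"
proof -
  have "uniformly_continuous_on (cball 0 (R+1)) f"
    by (intro compact_uniformly_continuous continuous_on_subset[OF assms(1)]) auto
  then obtain d where d: "d > 0" "\<And>x y. x \<in> cball 0 (R+1) \<Longrightarrow> y \<in> cball 0 (R+1) \<Longrightarrow> dist y x < d \<Longrightarrow> dist (f y) (f x) < e"
    using assms(3) unfolding uniformly_continuous_on_def by metis
  have "dist (f x) (f y) < e" if "dist x y < min d 1" for x y
  proof -
    have n: "norm y \<le> norm x + dist x y" "norm x \<le> norm y + dist x y"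
      using norm_triangle_ineq2[of y x] norm_triangle_ineq2[of x y] by (simp_all add: dist_norm norm_minus_commute)
    show ?thesis
    proof (cases "norm x \<le> R \<or> norm y \<le> R")
      case True then show ?thesis using d(2)[of y x] n that by (auto simp: dist_commute)
    next
      case False then show ?thesis using assms(2)[of x] assms(2)[of y] assms(3) by simp
    qed
  qed
  then show ?thesis using d(1) by (intro exI[of _ "min d 1"]) auto
qed

lemma cs_bounded:
  fixes f :: "'a::euclidean_space \<Rightarrow> complex"
  assumes "continuous_on UNIV f" "\<And>x. norm x > R \<Longrightarrow> f x = 0"
  shows "\<exists>C\<ge>0. \<forall>x. norm (f x) \<le> C"
proof -
  have "bounded (f ` cball 0 R)"
    by (intro compact_imp_bounded compact_continuous_image continuous_on_subset[OF assms(1)]) auto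
  then obtain C where C: "\<And>x. x \<in> cball 0 R \<Longrightarrow> norm (f x) \<le> C" unfolding bounded_iff by blast
  have "norm (f x) \<le> max 0 C" for x using C[of x] assms(2)[of x] by (cases "norm x \<le> R") auto
  then show ?thesis by (intro exI[of _ "max 0 C"]) auto
qed

lemma dir_deriv_zero_outside:
  assumes "\<And>x. norm x > R \<Longrightarrow> f x = 0" "norm x > R"
  shows "dir_deriv b f x = 0"
proof -
  have "open {y. norm y > R}" by (intro open_Collect_less continuous_intros)
  then have "dir_deriv b f x = dir_deriv b (\<lambda>_. 0) x" by (rule dir_deriv_cong) (use assms in auto)
  then show ?thesis by simp
qed

lemma integrable_mult_cs:
  fixes f K :: "'a::euclidean_space \<Rightarrow> complex"
  assumes "integrable lborel f" "continuous_on UNIV K" "\<And>x. norm x > R \<Longrightarrow> K x = 0"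
  shows "integrable lborel (\<lambda>z. f z * K (x - z))"
proof -
  obtain C where C: "C \<ge> 0" "\<And>x. norm (K x) \<le> C" using cs_bounded[OF assms(2,3)] by auto
  have m: "(\<lambda>z. K (x - z)) \<in> borel_measurable lborel"
    by (simp, intro borel_measurable_continuous_onI continuous_on_compose2[OF assms(2)] continuous_intros) auto
  have "norm (f z * K (x - z)) \<le> norm (of_real C * f z)" for z
    using mult_left_mono[OF C(2)[of "x - z"], of "norm (f z)"] C(1) by (simp add: norm_mult mult.commute)
  then have n: "AE z in lborel. norm (f z * K (x - z)) \<le> norm (of_real C * f z)" by simp
  have 1: "integrable lborel (\<lambda>z. of_real C * f z)" using assms(1) by (rule integrable_mult_right)
  have 2: "(\<lambda>z. f z * K (x - z)) \<in> borel_measurable lborel"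
    by (rule borel_measurable_times[OF borel_measurable_integrable[OF assms(1)] m])
  show ?thesis by (rule Bochner_Integration.integrable_bound[OF 1 2 n])
qed

text \<open>Only integrability of f is available, so all smoothness sits in K. The partial
  derivatives of K are uniformly continuous, which bounds the linearisation error of K by
  \<open>norm h * (DIM('a) * \<epsilon>)\<close> at every point simultaneously; integrating against
  |f| keeps this bound.\<close>

lemma conv_has_derivative:
  fixes f K :: "'a::euclidean_space \<Rightarrow> complex"
  assumes f: "integrable lborel f" and K: "Ck 1 K UNIV" "\<And>x. norm x > R \<Longrightarrow> K x = 0"
  shows "((\<lambda>x. \<integral>z. f z * K (x - z) \<partial>lborel) has_derivative
            (\<lambda>v. \<Sum>b\<in>Basis. of_real (v \<bullet> b) * (\<integral>z. f z * dir_deriv b K (x - z) \<partial>lborel))) (at x)"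
  unfolding has_derivative_at_alt
proof (intro conjI allI impI)
  have Kd: "K differentiable at y" for y using K(1) by auto
  have Kc: "continuous_on UNIV K" using Ck_continuous[OF K(1)] .
  have dc: "continuous_on UNIV (dir_deriv b K)" if "b \<in> Basis" for b using K(1) that by auto
  have d0: "norm y > R \<Longrightarrow> dir_deriv b K y = 0" for b y using dir_deriv_zero_outside K(2) by blast
  show "bounded_linear (\<lambda>v. \<Sum>b\<in>Basis. of_real (v \<bullet> b) * (\<integral>z. f z * dir_deriv b K (x - z) \<partial>lborel))"
    by (intro bounded_linear_sum bounded_linear_mult_const bounded_linear_compose[OF bounded_linear_of_real] bounded_linear_inner_left)
  fix e :: real assume e: "e > 0"
  \<comment> \<open>The summand 1 keeps M positive even if f is null, so that \<epsilon> can be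
    defined by division.\<close>
  define M where "M = (\<integral>z. norm (f z) \<partial>lborel) + 1"
  have M: "M > 0" unfolding M_def by (intro add_nonneg_pos Bochner_Integration.integral_nonneg) auto
  define \<epsilon> where "\<epsilon> = e / (M * DIM('a))"
  have "\<epsilon> > 0" using e M by (simp add: \<epsilon>_def)
  have "\<exists>d>0. \<forall>x y. dist x y < d \<longrightarrow> dist (dir_deriv b K x) (dir_deriv b K y) < \<epsilon>" if "b \<in> Basis" for b
    by (rule cs_uniformly_continuous[OF dc[OF that] d0 \<open>\<epsilon> > 0\<close>])
  then obtain d where d: "\<And>b. b \<in> Basis \<Longrightarrow> d b > 0"
    "\<And>b x y. b \<in> Basis \<Longrightarrow> dist x y < d b \<Longrightarrow> dist (dir_deriv b K x) (dir_deriv b K y) < \<epsilon>" by metis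
  define \<delta> where "\<delta> = Min (d ` Basis)"
  have \<delta>: "\<delta> > 0" "\<And>b. b \<in> Basis \<Longrightarrow> \<delta> \<le> d b" unfolding \<delta>_def using d(1) by auto
  have lin: "norm (K (w + h) - K w - (\<Sum>b\<in>Basis. of_real (h \<bullet> b) * dir_deriv b K w)) \<le> norm h * (DIM('a) * \<epsilon>)"
    if "norm h < \<delta>" for w h
  proof -
    have "norm (K (w + h) - K w - dir_deriv ((w + h) - w) K w) \<le> norm ((w + h) - w) * (DIM('a) * \<epsilon>)"
    proof (rule differentiable_bound_linearization[where S = "closed_segment w (w + h)" and f' = "\<lambda>x v. dir_deriv v K x"])
      show "w + t *\<^sub>R (w + h - w) \<in> closed_segment w (w + h)" if "t \<in> {0..1}" for t
        using that by (auto simp: in_segment algebra_simps intro!: exI[of _ t])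
      show "(K has_derivative (\<lambda>v. dir_deriv v K y)) (at y within closed_segment w (w + h))" for y
        by (rule has_derivative_at_withinI[OF dir_deriv_has[OF Kd]])
      show "onorm ((\<lambda>v. dir_deriv v K y) - (\<lambda>v. dir_deriv v K w)) \<le> DIM('a) * \<epsilon>" if y: "y \<in> closed_segment w (w + h)" for y
      proof (rule onorm_bound)
        show "0 \<le> DIM('a) * \<epsilon>" using \<open>\<epsilon> > 0\<close> by simp
        have "dist y w < \<delta>" using dist_in_closed_segment[OF y] \<open>norm h < \<delta>\<close> by (simp add: dist_norm)
        then have *: "norm (dir_deriv b K y - dir_deriv b K w) \<le> \<epsilon>" if "b \<in> Basis" for b
          using d(2)[OF that, of y w] \<delta>(2)[OF that] by (simp add: dist_norm)
        fix v
        have "norm (dir_deriv v K y - dir_deriv v K w)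
          = norm (\<Sum>b\<in>Basis. of_real (v \<bullet> b) * (dir_deriv b K y - dir_deriv b K w))"
          by (simp add: dir_deriv_linear_basis[OF Kd, of v] sum_subtractf right_diff_distrib)
        also have "\<dots> \<le> (\<Sum>b\<in>(Basis::'a set). norm v * \<epsilon>)"
          by (rule sum_norm_le) (use * in \<open>auto simp: norm_mult intro!: mult_mono Basis_le_norm\<close>)
        finally show "norm (((\<lambda>v. dir_deriv v K y) - (\<lambda>v. dir_deriv v K w)) v) \<le> DIM('a) * \<epsilon> * norm v"
          by (simp add: mult_ac)
      qed
    qed auto
    then show ?thesis by (simp add: dir_deriv_linear_basis[OF Kd, of h])
  qed
  have "norm ((\<integral>z. f z * K (y - z) \<partial>lborel) - (\<integral>z. f z * K (x - z) \<partial>lborel)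
      - (\<Sum>b\<in>Basis. of_real ((y - x) \<bullet> b) * (\<integral>z. f z * dir_deriv b K (x - z) \<partial>lborel))) \<le> e * norm (y - x)"
    if "norm (y - x) < \<delta>" for y
  proof -
    let ?g = "\<lambda>z. f z * K (y - z) - f z * K (x - z) - (\<Sum>b\<in>Basis. of_real ((y - x) \<bullet> b) * (f z * dir_deriv b K (x - z)))"
    have i1: "integrable lborel (\<lambda>z. f z * K (w - z))" for w by (rule integrable_mult_cs[OF f Kc K(2)])
    have i2: "integrable lborel (\<lambda>z. f z * dir_deriv b K (w - z))" if "b \<in> Basis" for b w
      by (rule integrable_mult_cs[OF f dc[OF that] d0])
    have g: "integrable lborel ?g" using i1 i2 by (intro Bochner_Integration.integrable_diff integrable_sum integrable_mult_right) auto
    have "(\<integral>z. f z * K (y - z) \<partial>lborel) - (\<integral>z. f z * K (x - z) \<partial>lborel)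
      - (\<Sum>b\<in>Basis. of_real ((y - x) \<bullet> b) * (\<integral>z. f z * dir_deriv b K (x - z) \<partial>lborel)) = (\<integral>z. ?g z \<partial>lborel)"
      using i1 i2 by (subst Bochner_Integration.integral_diff, auto)+
    also have "norm \<dots> \<le> (\<integral>z. norm (f z) * (norm (y - x) * (DIM('a) * \<epsilon>)) \<partial>lborel)"
    proof (rule Bochner_Integration.integral_norm_bound_integral[OF g])
      show "integrable lborel (\<lambda>z. norm (f z) * (norm (y - x) * (DIM('a) * \<epsilon>)))" using f by auto
      show "norm (?g z) \<le> norm (f z) * (norm (y - x) * (DIM('a) * \<epsilon>))" for z
      proof -
        have "?g z = f z * (K ((x - z) + (y - x)) - K (x - z) - (\<Sum>b\<in>Basis. of_real ((y - x) \<bullet> b) * dir_deriv b K (x - z)))"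
          by (simp add: algebra_simps sum_distrib_left)
        then show ?thesis using lin[OF that, of "x - z"] by (simp add: norm_mult mult_left_mono)
      qed
    qed
    also have "\<dots> = (M - 1) * (norm (y - x) * (e / M))" using M by (simp add: M_def \<epsilon>_def)
    also have "\<dots> \<le> e * norm (y - x)" using M e by (simp add: field_simps)
    finally show ?thesis .
  qed
  then show "\<exists>d>0. \<forall>y. norm (y - x) < d \<longrightarrow> norm ((\<integral>z. f z * K (y - z) \<partial>lborel) - (\<integral>z. f z * K (x - z) \<partial>lborel)
      - (\<Sum>b\<in>Basis. of_real ((y - x) \<bullet> b) * (\<integral>z. f z * dir_deriv b K (x - z) \<partial>lborel))) \<le> e * norm (y - x)"
    using \<delta>(1) by blast
qed

lemma dir_deriv_conv:
  fixes f K :: "'a::euclidean_space \<Rightarrow> complex"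
  assumes "integrable lborel f" "Ck 1 K UNIV" "\<And>x. norm x > R \<Longrightarrow> K x = 0" "b \<in> Basis"
  shows "dir_deriv b (\<lambda>x. \<integral>z. f z * K (x - z) \<partial>lborel) x = (\<integral>z. f z * dir_deriv b K (x - z) \<partial>lborel)"
proof -
  have "dir_deriv b (\<lambda>x. \<integral>z. f z * K (x - z) \<partial>lborel) x
     = (\<Sum>c\<in>Basis. of_real (b \<bullet> c) * (\<integral>z. f z * dir_deriv c K (x - z) \<partial>lborel))"
    by (rule dir_deriv_eq[OF conv_has_derivative[OF assms(1-3)]])
  also have "\<dots> = (\<Sum>c\<in>Basis. if c = b then (\<integral>z. f z * dir_deriv c K (x - z) \<partial>lborel) else 0)"
    by (rule sum.cong) (use assms(4) in \<open>auto simp: inner_Basis\<close>)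
  finally show ?thesis using assms(4) by simp
qed

text \<open>One order is given away: in the base case continuity is read off from differentiability,
  which costs a derivative of the kernel.\<close>

lemma Ck_conv:
  fixes f K :: "'a::euclidean_space \<Rightarrow> complex"
  assumes f: "integrable lborel f" and "Ck (Suc k) K UNIV" "\<And>x. norm x > R \<Longrightarrow> K x = 0"
  shows "Ck k (\<lambda>x. \<integral>z. f z * K (x - z) \<partial>lborel) UNIV"
  using assms(2,3)
proof (induction k arbitrary: K)
  case 0
  have "isCont (\<lambda>x. \<integral>z. f z * K (x - z) \<partial>lborel) x" for x
    by (rule has_derivative_continuous[OF conv_has_derivative[OF f _ 0(2)]]) (use 0(1) in auto)
  then show ?case by (auto simp: continuous_on_eq_continuous_at)
next
  case (Suc k)
  have 1: "Ck 1 K UNIV" by (rule Ck_le[OF Suc.prems(1)]) simp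
  have "Ck k (dir_deriv b (\<lambda>x. \<integral>z. f z * K (x - z) \<partial>lborel)) UNIV" if b: "b \<in> Basis" for b
  proof (rule Ck_cong[OF open_UNIV])
    show "Ck k (\<lambda>x. \<integral>z. f z * dir_deriv b K (x - z) \<partial>lborel) UNIV"
    proof (rule Suc.IH)
      show "Ck (Suc k) (dir_deriv b K) UNIV" by (rule Ck_dir_deriv[OF Suc.prems(1) b])
      show "norm x > R \<Longrightarrow> dir_deriv b K x = 0" for x using dir_deriv_zero_outside Suc.prems(2) by blast
    qed
  qed (rule dir_deriv_conv[OF f 1 Suc.prems(2) b, symmetric])
  then show ?case using conv_has_derivative[OF f 1 Suc.prems(2)]
    by (auto simp: differentiable_def) 
qed

text \<open>Convolve K with the indicator of a large ball. Near the origin the convolution is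
  constantly the integral of K, so its derivative at 0 vanishes; differentiation under the integral
  identifies that derivative with the integral of \<open>dir_deriv b K\<close>. This avoids iterated
  integrals.\<close>

lemma integral_dir_deriv_cs:
  fixes K :: "'a::euclidean_space \<Rightarrow> complex"
  assumes "Ck 1 K UNIV" "\<And>x. norm x > R \<Longrightarrow> K x = 0" "b \<in> Basis"
  shows "(\<integral>z. dir_deriv b K z \<partial>lborel) = 0"
proof -
  define R' where "R' = max R 0"
  let ?f = "\<lambda>z. complex_of_real (indicator (cball (0::'a) (R' + 1)) z)"
  have f: "integrable lborel ?f"
    using borel_integrable_compact[of "cball (0::'a) (R'+1)" "\<lambda>_. 1::complex"] by (simp add: scaleR_conv_of_real)
  \<comment> \<open>Lebesgue measure is invariant under the reflection z -> x - z.\<close>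
  have refl: "(\<integral>z. g (x - z) \<partial>lborel) = (\<integral>z. g z \<partial>lborel)" if "g \<in> borel_measurable borel" for g :: "'a \<Rightarrow> complex" and x
  proof -
    have "(\<integral>z. g z \<partial>lborel) = (\<integral>z. g z \<partial>(distr lborel borel (\<lambda>z. x - z)))"
      using lborel_affine[of "-1" x] by (simp add: density_1)
    also have "\<dots> = (\<integral>z. g (x - z) \<partial>lborel)" by (rule integral_distr) (use that in auto)
    finally show ?thesis by simp
  qed
  have eq: "(\<integral>z. ?f z * g (x - z) \<partial>lborel) = (\<integral>z. g z \<partial>lborel)"
    if "continuous_on UNIV g" "\<And>y. norm y > R \<Longrightarrow> g y = 0" "norm x < 1" for g :: "'a \<Rightarrow> complex" and x
  proof -
    have *: "?f z * g (x - z) = g (x - z)" for z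
    proof (cases "norm z \<le> R' + 1")
      case False
      have "norm (x - z) \<ge> norm z - norm x" by (metis norm_minus_commute norm_triangle_ineq2)
      then have "norm (x - z) > R" using False that(3) by (auto simp: R'_def)
      then show ?thesis using that(2) by simp
    qed simp
    show ?thesis unfolding * by (rule refl[OF borel_measurable_continuous_onI[OF that(1)]])
  qed
  have 0: "norm y > R \<Longrightarrow> dir_deriv b K y = 0" for y using dir_deriv_zero_outside assms(2) by blast
  have "(\<integral>z. dir_deriv b K z \<partial>lborel) = (\<integral>z. ?f z * dir_deriv b K (0 - z) \<partial>lborel)"
    by (rule eq[symmetric]) (use assms 0 in auto)
  also have "\<dots> = dir_deriv b (\<lambda>x. \<integral>z. ?f z * K (x - z) \<partial>lborel) 0"
    by (rule dir_deriv_conv[OF f assms, symmetric])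
  also have "\<dots> = dir_deriv b (\<lambda>x. \<integral>z. K z \<partial>lborel) 0"
    by (rule dir_deriv_cong[of "ball 0 1"]) (auto intro!: eq Ck_continuous[OF assms(1)] assms(2))
  finally show ?thesis by simp
qed

text \<open>Compact support inside the ball, phrased only for points of the ball because values
  outside it are arbitrary.\<close>

definition inner_supp :: "('a::euclidean_space \<Rightarrow> complex) \<Rightarrow> bool" where
  "inner_supp f \<longleftrightarrow> (\<exists>R<1. \<forall>x\<in>ball 0 1. R < norm x \<longrightarrow> f x = 0)"

abbreviation ball_integral :: "('a::euclidean_space \<Rightarrow> complex) \<Rightarrow> complex" where
  "ball_integral f \<equiv> (LINT x:ball 0 1|lborel. f x)"

lemma inner_suppE:
  assumes "inner_supp f"
  obtains R where "0 < R" "R < 1" "\<forall>x\<in>ball 0 1. R < norm x \<longrightarrow> f x = 0"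
proof -
  from assms obtain R where R: "R < 1" "\<And>x. x \<in> ball 0 1 \<Longrightarrow> R < norm x \<Longrightarrow> f x = 0" unfolding inner_supp_def by blast
  show ?thesis by (rule that[of "max R (1/2)"]) (use R in auto)
qed

lemma inner_supp_mult [intro]: "inner_supp f \<Longrightarrow> inner_supp (\<lambda>x. f x * g x)" "inner_supp g \<Longrightarrow> inner_supp (\<lambda>x. f x * g x)"
  by (auto simp: inner_supp_def)

lemma inner_supp_add [intro]: "inner_supp f \<Longrightarrow> inner_supp g \<Longrightarrow> inner_supp (\<lambda>x. f x + g x)"
  unfolding inner_supp_def by (metis (no_types, opaque_lifting) add_0 max_less_iff_conj)

lemma inner_supp_diff [intro]: "inner_supp f \<Longrightarrow> inner_supp g \<Longrightarrow> inner_supp (\<lambda>x. f x - g x)"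
  using inner_supp_add[of f "\<lambda>x. (-1) * g x"] inner_supp_mult(2)[of g "\<lambda>_. -1"] by simp

lemma inner_supp_set_integrable:
  assumes "continuous_on (ball 0 1) f" "inner_supp f"
  shows "set_integrable lborel (ball 0 1) f"
proof -
  obtain R where R: "0 < R" "R < 1" "\<forall>x\<in>ball 0 1. R < norm x \<longrightarrow> f x = 0" using inner_suppE[OF assms(2)] by blast
  have "integrable lborel (\<lambda>x. indicator (cball 0 R) x *\<^sub>R f x)"
    by (intro borel_integrable_compact continuous_on_subset[OF assms(1)]) (use R in auto)
  moreover have "indicator (cball 0 R) x *\<^sub>R f x = indicator (ball 0 1) x *\<^sub>R f x" for x
    using R by (cases "norm x \<le> R") (auto simp: indicator_def)
  ultimately show ?thesis by (simp add: set_integrable_def)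
qed

lemma inner_supp_dir_deriv: assumes "inner_supp f" shows "inner_supp (dir_deriv b f)"
proof -
  obtain R where R: "0 < R" "R < 1" "\<forall>x\<in>ball 0 1. R < norm x \<longrightarrow> f x = 0" using inner_suppE[OF assms] by blast
  have "open ({y. norm y > R} \<inter> ball 0 1)" by (intro open_Int open_ball open_Collect_less continuous_intros)
  then have "dir_deriv b f x = dir_deriv b (\<lambda>_. 0) x" if "x \<in> ball 0 1" "R < norm x" for x
    by (rule dir_deriv_cong) (use R that in auto)
  then show ?thesis unfolding inner_supp_def using R by (intro exI[of _ R]) auto
qed

lemma inner_supp_sum: "(\<And>i. i \<in> I \<Longrightarrow> inner_supp (f i)) \<Longrightarrow> inner_supp (\<lambda>x. \<Sum>i\<in>I. f i x)"
proof (induction I rule: infinite_finite_induct)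
  case empty then show ?case by (auto simp: inner_supp_def intro!: exI[of _ 0])
next
  case (infinite A) then show ?case by (auto simp: inner_supp_def intro!: exI[of _ 0])
qed auto

lemma inner_supp_laplacian: "inner_supp f \<Longrightarrow> inner_supp (laplacian f)"
  unfolding laplacian_def[abs_def] by (intro inner_supp_sum inner_supp_dir_deriv)

section \<open>Integration by parts on the ball\<close>

lemma ball_integral_dir_deriv:
  assumes "Ck 1 G (ball 0 1)" "inner_supp G" "b \<in> Basis"
  shows "ball_integral (dir_deriv b G) = 0"
proof -
  obtain R where R: "0 < R" "R < 1" "\<forall>x\<in>ball 0 1. R < norm x \<longrightarrow> G x = 0" using inner_suppE[OF assms(2)] by blast
  \<comment> \<open>Extension by zero. It is C^1 on the ball and on the exterior of radius R, and as
    R < 1 these two open sets cover the space.\<close>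
  define K where "K = (\<lambda>x. if x \<in> ball 0 1 then G x else 0)"
  have K0: "K x = 0" if "norm x > R" for x using R that by (auto simp: K_def)
  have o: "open {x::'a. norm x > R}" by (intro open_Collect_less continuous_intros)
  have "Ck 1 K (ball 0 1)" by (rule Ck_cong[OF open_ball assms(1)]) (simp add: K_def)
  moreover have "Ck 1 K {x. norm x > R}" by (rule Ck_cong[OF o Ck_const[of _ 0]]) (simp add: K0)
  ultimately have "Ck 1 K (ball 0 1 \<union> {x. norm x > R})" by (intro Ck_Un_open o open_ball)
  also have "ball 0 1 \<union> {x. norm x > R} = UNIV" using R by auto
  finally have "Ck 1 K UNIV" .
  then have "(\<integral>z. dir_deriv b K z \<partial>lborel) = 0" by (rule integral_dir_deriv_cs[OF _ K0 assms(3)])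
  moreover have "indicator (ball 0 1) z *\<^sub>R dir_deriv b G z = dir_deriv b K z" for z
  proof (cases "z \<in> ball 0 1")
    case True
    have "dir_deriv b G z = dir_deriv b K z"
      by (rule dir_deriv_cong[OF open_ball True]) (simp add: K_def)
    then show ?thesis using True by simp
  next
    case False
    then have "norm z > R" using R by auto
    then show ?thesis using False dir_deriv_zero_outside[of R K z] K0 by simp
  qed
  ultimately show ?thesis by (simp add: set_lebesgue_integral_def)
qed

text \<open>Green's second identity. The difference of the integrands is the divergence of the field
  with components \<open>?G b\<close>, and \<Psi> keeps this field away from the boundary, so each
  component contributes 0.\<close>

lemma green:
  assumes u: "Ck 2 u (ball 0 1)" and \<Psi>: "Ck 2 \<Psi> (ball 0 1)" "inner_supp \<Psi>"
  shows "ball_integral (\<lambda>x. laplacian u x * \<Psi> x) = ball_integral (\<lambda>x. u x * laplacian \<Psi> x)"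
proof -
  let ?B = "ball (0::'a) 1"
  let ?G = "\<lambda>b x. dir_deriv b u x * \<Psi> x - u x * dir_deriv b \<Psi> x"
  have 1: "Ck 1 f ?B" "\<And>b. b \<in> Basis \<Longrightarrow> Ck 1 (dir_deriv b f) ?B"
    "\<And>b. b \<in> Basis \<Longrightarrow> continuous_on ?B (dir_deriv b (dir_deriv b f))"
    "continuous_on ?B (laplacian f)" if "Ck 2 f ?B" for f
    using that Ck_le[OF that, of 1] Ck_laplacian[of ?B 0 f] by (auto simp: numeral_2_eq_2)
  note u1 = 1[OF u] and p1 = 1[OF \<Psi>(1)]
  have G: "Ck 1 (?G b) ?B" "inner_supp (?G b)" if "b \<in> Basis" for b
    using that by (intro Ck_diff Ck_mult u1 p1 open_ball, simp_all, intro inner_supp_diff inner_supp_mult \<Psi> inner_supp_dir_deriv)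
  have dG: "dir_deriv b (?G b) x = dir_deriv b (dir_deriv b u) x * \<Psi> x - u x * dir_deriv b (dir_deriv b \<Psi>) x"
    if b: "b \<in> Basis" and x: "x \<in> ?B" for b x
  proof -
    note du = Ck2D(1)[OF u x] Ck2D(2)[OF u x b] Ck2D(1)[OF \<Psi>(1) x] Ck2D(2)[OF \<Psi>(1) x b]
    show ?thesis
      by (subst dir_deriv_diff) (auto intro!: differentiable_mult du simp: dir_deriv_mult du)
  qed
  have int: "set_integrable lborel ?B (\<lambda>x. dir_deriv b (dir_deriv b u) x * \<Psi> x - u x * dir_deriv b (dir_deriv b \<Psi>) x)"
    if "b \<in> Basis" for b
    using that by (intro inner_supp_set_integrable continuous_intros u1 p1 Ck_continuous[OF u] Ck_continuous[OF \<Psi>(1)]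
       inner_supp_diff inner_supp_mult \<Psi> inner_supp_dir_deriv)
  have "0 = (\<Sum>b\<in>Basis. ball_integral (dir_deriv b (?G b)))" using ball_integral_dir_deriv[OF G] by simp
  also have "\<dots> = (\<Sum>b\<in>Basis. ball_integral (\<lambda>x. dir_deriv b (dir_deriv b u) x * \<Psi> x - u x * dir_deriv b (dir_deriv b \<Psi>) x))"
    by (intro sum.cong refl set_lebesgue_integral_cong) (use dG in auto)
  also have "\<dots> = ball_integral (\<lambda>x. \<Sum>b\<in>Basis. dir_deriv b (dir_deriv b u) x * \<Psi> x - u x * dir_deriv b (dir_deriv b \<Psi>) x)"
    using int unfolding set_lebesgue_integral_def set_integrable_def scaleR_sum_right
    by (subst Bochner_Integration.integral_sum) auto
  also have "\<dots> = ball_integral (\<lambda>x. laplacian u x * \<Psi> x - u x * laplacian \<Psi> x)"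
    by (simp add: laplacian_def sum_subtractf sum_distrib_left sum_distrib_right)
  also have "\<dots> = ball_integral (\<lambda>x. laplacian u x * \<Psi> x) - ball_integral (\<lambda>x. u x * laplacian \<Psi> x)"
    by (intro set_integral_diff inner_supp_set_integrable continuous_intros u1 p1 Ck_continuous[OF u] Ck_continuous[OF \<Psi>(1)]
       inner_supp_mult \<Psi> inner_supp_laplacian)
  finally show ?thesis by simp
qed

section \<open>Truncated powers of the squared radius\<close>

lemma DERIV_max0_power:
  assumes "a \<ge> 2"
  shows "((\<lambda>t::real. (max 0 t) ^ a) has_real_derivative (real a * (max 0 t) ^ (a - 1))) (at t)"
proof -
  consider "t > 0" | "t < 0" | "t = 0" by linarith
  then show ?thesis
  proof cases
    case 1
    have "((\<lambda>t::real. t ^ a) has_real_derivative (real a * (max 0 t) ^ (a - 1))) (at t)"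
      using 1 by (auto intro!: derivative_eq_intros)
    then show ?thesis
      by (rule has_field_derivative_transform_within_open[of _ _ _ "{0<..}"]) (use 1 in auto)
  next
    case 2
    have "((\<lambda>t::real. 0) has_real_derivative (real a * (max 0 t) ^ (a - 1))) (at t)"
      using 2 assms by (auto simp: max_def power_0_left)
    then show ?thesis
      by (rule has_field_derivative_transform_within_open[of _ _ _ "{..<0}"]) (use 2 assms in \<open>auto simp: max_def\<close>)
  next
    case 3
    \<comment> \<open>At the kink the difference quotient is O(|h|^(a - 1)), and a >= 2 makes this
      tend to 0.\<close>
    have "((\<lambda>h::real. (max 0 h) ^ a / h) \<longlongrightarrow> 0) (at 0)"
    proof (rule Lim_null_comparison)
      show "eventually (\<lambda>h::real. norm ((max 0 h) ^ a / h) \<le> \<bar>h\<bar> ^ (a - 1)) (at 0)"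
      proof (rule always_eventually, rule allI)
        fix h :: real
        have "(max 0 h) ^ a \<le> \<bar>h\<bar> ^ a" by (rule power_mono) auto
        also have "\<bar>h\<bar> ^ a = \<bar>h\<bar> ^ (a - 1) * \<bar>h\<bar>" using power_minus_mult[of a "\<bar>h\<bar>"] assms by simp
        finally show "norm ((max 0 h) ^ a / h) \<le> \<bar>h\<bar> ^ (a - 1)" by (cases "h = 0") (auto simp: field_simps abs_mult)
      qed
      have "((\<lambda>h::real. \<bar>h\<bar> ^ (a - 1)) \<longlongrightarrow> \<bar>0\<bar> ^ (a - 1)) (at 0)" by (intro tendsto_intros)
      moreover have "\<bar>0::real\<bar> ^ (a - 1) = 0" using assms by simp
      ultimately show "((\<lambda>h::real. \<bar>h\<bar> ^ (a - 1)) \<longlongrightarrow> 0) (at 0)" by (simp only:)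
    qed
    then show ?thesis using 3 assms by (simp add: has_field_derivative_iff power_0_left)
  qed
qed

text \<open>A weight of class C^(a - 1) that replaces the ball of squared radius \<rho>: for \<rho>
  < 1 it has compact support in the unit ball, and both its Laplacian and its \<rho>-derivative are
  combinations of weights of lower order.\<close>

definition trunc_weight :: "nat \<Rightarrow> real \<Rightarrow> 'a::euclidean_space \<Rightarrow> complex" where
  "trunc_weight a \<rho> x = complex_of_real ((max 0 (\<rho> - x \<bullet> x)) ^ a)"

lemma Ck_radius: "open S \<Longrightarrow> Ck k (\<lambda>x. complex_of_real (\<rho> - x \<bullet> x)) S"
  using Ck_diff[of S k "\<lambda>_. of_real \<rho>"] Ck_nsq[of S k 0] by (simp add: Ck_diff)

lemma dir_deriv_radius: "dir_deriv b (\<lambda>x. complex_of_real (\<rho> - x \<bullet> x)) x = - 2 * of_real (x \<bullet> b)"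
  by (rule dir_deriv_eq[where f' = "\<lambda>v. of_real (- 2 * (v \<bullet> x))", THEN trans])
    (auto intro!: derivative_eq_intros ext simp: inner_commute)

lemma laplacian_radius: "laplacian (\<lambda>x::'a::euclidean_space. complex_of_real (\<rho> - x \<bullet> x)) x = - 2 * of_nat DIM('a)"
proof -
  have "dir_deriv b (\<lambda>x::'a. - 2 * complex_of_real (x \<bullet> b)) x = -2" if "b \<in> Basis" for b
    by (rule dir_deriv_eq[where f' = "\<lambda>v. - 2 * of_real (v \<bullet> b)", THEN trans]) (use that in \<open>auto intro!: derivative_eq_intros\<close>)
  then show ?thesis by (simp add: laplacian_def dir_deriv_radius[abs_def] del: of_real_diff mult_minus_left)
qed

lemma continuous_trunc_weight: "continuous_on S (trunc_weight a \<rho>)"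
  unfolding trunc_weight_def[abs_def] by (intro continuous_intros)

lemma has_derivative_trunc_weight:
  assumes "a \<ge> 2"
  shows "trunc_weight a \<rho> differentiable at x" "dir_deriv b (trunc_weight a \<rho>) x = of_nat a * trunc_weight (a - 1) \<rho> x * (- 2 * of_real (x \<bullet> b))"
proof -
  have 1: "(\<lambda>x. complex_of_real (\<rho> - x \<bullet> x)) differentiable at x"
    using Ck_radius[of UNIV 1 \<rho>] by auto
  show "trunc_weight a \<rho> differentiable at x"
    using has_derivative_compose_real[OF 1 DERIV_max0_power[OF assms]] unfolding trunc_weight_def[abs_def] differentiable_def by blast
  show "dir_deriv b (trunc_weight a \<rho>) x = of_nat a * trunc_weight (a - 1) \<rho> x * (- 2 * of_real (x \<bullet> b))"
    using dir_deriv_compose_real[OF 1 DERIV_max0_power[OF assms], of b]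
    by (simp add: trunc_weight_def[abs_def] dir_deriv_radius del: of_real_diff)
qed

lemma Ck_trunc_weight: "open S \<Longrightarrow> k < a \<Longrightarrow> Ck k (trunc_weight a \<rho>) S"
proof (induction k arbitrary: a)
  case 0 then show ?case by (simp add: continuous_trunc_weight)
next
  case (Suc k)
  then have a: "a \<ge> 2" by simp
  have "Ck k (dir_deriv b (trunc_weight a \<rho>)) S" for b
    unfolding has_derivative_trunc_weight(2)[OF a, abs_def]
    by (intro Ck_mult Ck_cmult Suc.IH Suc.prems(1) Ck_inner Ck_const) (use Suc.prems in auto)
  then show ?case using has_derivative_trunc_weight(1)[OF a] by auto
qed

lemma inner_supp_trunc_weight: assumes "\<rho> < 1" "a \<ge> 1" shows "inner_supp (trunc_weight a \<rho>)"
  unfolding inner_supp_def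
proof (intro exI conjI ballI impI)
  show "sqrt (max 0 \<rho>) < 1" using assms by (auto simp: max_def)
  fix x :: 'a assume "x \<in> ball 0 1" "sqrt (max 0 \<rho>) < norm x"
  then have "max 0 \<rho> < (norm x)\<^sup>2"
    using real_le_rsqrt[of "norm x" "max 0 \<rho>"] by linarith
  then have "max 0 (\<rho> - x \<bullet> x) = 0" by (simp add: power2_norm_eq_inner)
  then show "trunc_weight a \<rho> x = 0" using assms by (simp add: trunc_weight_def)
qed

text \<open>Write |x|^2 as \<rho> - (\<rho> - |x|^2): a factor |x|^2 is traded for a weight of the
  next order.\<close>

lemma trunc_weight_mult_nsq:
  assumes "a \<ge> 1"
  shows "of_real (x \<bullet> x) * trunc_weight a \<rho> x = of_real \<rho> * trunc_weight a \<rho> x - trunc_weight (Suc a) \<rho> x"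
proof (cases "\<rho> - x \<bullet> x \<le> 0")
  case True then show ?thesis using assms by (simp add: trunc_weight_def)
next
  case False
  then have "trunc_weight j \<rho> x = of_real (\<rho> - x \<bullet> x) ^ j" for j by (simp add: trunc_weight_def max_def)
  then show ?thesis by (simp add: algebra_simps)
qed

lemma laplacian_trunc_weight:
  fixes x :: "'a::euclidean_space"
  assumes "a \<ge> 3"
  shows "laplacian (trunc_weight a \<rho>) x = of_nat a * (4 * of_nat (a - 1) * of_real \<rho> * trunc_weight (a - 2) \<rho> x
     - (4 * of_nat (a - 1) + 2 * of_nat DIM('a)) * trunc_weight (a - 1) \<rho> x)"
proof -
  have D: "((\<lambda>t. real a * (max 0 t) ^ (a - 1)) has_real_derivative real a * (real (a - 1) * (max 0 t) ^ (a - 1 - 1))) (at t)" for t :: real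
    by (rule DERIV_cmult[OF DERIV_max0_power]) (use assms in simp)
  have "laplacian (trunc_weight a \<rho>) x = of_real (real a * (max 0 (\<rho> - x \<bullet> x)) ^ (a - 1)) * laplacian (\<lambda>x. of_real (\<rho> - x \<bullet> x)) x
     + of_real (real a * (real (a - 1) * (max 0 (\<rho> - x \<bullet> x)) ^ (a - 1 - 1))) * (\<Sum>b\<in>Basis. (dir_deriv b (\<lambda>x. of_real (\<rho> - x \<bullet> x)) x)\<^sup>2)"
    unfolding trunc_weight_def[abs_def]
    by (rule laplacian_compose_real[of UNIV, where \<phi>' = "\<lambda>t. real a * (max 0 t) ^ (a - 1)"])
     (rule open_UNIV Ck_radius DERIV_max0_power D UNIV_I; use assms in simp)+
  also have "(\<Sum>b\<in>Basis. (dir_deriv b (\<lambda>x. complex_of_real (\<rho> - x \<bullet> x)) x)\<^sup>2) = 4 * of_real (x \<bullet> x)"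
    by (simp add: dir_deriv_radius power_mult_distrib del: of_real_diff flip: sum_distrib_left) (simp add: euclidean_inner[of x x] power2_eq_square)
  also have "of_real (real a * (real (a - 1) * (max 0 (\<rho> - x \<bullet> x)) ^ (a - 1 - 1))) * (4 * of_real (x \<bullet> x))
      = of_nat a * 4 * of_nat (a - 1) * (of_real (x \<bullet> x) * trunc_weight (a - 2) \<rho> x)"
    by (simp add: trunc_weight_def numeral_2_eq_2)
  also have "\<dots> = of_nat a * 4 * of_nat (a - 1) * (of_real \<rho> * trunc_weight (a - 2) \<rho> x - trunc_weight (a - 1) \<rho> x)"
  proof -
    have "Suc (a - 2) = a - 1" "1 \<le> a - 2" using assms by auto
    then show ?thesis using trunc_weight_mult_nsq[of "a - 2" x \<rho>] by simp
  qed
  finally show ?thesis by (simp add: laplacian_radius trunc_weight_def[abs_def] algebra_simps del: of_real_diff)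
qed

section \<open>Moments of polyharmonic functions\<close>

text \<open>The derivative of the truncated power is Lipschitz up to the argument 1 with a constant
  depending only on a; this uniformity is what allows the moments to be differentiated in \<rho>
  under the integral.\<close>

lemma truncated_power_taylor:
  fixes s t :: real
  assumes a: "a \<ge> 2" and "s \<le> 1" "t \<le> 1"
  shows "\<bar>(max 0 s) ^ a - (max 0 t) ^ a - (s - t) * (real a * (max 0 t) ^ (a - 1))\<bar> \<le> (real a)\<^sup>2 * (s - t)\<^sup>2"
proof -
  have "norm ((max 0 s) ^ a - (max 0 t) ^ a - (s - t) *\<^sub>R (real a * (max 0 t) ^ (a - 1))) \<le> norm (s - t) * ((real a)\<^sup>2 * \<bar>s - t\<bar>)"
  proof (rule vector_differentiable_bound_linearization[where S = "closed_segment t s" and ?x0.0 = t and f' = "\<lambda>t. real a * (max 0 t) ^ (a - 1)"])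
    show "((\<lambda>t. max 0 t ^ a) has_vector_derivative real a * max 0 x ^ (a - 1)) (at x within closed_segment t s)" for x :: real
      using DERIV_max0_power[OF a, of x]
      by (simp add: has_real_derivative_iff_has_vector_derivative has_vector_derivative_at_within)
    fix x assume x: "x \<in> closed_segment t s"
    have x1: "x \<le> 1" "\<bar>x - t\<bar> \<le> \<bar>s - t\<bar>" using x assms by (auto simp: closed_segment_eq_real_ivl split: if_splits)
    have "\<bar>max 0 x ^ (a - 1) - max 0 t ^ (a - 1)\<bar> \<le> real (a - 1) * \<bar>max 0 x - max 0 t\<bar>"
      using norm_power_diff[of "max 0 x" "max 0 t" "a - 1"] x1 assms by auto
    also have "\<dots> \<le> real a * \<bar>s - t\<bar>" using x1 by (intro mult_mono) auto
    finally have "real a * \<bar>max 0 x ^ (a - 1) - max 0 t ^ (a - 1)\<bar> \<le> real a * (real a * \<bar>s - t\<bar>)"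
      by (rule mult_left_mono) auto
    then show "norm (real a * max 0 x ^ (a - 1) - real a * max 0 t ^ (a - 1)) \<le> (real a)\<^sup>2 * \<bar>s - t\<bar>"
      by (simp add: power2_eq_square mult.assoc abs_mult flip: right_diff_distrib)
  qed auto
  also have "norm (s - t) * ((real a)\<^sup>2 * \<bar>s - t\<bar>) = (real a)\<^sup>2 * (s - t)\<^sup>2"
    by (simp add: power2_eq_square)
  finally show ?thesis by simp
qed

lemma ball_integral_norm_le:
  assumes "set_integrable lborel (ball 0 1) f" "set_integrable lborel (ball 0 1) g"
    "\<And>x. x \<in> ball 0 1 \<Longrightarrow> norm (f x) \<le> g x"
  shows "norm (ball_integral f) \<le> (LINT x:ball 0 1|lborel. g x)"
  unfolding set_lebesgue_integral_def
proof (rule Bochner_Integration.integral_norm_bound_integral)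
  show "norm (indicator (ball 0 1) x *\<^sub>R f x) \<le> indicator (ball 0 1) x *\<^sub>R g x" for x
    using assms(3)[of x] by (cases "x \<in> ball 0 1") simp_all
qed (use assms(1,2) in \<open>simp_all add: set_integrable_def\<close>)

lemma set_integrable_inner_le:
  fixes f :: "'a::euclidean_space \<Rightarrow> complex"
  assumes "continuous_on (ball 0 1) f" "0 \<le> r" "r < 1"
  shows "set_integrable lborel (ball 0 1) (\<lambda>x. if x \<bullet> x \<le> r then norm (f x) else 0)"
proof -
  have le: "x \<bullet> x \<le> r \<longleftrightarrow> norm x \<le> sqrt r" for x :: 'a
    using assms(2) by (simp add: norm_eq_sqrt_inner)
  have s1: "sqrt r < 1" using assms by simp
  have "integrable lborel (\<lambda>x. indicator (cball 0 (sqrt r)) x *\<^sub>R norm (f x))"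
    by (intro borel_integrable_compact continuous_on_norm continuous_on_subset[OF assms(1)] compact_cball)
      (simp only: subset_iff mem_cball mem_ball dist_0_norm, blast intro: le_less_trans[OF _ s1])
  moreover have "indicator (cball 0 (sqrt r)) x *\<^sub>R norm (f x) = indicator (ball 0 1) x *\<^sub>R (if x \<bullet> x \<le> r then norm (f x) else 0)" for x
    unfolding le using le_less_trans[OF _ s1, of "norm x"] by (cases "norm x \<le> sqrt r") simp_all
  ultimately show ?thesis by (simp add: set_integrable_def)
qed

definition weighted_mom :: "nat \<Rightarrow> ('a::euclidean_space \<Rightarrow> complex) \<Rightarrow> real \<Rightarrow> complex" where
  "weighted_mom a f \<rho> = ball_integral (\<lambda>x. f x * trunc_weight a \<rho> x)"

lemma weighted_mom_integrable:
  assumes "continuous_on (ball 0 1) f" "\<rho> < 1" "1 \<le> a"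
  shows "set_integrable lborel (ball 0 1) (\<lambda>x. f x * trunc_weight a \<rho> x)"
  by (intro inner_supp_set_integrable continuous_on_mult continuous_trunc_weight inner_supp_mult(2) inner_supp_trunc_weight assms)

lemma weighted_mom_deriv:
  assumes f: "continuous_on (ball 0 1) f" and a: "2 \<le> a" and \<rho>: "0 < \<rho>" "\<rho> < 1"
  shows "(weighted_mom a f has_vector_derivative (of_nat a * weighted_mom (a - 1) f \<rho>)) (at \<rho>)"
proof -
  \<comment> \<open>A common squared radius: for \<sigma> close to \<rho> all weights involved
    vanish where x \<bullet> x > r, and f is integrable on the rest.\<close>
  define r where "r = (\<rho> + 1) / 2"
  have r: "0 \<le> r" "r < 1" using \<rho> by (auto simp: r_def)
  define M where "M = (LINT x:ball 0 1|lborel. (if x \<bullet> x \<le> r then norm (f x) else 0))"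
  have Mi: "set_integrable lborel (ball 0 1) (\<lambda>x. if x \<bullet> x \<le> r then norm (f x) else 0)"
    by (rule set_integrable_inner_le[OF f r])
  have M0: "M \<ge> 0" unfolding M_def set_lebesgue_integral_def
    by (intro Bochner_Integration.integral_nonneg) (auto simp: indicator_def)
  have est: "norm (weighted_mom a f \<sigma> - weighted_mom a f \<rho> - (\<sigma> - \<rho>) *\<^sub>R (of_nat a * weighted_mom (a - 1) f \<rho>)) \<le> ((real a)\<^sup>2 * M) * (\<sigma> - \<rho>)\<^sup>2"
    if \<sigma>: "\<bar>\<sigma> - \<rho>\<bar> < (1 - \<rho>) / 2" for \<sigma>
  proof -
    have \<sigma>r: "\<sigma> < r" "\<rho> < r" using \<sigma> \<rho> by (auto simp: r_def abs_if field_simps split: if_splits)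
    let ?g = "\<lambda>x. f x * trunc_weight a \<sigma> x - f x * trunc_weight a \<rho> x - (of_real (\<sigma> - \<rho>) * of_nat a) * (f x * trunc_weight (a - 1) \<rho> x)"
    have i: "set_integrable lborel (ball 0 1) (\<lambda>x. f x * trunc_weight a \<sigma> x)" "set_integrable lborel (ball 0 1) (\<lambda>x. f x * trunc_weight a \<rho> x)"
       "set_integrable lborel (ball 0 1) (\<lambda>x. (of_real (\<sigma> - \<rho>) * of_nat a) * (f x * trunc_weight (a - 1) \<rho> x))"
      using \<sigma>r r \<rho> a by (auto intro!: weighted_mom_integrable f set_integrable_mult_right)
    have "weighted_mom a f \<sigma> - weighted_mom a f \<rho> - (\<sigma> - \<rho>) *\<^sub>R (of_nat a * weighted_mom (a - 1) f \<rho>) = ball_integral ?g"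
      by (subst set_integral_diff(2)[OF set_integral_diff(1)[OF i(1,2)] i(3)], subst set_integral_diff(2)[OF i(1,2)])
        (simp add: weighted_mom_def scaleR_conv_of_real mult.assoc)
    also have "norm \<dots> \<le> (LINT x:ball 0 1|lborel. ((real a)\<^sup>2 * (\<sigma> - \<rho>)\<^sup>2) * (if x \<bullet> x \<le> r then norm (f x) else 0))"
    proof (rule ball_integral_norm_le[OF set_integral_diff(1)[OF set_integral_diff(1)[OF i(1,2)] i(3)]])
      show "set_integrable lborel (ball 0 1) (\<lambda>x. ((real a)\<^sup>2 * (\<sigma> - \<rho>)\<^sup>2) * (if x \<bullet> x \<le> r then norm (f x) else 0))"
        using Mi by (rule set_integrable_mult_right)
      fix x :: 'a assume "x \<in> ball 0 1"
      show "norm (?g x) \<le> ((real a)\<^sup>2 * (\<sigma> - \<rho>)\<^sup>2) * (if x \<bullet> x \<le> r then norm (f x) else 0)"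
      proof (cases "x \<bullet> x \<le> r")
        case True
        have "?g x = f x * of_real ((max 0 (\<sigma> - x \<bullet> x)) ^ a - (max 0 (\<rho> - x \<bullet> x)) ^ a - (\<sigma> - \<rho>) * (real a * (max 0 (\<rho> - x \<bullet> x)) ^ (a - 1)))"
          by (simp add: trunc_weight_def algebra_simps)
        also have "norm \<dots> = norm (f x) * \<bar>(max 0 (\<sigma> - x \<bullet> x)) ^ a - (max 0 (\<rho> - x \<bullet> x)) ^ a - (\<sigma> - \<rho>) * (real a * (max 0 (\<rho> - x \<bullet> x)) ^ (a - 1))\<bar>"
          by (simp only: norm_mult norm_of_real)
        also have "\<dots> \<le> norm (f x) * ((real a)\<^sup>2 * (\<sigma> - \<rho>)\<^sup>2)"
          using truncated_power_taylor[OF a, of "\<sigma> - x \<bullet> x" "\<rho> - x \<bullet> x"] \<sigma>r r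
          by (intro mult_left_mono) (auto intro: order_trans[OF _ inner_ge_zero] simp: algebra_simps add_increasing2)
        finally show ?thesis using True by (simp add: mult.commute)
      next
        case False
        then have "trunc_weight j \<sigma> x = 0" "trunc_weight j \<rho> x = 0" if "j \<ge> 1" for j
          using \<sigma>r that by (auto simp: trunc_weight_def max_def)
        then show ?thesis using a False by simp
      qed
    qed
    finally show ?thesis by (simp add: M_def mult_ac)
  qed
  show ?thesis
    unfolding has_vector_derivative_def has_derivative_at_alt
  proof (intro conjI allI impI)
    show "bounded_linear (\<lambda>x. x *\<^sub>R (of_nat a * weighted_mom (a - 1) f \<rho>))" by (rule bounded_linear_scaleR_left)
    fix e :: real assume e: "e > 0"
    define d where "d = min ((1 - \<rho>) / 2) (e / ((real a)\<^sup>2 * M + 1))"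
    have c: "(real a)\<^sup>2 * M + 1 > 0" using M0 by (simp add: add_nonneg_pos)
    have d: "d > 0" using \<rho> e c by (simp add: d_def)
    have "norm (weighted_mom a f \<sigma> - weighted_mom a f \<rho> - (\<sigma> - \<rho>) *\<^sub>R (of_nat a * weighted_mom (a - 1) f \<rho>)) \<le> e * norm (\<sigma> - \<rho>)"
      if "norm (\<sigma> - \<rho>) < d" for \<sigma>
    proof -
      have "((real a)\<^sup>2 * M) * \<bar>\<sigma> - \<rho>\<bar> \<le> ((real a)\<^sup>2 * M + 1) * (e / ((real a)\<^sup>2 * M + 1))"
        using that M0 by (intro mult_mono) (auto simp: d_def)
      then have "((real a)\<^sup>2 * M) * \<bar>\<sigma> - \<rho>\<bar> \<le> e" using c by simp
      from mult_right_mono[OF this, of "\<bar>\<sigma> - \<rho>\<bar>"]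
      have "((real a)\<^sup>2 * M) * (\<sigma> - \<rho>)\<^sup>2 \<le> e * \<bar>\<sigma> - \<rho>\<bar>" by (simp add: power2_eq_square mult.assoc)
      then show ?thesis using est[of \<sigma>] that by (simp add: d_def)
    qed
    then show "\<exists>d>0. \<forall>y. norm (y - \<rho>) < d \<longrightarrow> norm (weighted_mom a f y - weighted_mom a f \<rho> - (y - \<rho>) *\<^sub>R (of_nat a * weighted_mom (a - 1) f \<rho>)) \<le> e * norm (y - \<rho>)"
      using d by blast
  qed
qed

text \<open>A homogeneous harmonic polynomial of degree m, with homogeneity encoded by Euler's
  identity: this form is stable under differentiation and is what the cross term in Green's identity
  asks for.\<close>

definition solid_harmonic :: "nat \<Rightarrow> ('a::euclidean_space \<Rightarrow> complex) \<Rightarrow> bool" where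
  "solid_harmonic m Y \<longleftrightarrow> (\<forall>j. Ck j Y UNIV) \<and>
     (\<forall>x. (\<Sum>b\<in>Basis. of_real (x \<bullet> b) * dir_deriv b Y x) = of_nat m * Y x) \<and> (\<forall>x. laplacian Y x = 0)"

text \<open>Green's identity moves the Laplacian to Y times the weight. Harmonicity of Y removes one
  term and Euler's identity turns the cross term into a multiple of m Y times the weight of order a,
  so only moments of u of orders a - 1 and a remain.\<close>

lemma weighted_mom_laplacian:
  fixes u :: "'a::euclidean_space \<Rightarrow> complex"
  assumes Y: "solid_harmonic m Y" and u: "Ck 2 u (ball 0 1)" and a: "2 \<le> a" and \<rho>: "\<rho> < 1"
  shows "weighted_mom (Suc a) (\<lambda>x. laplacian u x * Y x) \<rho> =
     4 * of_nat (Suc a) * (of_real \<rho> * (of_nat a * weighted_mom (a - 1) (\<lambda>x. u x * Y x) \<rho>)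
       - of_real (real DIM('a) / 2 + real m + real a) * weighted_mom a (\<lambda>x. u x * Y x) \<rho>)"
proof -
  let ?c = "4 * of_nat (Suc a) :: complex" and ?k = "real DIM('a) / 2 + real m + real a"
  have Y2: "Ck 2 Y S" for S using Y Ck_subset[of 2 Y UNIV S] by (auto simp: solid_harmonic_def)
  have k2: "Ck 2 (trunc_weight (Suc a) \<rho>) S" if "open S" for S :: "'a set" using a that by (intro Ck_trunc_weight) auto
  have cY: "continuous_on (ball 0 1) Y" using Ck_continuous[OF Y2] .
  have cu: "continuous_on (ball 0 1) u" using Ck_continuous[OF u] .
  have L: "laplacian (\<lambda>x. Y x * trunc_weight (Suc a) \<rho> x) x = ?c * of_real \<rho> * of_nat a * (Y x * trunc_weight (a - 1) \<rho> x)
       - ?c * of_real ?k * (Y x * trunc_weight a \<rho> x)" for x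
  proof -
    have "laplacian (\<lambda>x. Y x * trunc_weight (Suc a) \<rho> x) x = Y x * laplacian (trunc_weight (Suc a) \<rho>) x
      + 2 * (\<Sum>b\<in>Basis. dir_deriv b Y x * dir_deriv b (trunc_weight (Suc a) \<rho>) x)"
      using laplacian_mult[OF open_UNIV Y2 k2[OF open_UNIV]] Y by (simp add: solid_harmonic_def)
    also have "(\<Sum>b\<in>Basis. dir_deriv b Y x * dir_deriv b (trunc_weight (Suc a) \<rho>) x)
       = - 2 * of_nat (Suc a) * trunc_weight a \<rho> x * (\<Sum>b\<in>Basis. of_real (x \<bullet> b) * dir_deriv b Y x)"
      using a by (simp add: has_derivative_trunc_weight sum_distrib_left algebra_simps flip: sum_negf sum.distrib)
    also have "\<dots> = - 2 * of_nat (Suc a) * trunc_weight a \<rho> x * (of_nat m * Y x)" using Y by (simp add: solid_harmonic_def)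
    also have "laplacian (trunc_weight (Suc a) \<rho>) x = of_nat (Suc a) * (4 * of_nat a * of_real \<rho> * trunc_weight (a - 1) \<rho> x
        - (4 * of_nat a + 2 * of_nat DIM('a)) * trunc_weight a \<rho> x)"
      using laplacian_trunc_weight[of "Suc a" \<rho> x] a by (simp add: Suc_diff_Suc numeral_2_eq_2)
    finally show ?thesis by (simp add: algebra_simps add_divide_distrib)
  qed
  have "weighted_mom (Suc a) (\<lambda>x. laplacian u x * Y x) \<rho> = ball_integral (\<lambda>x. laplacian u x * (Y x * trunc_weight (Suc a) \<rho> x))"
    by (simp add: weighted_mom_def mult.assoc)
  also have "\<dots> = ball_integral (\<lambda>x. u x * laplacian (\<lambda>x. Y x * trunc_weight (Suc a) \<rho> x) x)"
    by (rule green[OF u]) (auto intro!: Ck_mult Y2 k2 inner_supp_mult inner_supp_trunc_weight \<rho>)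
  also have "\<dots> = ball_integral (\<lambda>x. (?c * of_real \<rho> * of_nat a) * ((u x * Y x) * trunc_weight (a - 1) \<rho> x)
       - (?c * of_real ?k) * ((u x * Y x) * trunc_weight a \<rho> x))"
    by (simp add: L algebra_simps)
  also have "\<dots> = (?c * of_real \<rho> * of_nat a) * weighted_mom (a - 1) (\<lambda>x. u x * Y x) \<rho> - (?c * of_real ?k) * weighted_mom a (\<lambda>x. u x * Y x) \<rho>"
    using a \<rho> by (subst set_integral_diff(2)) (auto simp: weighted_mom_def intro!: set_integrable_mult_right weighted_mom_integrable continuous_on_mult cu cY)
  finally have e: "weighted_mom (Suc a) (\<lambda>x. laplacian u x * Y x) \<rho> = \<dots>" .
  show ?thesis unfolding e by (simp only: right_diff_distrib mult.assoc mult.left_commute)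
qed

section \<open>Normalised moments and Pizzetti's expansion\<close>

lemma powr_has_vector_derivative:
  "\<rho> > 0 \<Longrightarrow> ((\<lambda>\<rho>. complex_of_real (\<rho> powr r)) has_vector_derivative complex_of_real (r * \<rho> powr (r - 1))) (at \<rho>)"
  by (intro has_vector_derivative_of_real has_real_derivative_powr)

lemma of_real_powr_cancel:
  assumes "\<rho> > 0"
  shows "complex_of_real (\<rho> powr - r) * of_real (\<rho> powr r) = 1"
    "complex_of_real (\<rho> powr r) * of_real (\<rho> powr - r) = 1"
  using assms by (simp_all add: powr_minus flip: of_real_mult)

text \<open>The normalisation that turns the Laplacian on the ball into differentiation in the squared radius.\<close>

lemma normalized_weighted_mom_deriv:
  fixes u :: "'a::euclidean_space \<Rightarrow> complex"
  assumes Y: "solid_harmonic m Y" and u: "Ck 2 u (ball 0 1)" and a: "2 \<le> a" and \<rho>: "0 < \<rho>" "\<rho> < 1"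
    and k: "k = real DIM('a) / 2 + real m"
  shows "((\<lambda>\<rho>. of_real (\<rho> powr - (k + real a)) * weighted_mom a (\<lambda>x. u x * Y x) \<rho>) has_vector_derivative
     of_real (\<rho> powr - (k + real (Suc a))) * weighted_mom (Suc a) (\<lambda>x. laplacian u x * Y x) \<rho> / (4 * of_nat (Suc a))) (at \<rho>)"
proof -
  have Y2: "Ck 2 Y (ball 0 1)" using Y Ck_subset[of 2 Y UNIV "ball 0 1"] by (auto simp: solid_harmonic_def)
  have c: "continuous_on (ball 0 1) (\<lambda>x. u x * Y x)"
    by (intro continuous_on_mult Ck_continuous[OF u] Ck_continuous[OF Y2])
  let ?b = "weighted_mom a (\<lambda>x. u x * Y x)" and ?b1 = "weighted_mom (a - 1) (\<lambda>x. u x * Y x)"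
  have "((\<lambda>\<rho>. of_real (\<rho> powr - (k + real a)) * ?b \<rho>) has_vector_derivative
     of_real (\<rho> powr - (k + real a)) * (of_nat a * ?b1 \<rho>) + of_real (- (k + real a) * \<rho> powr (- (k + real a) - 1)) * ?b \<rho>) (at \<rho>)"
    by (intro has_vector_derivative_mult powr_has_vector_derivative weighted_mom_deriv c a \<rho>)
  moreover have "of_real (\<rho> powr - (k + real a)) = of_real (\<rho> powr - (k + real (Suc a))) * complex_of_real \<rho>"
  proof -
    have "\<rho> powr - (k + real a) = \<rho> powr - (k + real (Suc a)) * \<rho> powr 1" unfolding powr_add[symmetric] by (simp add: algebra_simps)
    then show ?thesis using \<rho> by simp
  qed
  moreover have "- (k + real a) - 1 = - (k + real (Suc a))" by simp
  ultimately have d: "((\<lambda>\<rho>. of_real (\<rho> powr - (k + real a)) * ?b \<rho>) has_vector_derivative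
     of_real (\<rho> powr - (k + real (Suc a))) * (of_real \<rho> * (of_nat a * ?b1 \<rho>) - of_real (k + real a) * ?b \<rho>)) (at \<rho>)"
    by (elim back_subst[where P = "\<lambda>d. (_ has_vector_derivative d) (at \<rho>)"]) (simp only: of_real_mult of_real_minus distrib_left mult_ac mult_minus_left mult_minus_right diff_conv_add_uminus)
  have "of_real (\<rho> powr - (k + real (Suc a))) * weighted_mom (Suc a) (\<lambda>x. laplacian u x * Y x) \<rho> / (4 * of_nat (Suc a))
     = of_real (\<rho> powr - (k + real (Suc a))) * (of_real \<rho> * (of_nat a * ?b1 \<rho>) - of_real (k + real a) * ?b \<rho>)"
    unfolding weighted_mom_laplacian[OF Y u a \<rho>(2)] k by (simp del: of_nat_Suc of_real_add of_real_divide)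
  with d show ?thesis by simp
qed

lemma has_vector_derivative_poly_sum:
  "((\<lambda>\<rho>. \<Sum>l<N. c l * of_real \<rho> ^ l) has_vector_derivative (\<Sum>l<N. c l * (of_nat l * of_real \<rho> ^ (l - 1)))) (at \<rho>)"
  for c :: "nat \<Rightarrow> complex"
proof -
  have "((\<lambda>\<rho>. complex_of_real (\<rho> ^ l)) has_vector_derivative complex_of_real (real l * \<rho> ^ (l - 1))) (at \<rho>)" for l
    by (rule has_vector_derivative_of_real) (auto intro!: derivative_eq_intros)
  then have "((\<lambda>\<rho>. c l * of_real \<rho> ^ l) has_vector_derivative c l * (of_nat l * of_real \<rho> ^ (l - 1))) (at \<rho>)" for l
    using has_vector_derivative_mult_right[of "\<lambda>\<rho>. complex_of_real (\<rho> ^ l)" _ _ "c l"] by simp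
  then show ?thesis by (intro has_vector_derivative_sum)
qed

lemma polyharmonic_laplacian:
  assumes "u \<in> polyharmonic (Suc N)"
  shows "laplacian u \<in> polyharmonic N" "Ck 2 u (ball 0 1)"
  using assms Ck_laplacian[of "ball 0 1" "2 * N" u] Ck_le[of "2 * Suc N" u "ball 0 1" 2]
  unfolding polyharmonic_def by (auto simp: funpow_Suc_right simp del: funpow.simps continuously_differentiable_on.simps)

text \<open>Pizzetti's expansion, twisted by a solid harmonic \<open>Y\<close>.\<close>

lemma weighted_mom_polyharmonic:
  fixes u :: "'a::euclidean_space \<Rightarrow> complex"
  assumes Y: "solid_harmonic m Y" and u: "u \<in> polyharmonic N" and a: "2 \<le> a"
    and k: "k = real DIM('a) / 2 + real m"
  shows "\<exists>c. \<forall>\<rho>. 0 < \<rho> \<longrightarrow> \<rho> < 1 \<longrightarrow>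
    weighted_mom a (\<lambda>x. u x * Y x) \<rho> = of_real (\<rho> powr (k + real a)) * (\<Sum>l<N. c l * of_real \<rho> ^ l)"
  using u a
proof (induction N arbitrary: u a)
  case 0
  then have u0: "u x = 0" if "x \<in> ball 0 1" for x using that by (auto simp: polyharmonic_def)
  have "weighted_mom a (\<lambda>x. u x * Y x) \<rho> = ball_integral (\<lambda>x::'a. 0)" for \<rho>
    unfolding weighted_mom_def set_lebesgue_integral_def by (intro Bochner_Integration.integral_cong refl) (auto simp: u0 indicator_def)
  then show ?case by (simp add: set_lebesgue_integral_def)
next
  case (Suc N)
  note u2 = polyharmonic_laplacian[OF Suc.prems(1)]
  obtain c where c: "weighted_mom (Suc a) (\<lambda>x. laplacian u x * Y x) \<rho> = of_real (\<rho> powr (k + real (Suc a))) * (\<Sum>l<N. c l * of_real \<rho> ^ l)"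
    if "0 < \<rho>" "\<rho> < 1" for \<rho> using Suc.IH[OF u2(1), of "Suc a"] Suc.prems(2) by auto
  \<comment> \<open>Coefficients of the termwise antiderivative; the slot l = 0 stays free for the
    constant d obtained below.\<close>
  define e where "e = (\<lambda>l. if l = 0 then 0 else c (l - 1) / (4 * of_nat (Suc a) * of_nat l))"
  let ?P = "\<lambda>\<rho>. of_real (\<rho> powr - (k + real a)) * weighted_mom a (\<lambda>x. u x * Y x) \<rho>"
  have D0: "((\<lambda>\<rho>. ?P \<rho> - (\<Sum>l<Suc N. e l * of_real \<rho> ^ l)) has_vector_derivative 0) (at \<rho>)"
    if \<rho>: "0 < \<rho>" "\<rho> < 1" for \<rho>
  proof -
    have "(\<Sum>l<Suc N. e l * (of_nat l * of_real \<rho> ^ (l - 1))) = (\<Sum>l<N. c l * complex_of_real \<rho> ^ l) / (4 * of_nat (Suc a))"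
      by (subst sum.lessThan_Suc_shift) (simp add: e_def sum_divide_distrib del: of_nat_Suc)
    then have "of_real (\<rho> powr - (k + real (Suc a))) * weighted_mom (Suc a) (\<lambda>x. laplacian u x * Y x) \<rho> / (4 * of_nat (Suc a))
        = (\<Sum>l<Suc N. e l * (of_nat l * complex_of_real \<rho> ^ (l - 1)))"
      by (simp only: c[OF \<rho>] mult.assoc[symmetric] of_real_powr_cancel(1)[OF \<rho>(1)] mult_1_left)
    with has_vector_derivative_diff[OF normalized_weighted_mom_deriv[OF Y u2(2) Suc.prems(2) \<rho> k] has_vector_derivative_poly_sum[of e "Suc N" \<rho>]]
    show ?thesis by simp
  qed
  have "\<forall>\<rho>\<in>{0<..<1}. ((\<lambda>\<rho>. ?P \<rho> - (\<Sum>l<Suc N. e l * of_real \<rho> ^ l)) has_vector_derivative 0) (at \<rho> within {0<..<1})"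
    by (rule ballI, rule has_vector_derivative_at_within, rule D0) simp_all
  then obtain d where d: "\<And>\<rho>. \<rho> \<in> {0<..<1} \<Longrightarrow> ?P \<rho> - (\<Sum>l<Suc N. e l * of_real \<rho> ^ l) = d"
    using has_vector_derivative_zero_constant[of "{0<..<1}" "\<lambda>\<rho>. ?P \<rho> - (\<Sum>l<Suc N. e l * of_real \<rho> ^ l)"] convex_real_interval(8) by blast
  show ?case
  proof (intro exI allI impI)
    fix \<rho> :: real assume \<rho>: "0 < \<rho>" "\<rho> < 1"
    have "?P \<rho> = d + (\<Sum>l<Suc N. e l * of_real \<rho> ^ l)" using d[of \<rho>] \<rho> by (simp only: diff_eq_eq greaterThanLessThan_iff simp_thms)
    also have "\<dots> = (\<Sum>l<Suc N. (if l = 0 then d else e l) * of_real \<rho> ^ l)"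
      unfolding sum.lessThan_Suc_shift by (simp add: e_def)
    finally have "?P \<rho> = \<dots>" .
    moreover have "weighted_mom a (\<lambda>x. u x * Y x) \<rho> = of_real (\<rho> powr (k + real a)) * ?P \<rho>"
      by (simp only: mult.assoc[symmetric] of_real_powr_cancel(2)[OF \<rho>(1)] mult_1_left)
    ultimately show "weighted_mom a (\<lambda>x. u x * Y x) \<rho> = of_real (\<rho> powr (k + real a)) * (\<Sum>l<Suc N. (if l = 0 then d else e l) * of_real \<rho> ^ l)"
      by simp
  qed
qed

text \<open>The converse of Pizzetti's expansion. Each Laplacian differentiates the normalised
  moment once, so a polynomial with N coefficients is annihilated after N of them. This is how the
  quotient by the weight is recognised as polyharmonic.\<close>

lemma weighted_mom_laplacian_pow_zero:
  fixes u :: "'a::euclidean_space \<Rightarrow> complex"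
  assumes Y: "solid_harmonic m Y" and u: "Ck (2 * N) u (ball 0 1)" and a: "2 \<le> a"
    and k: "k = real DIM('a) / 2 + real m"
    and c: "\<And>\<rho>. 0 < \<rho> \<Longrightarrow> \<rho> < 1 \<Longrightarrow>
       weighted_mom a (\<lambda>x. u x * Y x) \<rho> = of_real (\<rho> powr (k + real a)) * (\<Sum>l<N. c l * of_real \<rho> ^ l)"
    and \<rho>: "0 < \<rho>" "\<rho> < 1"
  shows "weighted_mom (a + N) (\<lambda>x. (laplacian ^^ N) u x * Y x) \<rho> = 0"
  using u a c
proof (induction N arbitrary: u a c)
  case 0 then show ?case using \<rho> by simp
next
  case (Suc N)
  have u2: "Ck 2 u (ball 0 1)" by (rule Ck_le[OF Suc.prems(1)]) simp
  have u3: "Ck (2 * N) (laplacian u) (ball 0 1)" by (rule Ck_laplacian) (use Suc.prems in simp_all)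
  have "weighted_mom (Suc a + N) (\<lambda>x. (laplacian ^^ N) (laplacian u) x * Y x) \<rho> = 0"
  proof (rule Suc.IH[OF u3])
    show "2 \<le> Suc a" using Suc.prems by simp
    fix \<sigma> :: real assume \<sigma>: "0 < \<sigma>" "\<sigma> < 1"
    let ?P = "\<lambda>\<rho>. of_real (\<rho> powr - (k + real a)) * weighted_mom a (\<lambda>x. u x * Y x) \<rho>"
    have "(?P has_vector_derivative (\<Sum>l<Suc N. c l * (of_nat l * of_real \<sigma> ^ (l - 1)))) (at \<sigma>)"
    proof (rule has_vector_derivative_transform_within_open[OF has_vector_derivative_poly_sum, where S = "{0<..<1}"])
      fix x :: real assume x: "x \<in> {0<..<1}"
      have "weighted_mom a (\<lambda>y. u y * Y y) x = of_real (x powr (k + real a)) * (\<Sum>l<Suc N. c l * of_real x ^ l)"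
        using Suc.prems(3)[of x] x by simp
      moreover have "complex_of_real (x powr - (k + real a)) * of_real (x powr (k + real a)) = 1"
        using x by (intro of_real_powr_cancel) simp
      ultimately show "(\<Sum>l<Suc N. c l * of_real x ^ l) = ?P x" by (simp only: mult.assoc[symmetric] mult_1_left)
    qed (use \<sigma> in auto)
    from vector_derivative_unique_at[OF this normalized_weighted_mom_deriv[OF Y u2 Suc.prems(2) \<sigma> k]]
    have eq: "of_real (\<sigma> powr - (k + real (Suc a))) * weighted_mom (Suc a) (\<lambda>x. laplacian u x * Y x) \<sigma> / (4 * of_nat (Suc a))
       = (\<Sum>l<N. c (Suc l) * (of_nat (Suc l) * of_real \<sigma> ^ l))"
      by (subst (asm) sum.lessThan_Suc_shift) simp
    have "weighted_mom (Suc a) (\<lambda>x. laplacian u x * Y x) \<sigma> = of_real (\<sigma> powr (k + real (Suc a))) * (4 * of_nat (Suc a))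
        * (of_real (\<sigma> powr - (k + real (Suc a))) * weighted_mom (Suc a) (\<lambda>x. laplacian u x * Y x) \<sigma> / (4 * of_nat (Suc a)))"
    proof -
      note of_real_powr_cancel(2)[OF \<sigma>(1), of "k + real (Suc a)"]
      moreover have "p * (4 * of_nat (Suc a)) * (q * X / (4 * of_nat (Suc a))) = X" if "p * q = 1" for p q X :: complex
        using that by (simp del: of_nat_Suc add: mult.assoc[symmetric])
      ultimately show ?thesis by simp
    qed
    also have "\<dots> = of_real (\<sigma> powr (k + real (Suc a))) * (\<Sum>l<N. (4 * of_nat (Suc a) * c (Suc l) * of_nat (Suc l)) * of_real \<sigma> ^ l)"
      unfolding eq by (simp add: sum_distrib_left mult_ac)
    finally show "weighted_mom (Suc a) (\<lambda>x. laplacian u x * Y x) \<sigma> = \<dots>" .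
  qed
  then show ?case by (simp add: funpow_Suc_right del: funpow.simps)
qed

section \<open>Behaviour of the moments as the radius tends to 0\<close>

lemma weighted_mom_bound:
  assumes f: "continuous_on (ball 0 1) f" and "1 \<le> a"
  shows "\<exists>C\<ge>0. \<forall>\<rho>. 0 < \<rho> \<longrightarrow> \<rho> < 1/2 \<longrightarrow> norm (weighted_mom a f \<rho>) \<le> C * \<rho> ^ a"
proof -
  have i: "set_integrable lborel (ball 0 1) (\<lambda>x. if x \<bullet> x \<le> 1/2 then norm (f x) else 0)"
    by (rule set_integrable_inner_le[OF f]) auto
  have "norm (weighted_mom a f \<rho>) \<le> (LINT x:ball 0 1|lborel. \<rho> ^ a * (if x \<bullet> x \<le> 1/2 then norm (f x) else 0))" if "0 < \<rho>" "\<rho> < 1/2" for \<rho>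
    unfolding weighted_mom_def
  proof (rule ball_integral_norm_le[OF weighted_mom_integrable[OF f _ assms(2)] set_integrable_mult_right[OF i]])
    fix x :: 'a
    have "norm (trunc_weight a \<rho> x) \<le> \<rho> ^ a" unfolding trunc_weight_def norm_of_real
      using that by (auto simp: power_abs intro!: power_mono)
    moreover have "trunc_weight a \<rho> x = 0" if "x \<bullet> x > 1/2" using that \<open>\<rho> < 1/2\<close> assms(2) by (simp add: trunc_weight_def)
    ultimately show "norm (f x * trunc_weight a \<rho> x) \<le> \<rho> ^ a * (if x \<bullet> x \<le> 1/2 then norm (f x) else 0)"
      using mult_left_mono[of "norm (trunc_weight a \<rho> x)" "\<rho> ^ a" "norm (f x)"] by (auto simp: norm_mult mult.commute)
  qed (use that in auto)
  moreover have "(LINT x:ball (0::'a) 1|lborel. (if x \<bullet> x \<le> 1/2 then norm (f x) else 0)) \<ge> 0"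
    unfolding set_lebesgue_integral_def by (intro Bochner_Integration.integral_nonneg) (auto simp: indicator_def)
  ultimately show ?thesis
    by (intro exI[of _ "LINT x:ball (0::'a) 1|lborel. (if x \<bullet> x \<le> 1/2 then norm (f x) else 0)"]) (auto simp: mult.commute)
qed

lemma weighted_mom_tendsto_0:
  assumes f: "continuous_on (ball 0 1) f" and a: "1 \<le> a"
  shows "(weighted_mom a f \<longlongrightarrow> 0) (at_right 0)"
proof -
  obtain C where C: "\<And>\<rho>. 0 < \<rho> \<Longrightarrow> \<rho> < 1/2 \<Longrightarrow> norm (weighted_mom a f \<rho>) \<le> C * \<rho> ^ a"
    using weighted_mom_bound[OF assms] by blast
  have "((\<lambda>\<rho>::real. C * \<rho> ^ a) \<longlongrightarrow> C * 0 ^ a) (at_right 0)" by (intro tendsto_intros)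
  then have "((\<lambda>\<rho>::real. C * \<rho> ^ a) \<longlongrightarrow> 0) (at_right 0)" using a by (simp add: power_0_left)
  moreover have "eventually (\<lambda>\<rho>. norm (weighted_mom a f \<rho>) \<le> C * \<rho> ^ a) (at_right 0)"
    using C by (auto simp: eventually_at_right_field intro!: exI[of _ "1/2"])
  ultimately show ?thesis by (rule Lim_null_comparison[rotated])
qed

text \<open>The derivative of the moment of order a + 1 is a multiple of the moment of order a, so
  the former is constant in \<rho>, and its limit at 0 fixes the constant.\<close>

lemma weighted_mom_zero_up:
  assumes f: "continuous_on (ball 0 1) f" and a: "1 \<le> a"
    and z: "\<And>\<rho>. 0 < \<rho> \<Longrightarrow> \<rho> < 1 \<Longrightarrow> weighted_mom a f \<rho> = 0" and \<rho>: "0 < \<rho>" "\<rho> < 1"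
  shows "weighted_mom (Suc a) f \<rho> = 0"
proof -
  have "(weighted_mom (Suc a) f has_vector_derivative 0) (at \<sigma>)" if "0 < \<sigma>" "\<sigma> < 1" for \<sigma>
    using weighted_mom_deriv[OF f, of "Suc a" \<sigma>] a z[of \<sigma>] that by simp
  then have "\<forall>\<sigma>\<in>{0<..<1}. (weighted_mom (Suc a) f has_vector_derivative 0) (at \<sigma> within {0<..<1})"
    by (auto intro: has_vector_derivative_at_within)
  then obtain d where d: "\<And>\<sigma>. \<sigma> \<in> {0<..<1} \<Longrightarrow> weighted_mom (Suc a) f \<sigma> = d"
    using has_vector_derivative_zero_constant[of "{0<..<1}" "weighted_mom (Suc a) f"] convex_real_interval(8) by blast
  have "eventually (\<lambda>\<sigma>. weighted_mom (Suc a) f \<sigma> = d) (at_right 0)"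
    using d by (auto simp: eventually_at_right_field intro!: exI[of _ 1])
  then have "(weighted_mom (Suc a) f \<longlongrightarrow> d) (at_right 0)" by (rule tendsto_eventually)
  then have "d = 0" using weighted_mom_tendsto_0[OF f, of "Suc a"] tendsto_unique[of "at_right (0::real)"] by auto
  then show ?thesis using d \<rho> by simp
qed

section \<open>Solid harmonics span the polynomials\<close>

definition euler :: "('a::euclidean_space \<Rightarrow> complex) \<Rightarrow> 'a \<Rightarrow> complex" where
  "euler f x = (\<Sum>b\<in>Basis. of_real (x \<bullet> b) * dir_deriv b f x)"

lemma euler_cong:
  "open S \<Longrightarrow> x \<in> S \<Longrightarrow> (\<And>y. y \<in> S \<Longrightarrow> f y = g y) \<Longrightarrow> euler f x = euler g x"
  unfolding euler_def using dir_deriv_cong[of S x f g] by simp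

lemma euler_mult:
  "f differentiable at x \<Longrightarrow> g differentiable at x \<Longrightarrow> euler (\<lambda>x. f x * g x) x = f x * euler g x + euler f x * g x"
  by (simp add: euler_def dir_deriv_mult sum_distrib_left sum_distrib_right sum.distrib[symmetric] algebra_simps)

lemma euler_const [simp]: "euler (\<lambda>x. c) x = 0"
  by (simp add: euler_def)

lemma euler_cmult: "f differentiable at x \<Longrightarrow> euler (\<lambda>x. c * f x) x = c * euler f x"
  using euler_mult[of "\<lambda>_. c" x f] by simp

lemma euler_add:
  "f differentiable at x \<Longrightarrow> g differentiable at x \<Longrightarrow> euler (\<lambda>x. f x + g x) x = euler f x + euler g x"
  by (simp add: euler_def dir_deriv_add sum.distrib[symmetric] algebra_simps)

lemma euler_diff:
  "f differentiable at x \<Longrightarrow> g differentiable at x \<Longrightarrow> euler (\<lambda>x. f x - g x) x = euler f x - euler g x"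
  by (simp add: euler_def dir_deriv_diff sum_subtractf[symmetric] algebra_simps)

lemma euler_inner: "euler (\<lambda>x. complex_of_real (x \<bullet> c)) x = of_real (x \<bullet> c)"
proof -
  have "euler (\<lambda>x. complex_of_real (x \<bullet> c)) x = complex_of_real (\<Sum>b\<in>Basis. (x \<bullet> b) * (c \<bullet> b))"
    by (simp add: euler_def inner_commute)
  then show ?thesis by (simp flip: euclidean_inner)
qed

lemma nsq_Ck: "open S \<Longrightarrow> Ck k (\<lambda>x. complex_of_real (x \<bullet> x)) S"
  using Ck_nsq[of S k 0] by simp

lemma dir_deriv_nsq0: "dir_deriv b (\<lambda>x. complex_of_real (x \<bullet> x)) x = 2 * of_real (x \<bullet> b)"
  using fun_cong[OF dir_deriv_nsq[of b 0], of x] by simp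

lemma euler_nsq: "euler (\<lambda>x. complex_of_real (x \<bullet> x)) x = 2 * of_real (x \<bullet> x)"
proof -
  have "euler (\<lambda>x. complex_of_real (x \<bullet> x)) x = complex_of_real (\<Sum>b\<in>Basis. 2 * ((x \<bullet> b) * (x \<bullet> b)))"
    by (simp add: euler_def dir_deriv_nsq0 mult_ac)
  then show ?thesis by (simp add: sum_distrib_left[symmetric] euclidean_inner[of x x, symmetric] del: of_real_sum)
qed

lemma laplacian_nsq0: "laplacian (\<lambda>x::'a::euclidean_space. complex_of_real (x \<bullet> x)) x = 2 * of_nat DIM('a)"
  using laplacian_nsq[of 0 x] by simp

lemma Ck_euler: assumes "open S" "Ck (Suc k) f S" shows "Ck k (euler f) S"
  unfolding euler_def[abs_def] by (intro Ck_sum Ck_mult assms Ck_inner Ck_dir_deriv[OF assms(2)])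

text \<open>The commutator of \<open>dir_deriv b\<close> with the Euler operator is
  \<open>dir_deriv b\<close> itself; this is why a derivative lowers the degree in Euler's identity
  by one.\<close>

lemma dir_deriv_euler:
  assumes "open S" "Ck 2 f S" "x \<in> S" "b \<in> Basis"
  shows "dir_deriv b (euler f) x = dir_deriv b f x + euler (dir_deriv b f) x"
proof -
  note f = Ck2D[OF assms(2,3)]
  have i: "(\<lambda>x. complex_of_real (x \<bullet> c)) differentiable at x" for c :: 'a
    using has_derivative_inner_of_real[of c x] by (auto simp: differentiable_def)
  have "dir_deriv b (euler f) x = (\<Sum>c\<in>Basis. dir_deriv b (\<lambda>x. of_real (x \<bullet> c) * dir_deriv c f x) x)"
    unfolding euler_def[abs_def] by (rule dir_deriv_sum) (intro differentiable_mult i f)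
  also have "\<dots> = (\<Sum>c\<in>Basis. of_real (x \<bullet> c) * dir_deriv c (dir_deriv b f) x + (if c = b then dir_deriv c f x else 0))"
  proof (rule sum.cong[OF refl])
    fix c :: 'a assume c: "c \<in> Basis"
    have "dir_deriv b (\<lambda>x. of_real (x \<bullet> c) * dir_deriv c f x) x
        = of_real (x \<bullet> c) * dir_deriv b (dir_deriv c f) x + of_real (b \<bullet> c) * dir_deriv c f x"
      by (subst dir_deriv_mult[OF i f(2)[OF c]]) simp
    then show "dir_deriv b (\<lambda>x. of_real (x \<bullet> c) * dir_deriv c f x) x
        = of_real (x \<bullet> c) * dir_deriv c (dir_deriv b f) x + (if c = b then dir_deriv c f x else 0)"
      using dir_deriv_commute[OF assms(1-3) assms(4) c] c assms(4) by (simp add: inner_Basis)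
  qed
  finally show ?thesis using assms(4) by (simp add: sum.distrib euler_def)
qed

section \<open>Derivatives and coordinate multiples of solid harmonics\<close>

lemma solid_harmonicD:
  assumes "solid_harmonic m Y"
  shows "Ck j Y UNIV" "Y differentiable at x" "euler Y x = of_nat m * Y x" "laplacian Y x = 0"
proof -
  show *: "Ck j Y UNIV" for j using assms by (simp add: solid_harmonic_def)
  show "Y differentiable at x" using *[of 1] by auto
qed (use assms in \<open>auto simp: solid_harmonic_def euler_def\<close>)

lemma solid_harmonicI:
  "(\<And>j. Ck j Y UNIV) \<Longrightarrow> (\<And>x. euler Y x = of_nat m * Y x) \<Longrightarrow> (\<And>x. laplacian Y x = 0) \<Longrightarrow> solid_harmonic m Y"
  by (auto simp: solid_harmonic_def euler_def)

lemma solid_harmonic_const: "solid_harmonic 0 (\<lambda>x. c)"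
  by (rule solid_harmonicI) auto

lemma solid_harmonic_dir_deriv:
  assumes Y: "solid_harmonic m Y" and b: "b \<in> Basis"
  shows "m = Suc l \<Longrightarrow> solid_harmonic l (dir_deriv b Y)"
    "euler (dir_deriv b Y) x = (of_nat m - 1) * dir_deriv b Y x" "laplacian (dir_deriv b Y) x = 0"
    "Ck j (dir_deriv b Y) UNIV"
proof -
  note Yd = solid_harmonicD[OF Y]
  show *: "Ck j (dir_deriv b Y) UNIV" for j by (rule Ck_dir_deriv[OF Yd(1) b])
  have e: "euler Y = (\<lambda>x. of_nat m * Y x)" using Yd(3) by auto
  show 1: "euler (dir_deriv b Y) x = (of_nat m - 1) * dir_deriv b Y x" for x
    using dir_deriv_euler[OF open_UNIV Yd(1) _ b, of x] Yd(2) unfolding e by (simp add: dir_deriv_cmult algebra_simps)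
  have l: "laplacian Y = (\<lambda>x. 0)" using Yd(4) by auto
  show 2: "laplacian (dir_deriv b Y) x = 0" for x
    using laplacian_dir_deriv[OF open_UNIV Yd(1) _ b, of x] unfolding l by simp
  show "m = Suc l \<Longrightarrow> solid_harmonic l (dir_deriv b Y)"
    by (rule solid_harmonicI) (use * 1 2 in auto)
qed

text \<open>Euler's identity with m = 0 says that Y has zero radial derivative away from the origin;
  continuity at the origin, common to all rays, makes Y constant.\<close>

lemma solid_harmonic_0_dir_deriv:
  assumes Y: "solid_harmonic 0 Y" and b: "b \<in> Basis"
  shows "dir_deriv b Y x = 0"
proof -
  note Yd = solid_harmonicD[OF Y]
  have "Y x = Y 0" for x
  proof -
    let ?f = "\<lambda>t::real. Y (0 + t *\<^sub>R x)"
    have d: "(?f has_vector_derivative dir_deriv x Y (0 + t *\<^sub>R x)) (at t)" for t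
      by (rule dir_deriv_line[OF Yd(2)])
    have z: "dir_deriv x Y (0 + t *\<^sub>R x) = 0" if "t \<noteq> 0" for t
    proof -
      have "of_real t * dir_deriv x Y (t *\<^sub>R x) = euler Y (t *\<^sub>R x)"
        by (simp add: dir_deriv_linear_basis[OF Yd(2), of x] euler_def sum_distrib_left mult.assoc)
      then show ?thesis using that Yd(3) by simp
    qed
    have "?f 1 = Y 0"
    proof (rule has_derivative_zero_unique_strong_interval[where k = "{0}" and a = 0 and b = 1 and f = ?f])
      show "continuous_on {0..1} ?f"
        by (intro continuous_at_imp_continuous_on ballI has_vector_derivative_continuous[OF d])
      fix t :: real assume "t \<in> {0..1} - {0}"
      then show "(?f has_derivative (\<lambda>h. 0)) (at t within {0..1})"
        using d[of t] z[of t] by (auto simp: has_vector_derivative_def intro: has_derivative_at_withinI)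
    qed auto
    then show ?thesis by simp
  qed
  then have "Y = (\<lambda>_. Y 0)" by auto
  then show ?thesis by (metis dir_deriv_const)
qed

lemma inner_differentiable [simp]: "(\<lambda>x. complex_of_real (x \<bullet> c)) differentiable at x"
  using has_derivative_inner_of_real[of c x] by (auto simp: differentiable_def)

lemma nsq_differentiable [simp]: "(\<lambda>x. complex_of_real (x \<bullet> x)) differentiable at x"
  using has_derivative_nsq[of 0 x] by (auto simp: differentiable_def)

text \<open>The harmonic part of a coordinate times a solid harmonic.\<close>

lemma solid_harmonic_linear_mult:
  fixes Y :: "'a::euclidean_space \<Rightarrow> complex"
  assumes Y: "solid_harmonic m Y" and b: "b \<in> Basis" and n: "DIM('a) \<ge> 2"
  defines "q \<equiv> 1 / of_real (real DIM('a) + 2 * real m - 2) :: complex"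
  shows "solid_harmonic (Suc m) (\<lambda>x. of_real (x \<bullet> b) * Y x - q * (of_real (x \<bullet> x) * dir_deriv b Y x))"
proof -
  let ?V = "dir_deriv b Y"
  note Yd = solid_harmonicD[OF Y] and Vd = solid_harmonic_dir_deriv(2-4)[OF Y b]
  have Vdiff: "?V differentiable at x" for x using Vd(3)[of 1] by auto
  have C1: "Ck j (\<lambda>x. of_real (x \<bullet> b) * Y x) UNIV" and C2: "Ck j (\<lambda>x. of_real (x \<bullet> x) * ?V x) UNIV" for j
    by (intro Ck_mult open_UNIV Ck_inner nsq_Ck Yd Vd)+
  show ?thesis
  proof (rule solid_harmonicI)
    show "Ck j (\<lambda>x. of_real (x \<bullet> b) * Y x - q * (of_real (x \<bullet> x) * ?V x)) UNIV" for j
      by (intro Ck_diff Ck_cmult open_UNIV C1 C2)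
    fix x :: 'a
    have "euler (\<lambda>x. of_real (x \<bullet> b) * Y x - q * (of_real (x \<bullet> x) * ?V x)) x
       = (of_real (x \<bullet> b) * euler Y x + euler (\<lambda>x. of_real (x \<bullet> b)) x * Y x)
        - q * (of_real (x \<bullet> x) * euler ?V x + euler (\<lambda>x. of_real (x \<bullet> x)) x * ?V x)"
      by (subst euler_diff euler_cmult euler_mult; (intro differentiable_mult differentiable_const inner_differentiable nsq_differentiable Yd Vdiff)?)+ simp
    then show "euler (\<lambda>x. of_real (x \<bullet> b) * Y x - q * (of_real (x \<bullet> x) * ?V x)) x
       = of_nat (Suc m) * (of_real (x \<bullet> b) * Y x - q * (of_real (x \<bullet> x) * ?V x))"
      unfolding Yd Vd euler_inner euler_nsq by (simp add: algebra_simps)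
    have l1: "laplacian (\<lambda>x. of_real (x \<bullet> b) * Y x) x = 2 * ?V x"
    proof -
      have "laplacian (\<lambda>x. complex_of_real (x \<bullet> b)) x = 0" by (simp add: laplacian_def)
      moreover have "(\<Sum>c\<in>Basis. complex_of_real (c \<bullet> b) * dir_deriv c Y x) = ?V x"
      proof -
        have "(\<Sum>c\<in>Basis. complex_of_real (c \<bullet> b) * dir_deriv c Y x) = (\<Sum>c\<in>Basis. if c = b then dir_deriv c Y x else 0)"
          by (rule sum.cong) (use b in \<open>auto simp: inner_Basis\<close>)
        then show ?thesis using b by simp
      qed
      ultimately show ?thesis
        using laplacian_mult[OF open_UNIV Ck_inner Yd(1), of x b] Yd(4) by simp
    qed
    have l2: "laplacian (\<lambda>x. of_real (x \<bullet> x) * ?V x) x = (2 * of_nat DIM('a) + 4 * (of_nat m - 1)) * ?V x"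
    proof -
      have "laplacian (\<lambda>x. of_real (x \<bullet> x) * ?V x) x = 2 * of_nat DIM('a) * ?V x + 4 * euler ?V x"
        using laplacian_mult[OF open_UNIV nsq_Ck[OF open_UNIV] Vd(3), of x] Vd(2)
        by (simp add: laplacian_nsq0 dir_deriv_nsq0 euler_def sum_distrib_left mult_ac)
      then show ?thesis by (simp add: Vd algebra_simps)
    qed
    have "laplacian (\<lambda>x. of_real (x \<bullet> b) * Y x - q * (of_real (x \<bullet> x) * ?V x)) x
       = laplacian (\<lambda>x. of_real (x \<bullet> b) * Y x) x - q * laplacian (\<lambda>x. of_real (x \<bullet> x) * ?V x) x"
      by (subst laplacian_diff[OF open_UNIV C1 Ck_cmult[OF open_UNIV C2]], simp, subst laplacian_cmult[OF open_UNIV C2]) auto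
    also have "\<dots> = 0"
    \<comment> \<open>For m = 0 in dimension 2 the denominator of q is 0 and q takes the default
      value 0; since \<open>dir_deriv b Y\<close> vanishes for m = 0, the formula survives.\<close>
    proof (cases "m = 0")
      case True then show ?thesis using solid_harmonic_0_dir_deriv[of Y b x] Y b l1 l2 by simp
    next
      case False
      then have nz: "complex_of_real (real DIM('a) + 2 * real m - 2) \<noteq> 0" using n by (subst of_real_eq_0_iff) linarith
      have "(2 * of_nat DIM('a) + 4 * (of_nat m - 1)) = 2 * complex_of_real (real DIM('a) + 2 * real m - 2)"
        by (simp add: algebra_simps)
      then have "q * (2 * of_nat DIM('a) + 4 * (of_nat m - 1)) = 2" using nz by (simp only: q_def) (simp del: of_real_add of_real_diff)
      then show ?thesis unfolding l1 l2 by (simp add: mult.assoc[symmetric] del: mult.assoc)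
    qed
    finally show "laplacian (\<lambda>x. of_real (x \<bullet> b) * Y x - q * (of_real (x \<bullet> x) * ?V x)) x = 0" .
  qed
qed

text \<open>The span of the products of powers of |x|^2 with solid harmonics, given as a closed
  class so that induction over it replaces an explicit decomposition of polynomials.\<close>

inductive solid :: "('a::euclidean_space \<Rightarrow> complex) \<Rightarrow> bool" where
  harm: "solid_harmonic m Y \<Longrightarrow> solid Y"
| nsq: "solid f \<Longrightarrow> solid (\<lambda>x. of_real (x \<bullet> x) * f x)"
| add: "solid f \<Longrightarrow> solid g \<Longrightarrow> solid (\<lambda>x. f x + g x)"
| scale: "solid f \<Longrightarrow> solid (\<lambda>x. c * f x)"

lemma solid_continuous: "solid f \<Longrightarrow> continuous_on S f"
proof (induction rule: solid.induct)
  case (harm m Y)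
  then show ?case using continuous_on_subset[OF Ck_continuous[OF solid_harmonicD(1)]] by blast
next
  case (nsq f)
  show ?case by (rule continuous_on_mult[OF Ck_continuous[OF Ck_subset[OF nsq_Ck[OF open_UNIV]]] nsq.IH]) simp
qed (simp_all add: continuous_on_add continuous_on_mult)

lemma solid_linear_mult:
  fixes f :: "'a::euclidean_space \<Rightarrow> complex"
  assumes "solid f" and b: "b \<in> Basis" and n: "DIM('a) \<ge> 2"
  shows "solid (\<lambda>x. of_real (x \<bullet> b) * f x)"
  using assms(1)
proof (induction rule: solid.induct)
  case (harm m Y)
  let ?q = "1 / of_real (real DIM('a) + 2 * real m - 2) :: complex"
  have V: "solid (dir_deriv b Y)"
  proof (cases m)
    case 0
    then have "dir_deriv b Y = (\<lambda>x. 0)" using solid_harmonic_0_dir_deriv[of Y b] harm b by auto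
    then show ?thesis using solid.harm[OF solid_harmonic_const[of 0]] by simp
  next
    case (Suc l) then show ?thesis using solid.harm solid_harmonic_dir_deriv(1)[OF harm b] by blast
  qed
  have "solid (\<lambda>x. (of_real (x \<bullet> b) * Y x - ?q * (of_real (x \<bullet> x) * dir_deriv b Y x)) + ?q * (of_real (x \<bullet> x) * dir_deriv b Y x))"
    by (rule solid.add[OF solid.harm[OF solid_harmonic_linear_mult[OF harm b n]] solid.scale[OF solid.nsq[OF V]]])
  then show ?case by (simp only: diff_add_cancel)
next
  case (nsq f)
  from solid.nsq[OF nsq.IH] show ?case by (simp only: mult.left_commute)
next
  case (add f g)
  from solid.add[OF add.IH] show ?case by (simp only: distrib_left)
next
  case (scale f c)
  from solid.scale[OF scale.IH, of c] show ?case by (simp only: mult.left_commute)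
qed

lemma solid_sum: "(\<And>i. i \<in> I \<Longrightarrow> solid (f i)) \<Longrightarrow> solid (\<lambda>x. \<Sum>i\<in>I. f i x)"
  by (induction I rule: infinite_finite_induct) (auto intro: solid.add solid.harm[OF solid_harmonic_const])

text \<open>Stated as stability under multiplication by p rather than as membership of p, so that
  the product case of the induction is a composition of the two hypotheses.\<close>

lemma solid_polynomial_mult:
  fixes f :: "'a::euclidean_space \<Rightarrow> complex"
  assumes "real_polynomial_function p" and n: "DIM('a) \<ge> 2" and "solid f"
  shows "solid (\<lambda>x. of_real (p x) * f x)"
  using assms(1,3)
proof (induction arbitrary: f rule: real_polynomial_function.induct)
  case (linear h)
  have hx: "h x = (\<Sum>b\<in>Basis. (x \<bullet> b) * h b)" for x
  proof -
    have "h x = h (\<Sum>b\<in>Basis. (x \<bullet> b) *\<^sub>R b)" by (simp add: euclidean_representation)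
    also have "\<dots> = (\<Sum>b\<in>Basis. (x \<bullet> b) * h b)"
      using linear(1) by (simp add: linear_sum[OF bounded_linear.linear] linear_scale[OF bounded_linear.linear])
    finally show ?thesis .
  qed
  have e: "of_real (h x) * f x = (\<Sum>b\<in>Basis. of_real (h b) * (of_real (x \<bullet> b) * f x))" for x
    by (subst hx) (simp add: sum_distrib_right sum_distrib_left mult_ac)
  show ?case unfolding e by (intro solid_sum solid.scale solid_linear_mult linear n)
next
  case (const c) then show ?case by (rule solid.scale)
next
  case (add g h)
  from solid.add[OF add.IH(1)[OF add.prems] add.IH(2)[OF add.prems]] show ?case by (simp only: of_real_add distrib_right)
next
  case (mult g h)
  from mult.IH(1)[OF mult.IH(2)[OF mult.prems]] show ?case by (simp only: of_real_mult mult.assoc)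
qed

section \<open>Vanishing of all moments forces the function to vanish\<close>

lemma weighted_mom_add:
  assumes "continuous_on (ball 0 1) f" "continuous_on (ball 0 1) g" "\<rho> < 1" "1 \<le> a"
  shows "weighted_mom a (\<lambda>x. f x + g x) \<rho> = weighted_mom a f \<rho> + weighted_mom a g \<rho>"
  unfolding weighted_mom_def distrib_right
  by (rule set_integral_add(2)[OF weighted_mom_integrable[OF assms(1,3,4)] weighted_mom_integrable[OF assms(2,3,4)]])

lemma weighted_mom_cmult: "weighted_mom a (\<lambda>x. c * f x) \<rho> = c * weighted_mom a f \<rho>"
  unfolding weighted_mom_def mult.assoc by simp

text \<open>A factor |x|^2 costs one order of the weight, so the induction must treat all orders j
  >= a together.\<close>

lemma weighted_mom_solid_zero:
  assumes g: "continuous_on (ball 0 1) g" and a: "1 \<le> a"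
    and z: "\<And>m Y \<rho>. solid_harmonic m Y \<Longrightarrow> 0 < \<rho> \<Longrightarrow> \<rho> < 1 \<Longrightarrow> weighted_mom a (\<lambda>x. g x * Y x) \<rho> = 0"
    and "solid f" "a \<le> j" "0 < \<rho>" "\<rho> < 1"
  shows "weighted_mom j (\<lambda>x. g x * f x) \<rho> = 0"
  using assms(4-)
proof (induction arbitrary: j rule: solid.induct)
  case (harm m Y)
  have c: "continuous_on (ball 0 1) (\<lambda>x. g x * Y x)"
    by (intro continuous_on_mult g continuous_on_subset[OF Ck_continuous[OF solid_harmonicD(1)[OF harm(1)]]]) auto
  have "\<forall>\<sigma>. 0 < \<sigma> \<longrightarrow> \<sigma> < 1 \<longrightarrow> weighted_mom j (\<lambda>x. g x * Y x) \<sigma> = 0"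
    using harm.prems(1)
  proof (induction j rule: dec_induct)
    case base then show ?case using z[OF harm(1)] by blast
  next
    case (step n) then show ?case using weighted_mom_zero_up[OF c, of n] a by auto
  qed
  then show ?case using harm by blast
next
  case (nsq f)
  have c: "continuous_on (ball 0 1) (\<lambda>x. g x * f x)" by (intro continuous_on_mult g solid_continuous nsq)
  have "weighted_mom j (\<lambda>x. g x * (of_real (x \<bullet> x) * f x)) \<rho> = ball_integral (\<lambda>x. of_real \<rho> * (g x * f x * trunc_weight j \<rho> x) - g x * f x * trunc_weight (Suc j) \<rho> x)"
  proof -
    have "g x * (of_real (x \<bullet> x) * f x) * trunc_weight j \<rho> x = of_real \<rho> * (g x * f x * trunc_weight j \<rho> x) - g x * f x * trunc_weight (Suc j) \<rho> x" for x
    proof -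
      have "g x * (of_real (x \<bullet> x) * f x) * trunc_weight j \<rho> x = g x * f x * (of_real (x \<bullet> x) * trunc_weight j \<rho> x)" by (simp only: mult_ac)
      also have "\<dots> = g x * f x * (of_real \<rho> * trunc_weight j \<rho> x - trunc_weight (Suc j) \<rho> x)" by (subst trunc_weight_mult_nsq) (use a nsq.prems in auto)
      finally show ?thesis by (simp add: algebra_simps)
    qed
    then show ?thesis by (simp add: weighted_mom_def)
  qed
  also have "\<dots> = of_real \<rho> * weighted_mom j (\<lambda>x. g x * f x) \<rho> - weighted_mom (Suc j) (\<lambda>x. g x * f x) \<rho>"
    by (subst set_integral_diff(2)) (use a nsq.prems in \<open>auto simp: weighted_mom_def intro!: set_integrable_mult_right weighted_mom_integrable c\<close>)
  also have "\<dots> = 0" using nsq.IH[of j] nsq.IH[of "Suc j"] nsq.prems by simp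
  finally show ?case .
next
  case (add f h)
  have "weighted_mom j (\<lambda>x. g x * f x + g x * h x) \<rho> = weighted_mom j (\<lambda>x. g x * f x) \<rho> + weighted_mom j (\<lambda>x. g x * h x) \<rho>"
    by (rule weighted_mom_add) (use add.prems a in \<open>auto intro!: continuous_on_mult g solid_continuous[OF add.hyps(1)] solid_continuous[OF add.hyps(2)]\<close>)
  then show ?case using add by (simp add: distrib_left)
next
  case (scale f c)
  have "weighted_mom j (\<lambda>x. g x * f x) \<rho> = 0" using scale by blast
  moreover have "(\<lambda>x. g x * (c * f x)) = (\<lambda>x. c * (g x * f x))" by (rule ext) (rule mult.left_commute)
  ultimately show ?case by (simp only: weighted_mom_cmult mult_zero_right)
qed

text \<open>The set of points of S where F differs from 0 is open and null, hence empty.\<close>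

lemma nn_integral_zero_ball:
  fixes F :: "'a::euclidean_space \<Rightarrow> real"
  assumes c: "continuous_on S F" and S: "open S"
    and z: "(\<integral>\<^sup>+x\<in>S. ennreal (F x) \<partial>lborel) = 0" and nn: "\<And>x. x \<in> S \<Longrightarrow> F x \<ge> 0" and x: "x \<in> S"
  shows "F x = 0"
proof (rule ccontr)
  assume ne: "F x \<noteq> 0"
  define U where "U = {x \<in> S. F x \<noteq> 0}"
  have "open U"
  proof -
    have "U = S \<inter> F -` (- {0})" by (auto simp: U_def)
    then show ?thesis using continuous_open_preimage[OF c S, of "- {0}"] by (simp add: open_Compl)
  qed
  have m: "(\<lambda>x. ennreal (F x) * indicator S x) \<in> borel_measurable lborel"
  proof -
    have "(\<lambda>x. indicator S x *\<^sub>R F x) \<in> borel_measurable borel"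
      by (rule borel_measurable_continuous_on_indicator) (use S c in auto)
    then have "(\<lambda>x. ennreal (indicator S x *\<^sub>R F x)) \<in> borel_measurable lborel" by simp
    moreover have "ennreal (indicator S x *\<^sub>R F x) = ennreal (F x) * indicator S x" for x
      by (simp add: indicator_def)
    ultimately show ?thesis by simp
  qed
  have "AE x in lborel. ennreal (F x) * indicator S x = 0"
    using z by (subst (asm) nn_integral_0_iff_AE[OF m])
  then have "AE x in lborel. x \<notin> U"
  proof eventually_elim
    case (elim x)
    show ?case
    proof
      assume "x \<in> U"
      then have "x \<in> S" "F x \<noteq> 0" by (auto simp: U_def)
      moreover have "F x \<le> 0" using elim \<open>x \<in> S\<close> by (simp add: ennreal_eq_0_iff)
      ultimately show False using nn[of x] by simp
    qed
  qed
  then have "U \<in> null_sets lborel" using \<open>open U\<close> by (subst (asm) AE_iff_null_sets[symmetric]) auto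
  then have "negligible U" by (simp add: negligible_iff_null_sets null_sets_completionI)
  moreover have "U \<noteq> {}" using x ne by (auto simp: U_def)
  ultimately show False using open_not_negligible[OF \<open>open U\<close>] by blast
qed

lemma set_integral_zero_ball:
  fixes F :: "'a::euclidean_space \<Rightarrow> real"
  assumes c: "continuous_on S F" and S: "open S" and i: "set_integrable lborel S F"
    and z: "(LINT x:S|lborel. F x) \<le> 0" and nn: "\<And>x. x \<in> S \<Longrightarrow> F x \<ge> 0" and x: "x \<in> S"
  shows "F x = 0"
proof (rule nn_integral_zero_ball[OF c S _ nn x])
  have "(\<integral>\<^sup>+x\<in>S. ennreal (F x) \<partial>lborel) = (\<integral>\<^sup>+x. ennreal (indicator S x *\<^sub>R F x) \<partial>lborel)"
    by (intro nn_integral_cong) (auto simp: indicator_def)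
  also have "\<dots> = ennreal (\<integral>x. indicator S x *\<^sub>R F x \<partial>lborel)"
    by (rule nn_integral_eq_integral) (use i nn in \<open>auto simp: set_integrable_def indicator_def\<close>)
  also have "\<dots> = 0" using z by (simp add: set_lebesgue_integral_def ennreal_eq_0_iff)
  finally show "(\<integral>\<^sup>+x\<in>S. ennreal (F x) \<partial>lborel) = 0" .
qed

text \<open>Real polynomials lie in \<open>solid\<close>, so Re g and Im g are orthogonal to all of
  them for the nonnegative weight \<kappa>. Stone-Weierstrass on the support of \<kappa> then makes
  the weighted integral of h^2 smaller than e M for every e > 0.\<close>

lemma zero_of_weighted_mom_zero:
  fixes g :: "'a::euclidean_space \<Rightarrow> complex"
  assumes g: "continuous_on (ball 0 1) g" and a: "1 \<le> a" and n: "DIM('a) \<ge> 2"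
    and z: "\<And>m Y \<rho>. solid_harmonic m Y \<Longrightarrow> 0 < \<rho> \<Longrightarrow> \<rho> < 1 \<Longrightarrow> weighted_mom a (\<lambda>x. g x * Y x) \<rho> = 0"
    and x: "x \<in> ball 0 1"
  shows "g x = 0"
proof -
  have main: "L (g x) = 0" if L: "bounded_linear L" "\<And>z r. L (z * of_real r) = L z * r" for L :: "complex \<Rightarrow> real"
  proof -
    \<comment> \<open>The squared radius is adapted to x: the weight must be positive at x while its
      support stays compact in the ball.\<close>
    obtain \<rho> where \<rho>: "x \<bullet> x < \<rho>" "\<rho> < 1"
    proof -
      have "x \<bullet> x < 1" using x by (simp add: norm_lt_square)
      then show ?thesis using that dense by blast
    qed
    have \<rho>0: "0 < \<rho>" using \<rho> inner_ge_zero[of x] by linarith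
    define h where "h = (\<lambda>y. L (g y))"
    define \<kappa> where "\<kappa> = (\<lambda>y::'a. (max 0 (\<rho> - y \<bullet> y)) ^ a)"
    have hc: "continuous_on (ball 0 1) h" unfolding h_def by (rule bounded_linear.continuous_on[OF L(1) g])
    have \<kappa>c: "continuous_on S \<kappa>" for S unfolding \<kappa>_def by (intro continuous_intros)
    have \<kappa>0: "\<kappa> y \<ge> 0" for y by (simp add: \<kappa>_def)
    have out: "\<kappa> y = 0" if "\<not> y \<bullet> y \<le> \<rho>" for y using that a by (simp add: \<kappa>_def max_def)
    have int: "set_integrable lborel (ball 0 1) (\<lambda>y. f y * \<kappa> y)" if "continuous_on (ball 0 1) f" for f
    proof -
      have "set_integrable lborel (ball 0 1) (\<lambda>y. complex_of_real (f y) * trunc_weight a \<rho> y)"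
        by (rule weighted_mom_integrable) (use that \<rho> a in \<open>auto intro: continuous_intros\<close>)
      from integrable_bounded_linear[OF bounded_linear_Re this[unfolded set_integrable_def]]
      show ?thesis by (simp add: set_integrable_def trunc_weight_def \<kappa>_def)
    qed
    have poly: "(LINT y:ball 0 1|lborel. h y * p y * \<kappa> y) = 0" if p: "real_polynomial_function p" for p
    proof -
      have pc: "continuous_on S p" for S
        by (intro continuous_at_imp_continuous_on ballI continuous_real_polymonial_function p)
      have s: "solid (\<lambda>x. of_real (p x) * 1)" by (rule solid_polynomial_mult[OF p n solid.harm[OF solid_harmonic_const]])
      have "weighted_mom a (\<lambda>y. g y * (of_real (p y) * 1)) \<rho> = 0" by (rule weighted_mom_solid_zero[OF g a z s order_refl \<rho>0 \<rho>(2)])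
      then have "0 = L (ball_integral (\<lambda>y. g y * of_real (p y) * trunc_weight a \<rho> y))" using L(1) by (simp add: weighted_mom_def linear_0 bounded_linear.linear)
      also have "\<dots> = (\<integral>y. L (indicator (ball 0 1) y *\<^sub>R (g y * of_real (p y) * trunc_weight a \<rho> y)) \<partial>lborel)"
        unfolding set_lebesgue_integral_def
        by (rule integral_bounded_linear[OF L(1), symmetric], fold set_integrable_def, rule weighted_mom_integrable)
          (use \<rho> a in \<open>auto intro!: continuous_on_mult g continuous_on_of_real pc\<close>)
      also have "\<dots> = (\<integral>y. indicator (ball 0 1) y *\<^sub>R (h y * p y * \<kappa> y) \<partial>lborel)"
        by (intro Bochner_Integration.integral_cong refl)
          (use L(2) in \<open>auto simp: indicator_def h_def trunc_weight_def \<kappa>_def linear_0[OF bounded_linear.linear[OF L(1)]] simp flip: of_real_power\<close>)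
      finally show ?thesis by (simp add: set_lebesgue_integral_def)
    qed
    define M where "M = (LINT y:ball 0 1|lborel. \<bar>h y\<bar> * \<kappa> y)"
    have le: "(LINT y:ball 0 1|lborel. (h y)\<^sup>2 * \<kappa> y) \<le> e * M" if e: "e > 0" for e
    proof -
      have s1: "sqrt \<rho> < 1" using \<rho> by simp
      have sub: "cball (0::'a) (sqrt \<rho>) \<subseteq> ball 0 1"
        by (simp only: subset_iff mem_cball mem_ball dist_0_norm, blast intro: le_less_trans[OF _ s1])
      obtain p where p: "real_polynomial_function p" "\<And>y. y \<in> cball 0 (sqrt \<rho>) \<Longrightarrow> \<bar>h y - p y\<bar> < e"
        using Stone_Weierstrass_real_polynomial_function[OF compact_cball continuous_on_subset[OF hc sub] e] by blast
      have pc: "continuous_on S p" for S by (intro continuous_at_imp_continuous_on ballI continuous_real_polymonial_function p)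
      have "(LINT y:ball 0 1|lborel. (h y)\<^sup>2 * \<kappa> y) = (LINT y:ball 0 1|lborel. (h y)\<^sup>2 * \<kappa> y) - (LINT y:ball 0 1|lborel. (h y * p y) * \<kappa> y)"
        using poly[OF p(1)] by simp
      also have "\<dots> = (LINT y:ball 0 1|lborel. (h y)\<^sup>2 * \<kappa> y - (h y * p y) * \<kappa> y)"
        by (intro set_integral_diff(2)[symmetric] int continuous_intros hc pc)
      also have "\<dots> \<le> (LINT y:ball 0 1|lborel. e * (\<bar>h y\<bar> * \<kappa> y))"
      proof (rule set_integral_mono)
        show "set_integrable lborel (ball 0 1) (\<lambda>y. (h y)\<^sup>2 * \<kappa> y - (h y * p y) * \<kappa> y)"
          by (intro set_integral_diff(1) int continuous_intros hc pc)
        show "set_integrable lborel (ball 0 1) (\<lambda>y. e * (\<bar>h y\<bar> * \<kappa> y))"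
          by (intro set_integrable_mult_right int continuous_intros hc)
        fix y :: 'a
        show "(h y)\<^sup>2 * \<kappa> y - (h y * p y) * \<kappa> y \<le> e * (\<bar>h y\<bar> * \<kappa> y)"
        proof (cases "y \<bullet> y \<le> \<rho>")
          case True
          then have "\<bar>h y - p y\<bar> < e" using p(2)[of y] by (simp add: norm_eq_sqrt_inner)
          then have "h y * (h y - p y) \<le> \<bar>h y\<bar> * e"
            by (metis abs_ge_self abs_ge_zero abs_mult mult_left_mono order_trans less_imp_le)
          from mult_right_mono[OF this \<kappa>0[of y]] show ?thesis by (simp add: algebra_simps power2_eq_square)
        qed (simp add: out)
      qed
      finally show ?thesis by (simp add: M_def)
    qed
    have "(LINT y:ball 0 1|lborel. (h y)\<^sup>2 * \<kappa> y) \<le> 0"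
    proof (rule ccontr)
      assume "\<not> ?thesis"
      then have p: "(LINT y:ball 0 1|lborel. (h y)\<^sup>2 * \<kappa> y) > 0" (is "?I > 0") by simp
      have "?I \<le> (?I / (2 * (\<bar>M\<bar> + 1))) * M" using p by (intro le) (auto intro!: divide_pos_pos)
      also have "\<dots> \<le> (?I / (2 * (\<bar>M\<bar> + 1))) * (\<bar>M\<bar> + 1)" using p by (intro mult_left_mono) auto
      also have "\<dots> = ?I / 2" by (simp add: field_simps)
      finally show False using p by simp
    qed
    then have "(h x)\<^sup>2 * \<kappa> x = 0"
      by (intro set_integral_zero_ball[of "ball 0 1" "\<lambda>y. (h y)\<^sup>2 * \<kappa> y"] continuous_intros hc \<kappa>c int) (use x \<kappa>0 in auto)
    moreover have "\<kappa> x > 0" using \<rho> by (simp add: \<kappa>_def)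
    ultimately show ?thesis by (simp add: h_def)
  qed
  show ?thesis using main[OF bounded_linear_Re] main[OF bounded_linear_Im] by (simp add: complex_eq_iff)
qed

section \<open>Dividing by the weight\<close>

lemma second_difference_powr:
  "((\<lambda>t::real. ((1 - t) powr e - 2 * (1 - 2*t) powr e + (1 - 3*t) powr e) / t^2) \<longlongrightarrow> e * (e - 1)) (at_right 0)"
  by real_asymp

lemma one_minus_norm_le_radius:
  fixes x :: "'a::euclidean_space"
  assumes "norm x < 1" shows "1 - norm x \<le> 1 - x \<bullet> x"
  using assms mult_left_le[of "norm x" "norm x"] by (simp add: dot_square_norm power2_eq_square)

text \<open>As a function of s = 1 - |x|^2 the second difference of the weights of order 1 is a tent
  of height t supported in [t, 3 t]. There 1 - |x| <= 3 t, so |u| is at most (3 t)^(-\<gamma>) times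
  |u| (1 - |x|)^\<gamma>. The nodes start at 1 - t because \<rho> = 1 is out of reach: the weights
  are compactly supported in the ball only for \<rho> < 1.\<close>

lemma shell_bound:
  fixes u Y :: "'a::euclidean_space \<Rightarrow> complex"
  assumes u: "continuous_on (ball 0 1) u" and Y: "continuous_on UNIV Y"
    and i: "set_integrable lborel (ball 0 1) (\<lambda>x. norm (u x) * (1 - norm x) powr \<gamma>)" and \<gamma>: "\<gamma> < 0"
  shows "\<exists>C\<ge>0. \<forall>t. 0 < t \<longrightarrow> t < 1/3 \<longrightarrow>
     norm (weighted_mom 1 (\<lambda>x. u x * Y x) (1 - t) - 2 * weighted_mom 1 (\<lambda>x. u x * Y x) (1 - 2*t) + weighted_mom 1 (\<lambda>x. u x * Y x) (1 - 3*t))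
       \<le> C * t powr (1 - \<gamma>)"
proof -
  have "compact (Y ` cball 0 1)" by (intro compact_continuous_image continuous_on_subset[OF Y]) auto
  then obtain M where M: "M > 0" "\<And>x. x \<in> cball 0 1 \<Longrightarrow> norm (Y x) \<le> M"
    using compact_imp_bounded[of "Y ` cball 0 1"] unfolding bounded_pos by (meson imageI)
  define I where "I = (LINT x:ball (0::'a) 1|lborel. norm (u x) * (1 - norm x) powr \<gamma>)"
  have I: "I \<ge> 0" unfolding I_def set_lebesgue_integral_def
    by (intro Bochner_Integration.integral_nonneg) (auto simp: indicator_def)
  let ?f = "\<lambda>x. u x * Y x"
  have fc: "continuous_on (ball 0 1) ?f" by (intro continuous_on_mult u continuous_on_subset[OF Y]) auto
  have "norm (weighted_mom 1 ?f (1 - t) - 2 * weighted_mom 1 ?f (1 - 2*t) + weighted_mom 1 ?f (1 - 3*t)) \<le> (M * 3 powr (-\<gamma>) * I) * t powr (1 - \<gamma>)"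
    if t: "0 < t" "t < 1/3" for t
  proof -
    let ?g = "\<lambda>x. ?f x * trunc_weight 1 (1 - t) x - 2 * (?f x * trunc_weight 1 (1 - 2*t) x) + ?f x * trunc_weight 1 (1 - 3*t) x"
    have b: "set_integrable lborel (ball 0 1) (\<lambda>x. ?f x * trunc_weight 1 \<rho> x)" if "\<rho> < 1" for \<rho>
      by (rule weighted_mom_integrable[OF fc that]) simp
    have i1: "set_integrable lborel (ball 0 1) (\<lambda>x. ?f x * trunc_weight 1 (1 - t) x - 2 * (?f x * trunc_weight 1 (1 - 2*t) x))"
      by (intro set_integral_diff(1) b set_integrable_mult_right) (use t in auto)
    have eq: "weighted_mom 1 ?f (1 - t) - 2 * weighted_mom 1 ?f (1 - 2*t) + weighted_mom 1 ?f (1 - 3*t) = ball_integral ?g"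
    proof -
      have "ball_integral ?g = ball_integral (\<lambda>x. ?f x * trunc_weight 1 (1 - t) x - 2 * (?f x * trunc_weight 1 (1 - 2*t) x)) + ball_integral (\<lambda>x. ?f x * trunc_weight 1 (1 - 3*t) x)"
        by (rule set_integral_add(2)[OF i1 b]) (use t in simp)
      also have "ball_integral (\<lambda>x. ?f x * trunc_weight 1 (1 - t) x - 2 * (?f x * trunc_weight 1 (1 - 2*t) x)) =
          ball_integral (\<lambda>x. ?f x * trunc_weight 1 (1 - t) x) - ball_integral (\<lambda>x. 2 * (?f x * trunc_weight 1 (1 - 2*t) x))"
        by (intro set_integral_diff(2) b set_integrable_mult_right) (use t in auto)
      finally show ?thesis by (simp add: weighted_mom_def)
    qed
    have "norm (ball_integral ?g) \<le> (LINT x:ball 0 1|lborel. (M * (t * (3*t) powr (-\<gamma>))) * (norm (u x) * (1 - norm x) powr \<gamma>))"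
    proof (rule ball_integral_norm_le)
      show "set_integrable lborel (ball 0 1) ?g"
        by (intro set_integral_add(1) i1 b) (use t in simp)
      show "set_integrable lborel (ball 0 1) (\<lambda>x. (M * (t * (3*t) powr (-\<gamma>))) * (norm (u x) * (1 - norm x) powr \<gamma>))"
        by (intro set_integrable_mult_right i)
      fix x :: 'a assume x: "x \<in> ball 0 1"
      define s where "s = 1 - x \<bullet> x"
      define h where "h = max 0 (s - t) - 2 * max 0 (s - 2*t) + max 0 (s - 3*t)"
      have g: "?g x = u x * Y x * of_real h" by (simp add: trunc_weight_def h_def s_def algebra_simps)
      have h: "\<bar>h\<bar> \<le> t" "s > 3 * t \<Longrightarrow> h = 0" using t by (auto simp: h_def max_def)
      have d: "0 < 1 - norm x" "1 - norm x \<le> s" using x one_minus_norm_le_radius[of x] by (auto simp: s_def)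
      show "norm (?g x) \<le> (M * (t * (3*t) powr (-\<gamma>))) * (norm (u x) * (1 - norm x) powr \<gamma>)"
      proof (cases "s > 3 * t")
        case True then show ?thesis using h(2) M t unfolding g by simp
      next
        case False
        then have "(1 - norm x) powr (-\<gamma>) \<le> (3*t) powr (-\<gamma>)" using d \<gamma> by (intro powr_mono2) auto
        then have "1 \<le> (3*t) powr (-\<gamma>) * (1 - norm x) powr \<gamma>"
          using d by (simp add: powr_minus field_simps)
        then have "norm (u x) * (M * t) * 1 \<le> norm (u x) * (M * t) * ((3*t) powr (-\<gamma>) * (1 - norm x) powr \<gamma>)"
          using M t by (intro mult_left_mono) auto
        moreover have "norm (?g x) \<le> norm (u x) * (M * t)"
        proof -
          have "norm (?g x) = norm (u x) * (norm (Y x) * \<bar>h\<bar>)" unfolding g by (simp only: norm_mult norm_of_real mult.assoc)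
          also have "\<dots> \<le> norm (u x) * (M * t)" using M(2)[of x] x h(1) t M(1) by (intro mult_left_mono mult_mono) auto
          finally show ?thesis .
        qed
        ultimately have "norm (?g x) \<le> norm (u x) * (M * t) * ((3*t) powr (-\<gamma>) * (1 - norm x) powr \<gamma>)"
          unfolding mult_1_right by (rule order_trans[rotated])
        also have "\<dots> = (M * (t * (3*t) powr (-\<gamma>))) * (norm (u x) * (1 - norm x) powr \<gamma>)"
          by (simp only: mult_ac)
        finally show ?thesis .
      qed
    qed
    also have "\<dots> = (M * (t * (3*t) powr (-\<gamma>))) * I"
      unfolding I_def by (rule set_integral_mult_right)
    also have "t * (3*t) powr (-\<gamma>) = 3 powr (-\<gamma>) * t powr (1 - \<gamma>)"
    proof -
      have "t powr (1 - \<gamma>) = t * t powr (-\<gamma>)" using t powr_mult_base[of t "-\<gamma>"] by simp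
      then show ?thesis using t by (simp add: powr_mult)
    qed
    finally show ?thesis unfolding eq by (simp only: mult_ac)
  qed
  then show ?thesis using M I by (intro exI[of _ "M * 3 powr (-\<gamma>) * I"]) auto
qed

text \<open>The basis is dictated by division by w. For B = \<rho>^(k + 2 + i) one has (1 - \<rho>)
  B' + 2 B = (k + 2 + i) \<rho>^(k + 1 + i) - (k + i) \<rho>^(k + 2 + i), and the operator on the
  left links the moments of u / w to those of u. The same combinations have vanishing second
  derivative at \<rho> = 1, so the one extra monomial needed to complete the basis can be detected
  there.\<close>

lemma exponent_basis_decomposition:
  fixes g :: "nat \<Rightarrow> complex"
  assumes k: "k > 0"
  shows "\<exists>d c. \<forall>\<rho>::real. (\<Sum>l<Suc M. g l * of_real \<rho> ^ l) =
     (\<Sum>i<M. d i * (of_real (k + 2 + real i) * of_real \<rho> ^ i - of_real (k + real i) * of_real \<rho> ^ Suc i)) + c * of_real \<rho> ^ M"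
proof (induction M)
  case 0 then show ?case by (intro exI[of _ "\<lambda>_. 0"] exI[of _ "g 0"]) simp
next
  case (Suc M)
  then obtain d c where dc: "\<And>\<rho>::real. (\<Sum>l<Suc M. g l * of_real \<rho> ^ l) =
     (\<Sum>i<M. d i * (of_real (k + 2 + real i) * of_real \<rho> ^ i - of_real (k + real i) * of_real \<rho> ^ Suc i)) + c * of_real \<rho> ^ M"
    by blast
  define e where "e = c / of_real (k + 2 + real M)"
  have nz: "complex_of_real (k + 2 + real M) \<noteq> 0" using k by (subst of_real_eq_0_iff) linarith
  have ec: "e * of_real (k + 2 + real M) = c" using nz by (simp add: e_def del: of_real_add)
  show ?case
  proof (intro exI[of _ "d(M := e)"] exI[of _ "g (Suc M) + e * of_real (k + real M)"] allI)
    fix \<rho> :: real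
    have "(\<Sum>i<Suc M. (d(M := e)) i * (of_real (k + 2 + real i) * of_real \<rho> ^ i - of_real (k + real i) * of_real \<rho> ^ Suc i))
      = (\<Sum>i<M. d i * (of_real (k + 2 + real i) * of_real \<rho> ^ i - of_real (k + real i) * of_real \<rho> ^ Suc i))
        + (e * of_real (k + 2 + real M)) * of_real \<rho> ^ M - e * of_real (k + real M) * of_real \<rho> ^ Suc M"
      by (simp add: algebra_simps del: of_real_add)
    then show "(\<Sum>l<Suc (Suc M). g l * of_real \<rho> ^ l) =
      (\<Sum>i<Suc M. (d(M := e)) i * (of_real (k + 2 + real i) * of_real \<rho> ^ i - of_real (k + real i) * of_real \<rho> ^ Suc i))
      + (g (Suc M) + e * of_real (k + real M)) * of_real \<rho> ^ Suc M"
      unfolding ec sum.lessThan_Suc[of _ "Suc M"] dc by (simp add: distrib_right del: of_real_add)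
  qed
qed

lemma powr_times_power: "\<rho> > 0 \<Longrightarrow> \<rho> powr r * \<rho> ^ i = \<rho> powr (r + real i)"
  by (simp add: powr_add powr_realpow)

lemma weighted_mom_derivD:
  assumes f: "continuous_on (ball 0 1) f" and \<rho>: "0 < \<rho>" "\<rho> < 1"
    and c: "\<And>\<rho>. 0 < \<rho> \<Longrightarrow> \<rho> < 1 \<Longrightarrow> weighted_mom 2 f \<rho> = (\<Sum>l<N. c l * of_real (\<rho> powr (k + 2 + real l)))"
  shows "weighted_mom 1 f \<rho> = (\<Sum>l<N. c l * of_real (k + 2 + real l) / 2 * of_real (\<rho> powr (k + 1 + real l)))"
proof -
  have "((\<lambda>\<rho>. \<Sum>l<N. c l * of_real (\<rho> powr (k + 2 + real l))) has_vector_derivative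
      (\<Sum>l<N. c l * of_real ((k + 2 + real l) * \<rho> powr (k + 2 + real l - 1)))) (at \<rho>)"
    by (intro has_vector_derivative_sum has_vector_derivative_mult_right powr_has_vector_derivative \<rho>)
  then have "(weighted_mom 2 f has_vector_derivative
      (\<Sum>l<N. c l * of_real ((k + 2 + real l) * \<rho> powr (k + 2 + real l - 1)))) (at \<rho>)"
    by (rule has_vector_derivative_transform_within_open[where S = "{0<..<1}"]) (use \<rho> c in auto)
  from vector_derivative_unique_at[OF this weighted_mom_deriv[OF f _ \<rho>, of 2]]
  have "2 * weighted_mom 1 f \<rho> = (\<Sum>l<N. c l * of_real ((k + 2 + real l) * \<rho> powr (k + 2 + real l - 1)))" by simp
  moreover have "k + 2 + real l - 1 = k + 1 + real l" for l by simp
  ultimately have "weighted_mom 1 f \<rho> * 2 = (\<Sum>l<N. c l * of_real ((k + 2 + real l) * \<rho> powr (k + 1 + real l)))"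
    by (simp only: mult.commute)
  then have "weighted_mom 1 f \<rho> = (\<Sum>l<N. c l * of_real ((k + 2 + real l) * \<rho> powr (k + 1 + real l))) / 2"
    by (simp only: eq_divide_eq_numeral1 zero_neq_numeral) simp
  then show ?thesis by (simp add: sum_divide_distrib mult.assoc del: of_real_add)
qed

section \<open>Comparing the moments of u and of u / w\<close>

abbreviation wt :: "'a::euclidean_space \<Rightarrow> complex" where
  "wt x \<equiv> complex_of_real (1 - x \<bullet> x)"

lemma wt_nonzero: "x \<in> ball 0 1 \<Longrightarrow> wt x \<noteq> 0"
  using norm_lt_square[of x 1] by (subst of_real_eq_0_iff) auto

lemma Ck_inverse_wt: "Ck k (\<lambda>x. 1 / wt x) (ball 0 1)"
proof (rule Ck_cong[OF open_ball])
  show "Ck k (\<lambda>x. complex_of_real ((1 - x \<bullet> x) powr (-1))) (ball 0 1)"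
    by (intro Ck_powr Ck_radius open_ball) (auto simp: norm_lt_square)
  show "complex_of_real ((1 - y \<bullet> y) powr (-1)) = 1 / wt y" if "y \<in> ball 0 1" for y :: 'a
    using that by (simp add: norm_lt_square powr_minus_divide del: of_real_diff)
qed

text \<open>Split 1 - |x|^2 as (1 - \<rho>) + (\<rho> - |x|^2). As the moment of order 2 of v has
  derivative twice the moment of order 1, the identity is a linear differential equation for the
  former.\<close>

lemma weighted_mom_weight:
  assumes v: "continuous_on (ball 0 1) v" and \<rho>: "\<rho> < 1" and f: "\<And>x. x \<in> ball 0 1 \<Longrightarrow> f x = wt x * v x"
  shows "weighted_mom 1 f \<rho> = of_real (1 - \<rho>) * weighted_mom 1 v \<rho> + weighted_mom 2 v \<rho>"
proof -
  have "f x * trunc_weight 1 \<rho> x = of_real (1 - \<rho>) * (v x * trunc_weight 1 \<rho> x) + v x * trunc_weight 2 \<rho> x" if "x \<in> ball 0 1" for x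
  proof -
    have "f x * trunc_weight 1 \<rho> x = v x * (trunc_weight 1 \<rho> x - of_real (x \<bullet> x) * trunc_weight 1 \<rho> x)" by (simp add: f[OF that] algebra_simps)
    also have "\<dots> = v x * (trunc_weight 1 \<rho> x - (of_real \<rho> * trunc_weight 1 \<rho> x - trunc_weight 2 \<rho> x))" by (subst trunc_weight_mult_nsq) (auto simp: numeral_2_eq_2)
    finally show ?thesis by (simp add: algebra_simps)
  qed
  then have "weighted_mom 1 f \<rho> = ball_integral (\<lambda>x. of_real (1 - \<rho>) * (v x * trunc_weight 1 \<rho> x) + v x * trunc_weight 2 \<rho> x)"
    unfolding weighted_mom_def by (intro set_lebesgue_integral_cong) auto
  also have "\<dots> = of_real (1 - \<rho>) * weighted_mom 1 v \<rho> + weighted_mom 2 v \<rho>"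
    unfolding weighted_mom_def set_integral_mult_right[symmetric]
    by (intro set_integral_add(2) set_integrable_mult_right weighted_mom_integrable v \<rho>) auto
  finally show ?thesis .
qed

text \<open>The top coefficient in the decomposition of \<^term>\<open>weighted_mom 1\<close> is visible in a second difference at the
  boundary, where the other terms cancel to second order.\<close>

lemma top_coefficient_zero:
  fixes d :: "nat \<Rightarrow> complex"
  assumes k: "k \<ge> 1" and N: "N \<ge> 1" and \<gamma>: "\<gamma> < -1"
    and F: "\<And>\<rho>. 0 < \<rho> \<Longrightarrow> \<rho> < 1 \<Longrightarrow> F \<rho> = (\<Sum>i<M. d i * (of_real (k + 2 + real i) * of_real (\<rho> powr (k + 1 + real i))
        - of_real (k + real i) * of_real (\<rho> powr (k + 2 + real i)))) + c * of_real (\<rho> powr (k + real N))"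
    and C: "\<And>t. 0 < t \<Longrightarrow> t < 1/3 \<Longrightarrow> norm (F (1 - t) - 2 * F (1 - 2*t) + F (1 - 3*t)) \<le> C * t powr (1 - \<gamma>)"
  shows "c = 0"
proof -
  define S where "S = (\<lambda>e t::real. ((1 - t) powr e - 2 * (1 - 2*t) powr e + (1 - 3*t) powr e) / t^2)"
  have S: "((\<lambda>t. complex_of_real (S e t)) \<longlongrightarrow> of_real (e * (e - 1))) (at_right 0)" for e
    unfolding S_def by (intro tendsto_of_real second_difference_powr)
  let ?G = "\<lambda>t. (\<Sum>i<M. d i * (of_real (k + 2 + real i) * of_real (S (k + 1 + real i) t)
        - of_real (k + real i) * of_real (S (k + 2 + real i) t))) + c * of_real (S (k + real N) t)"
  have "(?G \<longlongrightarrow> (\<Sum>i<M. d i * (of_real (k + 2 + real i) * of_real ((k + 1 + real i) * (k + 1 + real i - 1))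
        - of_real (k + real i) * of_real ((k + 2 + real i) * (k + 2 + real i - 1)))) + c * of_real ((k + real N) * (k + real N - 1))) (at_right 0)"
    by (intro tendsto_intros S)
  \<comment> \<open>Both products equal (k + i)(k + 1 + i)(k + 2 + i), so each basis element has
    second derivative 0 at \<rho> = 1.\<close>
  moreover have "of_real (k + 2 + real i) * of_real ((k + 1 + real i) * (k + 1 + real i - 1))
        - of_real (k + real i) * complex_of_real ((k + 2 + real i) * (k + 2 + real i - 1)) = 0" for i
  proof -
    have "(k + 2 + real i) * ((k + 1 + real i) * (k + 1 + real i - 1)) - (k + real i) * ((k + 2 + real i) * (k + 2 + real i - 1)) = 0"
      by (simp add: algebra_simps)
    then show ?thesis unfolding of_real_mult[symmetric] of_real_diff[symmetric] by (simp only: of_real_0)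
  qed
  ultimately have lim: "(?G \<longlongrightarrow> c * of_real ((k + real N) * (k + real N - 1))) (at_right 0)"
    by (simp only: mult_zero_right sum.neutral_const add_0_left)
  have ev: "eventually (\<lambda>t. norm (?G t) \<le> C * t powr (- \<gamma> - 1)) (at_right 0)"
    unfolding eventually_at_right_field
  proof (intro exI[of _ "1/3"] conjI allI impI)
    fix t :: real assume t: "0 < t" "t < 1/3"
    have "F (1 - t) - 2 * F (1 - 2*t) + F (1 - 3*t) = ?G t * of_real (t^2)"
    proof -
      have S2: "of_real (S e t) * complex_of_real (t^2) = of_real ((1 - t) powr e) - 2 * of_real ((1 - 2*t) powr e) + of_real ((1 - 3*t) powr e)" for e
      proof -
        have "S e t * t^2 = (1 - t) powr e - 2 * (1 - 2*t) powr e + (1 - 3*t) powr e" using t by (simp add: S_def)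
        from arg_cong[OF this, of complex_of_real] show ?thesis
          by (simp only: of_real_add of_real_diff of_real_mult of_real_numeral)
      qed
      have "?G t * of_real (t^2) = (\<Sum>i<M. d i * (of_real (k + 2 + real i) * (of_real (S (k + 1 + real i) t) * of_real (t^2))
        - of_real (k + real i) * (of_real (S (k + 2 + real i) t) * of_real (t^2)))) + c * (of_real (S (k + real N) t) * of_real (t^2))"
        by (simp add: distrib_right sum_distrib_right left_diff_distrib mult.assoc del: of_real_power of_real_add)
      also have "\<dots> = F (1 - t) - 2 * F (1 - 2*t) + F (1 - 3*t)"
      proof -
        have lin: "(\<Sum>i<M. d i * (A i * (p i - 2 * q i + r i) - B i * (p' i - 2 * q' i + r' i))) + c * (x - 2 * y + z)
          = ((\<Sum>i<M. d i * (A i * p i - B i * p' i)) + c * x) - 2 * ((\<Sum>i<M. d i * (A i * q i - B i * q' i)) + c * y)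
            + ((\<Sum>i<M. d i * (A i * r i - B i * r' i)) + c * z)" for A B p q r p' q' r' :: "nat \<Rightarrow> complex" and x y z
          by (induction M) (simp_all add: algebra_simps)
        have r: "0 < 1 - t" "1 - t < 1" "0 < 1 - 2 * t" "1 - 2 * t < 1" "0 < 1 - 3 * t" "1 - 3 * t < 1" using t by auto
        show ?thesis unfolding S2 F[OF r(1,2)] F[OF r(3,4)] F[OF r(5,6)] by (rule lin)
      qed
      finally show ?thesis by simp
    qed
    then have "norm (?G t) * t^2 \<le> C * t powr (1 - \<gamma>)" using C[OF t] by (simp add: norm_mult norm_power)
    also have "t powr (1 - \<gamma>) = t powr (-\<gamma> - 1) * t^2"
      using t by (simp add: powr_times_power)
    finally show "norm (?G t) \<le> C * t powr (-\<gamma> - 1)" using t by simp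
  qed simp
  \<comment> \<open>Here \<gamma> < -1 enters: after division by t^2 the bound still tends to
    0.\<close>
  have "((\<lambda>t. C * t powr (-\<gamma> - 1)) \<longlongrightarrow> 0) (at_right 0)"
    using \<gamma> by real_asymp
  with ev have "(?G \<longlongrightarrow> 0) (at_right 0)" by (rule Lim_null_comparison)
  with lim have "c * of_real ((k + real N) * (k + real N - 1)) = 0"
    using tendsto_unique trivial_limit_at_right_real by blast
  moreover have "(k + real N) * (k + real N - 1) > 0" using k N by (intro mult_pos_pos) auto
  ultimately show ?thesis by (metis less_irrefl mult_eq_0_iff of_real_eq_0_iff)
qed

text \<open>The factor (1 - \<rho>)^(-2) is the integrating factor of (1 - \<rho>) z' = -2 z, whose
  solutions are the multiples of (1 - \<rho>)^2.\<close>

lemma has_vector_derivative_mult_inverse_square: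
  assumes "(z has_vector_derivative z') (at \<rho>)" "\<rho> < (1::real)" "of_real (1 - \<rho>) * z' = - 2 * z \<rho>"
  shows "((\<lambda>\<rho>. z \<rho> * of_real ((1 - \<rho>) powr (-2))) has_vector_derivative (0::complex)) (at \<rho>)"
proof -
  have "((\<lambda>\<rho>. (1 - \<rho>) powr (-2)) has_real_derivative (2 * (1 - \<rho>) powr (-3))) (at \<rho>)"
    using assms(2) by (auto intro!: derivative_eq_intros)
  from has_vector_derivative_mult[OF assms(1) has_vector_derivative_of_real[OF this]]
  have "((\<lambda>\<rho>. z \<rho> * of_real ((1 - \<rho>) powr (-2))) has_vector_derivative
      z \<rho> * of_real (2 * (1 - \<rho>) powr (-3)) + z' * of_real ((1 - \<rho>) powr (-2))) (at \<rho>)" .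
  moreover have "z \<rho> * of_real (2 * (1 - \<rho>) powr (-3)) + z' * of_real ((1 - \<rho>) powr (-2)) = 0"
  proof -
    have "(1 - \<rho>) powr (-3) * (1 - \<rho>) = (1 - \<rho>) powr (-3) * (1 - \<rho>) ^ 1" by simp
    also have "\<dots> = (1 - \<rho>) powr (-2)" using assms(2) by (subst powr_times_power) auto
    finally have e: "(1 - \<rho>) powr (-2) = (1 - \<rho>) powr (-3) * (1 - \<rho>)" by simp
    have "z' * of_real ((1 - \<rho>) powr (-2)) = of_real ((1 - \<rho>) powr (-3)) * (of_real (1 - \<rho>) * z')"
      by (simp only: e of_real_mult mult_ac)
    then show ?thesis unfolding assms(3) by simp
  qed
  ultimately show ?thesis by simp
qed

text \<open>For each solid harmonic Y the moments of v = u / w solve a first-order linear equation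
  whose right side comes from u. Once the top coefficient e is known to vanish, B is a particular
  solution of Pizzetti form with N - 1 coefficients, and the solutions of the homogeneous equation
  are excluded by the behaviour at \<rho> = 0. The converse of Pizzetti's expansion then applies to
  v.\<close>

theorem polyharmonic_divide_weight:
  fixes u :: "'a::euclidean_space \<Rightarrow> complex"
  assumes u: "u \<in> polyharmonic N" and N: "N \<ge> 1" and n: "DIM('a) \<ge> 2" and \<gamma>: "\<gamma> < -1"
    and i: "set_integrable lborel (ball 0 1) (\<lambda>x. norm (u x) * (1 - norm x) powr \<gamma>)"
  shows "(\<lambda>x. u x / wt x) \<in> polyharmonic (N - 1)"
proof -
  define v where "v = (\<lambda>x. u x / wt x)"
  have uC: "Ck (2 * N) u (ball 0 1)" using u by (simp add: polyharmonic_def)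
  have v: "Ck (2 * N) v (ball 0 1)"
    using Ck_mult[OF open_ball uC Ck_inverse_wt] by (simp add: v_def)
  have v': "Ck (2 * (N - 1)) v (ball 0 1)" by (rule Ck_le[OF v]) simp
  have uv: "u x = wt x * v x" if "x \<in> ball 0 1" for x using wt_nonzero[OF that] by (simp add: v_def)
  have gc: "continuous_on (ball 0 1) ((laplacian ^^ (N - 1)) v)"
    by (rule Ck_continuous[of 0], rule Ck_laplacian_pow) (use v' in auto)
  have key: "weighted_mom (N + 1) (\<lambda>x. (laplacian ^^ (N - 1)) v x * Y x) \<rho> = 0"
    if Y: "solid_harmonic m Y" and \<rho>: "0 < \<rho>" "\<rho> < 1" for m Y \<rho>
  proof -
    define k where "k = real DIM('a) / 2 + real m"
    have k: "k \<ge> 1" using n by (simp add: k_def)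
    let ?f = "\<lambda>x. u x * Y x" and ?h = "\<lambda>x. v x * Y x"
    have Yc: "continuous_on S Y" for S using continuous_on_subset[OF Ck_continuous[OF solid_harmonicD(1)[OF Y]]] by blast
    have fc: "continuous_on (ball 0 1) ?f" and hc: "continuous_on (ball 0 1) ?h"
      using Ck_continuous[OF uC] Ck_continuous[OF v] Yc by (auto intro!: continuous_on_mult)
    obtain c where c: "\<And>\<rho>. 0 < \<rho> \<Longrightarrow> \<rho> < 1 \<Longrightarrow> weighted_mom 2 ?f \<rho> = of_real (\<rho> powr (k + real 2)) * (\<Sum>l<N. c l * of_real \<rho> ^ l)"
      using weighted_mom_polyharmonic[OF Y u order_refl k_def] by blast
    have "weighted_mom 2 ?f \<rho> = (\<Sum>l<N. c l * of_real (\<rho> powr (k + 2 + real l)))" if "0 < \<rho>" "\<rho> < 1" for \<rho>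
    proof -
      have "of_real (\<rho> powr (k + 2)) * (c l * of_real \<rho> ^ l) = c l * of_real (\<rho> powr (k + 2 + real l))" for l
        using powr_times_power[OF that(1), of "k + 2" l, symmetric] by (simp only: of_real_mult of_real_power mult.left_commute)
      then show ?thesis using c[OF that] by (simp only: sum_distrib_left of_nat_numeral)
    qed
    note b1 = weighted_mom_derivD[OF fc _ _ this]
    define M where "M = N - 1"
    have NM: "N = Suc M" using N by (simp add: M_def)
    obtain d e where de: "\<And>\<rho>::real. (\<Sum>l<Suc M. (c l * of_real (k + 2 + real l) / 2) * of_real \<rho> ^ l) =
     (\<Sum>i<M. d i * (of_real (k + 2 + real i) * of_real \<rho> ^ i - of_real (k + real i) * of_real \<rho> ^ Suc i)) + e * of_real \<rho> ^ M"
      using exponent_basis_decomposition[where k = k and M = M and g = "\<lambda>l. c l * of_real (k + 2 + real l) / 2"] k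
      by (meson less_le_trans zero_less_one)
    have F: "weighted_mom 1 ?f \<rho> = (\<Sum>i<M. d i * (of_real (k + 2 + real i) * of_real (\<rho> powr (k + 1 + real i))
        - of_real (k + real i) * of_real (\<rho> powr (k + 2 + real i)))) + e * of_real (\<rho> powr (k + real N))"
      if r: "0 < \<rho>" "\<rho> < 1" for \<rho>
    proof -
      have pw: "of_real (\<rho> powr (k + 1 + real l)) = of_real (\<rho> powr (k + 1)) * complex_of_real \<rho> ^ l" for l
        using powr_times_power[OF r(1), of "k + 1" l, symmetric] by (simp only: of_real_mult of_real_power)
      have pw2: "k + 2 + real l = k + 1 + real (Suc l)" and pw3: "k + real N = k + 1 + real M" for l by (auto simp: NM)
      have "weighted_mom 1 ?f \<rho> = (\<Sum>l<Suc M. c l * of_real (k + 2 + real l) / 2 * of_real (\<rho> powr (k + 1 + real l)))"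
        by (subst NM[symmetric]) (rule b1[OF r])
      also have "\<dots> = of_real (\<rho> powr (k + 1)) * (\<Sum>l<Suc M. (c l * of_real (k + 2 + real l) / 2) * of_real \<rho> ^ l)"
        unfolding pw sum_distrib_left by (intro sum.cong refl) (rule mult.left_commute)
      also have "\<dots> = (\<Sum>i<M. d i * (of_real (k + 2 + real i) * (of_real (\<rho> powr (k + 1)) * of_real \<rho> ^ i)
        - of_real (k + real i) * (of_real (\<rho> powr (k + 1)) * of_real \<rho> ^ Suc i))) + e * (of_real (\<rho> powr (k + 1)) * of_real \<rho> ^ M)"
        unfolding de by (simp add: distrib_left sum_distrib_left right_diff_distrib mult_ac del: of_real_add)
      finally show ?thesis unfolding pw[symmetric] by (simp only: pw2 pw3)
    qed
    obtain C where C: "\<And>t. 0 < t \<Longrightarrow> t < 1/3 \<Longrightarrow> norm (weighted_mom 1 ?f (1 - t) - 2 * weighted_mom 1 ?f (1 - 2*t) + weighted_mom 1 ?f (1 - 3*t)) \<le> C * t powr (1 - \<gamma>)"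
    proof -
      have "\<gamma> < 0" using \<gamma> by simp
      from shell_bound[OF Ck_continuous[OF uC] Yc i this] show ?thesis using that by blast
    qed
    have e0: "e = 0" by (rule top_coefficient_zero[OF k N \<gamma> F C])
    define B where "B = (\<lambda>\<rho>. \<Sum>i<M. (2 * d i) * complex_of_real (\<rho> powr (k + 2 + real i)))"
    define B' where "B' = (\<lambda>\<rho>. \<Sum>i<M. (2 * d i) * complex_of_real ((k + 2 + real i) * \<rho> powr (k + 2 + real i - 1)))"
    have Bd: "(B has_vector_derivative B' \<rho>) (at \<rho>)" if "0 < \<rho>" for \<rho>
      unfolding B_def B'_def
      by (intro has_vector_derivative_sum has_vector_derivative_mult_right powr_has_vector_derivative that)
    have Beq: "of_real (1 - \<rho>) * B' \<rho> + 2 * B \<rho> = 2 * weighted_mom 1 ?f \<rho>" if r: "0 < \<rho>" "\<rho> < 1" for \<rho>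
    proof -
      have p: "complex_of_real (\<rho> powr (k + 2 + real i)) = of_real \<rho> * of_real (\<rho> powr (k + 1 + real i))" for i
      proof -
        have "\<rho> powr (k + 1 + real i) * \<rho> ^ 1 = \<rho> powr (k + 2 + real i)" using r by (subst powr_times_power) (auto simp: algebra_simps)
        from arg_cong[OF this[symmetric], of complex_of_real] show ?thesis
          by (simp only: of_real_mult power_one_right mult.commute)
      qed
      have m: "k + 2 + real i - 1 = k + 1 + real i" for i by simp
      have lin: "of_real (1 - \<rho>) * (\<Sum>i<M. 2 * d i * of_real (E i * P i)) + 2 * (\<Sum>i<M. 2 * d i * (of_real \<rho> * of_real (P i)))
         = 2 * ((\<Sum>i<M. d i * (of_real (E i) * of_real (P i) - of_real (K i) * (of_real \<rho> * of_real (P i)))) + 0 * y)"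
        if "\<And>i. E i = K i + 2" for E P K :: "nat \<Rightarrow> real" and y
        by (induction M) (simp_all add: algebra_simps that)
      show ?thesis unfolding F[OF r] e0 B_def B'_def p m by (rule lin) simp
    qed
    \<comment> \<open>The error against the particular solution satisfies (1 - \<rho>) z' = -2 z, so
      z / (1 - \<rho>)^2 is constant; both moments and B tend to 0 at \<rho> = 0, which makes the
      constant 0.\<close>
    define z where "z = (\<lambda>\<rho>. weighted_mom 2 ?h \<rho> - B \<rho>)"
    have hd: "(weighted_mom 2 ?h has_vector_derivative 2 * weighted_mom 1 ?h \<rho>) (at \<rho>)" if "0 < \<rho>" "\<rho> < 1" for \<rho>
      using weighted_mom_deriv[OF hc _ that, of 2] by simp
    have zd: "((\<lambda>\<rho>. z \<rho> * of_real ((1 - \<rho>) powr (-2))) has_vector_derivative 0) (at \<rho>)" if r: "0 < \<rho>" "\<rho> < 1" for \<rho>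
    proof (rule has_vector_derivative_mult_inverse_square)
      show "(z has_vector_derivative (2 * weighted_mom 1 ?h \<rho> - B' \<rho>)) (at \<rho>)"
        unfolding z_def by (rule has_vector_derivative_diff[OF hd[OF r] Bd[OF r(1)]])
      have "weighted_mom 1 ?f \<rho> = of_real (1 - \<rho>) * weighted_mom 1 ?h \<rho> + weighted_mom 2 ?h \<rho>"
        by (rule weighted_mom_weight[OF hc r(2)]) (simp add: uv mult.assoc del: of_real_diff)
      then show "of_real (1 - \<rho>) * (2 * weighted_mom 1 ?h \<rho> - B' \<rho>) = - 2 * z \<rho>"
        using Beq[OF r] by (simp add: z_def right_diff_distrib left_diff_distrib) (simp add: algebra_simps)
    qed (use r in auto)
    then have "\<forall>\<rho>\<in>{0<..<1}. ((\<lambda>\<rho>. z \<rho> * of_real ((1 - \<rho>) powr (-2))) has_vector_derivative 0) (at \<rho> within {0<..<1})"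
      by (auto intro: has_vector_derivative_at_within)
    then obtain q where q: "\<And>\<rho>. \<rho> \<in> {0<..<1} \<Longrightarrow> z \<rho> * of_real ((1 - \<rho>) powr (-2)) = q"
      using has_vector_derivative_zero_constant[of "{0<..<1}" "\<lambda>\<rho>. z \<rho> * of_real ((1 - \<rho>) powr (-2))"] convex_real_interval(8) by blast
    have "(B \<longlongrightarrow> (\<Sum>i<M. (2 * d i) * of_real 0)) (at_right 0)"
      unfolding B_def
    proof (intro tendsto_sum tendsto_mult tendsto_const tendsto_of_real)
      fix i
      have "((\<lambda>\<rho>::real. \<rho> powr (k + 2 + real i)) \<longlongrightarrow> 0 powr (k + 2 + real i)) (at_right 0)"
        using k by (intro tendsto_powr2 tendsto_ident_at tendsto_const) (auto simp: eventually_at_right_field intro: exI[of _ 1])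
      then show "((\<lambda>\<rho>::real. \<rho> powr (k + 2 + real i)) \<longlongrightarrow> 0) (at_right 0)" by simp
    qed
    then have "(z \<longlongrightarrow> 0 - 0) (at_right 0)" unfolding z_def using weighted_mom_tendsto_0[OF hc, of 2] by (intro tendsto_diff) auto
    moreover have "((\<lambda>\<rho>. complex_of_real ((1 - \<rho>) powr (-2))) \<longlongrightarrow> of_real ((1 - 0) powr (-2))) (at_right 0)"
      by (intro tendsto_intros) auto
    ultimately have "((\<lambda>\<rho>. z \<rho> * of_real ((1 - \<rho>) powr (-2))) \<longlongrightarrow> (0 - 0) * of_real ((1 - 0) powr (-2))) (at_right 0)"
      by (rule tendsto_mult)
    moreover have "((\<lambda>\<rho>. z \<rho> * of_real ((1 - \<rho>) powr (-2))) \<longlongrightarrow> q) (at_right 0)"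
      by (rule tendsto_eventually) (use q in \<open>auto simp: eventually_at_right_field intro!: exI[of _ 1]\<close>)
    ultimately have q0: "q = 0" using tendsto_unique trivial_limit_at_right_real by fastforce
    have z0: "weighted_mom 2 ?h \<rho> = of_real (\<rho> powr (k + real 2)) * (\<Sum>l<N - 1. (2 * d l) * of_real \<rho> ^ l)" if r: "0 < \<rho>" "\<rho> < 1" for \<rho>
    proof -
      have "z \<rho> = 0" using q[of \<rho>] q0 r by simp
      then have "weighted_mom 2 ?h \<rho> = B \<rho>" by (simp add: z_def)
      moreover have "of_real (\<rho> powr (k + 2 + real l)) = of_real (\<rho> powr (k + 2)) * complex_of_real \<rho> ^ l" for l
        using powr_times_power[OF r(1), of "k + 2" l, symmetric] by (simp only: of_real_mult of_real_power)
      ultimately show ?thesis by (simp add: B_def M_def sum_distrib_left mult_ac)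
    qed
    have "weighted_mom (2 + (N - 1)) (\<lambda>x. (laplacian ^^ (N - 1)) v x * Y x) \<rho> = 0"
      by (rule weighted_mom_laplacian_pow_zero[OF Y v' order_refl k_def z0 \<rho>])
    then show ?thesis using N by simp
  qed
  have "(laplacian ^^ (N - 1)) v x = 0" if "x \<in> ball 0 1" for x
    by (rule zero_of_weighted_mom_zero[OF gc _ n key that]) auto
  then show ?thesis using v' by (simp add: polyharmonic_def v_def)
qed

section \<open>Smoothness of polyharmonic functions\<close>

lemma affine_has_derivative: "((\<lambda>y. x + r *\<^sub>R y) has_derivative (\<lambda>v. r *\<^sub>R v)) (at y)"
  by (auto intro!: derivative_eq_intros)

lemma affine_differentiable:
  assumes "f differentiable at (x + r *\<^sub>R y)"
  shows "(\<lambda>y. f (x + r *\<^sub>R y)) differentiable at y"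
    and "dir_deriv b (\<lambda>y. f (x + r *\<^sub>R y)) y = of_real r * dir_deriv b f (x + r *\<^sub>R y)"
proof -
  have d: "((\<lambda>y. f (x + r *\<^sub>R y)) has_derivative (\<lambda>v. dir_deriv (r *\<^sub>R v) f (x + r *\<^sub>R y))) (at y)"
    using diff_chain_at[OF affine_has_derivative dir_deriv_has[OF assms]] by (simp add: o_def)
  then show "(\<lambda>y. f (x + r *\<^sub>R y)) differentiable at y" by (auto simp: differentiable_def)
  have "dir_deriv (r *\<^sub>R b) f (x + r *\<^sub>R y) = r *\<^sub>R dir_deriv b f (x + r *\<^sub>R y)"
    unfolding dir_deriv_def using linear_frechet_derivative[OF assms] by (simp add: linear_scale)
  then show "dir_deriv b (\<lambda>y. f (x + r *\<^sub>R y)) y = of_real r * dir_deriv b f (x + r *\<^sub>R y)"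
    using dir_deriv_eq[OF d, of b] by (simp add: scaleR_conv_of_real)
qed

lemma open_affine_preimage:
  fixes S :: "'a::euclidean_space set"
  assumes "open S" shows "open {y. x + r *\<^sub>R y \<in> S}"
proof -
  have "continuous_on UNIV (\<lambda>y. x + r *\<^sub>R y)" by (intro continuous_intros)
  from open_vimage[OF assms this] show ?thesis by (simp add: vimage_def)
qed

lemma Ck_affine:
  assumes S: "open S" and "Ck k f S"
  shows "Ck k (\<lambda>y. f (x + r *\<^sub>R y)) {y. x + r *\<^sub>R y \<in> S}"
  using assms(2)
proof (induction k arbitrary: f)
  case 0
  then show ?case by (auto intro!: continuous_on_compose2[of S f] continuous_intros)
next
  case (Suc k)
  have d: "f differentiable at (x + r *\<^sub>R y)" if "x + r *\<^sub>R y \<in> S" for y using Suc.prems that by simp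
  have "Ck k (dir_deriv b (\<lambda>y. f (x + r *\<^sub>R y))) {y. x + r *\<^sub>R y \<in> S}" if b: "b \<in> Basis" for b
  proof (rule Ck_cong[OF open_affine_preimage[OF S]])
    show "Ck k (\<lambda>y. of_real r * dir_deriv b f (x + r *\<^sub>R y)) {y. x + r *\<^sub>R y \<in> S}"
      by (intro Ck_cmult open_affine_preimage S Suc.IH Ck_dir_deriv[OF Suc.prems b])
  qed (simp add: affine_differentiable(2)[OF d])
  then show ?case using affine_differentiable(1)[OF d] by simp
qed

lemma laplacian_affine:
  assumes S: "open S" and f: "Ck 2 f S" and y: "x + r *\<^sub>R y \<in> S"
  shows "laplacian (\<lambda>y. f (x + r *\<^sub>R y)) y = of_real (r\<^sup>2) * laplacian f (x + r *\<^sub>R y)"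
proof -
  have "dir_deriv b (dir_deriv b (\<lambda>y. f (x + r *\<^sub>R y))) y = of_real (r\<^sup>2) * dir_deriv b (dir_deriv b f) (x + r *\<^sub>R y)"
    if b: "b \<in> Basis" for b
  proof -
    have "dir_deriv b (dir_deriv b (\<lambda>y. f (x + r *\<^sub>R y))) y = dir_deriv b (\<lambda>y. of_real r * dir_deriv b f (x + r *\<^sub>R y)) y"
      by (rule dir_deriv_cong[OF open_affine_preimage[OF S]]) (use y affine_differentiable(2)[OF Ck2D(1)[OF f]] in auto)
    also have "\<dots> = of_real r * dir_deriv b (\<lambda>y. dir_deriv b f (x + r *\<^sub>R y)) y"
      by (rule dir_deriv_cmult[OF affine_differentiable(1)[OF Ck2D(2)[OF f y b]]])
    finally show ?thesis by (simp add: affine_differentiable(2)[OF Ck2D(2)[OF f y b]] power2_eq_square)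
  qed
  then show ?thesis by (simp add: laplacian_def sum_distrib_left)
qed

lemma laplacian_pow_affine:
  assumes S: "open S" and f: "Ck (2 * N) f S" and y: "x + r *\<^sub>R y \<in> S"
  shows "(laplacian ^^ N) (\<lambda>y. c * f (x + r *\<^sub>R y)) y = c * of_real (r ^ (2 * N)) * (laplacian ^^ N) f (x + r *\<^sub>R y)"
  using f y
proof (induction N arbitrary: f c y)
  case (Suc N)
  let ?T = "{y. x + r *\<^sub>R y \<in> S}"
  have f2: "Ck 2 f S" by (rule Ck_le[OF Suc.prems(1)]) simp
  have Lf: "Ck (2 * N) (laplacian f) S" by (rule Ck_laplacian[OF S]) (use Suc.prems in simp)
  have T: "open ?T" by (rule open_affine_preimage[OF S])
  have "(laplacian ^^ Suc N) (\<lambda>y. c * f (x + r *\<^sub>R y)) y = (laplacian ^^ N) (laplacian (\<lambda>y. c * f (x + r *\<^sub>R y))) y"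
    by (simp add: funpow_Suc_right del: funpow.simps)
  also have "\<dots> = (laplacian ^^ N) (\<lambda>y. (c * of_real (r\<^sup>2)) * laplacian f (x + r *\<^sub>R y)) y"
  proof (rule laplacian_pow_cong[OF T])
    show "y \<in> ?T" using Suc.prems by simp
    show "laplacian (\<lambda>y. c * f (x + r *\<^sub>R y)) z = (c * of_real (r\<^sup>2)) * laplacian f (x + r *\<^sub>R z)" if "z \<in> ?T" for z
      using that laplacian_cmult[OF T Ck_affine[OF S f2] that, of c] laplacian_affine[OF S f2, of x r z] by simp
  qed
  also have "\<dots> = c * of_real (r\<^sup>2) * of_real (r ^ (2 * N)) * (laplacian ^^ N) (laplacian f) (x + r *\<^sub>R y)"
    by (rule Suc.IH[OF Lf Suc.prems(2)])
  finally show ?case by (simp add: funpow_Suc_right power2_eq_square del: funpow.simps)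
qed simp

lemma ball_affine_subset:
  assumes "norm x + r \<le> 1" "0 < r" "y \<in> ball 0 1" shows "x + r *\<^sub>R y \<in> ball 0 1"
proof -
  have "norm (x + r *\<^sub>R y) \<le> norm x + r * norm y" using norm_triangle_ineq[of x "r *\<^sub>R y"] assms(2) by simp
  also have "\<dots> < norm x + r * 1" using assms by (intro add_strict_left_mono mult_strict_left_mono) auto
  finally show ?thesis using assms by simp
qed

lemma polyharmonic_affine:
  assumes u: "u \<in> polyharmonic N" and x: "norm x + r \<le> 1" "0 < r"
  shows "(\<lambda>y. u (x + r *\<^sub>R y)) \<in> polyharmonic N"
proof -
  have uC: "Ck (2 * N) u (ball 0 1)" using u by (simp add: polyharmonic_def)
  have "Ck (2 * N) (\<lambda>y. u (x + r *\<^sub>R y)) (ball 0 1)"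
    by (rule Ck_subset[OF Ck_affine[OF open_ball uC]]) (use ball_affine_subset[OF x] in auto)
  moreover have "(laplacian ^^ N) (\<lambda>y. u (x + r *\<^sub>R y)) y = 0" if "y \<in> ball 0 1" for y
    using laplacian_pow_affine[OF open_ball uC ball_affine_subset[OF x that], of 1] u ball_affine_subset[OF x that]
    by (simp add: polyharmonic_def)
  ultimately show ?thesis by (simp add: polyharmonic_def)
qed

text \<open>Extrapolation to 0: such weights recover the constant term of any polynomial of degree
  below N from its values at the points 2^(-i). The induction is a Richardson step, which combines
  the weights on the halved nodes (A) with those on the old ones (B) so that degree N
  cancels.\<close>

lemma interpolation_at_zero:
  assumes "N \<ge> 1"
  shows "\<exists>\<nu>::nat \<Rightarrow> real. \<forall>l<N. (\<Sum>i<N. \<nu> i * (1/2 ^ i) ^ l) = (if l = 0 then 1 else 0)"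
  using assms
proof (induction N rule: dec_induct)
  case base then show ?case by (intro exI[of _ "\<lambda>_. 1"]) auto
next
  case (step N)
  then obtain \<nu> :: "nat \<Rightarrow> real" where l: "\<And>l. l < N \<Longrightarrow> (\<Sum>i<N. \<nu> i * (1/2 ^ i) ^ l) = (if l = 0 then 1 else 0)" by blast
  define A where "A = (\<lambda>i. if i = 0 then 0 else \<nu> (i - 1))"
  define B where "B = (\<lambda>i. if i < N then \<nu> i else 0)"
  define \<mu> where "\<mu> = (\<lambda>i. (2 ^ N * A i - B i) / (2 ^ N - 1))"
  have N: "(2::real) ^ N > 1" using step by (intro one_less_power) auto
  have SA: "(\<Sum>i<Suc N. A i * (1/2 ^ i) ^ l) = (1/2) ^ l * (\<Sum>i<N. \<nu> i * (1/2 ^ i) ^ l)" for l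
    by (subst sum.lessThan_Suc_shift) (simp add: A_def sum_distrib_left power_divide power_mult_distrib mult_ac)
  have SB: "(\<Sum>i<Suc N. B i * (1/2 ^ i) ^ l) = (\<Sum>i<N. \<nu> i * (1/2 ^ i) ^ l)" for l
    by (simp add: B_def)
  have \<mu>: "(\<Sum>i<Suc N. \<mu> i * (1/2 ^ i) ^ l) = (2 ^ N * (1/2) ^ l - 1) / (2 ^ N - 1) * (\<Sum>i<N. \<nu> i * (1/2 ^ i) ^ l)" for l
  proof -
    have "(\<Sum>i<Suc N. \<mu> i * (1/2 ^ i) ^ l) = (2 ^ N * (\<Sum>i<Suc N. A i * (1/2 ^ i) ^ l) - (\<Sum>i<Suc N. B i * (1/2 ^ i) ^ l)) / (2 ^ N - 1)"
      unfolding sum_distrib_left sum_subtractf[symmetric] sum_divide_distrib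
      by (intro sum.cong refl) (simp add: \<mu>_def left_diff_distrib diff_divide_distrib mult.assoc)
    then show ?thesis unfolding SA SB by (simp add: left_diff_distrib)
  qed
  show ?case
  proof (intro exI[of _ \<mu>] allI impI)
    fix k assume "k < Suc N"
    then consider "k < N" | "k = N" by linarith
    then show "(\<Sum>i<Suc N. \<mu> i * (1/2 ^ i) ^ k) = (if k = 0 then 1 else 0)"
    proof cases
      case 1
      have "(2::real) ^ N - 1 \<noteq> 0" using N by simp
      then have "((2::real) ^ N - 1) / (2 ^ N - 1) = 1" by (rule divide_self)
      then show ?thesis unfolding \<mu> l[OF 1] by (cases "k = 0") (simp_all only: power_0 mult_1_right if_False mult_zero_right refl if_True)
    next
      case 2 then show ?thesis unfolding \<mu> using step by (simp add: power_divide)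
    qed
  qed
qed

section \<open>A reproducing kernel for polyharmonic functions\<close>

lemma trunc_weight_eq_of_real: "trunc_weight a \<rho> x = of_real (norm (trunc_weight a \<rho> x))"
  unfolding trunc_weight_def norm_of_real by (subst abs_of_nonneg) simp_all

lemma weighted_mom_one_pos:
  assumes a: "1 \<le> a" and \<rho>: "0 < \<rho>" "\<rho> < 1"
  shows "\<exists>r>0. weighted_mom a (\<lambda>x::'a::euclidean_space. 1) \<rho> = of_real r"
proof (intro exI conjI)
  let ?r = "LINT x:ball (0::'a) 1|lborel. norm (trunc_weight a \<rho> x)"
  have i: "set_integrable lborel (ball 0 1) (\<lambda>x::'a. 1 * trunc_weight a \<rho> x)" by (rule weighted_mom_integrable) (use a \<rho> in auto)
  have i': "set_integrable lborel (ball 0 1) (\<lambda>x::'a. norm (trunc_weight a \<rho> x))" using set_integrable_norm[OF i] by simp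
  show "weighted_mom a (\<lambda>x::'a. 1) \<rho> = of_real ?r"
  proof -
    have "weighted_mom a (\<lambda>x::'a. 1) \<rho> = ball_integral (\<lambda>x::'a. of_real (norm (trunc_weight a \<rho> x)))"
      unfolding weighted_mom_def by (simp flip: trunc_weight_eq_of_real)
    also have "\<dots> = of_real ?r"
      unfolding set_lebesgue_integral_def by (simp add: scaleR_conv_of_real flip: of_real_mult)
    finally show ?thesis .
  qed
  show "?r > 0"
  proof (rule ccontr)
    assume "\<not> ?r > 0"
    then have "norm (trunc_weight a \<rho> (0::'a)) = 0"
      by (intro set_integral_zero_ball[of "ball 0 1" "\<lambda>x::'a. norm (trunc_weight a \<rho> x)"] continuous_on_norm continuous_trunc_weight i') auto
    then show False using \<rho> by (simp add: trunc_weight_def)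
  qed
qed

lemma one_polyharmonic: "(\<lambda>x. 1) \<in> polyharmonic (Suc 0)"
  by (simp add: polyharmonic_def del: continuously_differentiable_on.simps)

text \<open>Evenness turns the pairing, once translated to a point x, into a convolution; the
  support condition bounds how far from x it looks.\<close>

definition reproducing :: "nat \<Rightarrow> nat \<Rightarrow> ('a::euclidean_space \<Rightarrow> complex) \<Rightarrow> bool" where
  "reproducing k N K \<longleftrightarrow> Ck k K UNIV \<and> (\<forall>y. 1/2 < y \<bullet> y \<longrightarrow> K y = 0) \<and> (\<forall>y. K (- y) = K y) \<and>
    (\<forall>u\<in>polyharmonic N. u 0 = ball_integral (\<lambda>y. u y * K y))"

lemma reproducingD:
  assumes "reproducing k N K"
  shows "Ck k K UNIV" "1/2 < y \<bullet> y \<Longrightarrow> K y = 0" "K (- y) = K y" "u \<in> polyharmonic N \<Longrightarrow> u 0 = ball_integral (\<lambda>y. u y * K y)"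
  using assms unfolding reproducing_def by blast+

text \<open>By Pizzetti's expansion with Y = 1 the normalised moment of u is a polynomial in \<rho>
  with constant term \<open>u 0 * \<kappa>\<close>. Extrapolating it to \<rho> = 0 from N radii
  writes \<open>u 0\<close> as an integral against a combination of weights that does not depend on
  u.\<close>

theorem polyharmonic_kernel:
  assumes a: "2 \<le> a"
  shows "\<exists>K :: 'a::euclidean_space \<Rightarrow> complex. reproducing (a - 1) N K"
proof (cases "N = 0")
  case True
  then show ?thesis by (intro exI[of _ "\<lambda>_. 0"]) (auto simp: polyharmonic_def reproducing_def)
next
  case False
  then obtain \<nu> :: "nat \<Rightarrow> real" where l: "\<And>l. l < N \<Longrightarrow> (\<Sum>i<N. \<nu> i * (1/2 ^ i) ^ l) = (if l = 0 then 1 else 0)"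
    using interpolation_at_zero[of N] by auto
  define k where "k = real DIM('a) / 2 + real 0"
  note one = solid_harmonic_const[of 1]
  obtain \<kappa> where \<kappa>: "\<And>\<rho>. 0 < \<rho> \<Longrightarrow> \<rho> < 1 \<Longrightarrow> weighted_mom a (\<lambda>x::'a. 1) \<rho> = of_real (\<rho> powr (k + real a)) * \<kappa>"
    using weighted_mom_polyharmonic[OF one one_polyharmonic a k_def] by auto
  have \<kappa>0: "\<kappa> \<noteq> 0" using \<kappa>[of "1/2"] weighted_mom_one_pos[of a "1/2", where 'a='a] a by auto
  \<comment> \<open>The nodes 2^(-i) are halved to keep every weight supported where |y|^2 <= 1/2;
    the factor (1/2)^l that this introduces is harmless since only l = 0 survives.\<close>
  define \<rho> where "\<rho> = (\<lambda>i::nat. (1/2) * (1/2 ^ i) :: real)"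
  have \<rho>: "0 < \<rho> i" "\<rho> i \<le> 1/2" "\<rho> i < 1" for i
  proof -
    show "0 < \<rho> i" "\<rho> i \<le> 1/2" by (auto simp: \<rho>_def field_simps)
    then show "\<rho> i < 1" by linarith
  qed
  define \<mu> where "\<mu> = (\<lambda>i. of_real (\<nu> i) * of_real (\<rho> i powr - (k + real a)) / \<kappa>)"
  define K :: "'a \<Rightarrow> complex" where "K = (\<lambda>y. \<Sum>i<N. \<mu> i * trunc_weight a (\<rho> i) y)"
  show ?thesis unfolding reproducing_def
  proof (intro exI[of _ K] conjI allI impI ballI)
    show "Ck (a - 1) K UNIV" unfolding K_def using a by (intro Ck_sum Ck_cmult Ck_trunc_weight open_UNIV) auto
    show "K y = 0" if "1/2 < y \<bullet> y" for y
    proof -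
      have "trunc_weight a (\<rho> i) y = 0" for i using \<rho>(2)[of i] that a by (simp add: trunc_weight_def max_def)
      then show ?thesis by (simp add: K_def)
    qed
    show "K (- y) = K y" for y by (simp add: K_def trunc_weight_def)
    fix u :: "'a \<Rightarrow> complex" assume u: "u \<in> polyharmonic N"
    have uc: "continuous_on (ball 0 1) u" using u Ck_continuous by (auto simp: polyharmonic_def)
    obtain c where c: "\<And>\<rho>. 0 < \<rho> \<Longrightarrow> \<rho> < 1 \<Longrightarrow> weighted_mom a u \<rho> = of_real (\<rho> powr (k + real a)) * (\<Sum>l<N. c l * of_real \<rho> ^ l)"
      using weighted_mom_polyharmonic[OF one u a k_def] by auto
    \<comment> \<open>As the radius tends to 0 the moment of u is compared with that of the constant
      \<open>u 0\<close>: on the support of the weight u differs little from \<open>u 0\<close>, by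
      continuity.\<close>
    have c0: "c 0 = u 0 * \<kappa>"
    proof -
      have bd: "norm ((\<Sum>l<N. c l * of_real r ^ l) - u 0 * \<kappa>) \<le> e * norm \<kappa>"
        if e: "e > 0" and d: "\<And>y. norm y < d \<Longrightarrow> norm (u y - u 0) \<le> e" and r: "0 < r" "r < 1" "sqrt r < d" for e d r
      proof -
        have eq: "weighted_mom a u r - u 0 * weighted_mom a (\<lambda>x::'a. 1) r = ball_integral (\<lambda>x. u x * trunc_weight a r x - u 0 * (1 * trunc_weight a r x))"
        proof -
          have "set_integrable lborel (ball 0 1) (\<lambda>x. u x * trunc_weight a r x)" "set_integrable lborel (ball 0 1) (\<lambda>x. u 0 * (1 * trunc_weight a r x))"
            by (intro weighted_mom_integrable uc set_integrable_mult_right r continuous_on_const, use a in simp)+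
          from set_integral_diff(2)[OF this] show ?thesis unfolding weighted_mom_def set_integral_mult_right by simp
        qed
        have i1: "set_integrable lborel (ball 0 1) (\<lambda>x::'a. 1 * trunc_weight a r x)" by (rule weighted_mom_integrable) (use a r in auto)
        obtain R where R: "R > 0" "weighted_mom a (\<lambda>x::'a. 1) r = of_real R" using weighted_mom_one_pos[of a r] a r by auto
        have Re: "R = (LINT x:ball (0::'a) 1|lborel. norm (trunc_weight a r x))"
        proof -
          have "complex_of_real R = ball_integral (\<lambda>x::'a. of_real (norm (trunc_weight a r x)))"
            unfolding R(2)[symmetric] weighted_mom_def by (simp flip: trunc_weight_eq_of_real)
          also have "\<dots> = of_real (LINT x:ball (0::'a) 1|lborel. norm (trunc_weight a r x))"
            unfolding set_lebesgue_integral_def by (simp add: scaleR_conv_of_real flip: of_real_mult)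
          finally show ?thesis using of_real_eq_iff by blast
        qed
        have "norm (weighted_mom a u r - u 0 * weighted_mom a (\<lambda>x::'a. 1) r) \<le> (LINT x:ball (0::'a) 1|lborel. e * norm (trunc_weight a r x))"
          unfolding eq
        proof (rule ball_integral_norm_le)
          show "set_integrable lborel (ball 0 1) (\<lambda>x. u x * trunc_weight a r x - u 0 * (1 * trunc_weight a r x))"
            by (intro set_integral_diff(1) weighted_mom_integrable uc set_integrable_mult_right r) (use a in auto)
          show "set_integrable lborel (ball 0 1) (\<lambda>x::'a. e * norm (trunc_weight a r x))"
            using set_integrable_norm[OF i1] by (intro set_integrable_mult_right) simp
          fix x :: 'a
          show "norm (u x * trunc_weight a r x - u 0 * (1 * trunc_weight a r x)) \<le> e * norm (trunc_weight a r x)"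
          proof (cases "x \<bullet> x < r")
            case True
            then have "norm x < d" using r(3) by (smt (verit) norm_eq_sqrt_inner real_sqrt_less_iff)
            from mult_right_mono[OF d[OF this], of "norm (trunc_weight a r x)"] show ?thesis
              by (simp add: norm_mult flip: left_diff_distrib)
          next
            case False
            then have "trunc_weight a r x = 0" using a by (simp add: trunc_weight_def max_def)
            then show ?thesis by simp
          qed
        qed
        also have "\<dots> = e * R" unfolding Re by (rule set_integral_mult_right)
        also have "R = norm (of_real (r powr (k + real a)) * \<kappa>)" using R \<kappa>[of r] r by (metis abs_of_pos norm_of_real)
        also have "weighted_mom a u r - u 0 * weighted_mom a (\<lambda>x::'a. 1) r = of_real (r powr (k + real a)) * ((\<Sum>l<N. c l * of_real r ^ l) - u 0 * \<kappa>)"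
          unfolding c[OF r(1,2)] \<kappa>[OF r(1,2)] by (simp only: right_diff_distrib mult.left_commute)
        finally have "r powr (k + real a) * norm ((\<Sum>l<N. c l * of_real r ^ l) - u 0 * \<kappa>) \<le> r powr (k + real a) * (e * norm \<kappa>)"
          by (simp add: norm_mult mult_ac)
        then show ?thesis using r by simp
      qed
      have lim: "((\<lambda>r. (\<Sum>l<N. c l * complex_of_real r ^ l)) \<longlongrightarrow> (\<Sum>l<N. c l * of_real 0 ^ l)) (at_right 0)"
        by (intro tendsto_intros)
      have l0: "(\<Sum>l<N. c l * complex_of_real 0 ^ l) = c 0"
        using False by (simp add: power_0_left if_distrib[of "\<lambda>x. _ * x"] cong: if_cong)
      have lim2: "((\<lambda>r. (\<Sum>l<N. c l * complex_of_real r ^ l)) \<longlongrightarrow> u 0 * \<kappa>) (at_right 0)"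
        unfolding tendsto_iff
      proof (intro allI impI)
        fix e :: real assume e: "e > 0"
        define e' where "e' = e / (2 * norm \<kappa>)"
        have e': "e' > 0" using e \<kappa>0 by (simp add: e'_def)
        have "isCont u 0" using uc by (simp add: continuous_on_eq_continuous_at)
        then obtain d where d: "d > 0" "\<And>y. dist y 0 < d \<Longrightarrow> dist (u y) (u 0) < e'"
          using e' unfolding continuous_at_eps_delta by metis
        have d': "norm y < d \<Longrightarrow> norm (u y - u 0) \<le> e'" for y using d(2)[of y] by (simp add: dist_norm)
        show "eventually (\<lambda>r. dist (\<Sum>l<N. c l * complex_of_real r ^ l) (u 0 * \<kappa>) < e) (at_right 0)"
          unfolding eventually_at_right_field
        proof (intro exI[of _ "min 1 (d\<^sup>2)"] conjI allI impI)
          fix r :: real assume r: "0 < r" "r < min 1 (d\<^sup>2)"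
          have "sqrt r < d" using r d(1) by (intro real_less_lsqrt) auto
          then have "norm ((\<Sum>l<N. c l * of_real r ^ l) - u 0 * \<kappa>) \<le> e' * norm \<kappa>" using bd[OF e' d'] r by simp
          also have "\<dots> < e" using e \<kappa>0 by (simp add: e'_def)
          finally show "dist (\<Sum>l<N. c l * complex_of_real r ^ l) (u 0 * \<kappa>) < e" by (simp add: dist_norm)
        qed (use d(1) in simp)
      qed
      from tendsto_unique[OF trivial_limit_at_right_real lim lim2] l0 show ?thesis by simp
    qed
    have "ball_integral (\<lambda>y. u y * K y) = (\<Sum>i<N. \<mu> i * weighted_mom a u (\<rho> i))"
    proof -
      have "ball_integral (\<lambda>y. u y * K y) = ball_integral (\<lambda>y. \<Sum>i<N. \<mu> i * (u y * trunc_weight a (\<rho> i) y))"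
        by (simp add: K_def sum_distrib_left mult_ac)
      also have "\<dots> = (\<Sum>i<N. ball_integral (\<lambda>y. \<mu> i * (u y * trunc_weight a (\<rho> i) y)))"
        unfolding set_lebesgue_integral_def scaleR_sum_right
        by (rule Bochner_Integration.integral_sum, fold set_integrable_def)
          (intro set_integrable_mult_right weighted_mom_integrable uc \<rho>, use a in simp)
      finally show ?thesis by (simp add: weighted_mom_def)
    qed
    also have "\<dots> = (\<Sum>i<N. of_real (\<nu> i) * (\<Sum>l<N. c l * of_real (\<rho> i) ^ l) / \<kappa>)"
    proof (intro sum.cong refl)
      fix i
      have "\<mu> i * weighted_mom a u (\<rho> i) = of_real (\<nu> i) * (of_real (\<rho> i powr - (k + real a)) * of_real (\<rho> i powr (k + real a))) * (\<Sum>l<N. c l * of_real (\<rho> i) ^ l) / \<kappa>"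
        unfolding c[OF \<rho>(1,3)] \<mu>_def by simp
      then show "\<mu> i * weighted_mom a u (\<rho> i) = of_real (\<nu> i) * (\<Sum>l<N. c l * of_real (\<rho> i) ^ l) / \<kappa>"
        unfolding of_real_powr_cancel(1)[OF \<rho>(1)] by simp
    qed
    also have "\<dots> = (\<Sum>l<N. c l * of_real ((1/2) ^ l * (\<Sum>i<N. \<nu> i * (1/2 ^ i) ^ l))) / \<kappa>"
    proof -
      have "(\<Sum>i<N. of_real (\<nu> i) * (\<Sum>l<N. c l * of_real (\<rho> i) ^ l)) = (\<Sum>l<N. \<Sum>i<N. of_real (\<nu> i) * (c l * of_real (\<rho> i) ^ l))"
        unfolding sum_distrib_left by (rule sum.swap)
      also have "\<dots> = (\<Sum>l<N. c l * of_real ((1/2) ^ l * (\<Sum>i<N. \<nu> i * (1/2 ^ i) ^ l)))"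
        by (intro sum.cong refl) (simp add: \<rho>_def sum_distrib_left power_mult_distrib power_divide mult_ac)
      finally show ?thesis by (simp add: sum_divide_distrib[symmetric])
    qed
    also have "\<dots> = (\<Sum>l<N. if l = 0 then c l else 0) / \<kappa>"
      by (intro arg_cong2[where f = "(/)"] sum.cong refl) (simp add: l)
    also have "\<dots> = u 0" using False c0 \<kappa>0 by simp
    finally show "u 0 = ball_integral (\<lambda>y. u y * K y)" by simp
  qed
qed

section \<open>Convolution formula and smoothness\<close>

lemma lborel_integral_affine:
  fixes g :: "'a::euclidean_space \<Rightarrow> complex"
  assumes g: "g \<in> borel_measurable borel" and r: "r > 0"
  shows "(\<integral>z. g z \<partial>lborel) = of_real (r ^ DIM('a)) * (\<integral>y. g (x + r *\<^sub>R y) \<partial>lborel)"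
proof -
  have "(\<integral>z. g z \<partial>lborel) = (\<integral>z. g z \<partial>(density (distr lborel borel (\<lambda>y. x + r *\<^sub>R y)) (\<lambda>_. ennreal (r ^ DIM('a)))))"
    using lborel_affine[of r x] r by simp
  also have "\<dots> = (\<integral>z. r ^ DIM('a) *\<^sub>R g z \<partial>(distr lborel borel (\<lambda>y. x + r *\<^sub>R y)))"
    by (rule integral_density) (use g r in auto)
  also have "\<dots> = (\<integral>y. r ^ DIM('a) *\<^sub>R g (x + r *\<^sub>R y) \<partial>lborel)"
    by (rule integral_distr) (use g in auto)
  finally show ?thesis by (simp add: scaleR_conv_of_real)
qed

text \<open>Apply the reproducing formula to y -> u (x + r y) and substitute z = x + r y. The cutoff
  to \<open>cball 0 R\<close> leaves the integral unchanged because the kernel sees only points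
  within r of x; it makes the first factor globally integrable and the same for all x with |x| + r
  <= R.\<close>

lemma polyharmonic_conv:
  fixes u K :: "'a::euclidean_space \<Rightarrow> complex"
  assumes K: "continuous_on UNIV K" "\<And>y. 1/2 < y \<bullet> y \<Longrightarrow> K y = 0" "\<And>y. K (- y) = K y"
    and rep: "\<And>u. u \<in> polyharmonic N \<Longrightarrow> u 0 = ball_integral (\<lambda>y. u y * K y)"
    and u: "u \<in> polyharmonic N" and r: "0 < r" "norm x + r \<le> R" "R < 1"
  shows "u x = (\<integral>z. (indicator (cball 0 R) z *\<^sub>R u z) * (of_real (1 / r ^ DIM('a)) * K ((1/r) *\<^sub>R (x - z))) \<partial>lborel)"
proof -
  have uc: "continuous_on (ball 0 1) u" using u Ck_continuous by (auto simp: polyharmonic_def)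
  have sub: "cball 0 R \<subseteq> ball (0::'a) 1" using r by auto
  let ?g = "\<lambda>z. (indicator (cball 0 R) z *\<^sub>R u z) * (of_real (1 / r ^ DIM('a)) * K ((1/r) *\<^sub>R (x - z)))"
  have K2: "K y = 0" if "y \<notin> ball 0 1" for y
  proof -
    have "1 \<le> norm y" using that by simp
    then have "1 \<le> y \<bullet> y" by (simp add: norm_ge_square)
    then show ?thesis by (intro K(2)) linarith
  qed
  have m: "?g \<in> borel_measurable borel"
    by (intro borel_measurable_times borel_measurable_continuous_on_indicator borel_measurable_const
        borel_measurable_continuous_onI continuous_on_compose2[OF K(1)] continuous_on_subset[OF uc sub] continuous_intros) auto
  have "u x = (\<lambda>y. u (x + r *\<^sub>R y)) 0" by simp
  also have "\<dots> = ball_integral (\<lambda>y. u (x + r *\<^sub>R y) * K y)"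
    by (rule rep[OF polyharmonic_affine[OF u]]) (use r in auto)
  also have "\<dots> = of_real (r ^ DIM('a)) * (\<integral>y. ?g (x + r *\<^sub>R y) \<partial>lborel)"
    unfolding set_lebesgue_integral_def integral_mult_right_zero[symmetric]
  proof (intro Bochner_Integration.integral_cong refl)
    fix y :: 'a
    show "indicator (ball 0 1) y *\<^sub>R (u (x + r *\<^sub>R y) * K y) = of_real (r ^ DIM('a)) * ?g (x + r *\<^sub>R y)"
    proof (cases "y \<in> ball 0 1")
      case True
      have "norm (x + r *\<^sub>R y) \<le> norm x + r * norm y" using norm_triangle_ineq[of x "r *\<^sub>R y"] r by simp
      also have "\<dots> \<le> norm x + r * 1" using True r by (intro add_left_mono mult_left_mono) auto
      finally have "x + r *\<^sub>R y \<in> cball 0 R" using r by simp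
      moreover have "(1/r) *\<^sub>R (x - (x + r *\<^sub>R y)) = - y" using r by simp
      ultimately show ?thesis using True r K(3)[of y] by simp
    next
      case False
      have "(1/r) *\<^sub>R (x - (x + r *\<^sub>R y)) = - y" using r by simp
      then show ?thesis using False K2[OF False] K(3)[of y] by simp
    qed
  qed
  also have "\<dots> = (\<integral>z. ?g z \<partial>lborel)" by (rule lborel_integral_affine[OF m r(1), symmetric])
  finally show ?thesis .
qed

lemma rescaled_kernel:
  fixes K :: "'a::euclidean_space \<Rightarrow> complex"
  assumes K: "Ck k K UNIV" "\<And>y. 1/2 < y \<bullet> y \<Longrightarrow> K y = 0" and r: "0 < r"
  shows "Ck k (\<lambda>w. c * K ((1/r) *\<^sub>R w)) UNIV" "norm w > r \<Longrightarrow> c * K ((1/r) *\<^sub>R w) = 0"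
proof -
  have "Ck k (\<lambda>w. K (0 + (1/r) *\<^sub>R w)) {w. 0 + (1/r) *\<^sub>R w \<in> UNIV}" by (rule Ck_affine[OF open_UNIV K(1)])
  then show "Ck k (\<lambda>w. c * K ((1/r) *\<^sub>R w)) UNIV" by (intro Ck_cmult open_UNIV) simp
  assume w: "norm w > r"
  have "1 < norm ((1/r) *\<^sub>R w)" using w r by simp
  then have "1 < ((1/r) *\<^sub>R w) \<bullet> ((1/r) *\<^sub>R w)" by (simp only: norm_gt_square) simp
  then have "K ((1/r) *\<^sub>R w) = 0" by (intro K(2)) linarith
  then show "c * K ((1/r) *\<^sub>R w) = 0" by simp
qed

lemma cutoff_integrable:
  fixes u :: "'a::euclidean_space \<Rightarrow> complex"
  assumes "continuous_on (ball 0 1) u" "R < 1"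
  shows "integrable lborel (\<lambda>z. indicator (cball 0 R) z *\<^sub>R u z)"
  by (intro borel_integrable_compact compact_cball continuous_on_subset[OF assms(1)]) (use assms in auto)

text \<open>Around x a single scale r and a single cutoff serve, so u is there the convolution of an
  integrable function with a kernel of any prescribed smoothness.\<close>

theorem polyharmonic_smooth:
  fixes u :: "'a::euclidean_space \<Rightarrow> complex"
  assumes u: "u \<in> polyharmonic N"
  shows "Ck k u (ball 0 1)"
proof (rule Ck_local)
  fix x :: 'a assume x: "x \<in> ball 0 1"
  \<comment> \<open>The kernel is of class C^(k + 1), one more than wanted, because
    \<open>Ck_conv\<close> gives one order away.\<close>
  obtain K :: "'a \<Rightarrow> complex" where "reproducing (Suc (Suc k) - 1) N K"
    using polyharmonic_kernel[of "Suc (Suc k)" N] by (rule exE) simp_all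
  then have "reproducing (Suc k) N K" by simp
  note K = reproducingD[OF this]
  have uc: "continuous_on (ball 0 1) u" using u Ck_continuous by (auto simp: polyharmonic_def)
  define r where "r = (1 - norm x) / 3"
  have r: "r > 0" using x by (simp add: r_def)
  define R where "R = norm x + 2 * r"
  have R: "R < 1" using x by (simp add: R_def r_def field_simps)
  let ?K = "\<lambda>w. of_real (1 / r ^ DIM('a)) * K ((1/r) *\<^sub>R w)"
  let ?f = "\<lambda>z. indicator (cball 0 R) z *\<^sub>R u z"
  have "Ck k (\<lambda>x. \<integral>z. ?f z * ?K (x - z) \<partial>lborel) UNIV"
    by (rule Ck_conv[OF cutoff_integrable[OF uc R] rescaled_kernel(1)[OF K(1,2) r] rescaled_kernel(2)[OF K(1,2) r]])
  then have "Ck k (\<lambda>x. \<integral>z. ?f z * ?K (x - z) \<partial>lborel) (ball x r)" by (rule Ck_subset) simp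
  then have "Ck k u (ball x r)"
  proof (rule Ck_cong[OF open_ball])
    fix y assume y: "y \<in> ball x r"
    have "norm y \<le> norm x + r" using y norm_triangle_sub[of y x] by (simp add: dist_norm norm_minus_commute)
    then show "(\<integral>z. ?f z * ?K (y - z) \<partial>lborel) = u y"
      by (intro polyharmonic_conv[OF Ck_continuous[OF K(1)] K(2-4) u r _ R, symmetric]) (auto simp: R_def)
  qed
  then show "\<exists>T. open T \<and> x \<in> T \<and> Ck k u T" using r by (intro exI[of _ "ball x r"]) auto
qed

section \<open>Pointwise growth\<close>

text \<open>The integral in \<open>weighted_Lp\<close> with the boundary distance written as 1 - |x|
  and Lebesgue measure replaced by \<open>lborel\<close>; for functions continuous on the ball the
  two conditions agree (\<open>weighted_Lp_iff\<close>).\<close>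

definition wint :: "real \<Rightarrow> real \<Rightarrow> ('a::euclidean_space \<Rightarrow> complex) \<Rightarrow> bool" where
  "wint p \<alpha> u \<longleftrightarrow> (\<integral>\<^sup>+x\<in>ball 0 1. ennreal (norm (u x) powr p * (1 - norm x) powr \<alpha>) \<partial>lborel) < \<infinity>"

section \<open>Stability of weighted integrability\<close>

lemma ball_measurable:
  fixes f :: "'a::euclidean_space \<Rightarrow> real"
  assumes "continuous_on S f" "open S"
  shows "(\<lambda>x. ennreal (f x) * indicator S x) \<in> borel_measurable borel"
proof -
  have "(\<lambda>x. ennreal (indicator S x *\<^sub>R f x)) \<in> borel_measurable borel"
    using borel_measurable_continuous_on_indicator[OF _ assms(1)] assms(2) by simp
  moreover have "ennreal (indicator S x *\<^sub>R f x) = ennreal (f x) * indicator S x" for x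
    by (simp add: indicator_def)
  ultimately show ?thesis by simp
qed

lemma continuous_norm_powr:
  assumes "continuous_on S u" "0 < p"
  shows "continuous_on S (\<lambda>x. norm (u x) powr p)"
  by (rule continuous_on_powr') (use assms in \<open>auto intro: continuous_on_norm\<close>)

lemma continuous_dist_powr: "continuous_on (ball 0 1) (\<lambda>x. (1 - norm x) powr \<alpha>)"
  by (intro continuous_on_powr continuous_intros) auto

lemma wint_measurable:
  fixes u :: "'a::euclidean_space \<Rightarrow> complex"
  assumes "continuous_on (ball 0 1) u" "0 < p"
  shows "(\<lambda>x. ennreal (norm (u x) powr p * (1 - norm x) powr \<alpha>) * indicator (ball 0 1) x) \<in> borel_measurable borel"
  by (intro ball_measurable continuous_on_mult continuous_norm_powr continuous_dist_powr assms open_ball)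

lemma wint_bound:
  assumes g: "wint q \<beta> g" "continuous_on (ball 0 1) g" "0 < q" and C: "0 \<le> C"
    and le: "\<And>x. x \<in> ball 0 1 \<Longrightarrow> norm (f x) powr p * (1 - norm x) powr \<alpha> \<le> C * (norm (g x) powr q * (1 - norm x) powr \<beta>)"
  shows "wint p \<alpha> f"
proof -
  have "(\<integral>\<^sup>+x\<in>ball 0 1. ennreal (norm (f x) powr p * (1 - norm x) powr \<alpha>) \<partial>lborel)
     \<le> (\<integral>\<^sup>+x. ennreal C * (ennreal (norm (g x) powr q * (1 - norm x) powr \<beta>) * indicator (ball 0 1) x) \<partial>lborel)"
    using le C by (intro nn_integral_mono) (auto simp: indicator_def ennreal_mult[symmetric] intro!: ennreal_leI)
  also have "\<dots> = ennreal C * (\<integral>\<^sup>+x\<in>ball 0 1. ennreal (norm (g x) powr q * (1 - norm x) powr \<beta>) \<partial>lborel)"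
    by (rule nn_integral_cmult) (use wint_measurable[OF g(2,3)] in simp)
  also have "\<dots> < \<infinity>" using g(1) by (simp add: wint_def ennreal_mult_less_top)
  finally show ?thesis by (simp add: wint_def)
qed

lemma wint_add:
  assumes f: "wint p \<alpha> f" "continuous_on (ball 0 1) f" and g: "wint p \<alpha> g" "continuous_on (ball 0 1) g" and p: "0 < p"
  shows "wint p \<alpha> (\<lambda>x. f x + g x)"
proof -
  have le: "norm (f x + g x) powr p \<le> 2 powr p * (norm (f x) powr p + norm (g x) powr p)" for x
  proof -
    have "norm (f x + g x) \<le> 2 * max (norm (f x)) (norm (g x))" using norm_triangle_ineq[of "f x" "g x"] by linarith
    then have "norm (f x + g x) powr p \<le> (2 * max (norm (f x)) (norm (g x))) powr p" using p by (intro powr_mono2) auto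
    also have "\<dots> = 2 powr p * max (norm (f x)) (norm (g x)) powr p" by (simp add: powr_mult)
    also have "\<dots> \<le> 2 powr p * (norm (f x) powr p + norm (g x) powr p)" by (intro mult_left_mono) (auto simp: max_def)
    finally show ?thesis .
  qed
  have "(\<integral>\<^sup>+x\<in>ball 0 1. ennreal (norm (f x + g x) powr p * (1 - norm x) powr \<alpha>) \<partial>lborel)
     \<le> (\<integral>\<^sup>+x. ennreal (2 powr p) * (ennreal (norm (f x) powr p * (1 - norm x) powr \<alpha>) * indicator (ball 0 1) x
         + ennreal (norm (g x) powr p * (1 - norm x) powr \<alpha>) * indicator (ball 0 1) x) \<partial>lborel)"
  proof (rule nn_integral_mono)
    fix x :: 'a
    have "norm (f x + g x) powr p * (1 - norm x) powr \<alpha> \<le> 2 powr p * (norm (f x) powr p * (1 - norm x) powr \<alpha> + norm (g x) powr p * (1 - norm x) powr \<alpha>)"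
      using mult_right_mono[OF le[of x], of "(1 - norm x) powr \<alpha>"] by (simp add: algebra_simps)
    then show "ennreal (norm (f x + g x) powr p * (1 - norm x) powr \<alpha>) * indicator (ball 0 1) x \<le> ennreal (2 powr p) * (ennreal (norm (f x) powr p * (1 - norm x) powr \<alpha>) * indicator (ball 0 1) x
         + ennreal (norm (g x) powr p * (1 - norm x) powr \<alpha>) * indicator (ball 0 1) x)"
      by (simp add: indicator_def ennreal_mult[symmetric] ennreal_leI flip: ennreal_plus)
  qed
  also have "\<dots> = ennreal (2 powr p) * ((\<integral>\<^sup>+x\<in>ball 0 1. ennreal (norm (f x) powr p * (1 - norm x) powr \<alpha>) \<partial>lborel)
      + (\<integral>\<^sup>+x\<in>ball 0 1. ennreal (norm (g x) powr p * (1 - norm x) powr \<alpha>) \<partial>lborel))"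
    using wint_measurable[OF f(2) p] wint_measurable[OF g(2) p]
    by (subst nn_integral_cmult, simp, subst nn_integral_add) auto
  also have "\<dots> < \<infinity>" using f(1) g(1) by (simp add: wint_def ennreal_mult_less_top)
  finally show ?thesis by (simp add: wint_def)
qed

lemma wint_sum:
  assumes "\<And>i. i \<in> I \<Longrightarrow> wint p \<alpha> (f i)" "\<And>i. i \<in> I \<Longrightarrow> continuous_on (ball 0 1) (f i)" "0 < p" "finite I"
  shows "wint p \<alpha> (\<lambda>x. \<Sum>i\<in>I. f i x)"
  using assms(4,1,2)
proof (induction I rule: finite_induct)
  case empty then show ?case by (simp add: wint_def)
next
  case (insert i I)
  then show ?case by (simp add: wint_add[OF _ _ _ continuous_on_sum assms(3)])
qed

section \<open>Mean value inequalities for p <= 1\<close>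

lemma nn_integral_affine:
  fixes g :: "'a::euclidean_space \<Rightarrow> ennreal"
  assumes g: "g \<in> borel_measurable borel" and r: "r > 0"
  shows "(\<integral>\<^sup>+z. g z \<partial>lborel) = ennreal (r ^ DIM('a)) * (\<integral>\<^sup>+y. g (x + r *\<^sub>R y) \<partial>lborel)"
proof -
  have "(\<integral>\<^sup>+z. g z \<partial>lborel) = (\<integral>\<^sup>+z. g z \<partial>(density (distr lborel borel (\<lambda>y. x + r *\<^sub>R y)) (\<lambda>_. ennreal (r ^ DIM('a)))))"
    using lborel_affine[of r x] r by simp
  also have "\<dots> = (\<integral>\<^sup>+z. ennreal (r ^ DIM('a)) * g z \<partial>(distr lborel borel (\<lambda>y. x + r *\<^sub>R y)))"
    by (rule nn_integral_density) (use g in auto)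
  also have "\<dots> = (\<integral>\<^sup>+y. ennreal (r ^ DIM('a)) * g (x + r *\<^sub>R y) \<partial>lborel)"
    by (rule nn_integral_distr) (use g in auto)
  also have "\<dots> = ennreal (r ^ DIM('a)) * (\<integral>\<^sup>+y. g (x + r *\<^sub>R y) \<partial>lborel)"
    by (rule nn_integral_cmult) (use g in auto)
  finally show ?thesis .
qed

lemma nn_integral_ball_rescale:
  fixes h :: "'a::euclidean_space \<Rightarrow> real"
  assumes h: "continuous_on (ball 0 1) h" and x: "norm x + r \<le> 1" "0 < r"
  shows "(\<integral>\<^sup>+y\<in>ball 0 1. ennreal (h (x + r *\<^sub>R y)) \<partial>lborel) = ennreal (1 / r ^ DIM('a)) * (\<integral>\<^sup>+z\<in>ball x r. ennreal (h z) \<partial>lborel)"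
proof -
  have "ball x r \<subseteq> ball 0 1"
  proof
    fix y assume "y \<in> ball x r"
    then show "y \<in> ball 0 1" using x norm_triangle_sub[of y x] by (simp add: dist_norm norm_minus_commute)
  qed
  then have m: "(\<lambda>z. ennreal (h z) * indicator (ball x r) z) \<in> borel_measurable borel"
    by (intro ball_measurable continuous_on_subset[OF h] open_ball)
  have "(\<integral>\<^sup>+z\<in>ball x r. ennreal (h z) \<partial>lborel)
     = ennreal (r ^ DIM('a)) * (\<integral>\<^sup>+y. ennreal (h (x + r *\<^sub>R y)) * indicator (ball x r) (x + r *\<^sub>R y) \<partial>lborel)"
    by (rule nn_integral_affine[OF m x(2)])
  also have "(\<lambda>y. indicator (ball x r) (x + r *\<^sub>R y) :: ennreal) = indicator (ball 0 1)"
    using x(2) by (auto simp: indicator_def dist_norm fun_eq_iff)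
  finally show ?thesis using x(2) by (simp add: mult.assoc[symmetric] ennreal_mult[symmetric])
qed

lemma norm_ball_integral_le_nn: "ennreal (norm (ball_integral f)) \<le> (\<integral>\<^sup>+x\<in>ball 0 1. ennreal (norm (f x)) \<partial>lborel)"
proof (cases "set_integrable lborel (ball 0 1) f")
  case True
  have "ennreal (norm (ball_integral f)) \<le> (\<integral>\<^sup>+x. ennreal (norm (indicator (ball 0 1) x *\<^sub>R f x)) \<partial>lborel)"
    using integral_norm_bound_ennreal[OF True[unfolded set_integrable_def]] by (simp only: set_lebesgue_integral_def)
  also have "\<dots> = (\<integral>\<^sup>+x\<in>ball 0 1. ennreal (norm (f x)) \<partial>lborel)"
    by (intro nn_integral_cong) (auto simp: indicator_def)
  finally show ?thesis .
next
  case False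
  then show ?thesis unfolding set_lebesgue_integral_def set_integrable_def by (simp add: not_integrable_integral_eq)
qed

lemma reproducing_bound:
  fixes K :: "'a::euclidean_space \<Rightarrow> complex"
  assumes "reproducing k N K"
  shows "\<exists>C>0. \<forall>y. norm (K y) \<le> C"
proof -
  have 0: "K y = 0" if "norm y > 1" for y
  proof (rule reproducingD(2)[OF assms])
    have "1 < y \<bullet> y" using that by (simp add: norm_gt_square)
    then show "1/2 < y \<bullet> y" by linarith
  qed
  obtain C where "C \<ge> 0" "\<forall>y. norm (K y) \<le> C" using cs_bounded[OF Ck_continuous[OF reproducingD(1)[OF assms]] 0] by blast
  then show ?thesis by (intro exI[of _ "C + 1"]) (auto intro: order_trans)
qed

lemma norm_split_powr:
  fixes x A p :: real
  assumes "0 \<le> x" "x \<le> A" "0 < p" "p \<le> 1"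
  shows "x \<le> x powr p * A powr (1 - p)"
proof (cases "x = 0")
  case False
  then have "x = x powr p * x powr (1 - p)" using assms by (simp flip: powr_add)
  also have "\<dots> \<le> x powr p * A powr (1 - p)" using assms by (intro mult_left_mono powr_mono2) auto
  finally show ?thesis .
qed simp

text \<open>The Hardy--Littlewood device: an \<open>L\<^sup>1\<close> mean value inequality, applied at a point where
  \<open>|u(y)| (1/2 - |y|)^(n/p)\<close> is maximal, improves to an \<open>L\<^sup>p\<close> one.\<close>

lemma polyharmonic_mean_powr:
  assumes p: "0 < p" "p \<le> 1"
  shows "\<exists>C>0. \<forall>u :: 'a::euclidean_space \<Rightarrow> complex. u \<in> polyharmonic N \<longrightarrow>
     ennreal (norm (u 0) powr p) \<le> ennreal C * (\<integral>\<^sup>+x\<in>ball 0 1. ennreal (norm (u x) powr p) \<partial>lborel)"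
proof -
  obtain K :: "'a \<Rightarrow> complex" where K: "reproducing (2 - 1) N K" using polyharmonic_kernel[of 2 N] by auto
  obtain C0 where C0: "C0 > 0" "\<And>y. norm (K y) \<le> C0" using reproducing_bound[OF K] by blast
  \<comment> \<open>Chosen so that q p = n: the powers of r from the rescaled volume and from the
    bound on |u| then match in \<open>b3\<close>, and r drops out.\<close>
  define q where "q = real DIM('a) / p"
  have q: "q > 0" "q * p = real DIM('a)" using p by (auto simp: q_def)
  have main: "norm (u 0) powr p \<le> (2 ^ DIM('a) * C0 * 2 powr q) * J"
    if u: "u \<in> polyharmonic N" and J: "J \<ge> 0" "(\<integral>\<^sup>+x\<in>ball 0 (1/2). ennreal (norm (u x) powr p) \<partial>lborel) = ennreal J" for u :: "'a \<Rightarrow> complex" and J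
  proof -
    have uc: "continuous_on (ball 0 1) u" using u Ck_continuous by (auto simp: polyharmonic_def)
    have sub: "cball 0 (1/2) \<subseteq> ball (0::'a) 1" by auto
    \<comment> \<open>The closed ball of radius 1/2 is compact in the unit ball, so the maximum
      exists although u may be unbounded; the factor vanishes on the sphere of radius 1/2, so a
      positive maximum is attained inside.\<close>
    define \<phi> where "\<phi> = (\<lambda>y. norm (u y) * (1/2 - norm y) powr q)"
    have "continuous_on (cball 0 (1/2)) \<phi>" unfolding \<phi>_def
      by (intro continuous_on_mult continuous_on_norm continuous_on_subset[OF uc sub] continuous_on_powr' continuous_intros) (use q in auto)
    then obtain y0 where y0: "y0 \<in> cball 0 (1/2)" "\<And>y. y \<in> cball 0 (1/2) \<Longrightarrow> \<phi> y \<le> \<phi> y0"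
      using continuous_attains_sup[of "cball 0 (1/2)" \<phi>] by auto
    define M where "M = \<phi> y0"
    have \<phi>0: "norm (u 0) * (1/2) powr q \<le> M" using y0(2)[of 0] by (simp add: \<phi>_def M_def)
    show ?thesis
    proof (cases "M \<le> 0")
      case True
      then have "norm (u 0) * (1/2) powr q \<le> 0" using \<phi>0 by linarith
      then have "u 0 = 0" by (simp add: mult_le_0_iff)
      then show ?thesis using C0 J by simp
    next
      case False
      then have M: "M > 0" by simp
      then have ny0: "norm y0 < 1/2" using y0(1) by (cases "norm y0 = 1/2") (auto simp: M_def \<phi>_def)
      \<comment> \<open>Half the distance of y0 to the sphere of radius 1/2: on the ball of radius r
        about y0 the factor is still at least r^q, whence |u| <= M r^(-q).\<close>
      define r where "r = (1/2 - norm y0) / 2"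
      have "2 * r = 1/2 - norm y0" by (simp add: r_def)
      then have r: "r > 0" "norm y0 + 2 * r = 1/2" using ny0 by auto
      have x1: "norm y0 + r \<le> 1" using r by linarith
      define v where "v = (\<lambda>y. u (y0 + r *\<^sub>R y))"
      define A where "A = (M * r powr (-q)) powr (1 - p)"
      have vle: "norm (v y) \<le> M * r powr (-q)" if "y \<in> ball 0 1" for y
      proof -
        have n: "norm (y0 + r *\<^sub>R y) \<le> norm y0 + r * 1"
        proof -
          have "norm (y0 + r *\<^sub>R y) \<le> norm y0 + r * norm y" using norm_triangle_ineq[of y0 "r *\<^sub>R y"] r by simp
          also have "\<dots> \<le> norm y0 + r * 1" using that r by (intro add_left_mono mult_left_mono) auto
          finally show ?thesis .
        qed
        have "norm (v y) * r powr q \<le> norm (v y) * (1/2 - norm (y0 + r *\<^sub>R y)) powr q"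
          using n r q by (intro mult_left_mono powr_mono2) auto
        also have "\<dots> = \<phi> (y0 + r *\<^sub>R y)" by (simp add: \<phi>_def v_def)
        also have "\<dots> \<le> M" unfolding M_def using n r by (intro y0(2)) simp
        finally show ?thesis using r by (simp add: powr_minus field_simps)
      qed
      have "ennreal (norm (u y0)) \<le> (\<integral>\<^sup>+y\<in>ball 0 1. ennreal (norm (v y * K y)) \<partial>lborel)"
      proof -
        have "u y0 = v 0" by (simp add: v_def)
        also have "\<dots> = ball_integral (\<lambda>y. v y * K y)" unfolding v_def
          by (rule reproducingD(4)[OF K polyharmonic_affine[OF u x1 r(1)]])
        finally show ?thesis using norm_ball_integral_le_nn[of "\<lambda>y. v y * K y"] by simp
      qed
      also have "\<dots> \<le> (\<integral>\<^sup>+y. ennreal (C0 * A) * (ennreal (norm (v y) powr p) * indicator (ball 0 1) y) \<partial>lborel)"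
      proof (rule nn_integral_mono)
        fix y :: 'a
        show "ennreal (norm (v y * K y)) * indicator (ball 0 1) y \<le> ennreal (C0 * A) * (ennreal (norm (v y) powr p) * indicator (ball 0 1) y)"
        proof (cases "y \<in> ball 0 1")
          case True
          have "norm (v y * K y) \<le> (norm (v y) powr p * A) * C0"
            unfolding norm_mult A_def by (intro mult_mono norm_split_powr vle True C0 p) auto
          then show ?thesis using True C0 by (simp add: ennreal_mult[symmetric] A_def ennreal_leI mult_ac)
        qed simp
      qed
      also have "\<dots> = ennreal (C0 * A) * (\<integral>\<^sup>+y\<in>ball 0 1. ennreal (norm (u (y0 + r *\<^sub>R y)) powr p) \<partial>lborel)"
      proof -
        have "continuous_on (ball 0 1) v"
          using polyharmonic_affine[OF u x1 r(1)] Ck_continuous unfolding v_def polyharmonic_def by blast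
        then have "(\<lambda>y. ennreal (norm (v y) powr p) * indicator (ball 0 1) y) \<in> borel_measurable lborel"
          using ball_measurable[OF continuous_norm_powr[of "ball 0 1" v p]] p by simp
        from nn_integral_cmult[OF this] show ?thesis by (simp only: v_def)
      qed
      also have "\<dots> = ennreal (C0 * A) * (ennreal (1 / r ^ DIM('a)) * (\<integral>\<^sup>+z\<in>ball y0 r. ennreal (norm (u z) powr p) \<partial>lborel))"
        using nn_integral_ball_rescale[OF continuous_norm_powr[OF uc p(1)] x1 r(1)] by simp
      also have "\<dots> \<le> ennreal (C0 * A) * (ennreal (1 / r ^ DIM('a)) * ennreal J)"
      proof -
        have "ball y0 r \<subseteq> ball 0 (1/2)"
        proof
          fix y assume "y \<in> ball y0 r"
          then show "y \<in> ball 0 (1/2)" using r norm_triangle_sub[of y y0] by (simp add: dist_norm norm_minus_commute)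
        qed
        then have "(\<integral>\<^sup>+z\<in>ball y0 r. ennreal (norm (u z) powr p) \<partial>lborel) \<le> ennreal J"
          unfolding J(2)[symmetric] by (intro nn_integral_mono) (auto simp: indicator_def)
        then show ?thesis by (intro mult_left_mono) auto
      qed
      also have "\<dots> = ennreal (C0 * A * (1 / r ^ DIM('a) * J))"
        using C0 J r by (simp add: ennreal_mult[symmetric] A_def)
      finally have b1: "norm (u y0) \<le> C0 * A * (1 / r ^ DIM('a) * J)"
        using C0 J r by (subst (asm) ennreal_le_iff) (auto simp: A_def)
      have b2: "norm (u y0) = M * 2 powr (-q) * r powr (-q)"
      proof -
        have "1/2 - norm y0 = 2 * r" using r by simp
        then have "M = norm (u y0) * (2 powr q * r powr q)" by (simp add: M_def \<phi>_def powr_mult)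
        then show ?thesis using r by (simp add: powr_minus field_simps)
      qed
      have b3: "A * (1 / r ^ DIM('a)) = M powr (1 - p) * r powr (-q)"
      proof -
        have "A = M powr (1 - p) * r powr (- q * (1 - p))" unfolding A_def using M r by (simp add: powr_mult powr_powr)
        also have "- q * (1 - p) = - q + real DIM('a)" using q(2) by (simp add: algebra_simps)
        finally show ?thesis using r by (simp add: powr_diff powr_minus powr_realpow field_simps)
      qed
      have "(M * 2 powr (-q)) * r powr (-q) \<le> C0 * J * (A * (1 / r ^ DIM('a)))" 
      proof -
        have "C0 * A * (1 / r ^ DIM('a) * J) = C0 * J * (A * (1 / r ^ DIM('a)))" by (simp only: mult_ac)
        then show ?thesis using b1 b2 by linarith
      qed
      then have "(M * 2 powr (-q)) * r powr (-q) \<le> (C0 * M powr (1 - p) * J) * r powr (-q)"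
        unfolding b3 by (simp only: mult_ac)
      then have b4: "M * 2 powr (-q) \<le> C0 * M powr (1 - p) * J" using r by (simp add: mult_le_cancel_right)
      have M1: "M powr p * M powr (1 - p) = M" using M by (simp flip: powr_add)
      have "(M powr p * 2 powr (-q)) * M powr (1 - p) = (M powr p * M powr (1 - p)) * 2 powr (-q)" by (simp only: mult_ac)
      also have "\<dots> \<le> (C0 * J) * M powr (1 - p)" using b4 unfolding M1 by (simp add: mult_ac)
      finally have "(M powr p * 2 powr (-q)) * M powr (1 - p) \<le> (C0 * J) * M powr (1 - p)" .
      then have "M powr p * 2 powr (-q) \<le> C0 * J" using M by (simp add: mult_le_cancel_right)
      note le = this
      have "M powr p = (M powr p * 2 powr (-q)) * 2 powr q" by (simp add: powr_minus)
      also have "\<dots> \<le> C0 * J * 2 powr q" by (rule mult_right_mono[OF le]) simp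
      finally have Mp: "M powr p \<le> C0 * J * 2 powr q" .
      have "(norm (u 0) * (1/2) powr q) powr p \<le> M powr p" using \<phi>0 p by (intro powr_mono2) auto
      moreover have "(norm (u 0) * (1/2) powr q) powr p = norm (u 0) powr p * (1/2) ^ DIM('a)"
        by (simp only: powr_mult powr_powr q(2)) (simp add: powr_realpow)
      ultimately have "norm (u 0) powr p * (1/2) ^ DIM('a) \<le> C0 * J * 2 powr q" using Mp by linarith
      from mult_right_mono[OF this, of "2 ^ DIM('a)"] show ?thesis by (simp add: power_divide mult_ac)
    qed
  qed
  show ?thesis
  proof (intro exI[of _ "2 ^ DIM('a) * C0 * 2 powr q"] conjI allI impI)
    show "2 ^ DIM('a) * C0 * 2 powr q > 0" using C0 by simp
    fix u :: "'a \<Rightarrow> complex" assume u: "u \<in> polyharmonic N"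
    let ?I = "\<integral>\<^sup>+x\<in>ball 0 1. ennreal (norm (u x) powr p) \<partial>lborel"
    let ?J = "\<integral>\<^sup>+x\<in>ball 0 (1/2). ennreal (norm (u x) powr p) \<partial>lborel"
    have JI: "?J \<le> ?I" by (intro nn_integral_mono) (auto simp: indicator_def)
    show "ennreal (norm (u 0) powr p) \<le> ennreal (2 ^ DIM('a) * C0 * 2 powr q) * ?I"
    proof (cases "?J = \<infinity>")
      case True
      then have "?I = \<infinity>" using JI by (simp add: top_unique)
      then show ?thesis using C0 by (simp add: ennreal_mult_top)
    next
      case False
      then obtain J where J: "J \<ge> 0" "?J = ennreal J" by (cases ?J) auto
      have "ennreal (norm (u 0) powr p) \<le> ennreal ((2 ^ DIM('a) * C0 * 2 powr q) * J)"
        by (intro ennreal_leI main u J)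
      also have "\<dots> = ennreal (2 ^ DIM('a) * C0 * 2 powr q) * ?J" using J C0 by (simp add: ennreal_mult)
      also have "\<dots> \<le> ennreal (2 ^ DIM('a) * C0 * 2 powr q) * ?I" by (intro mult_left_mono JI) auto
      finally show ?thesis .
    qed
  qed
qed

lemma polyharmonic_mean_at:
  assumes p: "0 < p" "p \<le> 1"
  shows "\<exists>C>0. \<forall>u :: 'a::euclidean_space \<Rightarrow> complex. \<forall>x r. u \<in> polyharmonic N \<longrightarrow> 0 < r \<longrightarrow> norm x + r \<le> 1 \<longrightarrow>
     ennreal (norm (u x) powr p) \<le> ennreal (C / r ^ DIM('a)) * (\<integral>\<^sup>+z\<in>ball x r. ennreal (norm (u z) powr p) \<partial>lborel)"
proof -
  obtain C where C: "C > 0" "\<And>u :: 'a \<Rightarrow> complex. u \<in> polyharmonic N \<Longrightarrow>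
     ennreal (norm (u 0) powr p) \<le> ennreal C * (\<integral>\<^sup>+x\<in>ball 0 1. ennreal (norm (u x) powr p) \<partial>lborel)"
    using polyharmonic_mean_powr[OF p, of N] by blast
  show ?thesis
  proof (intro exI[of _ C] conjI allI impI C(1))
    fix u :: "'a \<Rightarrow> complex" and x :: 'a and r :: real
    assume u: "u \<in> polyharmonic N" and r: "0 < r" "norm x + r \<le> 1"
    have uc: "continuous_on (ball 0 1) u" using u Ck_continuous by (auto simp: polyharmonic_def)
    show "ennreal (norm (u x) powr p) \<le> ennreal (C / r ^ DIM('a)) * (\<integral>\<^sup>+z\<in>ball x r. ennreal (norm (u z) powr p) \<partial>lborel)"
      using C(2)[OF polyharmonic_affine[OF u r(2,1)]] nn_integral_ball_rescale[OF continuous_norm_powr[OF uc p(1)] r(2,1)] C(1) r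
      by (simp add: mult.assoc[symmetric] ennreal_mult[symmetric])
  qed
qed

text \<open>The derivative is moved onto the kernel in the convolution formula, so only the size of
  u enters. Scale 1/2 and cutoff radius 3/4 make the formula valid for |x| < 1/4, a neighbourhood of
  the point 0 at which it is differentiated.\<close>

lemma polyharmonic_deriv_sup:
  "\<exists>C>0. \<forall>u :: 'a::euclidean_space \<Rightarrow> complex. \<forall>S. \<forall>b\<in>Basis. u \<in> polyharmonic N \<longrightarrow> (\<forall>z\<in>cball 0 (3/4). norm (u z) \<le> S) \<longrightarrow>
     norm (dir_deriv b u 0) \<le> C * S"
proof -
  obtain K :: "'a \<Rightarrow> complex" where K: "reproducing 1 N K" using polyharmonic_kernel[of 2 N] by auto
  note K' = reproducingD[OF K]
  define Kr where "Kr = (\<lambda>w. of_real (1 / (1/2) ^ DIM('a)) * K ((1/(1/2)) *\<^sub>R w))"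
  have Kr: "Ck 1 Kr UNIV" "\<And>w. norm w > 1/2 \<Longrightarrow> Kr w = 0"
    unfolding Kr_def by (rule rescaled_kernel(1)[OF K'(1,2)], simp_all, rule rescaled_kernel(2)[OF K'(1,2), where r = "1/2" and c = 1, simplified])
  have "\<exists>C\<ge>0. \<forall>w. norm (dir_deriv b Kr w) \<le> C" if "b \<in> Basis" for b
  proof (rule cs_bounded[of _ "1/2"])
    show "continuous_on UNIV (dir_deriv b Kr)" using Kr(1) that by simp
    show "dir_deriv b Kr w = 0" if "norm w > 1/2" for w
      by (rule dir_deriv_zero_outside[OF Kr(2) that])
  qed
  then obtain Cb where Cb: "\<And>b. b \<in> Basis \<Longrightarrow> Cb b \<ge> 0" "\<And>b w. b \<in> Basis \<Longrightarrow> norm (dir_deriv b Kr w) \<le> Cb b" by metis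
  define C1 where "C1 = (\<Sum>b\<in>Basis. Cb b) + 1"
  have C1: "C1 > 0" "\<And>b w. b \<in> Basis \<Longrightarrow> norm (dir_deriv b Kr w) \<le> C1"
  proof -
    show "C1 > 0" unfolding C1_def using sum_nonneg[of Basis Cb] Cb(1) by auto
    fix b w assume b: "b \<in> (Basis::'a set)"
    have "Cb b \<le> (\<Sum>b\<in>Basis. Cb b)" using Cb(1) by (intro member_le_sum b) auto
    then show "norm (dir_deriv b Kr w) \<le> C1" using Cb(2)[OF b, of w] by (simp add: C1_def)
  qed
  define V where "V = measure lborel (cball (0::'a) (3/4)) + 1"
  have V: "V > 0" by (simp add: V_def add_nonneg_pos)
  show ?thesis
  proof (intro exI[of _ "C1 * V"] conjI allI ballI impI)
    show "C1 * V > 0" using C1 V by simp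
    fix u :: "'a \<Rightarrow> complex" and S b assume b: "b \<in> (Basis::'a set)" and u: "u \<in> polyharmonic N" and S: "\<forall>z\<in>cball 0 (3/4). norm (u z) \<le> S"
    have S0: "S \<ge> 0" using S[rule_format, of 0] norm_ge_zero[of "u 0"] by (simp del: norm_ge_zero)
    have uc: "continuous_on (ball 0 1) u" using u Ck_continuous by (auto simp: polyharmonic_def)
    let ?f = "\<lambda>z. indicator (cball 0 (3/4)) z *\<^sub>R u z"
    have f: "integrable lborel ?f" by (rule cutoff_integrable[OF uc]) simp
    have "dir_deriv b u 0 = dir_deriv b (\<lambda>x. \<integral>z. ?f z * Kr (x - z) \<partial>lborel) 0"
    proof (rule dir_deriv_cong[of "ball 0 (1/4)"])
      fix x :: 'a assume x: "x \<in> ball 0 (1/4)"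
      show "u x = (\<integral>z. ?f z * Kr (x - z) \<partial>lborel)" unfolding Kr_def
        by (rule polyharmonic_conv[OF Ck_continuous[OF K'(1)] K'(2-4) u]) (use x in auto)
    qed auto
    also have "\<dots> = (\<integral>z. ?f z * dir_deriv b Kr (0 - z) \<partial>lborel)" by (rule dir_deriv_conv[OF f Kr b])
    finally have e: "norm (dir_deriv b u 0) = norm (\<integral>z. ?f z * dir_deriv b Kr (0 - z) \<partial>lborel)" by simp
    have "norm (dir_deriv b u 0) \<le> (\<integral>z. indicator (cball (0::'a) (3/4)) z *\<^sub>R (S * C1) \<partial>lborel)"
      unfolding e
    proof (rule Bochner_Integration.integral_norm_bound_integral)
      show "integrable lborel (\<lambda>z. ?f z * dir_deriv b Kr (0 - z))"
        by (rule integrable_mult_cs[OF f, of _ "1/2"]) (use Kr(1) b in simp, erule dir_deriv_zero_outside[OF Kr(2), rotated])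
      show "integrable lborel (\<lambda>z::'a. indicator (cball 0 (3/4)) z *\<^sub>R (S * C1))"
        by (intro borel_integrable_compact) auto
      show "norm (?f z * dir_deriv b Kr (0 - z)) \<le> indicator (cball 0 (3/4)) z *\<^sub>R (S * C1)" for z
      proof (cases "z \<in> cball 0 (3/4)")
        case True
        then have "norm (u z) * norm (dir_deriv b Kr (0 - z)) \<le> S * C1" using S S0 by (intro mult_mono C1(2) b) auto
        then show ?thesis using True by (simp add: norm_mult)
      qed simp
    qed
    also have "\<dots> = (V - 1) * (S * C1)" by (simp add: V_def)
    also have "\<dots> \<le> V * (S * C1)" using S0 C1 by (intro mult_right_mono) auto
    finally show "norm (dir_deriv b u 0) \<le> C1 * V * S" by (simp add: mult_ac)
  qed
qed

text \<open>Every point of \<open>cball 0 (3/4)\<close> is the centre of a ball of radius 1/4 inside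
  the unit ball, so the L^p mean value inequality bounds the supremum required by
  \<open>polyharmonic_deriv_sup\<close>.\<close>

lemma polyharmonic_deriv_powr:
  assumes p: "0 < p" "p \<le> 1"
  shows "\<exists>C>0. \<forall>u :: 'a::euclidean_space \<Rightarrow> complex. \<forall>b\<in>Basis. u \<in> polyharmonic N \<longrightarrow>
     ennreal (norm (dir_deriv b u 0) powr p) \<le> ennreal C * (\<integral>\<^sup>+x\<in>ball 0 1. ennreal (norm (u x) powr p) \<partial>lborel)"
proof -
  obtain C1 where C1: "C1 > 0" "\<And>u :: 'a \<Rightarrow> complex. \<And>x r. u \<in> polyharmonic N \<Longrightarrow> 0 < r \<Longrightarrow> norm x + r \<le> 1 \<Longrightarrow>
     ennreal (norm (u x) powr p) \<le> ennreal (C1 / r ^ DIM('a)) * (\<integral>\<^sup>+z\<in>ball x r. ennreal (norm (u z) powr p) \<partial>lborel)"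
    using polyharmonic_mean_at[OF p, of N] by blast
  obtain C2 where C2: "C2 > 0" "\<And>u :: 'a \<Rightarrow> complex. \<And>S b. b \<in> Basis \<Longrightarrow> u \<in> polyharmonic N \<Longrightarrow> (\<forall>z\<in>cball 0 (3/4). norm (u z) \<le> S) \<Longrightarrow>
     norm (dir_deriv b u 0) \<le> C2 * S"
    using polyharmonic_deriv_sup[of N] by metis
  define D where "D = C1 / (1/4) ^ DIM('a)"
  have D: "D > 0" using C1 by (simp add: D_def)
  show ?thesis
  proof (intro exI[of _ "C2 powr p * D"] conjI allI ballI impI)
    show "C2 powr p * D > 0" using C2 D by simp
    fix u :: "'a \<Rightarrow> complex" and b assume b: "b \<in> (Basis::'a set)" and u: "u \<in> polyharmonic N"
    let ?I = "\<integral>\<^sup>+x\<in>ball 0 1. ennreal (norm (u x) powr p) \<partial>lborel"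
    show "ennreal (norm (dir_deriv b u 0) powr p) \<le> ennreal (C2 powr p * D) * ?I"
    proof (cases "?I = \<infinity>")
      case True then show ?thesis using C2 D by (simp add: ennreal_mult_top)
    next
      case False
      then obtain I where I: "I \<ge> 0" "?I = ennreal I" by (cases ?I) auto
      have "norm (u z) \<le> (D * I) powr (1/p)" if z: "z \<in> cball 0 (3/4)" for z
      proof -
        have "ennreal (norm (u z) powr p) \<le> ennreal D * (\<integral>\<^sup>+x\<in>ball z (1/4). ennreal (norm (u x) powr p) \<partial>lborel)"
          unfolding D_def by (rule C1(2)[OF u]) (use z in auto)
        also have "\<dots> \<le> ennreal D * ?I"
        proof (rule mult_left_mono, rule nn_integral_mono)
          fix x
          have "x \<in> ball 0 1" if "x \<in> ball z (1/4)"
            using that z norm_triangle_sub[of x z] by (simp add: dist_norm norm_minus_commute)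
          then show "ennreal (norm (u x) powr p) * indicator (ball z (1/4)) x \<le> ennreal (norm (u x) powr p) * indicator (ball 0 1) x"
            by (auto simp: indicator_def)
        qed simp
        also have "\<dots> = ennreal (D * I)" using D I by (simp add: ennreal_mult)
        finally have "norm (u z) powr p \<le> D * I" using D I by (subst (asm) ennreal_le_iff) auto
        then have "(norm (u z) powr p) powr (1/p) \<le> (D * I) powr (1/p)" using p by (intro powr_mono2) auto
        then show ?thesis using p by (simp add: powr_powr)
      qed
      then have "norm (dir_deriv b u 0) \<le> C2 * (D * I) powr (1/p)" by (intro C2(2) b u) auto
      then have "norm (dir_deriv b u 0) powr p \<le> (C2 * (D * I) powr (1/p)) powr p" using p by (intro powr_mono2) auto
      also have "\<dots> = C2 powr p * D * I" using p D I by (simp add: powr_mult powr_powr)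
      finally have "ennreal (norm (dir_deriv b u 0) powr p) \<le> ennreal (C2 powr p * D * I)" by (rule ennreal_leI)
      then show ?thesis using I C2 D by (simp add: ennreal_mult mult.assoc)
    qed
  qed
qed

lemma polyharmonic_deriv_at:
  assumes p: "0 < p" "p \<le> 1"
  shows "\<exists>C>0. \<forall>u :: 'a::euclidean_space \<Rightarrow> complex. \<forall>x r. \<forall>b\<in>Basis. u \<in> polyharmonic N \<longrightarrow> 0 < r \<longrightarrow> norm x + r \<le> 1 \<longrightarrow> norm x < 1 \<longrightarrow>
     ennreal (norm (dir_deriv b u x) powr p) \<le> ennreal (C * r powr (- real DIM('a) - p)) * (\<integral>\<^sup>+z\<in>ball x r. ennreal (norm (u z) powr p) \<partial>lborel)"
proof -
  obtain C where C: "C > 0" "\<And>u :: 'a \<Rightarrow> complex. \<And>b. b \<in> Basis \<Longrightarrow> u \<in> polyharmonic N \<Longrightarrow>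
     ennreal (norm (dir_deriv b u 0) powr p) \<le> ennreal C * (\<integral>\<^sup>+x\<in>ball 0 1. ennreal (norm (u x) powr p) \<partial>lborel)"
    using polyharmonic_deriv_powr[OF p, of N] by blast
  show ?thesis
  proof (intro exI[of _ C] conjI allI ballI impI C(1))
    fix u :: "'a \<Rightarrow> complex" and x :: 'a and r :: real and b :: 'a
    assume b: "b \<in> Basis" and u: "u \<in> polyharmonic N" and r: "0 < r" "norm x + r \<le> 1" and x: "norm x < 1"
    have uc: "continuous_on (ball 0 1) u" using u Ck_continuous by (auto simp: polyharmonic_def)
    have "u differentiable at (x + r *\<^sub>R 0)" using Ck_differentiable[OF polyharmonic_smooth[OF u, of 1]] x by simp
    from affine_differentiable(2)[OF this, of b]
    have d: "norm (dir_deriv b (\<lambda>y. u (x + r *\<^sub>R y)) 0) powr p = r powr p * norm (dir_deriv b u x) powr p"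
      using r by (simp add: norm_mult powr_mult)
    have "ennreal (r powr p * norm (dir_deriv b u x) powr p) \<le> ennreal (C / r ^ DIM('a)) * (\<integral>\<^sup>+z\<in>ball x r. ennreal (norm (u z) powr p) \<partial>lborel)"
      using C(2)[OF b polyharmonic_affine[OF u r(2,1)]] nn_integral_ball_rescale[OF continuous_norm_powr[OF uc p(1)] r(2,1)] C(1) r
      unfolding d by (simp add: mult.assoc[symmetric] ennreal_mult[symmetric])
    then have "ennreal (r powr (-p)) * ennreal (r powr p * norm (dir_deriv b u x) powr p)
        \<le> ennreal (r powr (-p)) * (ennreal (C / r ^ DIM('a)) * (\<integral>\<^sup>+z\<in>ball x r. ennreal (norm (u z) powr p) \<partial>lborel))"
      by (rule mult_left_mono) simp
    then have "ennreal (r powr (-p) * (r powr p * norm (dir_deriv b u x) powr p)) \<le> ennreal (r powr (-p) * (C / r ^ DIM('a))) * (\<integral>\<^sup>+z\<in>ball x r. ennreal (norm (u z) powr p) \<partial>lborel)"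
    proof -
      have "ennreal (r powr (-p) * (C / r ^ DIM('a))) = ennreal (r powr (-p)) * ennreal (C / r ^ DIM('a))"
        by (rule ennreal_mult) (use C r in auto)
      moreover have "ennreal (r powr (-p) * (r powr p * norm (dir_deriv b u x) powr p)) = ennreal (r powr (-p)) * ennreal (r powr p * norm (dir_deriv b u x) powr p)"
        by (rule ennreal_mult) auto
      ultimately show ?thesis
        using \<open>ennreal (r powr (-p)) * ennreal (r powr p * norm (dir_deriv b u x) powr p) \<le> ennreal (r powr (-p)) * _\<close> by (simp only: mult.assoc)
    qed
    moreover have "r powr (-p) * (r powr p * norm (dir_deriv b u x) powr p) = norm (dir_deriv b u x) powr p"
      using r by (simp add: powr_minus)
    moreover have "r powr (-p) * (C / r ^ DIM('a)) = C * r powr (- real DIM('a) - p)"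
      using r by (simp add: powr_diff powr_minus powr_realpow field_simps)
    ultimately show "ennreal (norm (dir_deriv b u x) powr p) \<le> ennreal (C * r powr (- real DIM('a) - p)) * (\<integral>\<^sup>+z\<in>ball x r. ennreal (norm (u z) powr p) \<partial>lborel)"
      by simp
  qed
qed

section \<open>Estimates on balls of half the boundary distance\<close>

lemma ennreal_mult3: "0 \<le> a \<Longrightarrow> 0 \<le> b \<Longrightarrow> 0 \<le> c \<Longrightarrow> ennreal (a * (b * c)) = ennreal a * (ennreal b * ennreal c)"
  by (simp add: ennreal_mult)

lemma powr_comparable:
  fixes s t e :: real
  assumes "0 < s" "s \<le> 2 * t" "t \<le> 2 * s"
  shows "s powr e \<le> 2 powr \<bar>e\<bar> * t powr e"
proof (cases "e \<ge> 0")
  case True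
  have "s powr e \<le> (2 * t) powr e" using assms True by (intro powr_mono2) auto
  then show ?thesis using True assms by (simp add: powr_mult)
next
  case False
  have "s powr e \<le> (t / 2) powr e" using assms False by (intro powr_mono2') auto
  also have "\<dots> = 2 powr \<bar>e\<bar> * t powr e" using False assms by (simp add: powr_divide powr_minus field_simps)
  finally show ?thesis .
qed

lemma dist_boundary_comparable:
  fixes x z :: "'a::real_normed_vector"
  assumes "dist x z < (1 - norm x) / 2"
  shows "1 - norm x \<le> 2 * (1 - norm z)" "1 - norm z \<le> 2 * (1 - norm x)" "0 < 1 - norm x"
    and "0 < 1 - norm z" and "dist x z < 1 - norm z"
proof -
  have 1: "norm z \<le> norm x + dist x z" "norm x \<le> norm z + dist x z" "2 * dist x z < 1 - norm x" "0 \<le> dist x z"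
    using assms norm_triangle_sub[of z x] norm_triangle_sub[of x z] by (simp_all add: dist_norm norm_minus_commute)
  show "1 - norm x \<le> 2 * (1 - norm z)" using 1 by (simp add: algebra_simps)
  show "1 - norm z \<le> 2 * (1 - norm x)" using 1 by (simp add: algebra_simps)
  show "0 < 1 - norm x" using 1 by (simp add: algebra_simps)
  show "0 < 1 - norm z" using 1 by (simp add: algebra_simps)
  show "dist x z < 1 - norm z" using 1 by (simp add: algebra_simps)
qed

text \<open>On the ball about x of half the boundary distance d the weight is comparable with
  d^\<alpha>, so the mean value inequality at x costs the factors d^(-n) and d^(-\<alpha>).\<close>

lemma polyharmonic_growth:
  fixes u :: "'a::euclidean_space \<Rightarrow> complex"
  assumes p: "0 < p" "p \<le> 1" and u: "u \<in> polyharmonic N" and w: "wint p \<alpha> u"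
  shows "\<exists>A\<ge>0. \<forall>x\<in>ball 0 1. norm (u x) powr p \<le> A * (1 - norm x) powr (- real DIM('a) - \<alpha>)"
proof -
  obtain C where C: "C > 0" "\<And>u :: 'a \<Rightarrow> complex. \<And>x r. u \<in> polyharmonic N \<Longrightarrow> 0 < r \<Longrightarrow> norm x + r \<le> 1 \<Longrightarrow>
     ennreal (norm (u x) powr p) \<le> ennreal (C / r ^ DIM('a)) * (\<integral>\<^sup>+z\<in>ball x r. ennreal (norm (u z) powr p) \<partial>lborel)"
    using polyharmonic_mean_at[OF p, of N] by blast
  have uc: "continuous_on (ball 0 1) u" using u Ck_continuous by (auto simp: polyharmonic_def)
  let ?I = "\<integral>\<^sup>+x\<in>ball 0 1. ennreal (norm (u x) powr p * (1 - norm x) powr \<alpha>) \<partial>lborel"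
  obtain I where I: "I \<ge> 0" "?I = ennreal I" using w unfolding wint_def by (cases ?I) auto
  show ?thesis
  proof (intro exI[of _ "C * 2 ^ DIM('a) * 2 powr \<bar>\<alpha>\<bar> * I"] conjI ballI)
    show "0 \<le> C * 2 ^ DIM('a) * 2 powr \<bar>\<alpha>\<bar> * I" using C I by simp
    fix x :: 'a assume x: "x \<in> ball 0 1"
    define d where "d = 1 - norm x"
    have d: "d > 0" using x by (simp add: d_def)
    have "ennreal (norm (u x) powr p) \<le> ennreal (C / (d/2) ^ DIM('a)) * (\<integral>\<^sup>+z\<in>ball x (d/2). ennreal (norm (u z) powr p) \<partial>lborel)"
      by (rule C(2)[OF u]) (use d in \<open>auto simp: d_def field_simps\<close>)
    also have "\<dots> \<le> ennreal (C / (d/2) ^ DIM('a)) * (\<integral>\<^sup>+z. ennreal (2 powr \<bar>\<alpha>\<bar> * d powr (-\<alpha>)) * (ennreal (norm (u z) powr p * (1 - norm z) powr \<alpha>) * indicator (ball 0 1) z) \<partial>lborel)"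
    proof (intro mult_left_mono nn_integral_mono)
      fix z
      show "ennreal (norm (u z) powr p) * indicator (ball x (d/2)) z
         \<le> ennreal (2 powr \<bar>\<alpha>\<bar> * d powr (-\<alpha>)) * (ennreal (norm (u z) powr p * (1 - norm z) powr \<alpha>) * indicator (ball 0 1) z)"
      proof (cases "z \<in> ball x (d/2)")
        case True
        then have "dist x z < (1 - norm x) / 2" by (simp add: d_def)
        note c = dist_boundary_comparable[OF this]
        have "(1 - norm z) powr (-\<alpha>) \<le> 2 powr \<bar>-\<alpha>\<bar> * d powr (-\<alpha>)"
          unfolding d_def by (rule powr_comparable) (use c in auto)
        then have "1 \<le> (2 powr \<bar>\<alpha>\<bar> * d powr (-\<alpha>)) * (1 - norm z) powr \<alpha>"
          using c by (simp add: powr_minus field_simps)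
        from mult_left_mono[OF this, of "norm (u z) powr p"]
        show ?thesis using True c by (simp add: ennreal_mult[symmetric] ennreal_leI mult_ac)
      qed simp
    qed simp
    also have "\<dots> = ennreal (C / (d/2) ^ DIM('a)) * (ennreal (2 powr \<bar>\<alpha>\<bar> * d powr (-\<alpha>)) * ?I)"
      using nn_integral_cmult[of "\<lambda>z. ennreal (norm (u z) powr p * (1 - norm z) powr \<alpha>) * indicator (ball 0 1) z" lborel] wint_measurable[OF uc p(1)] by simp
    also have "\<dots> = ennreal ((C / (d/2) ^ DIM('a)) * (2 powr \<bar>\<alpha>\<bar> * d powr (-\<alpha>) * I))"
      unfolding I(2) by (rule ennreal_mult3[symmetric]) (use C d I in auto)
    finally have "norm (u x) powr p \<le> (C / (d/2) ^ DIM('a)) * (2 powr \<bar>\<alpha>\<bar> * d powr (-\<alpha>) * I)"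
      using C d I by (subst (asm) ennreal_le_iff) auto
    also have "\<dots> = C * 2 ^ DIM('a) * 2 powr \<bar>\<alpha>\<bar> * I * d powr (- real DIM('a) - \<alpha>)"
      using d by (simp add: powr_diff powr_minus powr_realpow power_divide field_simps)
    finally show "norm (u x) powr p \<le> C * 2 ^ DIM('a) * 2 powr \<bar>\<alpha>\<bar> * I * (1 - norm x) powr (- real DIM('a) - \<alpha>)"
      by (simp add: d_def)
  qed
qed

text \<open>Apply the local derivative estimate on balls of half the boundary distance and exchange
  the integrals. For fixed z the admissible x lie within the boundary distance d of z, a set of
  volume O(d^n), which cancels the d^(-n) of the local estimate; what remains is d^p.\<close>

theorem wint_dir_deriv:
  fixes u :: "'a::euclidean_space \<Rightarrow> complex"
  assumes p: "0 < p" "p \<le> 1" and u: "u \<in> polyharmonic N" and w: "wint p \<alpha> u" and b: "b \<in> Basis"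
  shows "wint p (\<alpha> + p) (dir_deriv b u)"
proof -
  let ?n = "real DIM('a)"
  obtain C where C: "C > 0" "\<And>u :: 'a \<Rightarrow> complex. \<And>x r b. b \<in> Basis \<Longrightarrow> u \<in> polyharmonic N \<Longrightarrow> 0 < r \<Longrightarrow> norm x + r \<le> 1 \<Longrightarrow> norm x < 1 \<Longrightarrow>
     ennreal (norm (dir_deriv b u x) powr p) \<le> ennreal (C * r powr (- real DIM('a) - p)) * (\<integral>\<^sup>+z\<in>ball x r. ennreal (norm (u z) powr p) \<partial>lborel)"
    using polyharmonic_deriv_at[OF p, of N] by blast
  have uc: "continuous_on (ball 0 1) u" using u Ck_continuous by (auto simp: polyharmonic_def)
  define U where "U = (\<lambda>z. ennreal (norm (u z) powr p) * indicator (ball 0 1) z)"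
  have U[measurable]: "U \<in> borel_measurable borel" unfolding U_def
    by (intro ball_measurable continuous_norm_powr uc p open_ball)
  define D where "D = C * 2 powr (?n + p)"
  have D: "D > 0" using C by (simp add: D_def)
  \<comment> \<open>The indicator couples x and z by the condition that z lies in the ball of half
    the boundary distance about x. It is that of an open set of pairs, which gives the joint
    measurability needed for Tonelli.\<close>
  define k where "k = (\<lambda>x z::'a. ennreal (D * (1 - norm x) powr (\<alpha> - ?n)) * indicator {xz. dist (fst xz) (snd xz) < (1 - norm (fst xz)) / 2} (x, z))"
  have Sm: "{xz::'a \<times> 'a. dist (fst xz) (snd xz) < (1 - norm (fst xz)) / 2} \<in> sets borel"
    by (intro borel_open open_Collect_less continuous_intros) simp_all
  have Sm': "{xz::'a \<times> 'a. dist (fst xz) (snd xz) < (1 - norm (fst xz)) / 2} \<in> sets (borel \<Otimes>\<^sub>M borel)"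
    using Sm by (simp only: borel_prod)
  have g1: "(\<lambda>x::'a. ennreal (D * (1 - norm x) powr (\<alpha> - ?n))) \<in> borel_measurable borel" by measurable
  have km: "(\<lambda>(x, z). k x z * U z) \<in> borel_measurable (borel \<Otimes>\<^sub>M borel)"
    unfolding k_def case_prod_beta prod.collapse
    by (intro borel_measurable_times_ennreal borel_measurable_indicator Sm' measurable_compose[OF measurable_fst g1] measurable_compose[OF measurable_snd U])
  have "(\<integral>\<^sup>+x\<in>ball 0 1. ennreal (norm (dir_deriv b u x) powr p * (1 - norm x) powr (\<alpha> + p)) \<partial>lborel)
     \<le> (\<integral>\<^sup>+x. \<integral>\<^sup>+z. k x z * U z \<partial>lborel \<partial>lborel)"
  proof (rule nn_integral_mono)
    fix x :: 'a
    show "ennreal (norm (dir_deriv b u x) powr p * (1 - norm x) powr (\<alpha> + p)) * indicator (ball 0 1) x \<le> (\<integral>\<^sup>+z. k x z * U z \<partial>lborel)"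
    proof (cases "x \<in> ball 0 1")
      case True
      define d where "d = 1 - norm x"
      have d: "d > 0" using True by (simp add: d_def)
      have "ennreal (norm (dir_deriv b u x) powr p * d powr (\<alpha> + p)) = ennreal (d powr (\<alpha> + p)) * ennreal (norm (dir_deriv b u x) powr p)"
        by (simp add: ennreal_mult mult.commute)
      also have "\<dots> \<le> ennreal (d powr (\<alpha> + p)) * (ennreal (C * (d/2) powr (- ?n - p)) * (\<integral>\<^sup>+z\<in>ball x (d/2). ennreal (norm (u z) powr p) \<partial>lborel))"
        by (intro mult_left_mono C(2)[OF b u]) (use d True in \<open>auto simp: d_def field_simps\<close>)
      also have "\<dots> = ennreal (D * d powr (\<alpha> - ?n)) * (\<integral>\<^sup>+z\<in>ball x (d/2). ennreal (norm (u z) powr p) \<partial>lborel)"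
      proof -
        have "d powr (\<alpha> + p) * (C * (d/2) powr (- ?n - p)) = D * (d powr (\<alpha> + p) * d powr (- ?n - p))"
          using d by (simp add: D_def powr_divide powr_diff powr_minus powr_add field_simps)
        also have "d powr (\<alpha> + p) * d powr (- ?n - p) = d powr (\<alpha> - ?n)" by (simp flip: powr_add)
        finally show ?thesis using C by (simp add: ennreal_mult[symmetric] mult.assoc[symmetric])
      qed
      also have "\<dots> = (\<integral>\<^sup>+z. ennreal (D * d powr (\<alpha> - ?n)) * (ennreal (norm (u z) powr p) * indicator (ball x (d/2)) z) \<partial>lborel)"
      proof (rule nn_integral_cmult[symmetric])
        have "ball x (d/2) \<subseteq> ball 0 1" using dist_boundary_comparable(4)[of x] by (auto simp: d_def)
        then show "(\<lambda>z. ennreal (norm (u z) powr p) * indicator (ball x (d/2)) z) \<in> borel_measurable lborel"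
          using ball_measurable[OF continuous_norm_powr[OF continuous_on_subset[OF uc] p(1)]] by simp
      qed
      also have "\<dots> \<le> (\<integral>\<^sup>+z. k x z * U z \<partial>lborel)"
      proof (rule nn_integral_mono)
        fix z
        show "ennreal (D * d powr (\<alpha> - ?n)) * (ennreal (norm (u z) powr p) * indicator (ball x (d/2)) z) \<le> k x z * U z"
          using dist_boundary_comparable(4)[of x z] by (auto simp: k_def U_def d_def indicator_def)
      qed
      finally show ?thesis using True by (simp add: d_def)
    qed simp
  qed
  also have "\<dots> = (\<integral>\<^sup>+z. \<integral>\<^sup>+x. k x z * U z \<partial>lborel \<partial>lborel)"
    by (rule lborel_pair.Fubini'[symmetric]) (use km in simp)
  also have "\<dots> \<le> (\<integral>\<^sup>+z. (ennreal (D * 2 powr \<bar>\<alpha> - ?n\<bar> * unit_ball_vol ?n)) * (ennreal (norm (u z) powr p * (1 - norm z) powr \<alpha>) * indicator (ball 0 1) z) \<partial>lborel)"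
  proof (rule nn_integral_mono)
    fix z :: 'a
    show "(\<integral>\<^sup>+x. k x z * U z \<partial>lborel) \<le> ennreal (D * 2 powr \<bar>\<alpha> - ?n\<bar> * unit_ball_vol ?n) * (ennreal (norm (u z) powr p * (1 - norm z) powr \<alpha>) * indicator (ball 0 1) z)"
    proof (cases "z \<in> ball 0 1")
      case True
      define d where "d = 1 - norm z"
      have d: "d > 0" using True by (simp add: d_def)
      have "(\<integral>\<^sup>+x. k x z * U z \<partial>lborel) \<le> (\<integral>\<^sup>+x. ennreal (D * (2 powr \<bar>\<alpha> - ?n\<bar> * d powr (\<alpha> - ?n)) * norm (u z) powr p) * indicator (ball z d) x \<partial>lborel)"
      proof (rule nn_integral_mono)
        fix x :: 'a
        show "k x z * U z \<le> ennreal (D * (2 powr \<bar>\<alpha> - ?n\<bar> * d powr (\<alpha> - ?n)) * norm (u z) powr p) * indicator (ball z d) x"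
        proof (cases "dist x z < (1 - norm x) / 2")
          case near: True
          note c = dist_boundary_comparable[OF near]
          have "(1 - norm x) powr (\<alpha> - ?n) \<le> 2 powr \<bar>\<alpha> - ?n\<bar> * d powr (\<alpha> - ?n)"
            unfolding d_def by (rule powr_comparable) (use c in auto)
          then have "D * (1 - norm x) powr (\<alpha> - ?n) * norm (u z) powr p \<le> D * (2 powr \<bar>\<alpha> - ?n\<bar> * d powr (\<alpha> - ?n)) * norm (u z) powr p"
            using D by (intro mult_right_mono mult_left_mono) auto
          then show ?thesis using c True near D
            by (simp add: k_def U_def d_def indicator_def dist_commute ennreal_mult[symmetric] ennreal_leI)
        qed (simp add: k_def)
      qed
      also have "\<dots> = ennreal (D * (2 powr \<bar>\<alpha> - ?n\<bar> * d powr (\<alpha> - ?n)) * norm (u z) powr p) * ennreal (unit_ball_vol ?n * d ^ DIM('a))"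
        using d by (simp add: nn_integral_cmult_indicator emeasure_ball)
      also have "\<dots> = ennreal (D * 2 powr \<bar>\<alpha> - ?n\<bar> * unit_ball_vol ?n * (norm (u z) powr p * d powr \<alpha>))"
      proof -
        have e: "d powr (\<alpha> - ?n) * d ^ DIM('a) = d powr \<alpha>" using d by (subst powr_times_power) auto
        have "D * (2 powr \<bar>\<alpha> - ?n\<bar> * d powr (\<alpha> - ?n)) * norm (u z) powr p * (unit_ball_vol ?n * d ^ DIM('a))
           = D * 2 powr \<bar>\<alpha> - ?n\<bar> * unit_ball_vol ?n * (norm (u z) powr p * d powr \<alpha>)"
          unfolding e[symmetric] by (simp only: mult_ac)
        then show ?thesis using D d by (simp add: ennreal_mult[symmetric])
      qed
      finally show ?thesis using True D by (simp add: d_def ennreal_mult)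
    qed (simp add: U_def)
  qed
  also have "\<dots> = ennreal (D * 2 powr \<bar>\<alpha> - ?n\<bar> * unit_ball_vol ?n) * (\<integral>\<^sup>+z\<in>ball 0 1. ennreal (norm (u z) powr p * (1 - norm z) powr \<alpha>) \<partial>lborel)"
    by (rule nn_integral_cmult) (use wint_measurable[OF uc p(1)] in simp)
  also have "\<dots> < \<infinity>" using w by (simp add: wint_def ennreal_mult_less_top)
  finally show ?thesis by (simp add: wint_def)
qed

section \<open>Vanishing of polyharmonic functions\<close>

text \<open>Duality: with a = H v, pair H with X, the symmetric trace-free part of the tensor
  product of a and v. The pairing is |a|^2, the squared norm of X is at most (1 - 1/n) |a|^2 |v|^2,
  and Cauchy-Schwarz concludes. The factor (n - 1)/n instead of 1 is what admits powers of the
  gradient below 1.\<close>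

lemma trace_free_symmetric_bound:
  fixes H :: "'a \<Rightarrow> 'a \<Rightarrow> real"
  assumes B: "finite B" "card B \<ge> 2" and sym: "\<And>b c. b \<in> B \<Longrightarrow> c \<in> B \<Longrightarrow> H b c = H c b" and tr: "(\<Sum>b\<in>B. H b b) = 0"
  shows "real (card B) * (\<Sum>c\<in>B. (\<Sum>b\<in>B. H c b * v b)\<^sup>2) \<le> (real (card B) - 1) * (\<Sum>c\<in>B. \<Sum>b\<in>B. (H c b)\<^sup>2) * (\<Sum>b\<in>B. (v b)\<^sup>2)"
proof -
  define n where "n = real (card B)"
  have n: "n \<ge> 2" using B by (simp add: n_def)
  define a where "a = (\<lambda>c. \<Sum>b\<in>B. H c b * v b)"
  define V where "V = (\<Sum>b\<in>B. (v b)\<^sup>2)"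
  define T where "T = (\<Sum>c\<in>B. a c * v c)"
  define A where "A = (\<Sum>c\<in>B. (a c)\<^sup>2)"
  define F where "F = (\<Sum>c\<in>B. \<Sum>b\<in>B. (H c b)\<^sup>2)"
  define X where "X = (\<lambda>c b. (a c * v b + a b * v c) / 2 - (if c = b then T / n else 0))"
  have A0: "A \<ge> 0" "F \<ge> 0" "V \<ge> 0" unfolding A_def F_def V_def by (auto intro!: sum_nonneg)
  have T2: "T\<^sup>2 \<le> A * V" unfolding T_def A_def V_def by (rule Cauchy_Schwarz_ineq_sum)
  have HX: "(\<Sum>c\<in>B. \<Sum>b\<in>B. H c b * X c b) = A"
  proof -
    have 1: "(\<Sum>c\<in>B. \<Sum>b\<in>B. H c b * (a c * v b)) = A"
      unfolding A_def power2_eq_square by (intro sum.cong refl) (simp add: a_def sum_distrib_left mult_ac)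
    have 2: "(\<Sum>c\<in>B. \<Sum>b\<in>B. H c b * (a b * v c)) = A"
    proof -
      have "(\<Sum>c\<in>B. \<Sum>b\<in>B. H c b * (a b * v c)) = (\<Sum>b\<in>B. \<Sum>c\<in>B. H c b * (a b * v c))" by (rule sum.swap)
      also have "\<dots> = (\<Sum>c\<in>B. \<Sum>b\<in>B. H c b * (a c * v b))" using sym by (intro sum.cong refl) simp
      finally show ?thesis using 1 by simp
    qed
    have "(\<Sum>c\<in>B. \<Sum>b\<in>B. H c b * X c b) = (\<Sum>c\<in>B. \<Sum>b\<in>B. H c b * (a c * v b) / 2 + H c b * (a b * v c) / 2 - (if c = b then H c b * (T / n) else 0))"
      by (intro sum.cong refl) (simp add: X_def algebra_simps add_divide_distrib)
    also have "\<dots> = (\<Sum>c\<in>B. \<Sum>b\<in>B. H c b * (a c * v b)) / 2 + (\<Sum>c\<in>B. \<Sum>b\<in>B. H c b * (a b * v c)) / 2 - (\<Sum>c\<in>B. H c c * (T / n))"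
      using B(1) by (simp add: sum.distrib sum_subtractf sum_divide_distrib)
    also have "(\<Sum>c\<in>B. H c c * (T / n)) = 0" using tr by (simp flip: sum_distrib_right sum_divide_distrib)
    finally show ?thesis unfolding 1 2 by simp
  qed
  have X2: "(\<Sum>c\<in>B. \<Sum>b\<in>B. (X c b)\<^sup>2) = (A * V + T\<^sup>2) / 2 - T\<^sup>2 / n"
  proof -
    have AV: "(\<Sum>c\<in>B. \<Sum>b\<in>B. (a c)\<^sup>2 * (v b)\<^sup>2) = A * V" by (simp add: A_def V_def sum_product)
    have VA: "(\<Sum>c\<in>B. \<Sum>b\<in>B. (a b)\<^sup>2 * (v c)\<^sup>2) = A * V"
      unfolding AV[symmetric] by (rule sum.swap)
    have TT: "(\<Sum>c\<in>B. \<Sum>b\<in>B. (a c * v c) * (a b * v b)) = T\<^sup>2" by (simp add: T_def power2_eq_square sum_product)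
    have "(X c b)\<^sup>2 = ((a c)\<^sup>2 * (v b)\<^sup>2) / 4 + ((a b)\<^sup>2 * (v c)\<^sup>2) / 4 + ((a c * v c) * (a b * v b)) / 2
        + (if c = b then (T / n)\<^sup>2 - 2 * (a c * v c) * (T / n) else 0)" for c b
      by (simp add: X_def power2_eq_square field_simps)
    then have "(\<Sum>c\<in>B. \<Sum>b\<in>B. (X c b)\<^sup>2) = A * V / 4 + A * V / 4 + T\<^sup>2 / 2 + (\<Sum>c\<in>B. (T / n)\<^sup>2 - 2 * (a c * v c) * (T / n))"
      using B(1) unfolding AV[symmetric] TT[symmetric] by (simp add: sum.distrib sum_divide_distrib) (simp add: AV VA flip: sum_divide_distrib)
    also have "(\<Sum>c\<in>B. (T / n)\<^sup>2 - 2 * (a c * v c) * (T / n)) = n * (T / n)\<^sup>2 - 2 * T * (T / n)"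
    proof -
      have "(\<Sum>c\<in>B. 2 * (a c * v c) * (T / n)) = 2 * (\<Sum>c\<in>B. a c * v c) * (T / n)"
        by (simp only: sum_distrib_left sum_distrib_right)
      then show ?thesis by (simp add: sum_subtractf n_def T_def[symmetric])
    qed
    also have "\<dots> = - T\<^sup>2 / n" using n by (simp add: power2_eq_square field_simps)
    finally show ?thesis by simp
  qed
  have CS: "A\<^sup>2 \<le> F * (\<Sum>c\<in>B. \<Sum>b\<in>B. (X c b)\<^sup>2)"
    using Cauchy_Schwarz_ineq_sum[of "\<lambda>(c, b). H c b" "\<lambda>(c, b). X c b" "B \<times> B"]
    unfolding HX[symmetric] F_def sum.cartesian_product by (simp add: case_prod_beta)
  have XV: "(\<Sum>c\<in>B. \<Sum>b\<in>B. (X c b)\<^sup>2) \<le> A * V * ((n - 1) / n)"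
  proof -
    \<comment> \<open>As n >= 2 the coefficient of the squared T is nonnegative, so it may be
      replaced by its Cauchy-Schwarz bound A V.\<close>
    have "(1/2 - 1/n) * T\<^sup>2 \<le> (1/2 - 1/n) * (A * V)" using n T2 by (intro mult_left_mono) (auto simp: field_simps)
    then show ?thesis unfolding X2 using n by (simp add: field_simps)
  qed
  have "A * A \<le> F * (A * V * ((n - 1) / n))"
    using order_trans[OF CS mult_left_mono[OF XV A0(2)]] unfolding power2_eq_square .
  also have "\<dots> = A * (F * V * ((n - 1) / n))" by (simp only: mult_ac)
  finally have "A * A \<le> A * (F * V * ((n - 1) / n))" .
  have "A \<le> F * V * ((n - 1) / n)"
  proof (cases "A = 0")
    case True
    have "0 \<le> (n - 1) / n" using n by simp
    then have "0 \<le> F * V * ((n - 1) / n)" using A0 by (intro mult_nonneg_nonneg)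
    then show ?thesis using True by simp
  next
    case False
    then show ?thesis using mult_left_le_imp_le[OF \<open>A * A \<le> A * (F * V * ((n - 1) / n))\<close>] A0 by simp
  qed
  then have "n * A \<le> (n - 1) * F * V" using n by (simp add: field_simps)
  then show ?thesis by (simp add: n_def A_def a_def F_def V_def)
qed

section \<open>Real parts, squares and powers of the squared gradient\<close>

lemma ball_integral_of_real: "ball_integral (\<lambda>x. complex_of_real (f x)) = of_real (LINT x:ball 0 1|lborel. f x)"
  unfolding set_lebesgue_integral_def by (simp add: scaleR_conv_of_real flip: of_real_mult)

lemma dir_deriv_Re:
  assumes "f differentiable at x"
  shows "(\<lambda>x. complex_of_real (Re (f x))) differentiable at x"
    and "dir_deriv b (\<lambda>x. complex_of_real (Re (f x))) x = of_real (Re (dir_deriv b f x))"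
proof -
  have d: "((\<lambda>x. complex_of_real (Re (f x))) has_derivative (\<lambda>v. of_real (Re (dir_deriv v f x)))) (at x)"
    by (intro has_derivative_of_real has_derivative_Re dir_deriv_has assms)
  then show "(\<lambda>x. complex_of_real (Re (f x))) differentiable at x" by (auto simp: differentiable_def)
  show "dir_deriv b (\<lambda>x. complex_of_real (Re (f x))) x = of_real (Re (dir_deriv b f x))"
    by (rule dir_deriv_eq[OF d])
qed

lemma Ck_Re:
  assumes S: "open S" and "Ck k f S" shows "Ck k (\<lambda>x. complex_of_real (Re (f x))) S"
  using assms(2)
proof (induction k arbitrary: f)
  case 0 then show ?case by (auto intro: continuous_on_of_real continuous_on_Re)
next
  case (Suc k)
  have d: "f differentiable at x" if "x \<in> S" for x using Suc.prems that by simp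
  have "Ck k (dir_deriv b (\<lambda>x. complex_of_real (Re (f x)))) S" if b: "b \<in> Basis" for b
    by (rule Ck_cong[OF S Suc.IH[OF Ck_dir_deriv[OF Suc.prems b]]]) (simp add: dir_deriv_Re(2)[OF d])
  then show ?case using dir_deriv_Re(1)[OF d] by simp
qed

lemma laplacian_Re:
  assumes S: "open S" and f: "Ck 2 f S" and x: "x \<in> S"
  shows "laplacian (\<lambda>x. complex_of_real (Re (f x))) x = of_real (Re (laplacian f x))"
proof -
  have "dir_deriv b (dir_deriv b (\<lambda>x. complex_of_real (Re (f x)))) x = of_real (Re (dir_deriv b (dir_deriv b f) x))"
    if b: "b \<in> Basis" for b
  proof -
    have "dir_deriv b (dir_deriv b (\<lambda>x. complex_of_real (Re (f x)))) x = dir_deriv b (\<lambda>x. complex_of_real (Re (dir_deriv b f x))) x"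
      by (rule dir_deriv_cong[OF S x]) (rule dir_deriv_Re(2)[OF Ck2D(1)[OF f]])
    then show ?thesis by (simp add: dir_deriv_Re(2)[OF Ck2D(2)[OF f x b]])
  qed
  then show ?thesis by (simp add: laplacian_def)
qed

lemma dir_deriv_square:
  "f differentiable at x \<Longrightarrow> dir_deriv b (\<lambda>x. (f x)\<^sup>2) x = 2 * f x * dir_deriv b f x"
  unfolding power2_eq_square by (simp add: dir_deriv_mult)

lemma laplacian_square:
  assumes "open S" "Ck 2 f S" "x \<in> S"
  shows "laplacian (\<lambda>x. (f x)\<^sup>2) x = 2 * f x * laplacian f x + 2 * (\<Sum>b\<in>Basis. (dir_deriv b f x)\<^sup>2)"
  unfolding power2_eq_square using laplacian_mult[OF assms(1,2,2,3)] by simp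

text \<open>Meant for real-valued h; such functions are kept as complex ones so that a single
  calculus of \<open>dir_deriv\<close> serves throughout.\<close>

definition gradsq :: "('a::euclidean_space \<Rightarrow> complex) \<Rightarrow> 'a \<Rightarrow> real" where
  "gradsq h x = (\<Sum>b\<in>Basis. (Re (dir_deriv b h x))\<^sup>2)"

text \<open>The Stein--Weiss inequality, which is where the lower bound on \<open>p\<close> comes from.\<close>

lemma gradient_power_subharmonic:
  fixes h :: "'a::euclidean_space \<Rightarrow> complex"
  assumes S: "open S" and n: "DIM('a) \<ge> 2" and h: "Ck 3 h S" and re: "\<And>x. h x = of_real (Re (h x))"
    and harm: "\<And>x. x \<in> S \<Longrightarrow> laplacian h x = 0"
    and p: "0 < p" "p \<le> 2" "(real DIM('a) - 2) / (real DIM('a) - 1) \<le> p" and \<epsilon>: "\<epsilon> > 0" and x: "x \<in> S"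
  shows "\<exists>r\<ge>0. laplacian (\<lambda>x. complex_of_real ((gradsq h x + \<epsilon>) powr (p/2))) x = of_real r"
    "Ck 2 (\<lambda>x. complex_of_real ((gradsq h x + \<epsilon>) powr (p/2))) S"
proof -
  define q where "q = p / 2"
  have h2: "Ck 2 h S" by (rule Ck_le[OF h]) simp
  have hb: "Ck 2 (dir_deriv b h) S" if "b \<in> Basis" for b using h that by (simp add: numeral_3_eq_3 numeral_2_eq_2)
  have re1: "dir_deriv b h y = of_real (Re (dir_deriv b h y))" if "y \<in> S" for b y
  proof -
    have "dir_deriv b h y = dir_deriv b (\<lambda>x. of_real (Re (h x))) y" using re by (metis (no_types))
    then show ?thesis using dir_deriv_Re(2)[OF Ck2D(1)[OF h2 that]] by metis
  qed
  have re2: "dir_deriv c (dir_deriv b h) y = of_real (Re (dir_deriv c (dir_deriv b h) y))" if "y \<in> S" "b \<in> Basis" for b c y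
  proof -
    have "dir_deriv c (dir_deriv b h) y = dir_deriv c (\<lambda>x. of_real (Re (dir_deriv b h x))) y"
      by (rule dir_deriv_cong[OF S that(1)]) (rule re1)
    then show ?thesis using dir_deriv_Re(2)[OF Ck2D(2)[OF h2 that]] by metis
  qed
  \<comment> \<open>Adding \<epsilon> keeps the base positive, since the power p/2 is not smooth
    where the gradient vanishes.\<close>
  define \<gamma> where "\<gamma> = (\<lambda>x. gradsq h x + \<epsilon>)"
  have gpos: "gradsq h y \<ge> 0" for y unfolding gradsq_def by (intro sum_nonneg) auto
  then have \<gamma>: "\<gamma> y > 0" for y using \<epsilon> by (simp add: \<gamma>_def add_nonneg_pos)
  let ?G = "\<lambda>x. (\<Sum>b\<in>Basis. (dir_deriv b h x)\<^sup>2) + of_real \<epsilon>"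
  have \<gamma>G: "complex_of_real (\<gamma> y) = ?G y" if "y \<in> S" for y
  proof -
    have "(\<Sum>b\<in>Basis. (dir_deriv b h y)\<^sup>2) = (\<Sum>b\<in>Basis. of_real ((Re (dir_deriv b h y))\<^sup>2))"
      by (intro sum.cong refl) (metis re1[OF that] of_real_power)
    then show ?thesis by (simp add: \<gamma>_def gradsq_def)
  qed
  have sq: "Ck 2 (\<lambda>x. (dir_deriv b h x)\<^sup>2) S" if "b \<in> Basis" for b by (intro Ck_power S hb that)
  have sumsq: "Ck 2 (\<lambda>x. \<Sum>b\<in>Basis. (dir_deriv b h x)\<^sup>2) S" by (intro Ck_sum S sq)
  have G2: "Ck 2 ?G S" by (intro Ck_add S sumsq Ck_const)
  have \<gamma>2: "Ck 2 (\<lambda>x. complex_of_real (\<gamma> x)) S" by (rule Ck_cong[OF S G2]) (simp add: \<gamma>G)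
  show "Ck 2 (\<lambda>x. complex_of_real ((gradsq h x + \<epsilon>) powr (p/2))) S"
    using Ck_powr[OF S \<gamma>2 \<gamma>] by (simp add: \<gamma>_def)
  define H where "H = (\<lambda>c b. Re (dir_deriv c (dir_deriv b h) x))"
  define v where "v = (\<lambda>b. Re (dir_deriv b h x))"
  have Hc: "dir_deriv c (dir_deriv b h) x = of_real (H c b)" if "b \<in> Basis" for b c
    using re2[OF x that] by (simp add: H_def)
  have vc: "dir_deriv b h x = of_real (v b)" for b using re1[OF x] by (simp add: v_def)
  have sym: "H b c = H c b" if "b \<in> Basis" "c \<in> Basis" for b c
    unfolding H_def using dir_deriv_commute[OF S h2 x that] by simp
  have tr: "(\<Sum>b\<in>Basis. H b b) = 0"
    using arg_cong[OF harm[OF x], of Re] by (simp add: laplacian_def H_def)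
  have D1: "dir_deriv c (\<lambda>x. complex_of_real (\<gamma> x)) x = of_real (2 * (\<Sum>b\<in>Basis. H c b * v b))" if c: "c \<in> Basis" for c
  proof -
    have "dir_deriv c (\<lambda>x. complex_of_real (\<gamma> x)) x = dir_deriv c ?G x" by (rule dir_deriv_cong[OF S x \<gamma>G])
    also have "\<dots> = dir_deriv c (\<lambda>x. \<Sum>b\<in>Basis. (dir_deriv b h x)\<^sup>2) x"
      using dir_deriv_add[OF Ck2D(1)[OF sumsq x], of "\<lambda>_. of_real \<epsilon>" c] by simp
    also have "\<dots> = (\<Sum>b\<in>Basis. dir_deriv c (\<lambda>x. (dir_deriv b h x)\<^sup>2) x)"
      by (rule dir_deriv_sum) (rule Ck2D(1)[OF sq x])
    also have "\<dots> = (\<Sum>b\<in>Basis. of_real (2 * (H c b * v b)))"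
      by (intro sum.cong refl) (simp add: dir_deriv_square[OF Ck2D(2)[OF h2 x]] Hc vc)
    finally show ?thesis by (simp add: sum_distrib_left)
  qed
  have D2: "laplacian (\<lambda>x. complex_of_real (\<gamma> x)) x = of_real (2 * (\<Sum>c\<in>Basis. \<Sum>b\<in>Basis. (H c b)\<^sup>2))"
  proof -
    have lb: "laplacian (dir_deriv b h) x = 0" if b: "b \<in> Basis" for b
    proof -
      have "laplacian (dir_deriv b h) x = dir_deriv b (laplacian h) x" by (rule laplacian_dir_deriv[OF S h x b])
      also have "\<dots> = dir_deriv b (\<lambda>_. 0) x" by (rule dir_deriv_cong[OF S x harm])
      finally show ?thesis by simp
    qed
    have "laplacian (\<lambda>x. complex_of_real (\<gamma> x)) x = laplacian ?G x" by (rule laplacian_cong[OF S x \<gamma>G])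
    also have "\<dots> = laplacian (\<lambda>x. \<Sum>b\<in>Basis. (dir_deriv b h x)\<^sup>2) x"
      by (subst laplacian_add[OF S sumsq Ck_const x]) simp
    also have "\<dots> = (\<Sum>b\<in>Basis. laplacian (\<lambda>x. (dir_deriv b h x)\<^sup>2) x)" by (rule laplacian_sum[OF S sq x])
    also have "\<dots> = (\<Sum>b\<in>Basis. \<Sum>c\<in>Basis. of_real (2 * (H c b)\<^sup>2))"
    proof (intro sum.cong refl)
      fix b :: 'a assume b: "b \<in> Basis"
      show "laplacian (\<lambda>x. (dir_deriv b h x)\<^sup>2) x = (\<Sum>c\<in>Basis. of_real (2 * (H c b)\<^sup>2))"
        by (simp add: laplacian_square[OF S hb[OF b] x] lb[OF b] Hc[OF b] sum_distrib_left)
    qed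
    also have "\<dots> = (\<Sum>c\<in>Basis. \<Sum>b\<in>Basis. of_real (2 * (H c b)\<^sup>2))" by (rule sum.swap)
    finally show ?thesis by (simp add: sum_distrib_left)
  qed
  define F where "F = (\<Sum>c\<in>Basis. \<Sum>b\<in>Basis. (H c b)\<^sup>2)"
  define A where "A = (\<Sum>c\<in>Basis. (\<Sum>b\<in>Basis. H c b * v b)\<^sup>2)"
  have F0: "F \<ge> 0" "A \<ge> 0" unfolding F_def A_def by (auto intro!: sum_nonneg)
  have L: "laplacian (\<lambda>x. complex_of_real (\<gamma> x powr q)) x
     = of_real (q * \<gamma> x powr (q - 1) * (2 * F) + q * (q - 1) * \<gamma> x powr (q - 2) * (4 * A))"
  proof -
    have "laplacian (\<lambda>x. complex_of_real (\<gamma> x powr q)) x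
      = of_real (q * \<gamma> x powr (q - 1)) * laplacian (\<lambda>x. of_real (\<gamma> x)) x
        + of_real (q * ((q - 1) * \<gamma> x powr (q - 1 - 1))) * (\<Sum>b\<in>Basis. (dir_deriv b (\<lambda>x. of_real (\<gamma> x)) x)\<^sup>2)"
    proof (rule laplacian_compose_real[OF S \<gamma>2 x, where \<phi>' = "\<lambda>t. q * t powr (q - 1)"])
      show "((\<lambda>t. t powr q) has_real_derivative q * \<gamma> y powr (q - 1)) (at (\<gamma> y))" for y
        by (rule has_real_derivative_powr[OF \<gamma>])
      show "((\<lambda>t. q * t powr (q - 1)) has_real_derivative q * ((q - 1) * \<gamma> x powr (q - 1 - 1))) (at (\<gamma> x))"
        by (intro DERIV_cmult has_real_derivative_powr \<gamma>)
    qed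
    also have "(\<Sum>b\<in>Basis. (dir_deriv b (\<lambda>x. complex_of_real (\<gamma> x)) x)\<^sup>2) = of_real (4 * A)"
    proof -
      have "(dir_deriv c (\<lambda>x. complex_of_real (\<gamma> x)) x)\<^sup>2 = of_real (4 * (\<Sum>b\<in>Basis. H c b * v b)\<^sup>2)" if "c \<in> Basis" for c
        unfolding D1[OF that] of_real_power[symmetric] by (simp only: power_mult_distrib) simp
      then show ?thesis by (simp add: A_def sum_distrib_left)
    qed
    finally show ?thesis unfolding D2 F_def[symmetric] by (simp add: mult_ac)
  qed
  have key: "2 * (1 - q) * A \<le> gradsq h x * F"
  proof -
    have "real DIM('a) * A \<le> (real DIM('a) - 1) * F * gradsq h x"
      using trace_free_symmetric_bound[where H = H and B = Basis and v = v, OF finite_Basis n sym tr] by (simp add: A_def F_def gradsq_def v_def)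
    then have k3: "2 * (1 - q) * (real DIM('a) * A) \<le> 2 * (1 - q) * ((real DIM('a) - 1) * F * gradsq h x)"
      using p by (intro mult_left_mono) (auto simp: q_def)
    \<comment> \<open>With q = p/2 this is (2 - p)(n - 1) <= n, which is the condition p >= (n -
      2)/(n - 1).\<close>
    have "2 * (1 - q) * (real DIM('a) - 1) \<le> real DIM('a)"
    proof -
      have "real DIM('a) - 2 \<le> p * (real DIM('a) - 1)" using p(3) n by (simp add: pos_divide_le_eq)
      then show ?thesis by (simp add: q_def algebra_simps)
    qed
    then have k2: "2 * (1 - q) * (real DIM('a) - 1) * (F * gradsq h x) \<le> real DIM('a) * (F * gradsq h x)"
      using F0 gpos by (intro mult_right_mono) auto
    have "real DIM('a) * (2 * (1 - q) * A) = 2 * (1 - q) * (real DIM('a) * A)" by (simp only: mult_ac)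
    also note k3
    also have "2 * (1 - q) * ((real DIM('a) - 1) * F * gradsq h x) = 2 * (1 - q) * (real DIM('a) - 1) * (F * gradsq h x)" by (simp only: mult_ac)
    also note k2
    also have "real DIM('a) * (F * gradsq h x) = real DIM('a) * (gradsq h x * F)" by (simp only: mult_ac)
    finally have "real DIM('a) * (2 * (1 - q) * A) \<le> real DIM('a) * (gradsq h x * F)" .
    then show ?thesis by (rule mult_left_le_imp_le) simp
  qed
  show "\<exists>r\<ge>0. laplacian (\<lambda>x. complex_of_real ((gradsq h x + \<epsilon>) powr (p/2))) x = of_real r"
  proof (intro exI conjI)
    show "laplacian (\<lambda>x. complex_of_real ((gradsq h x + \<epsilon>) powr (p/2))) x = of_real (q * \<gamma> x powr (q - 1) * (2 * F) + q * (q - 1) * \<gamma> x powr (q - 2) * (4 * A))"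
      using L by (simp add: \<gamma>_def q_def)
    have e: "\<gamma> x powr (q - 1) = \<gamma> x powr (q - 2) * \<gamma> x"
    proof -
      have "\<gamma> x powr (q - 2) * \<gamma> x ^ 1 = \<gamma> x powr (q - 1)" by (subst powr_times_power[OF \<gamma>]) (simp add: algebra_simps)
      then show ?thesis by simp
    qed
    have "gradsq h x * F \<le> \<gamma> x * F" unfolding \<gamma>_def using F0 \<epsilon> by (intro mult_right_mono) auto
    then have "0 \<le> \<gamma> x * F - 2 * (1 - q) * A" using key by linarith
    then have "0 \<le> (2 * q * \<gamma> x powr (q - 2)) * (\<gamma> x * F - 2 * (1 - q) * A)" using p by (intro mult_nonneg_nonneg) (auto simp: q_def)
    then show "0 \<le> q * \<gamma> x powr (q - 1) * (2 * F) + q * (q - 1) * \<gamma> x powr (q - 2) * (4 * A)"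
      unfolding e by (simp add: algebra_simps)
  qed
qed

text \<open>First and second derivative of the convex cutoff \<open>(s - t)\<^sub>+\<^sup>3 / s\<^sup>2\<close>; the first is bounded below on
  \<open>s \<ge> 2 t\<close>, while the second is \<open>O((t/s)\<^sup>2 / s)\<close>.\<close>

definition cut1 :: "real \<Rightarrow> real \<Rightarrow> real" where
  "cut1 t s = 3 * (max 0 (s - t))\<^sup>2 * s powr (-2) - 2 * (max 0 (s - t)) ^ 3 * s powr (-3)"

definition cut2 :: "real \<Rightarrow> real \<Rightarrow> real" where
  "cut2 t s = 6 * max 0 (s - t) * s powr (-2) - 12 * (max 0 (s - t))\<^sup>2 * s powr (-3) + 6 * (max 0 (s - t)) ^ 3 * s powr (-4)"

lemma DERIV_cut:
  assumes s: "s > 0"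
  shows "((\<lambda>s. (max 0 (s - t)) ^ 3 * s powr (-2)) has_real_derivative cut1 t s) (at s)"
    "(cut1 t has_real_derivative cut2 t s) (at s)"
proof -
  have m: "((\<lambda>s. (max 0 (s - t)) ^ a) has_real_derivative real a * (max 0 (s - t)) ^ (a - 1)) (at s)" if "a \<ge> 2" for a
    using DERIV_chain2[OF DERIV_max0_power[OF that, of "s - t"] DERIV_diff[OF DERIV_ident DERIV_const]] by simp
  show "((\<lambda>s. (max 0 (s - t)) ^ 3 * s powr (-2)) has_real_derivative cut1 t s) (at s)"
    by (rule DERIV_cong[OF DERIV_mult[OF m has_real_derivative_powr[OF s]]]) (simp_all add: cut1_def numeral_2_eq_2)
  show "(cut1 t has_real_derivative cut2 t s) (at s)"
    unfolding cut1_def[abs_def]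
    by (rule DERIV_cong[OF DERIV_diff[OF DERIV_mult[OF DERIV_cmult[OF m] has_real_derivative_powr[OF s]]
        DERIV_mult[OF DERIV_cmult[OF m] has_real_derivative_powr[OF s]]]]) (simp_all add: cut2_def algebra_simps numeral_2_eq_2)
qed

section \<open>Subharmonic functions against the convex cutoff\<close>

lemma cut_zero: "s \<le> t \<Longrightarrow> cut1 t s = 0" "s \<le> t \<Longrightarrow> cut2 t s = 0"
  by (simp_all add: cut1_def cut2_def)

text \<open>In the ratio z = t/s signs and sizes become visible: \<open>cut1\<close> is a function
  of z alone, and \<open>cut2\<close> carries the decay z^2 / s.\<close>

lemma cut_eq:
  assumes "0 < t" "t \<le> s"
  shows "cut1 t s = (1 - t/s)\<^sup>2 * (1 + 2 * (t/s))" "cut2 t s = 6 * (1 - t/s) * (t/s)\<^sup>2 / s"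
proof -
  have s: "s > 0" using assms by simp
  have pw: "s powr (-2) = 1 / s^2" "s powr (-3) = 1 / s^3" "s powr (-4) = 1 / s^4"
    using s by (simp_all add: powr_minus_divide)
  have m: "max 0 (s - t) = s - t" using assms by simp
  show "cut1 t s = (1 - t/s)\<^sup>2 * (1 + 2 * (t/s))"
    unfolding cut1_def pw m using s by (simp add: field_simps power2_eq_square power3_eq_cube)
  show "cut2 t s = 6 * (1 - t/s) * (t/s)\<^sup>2 / s"
    unfolding cut2_def pw m using s by (simp add: field_simps power2_eq_square power3_eq_cube power4_eq_xxxx)
qed

lemma cut_nonneg:
  assumes "0 < t" shows "0 \<le> cut1 t s" "0 \<le> cut2 t s"
proof -
  have "0 \<le> cut1 t s \<and> 0 \<le> cut2 t s"
  proof (cases "t \<le> s")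
    case True
    then have "0 \<le> 1 - t/s" using assms by simp
    then show ?thesis using True assms unfolding cut_eq[OF assms True]
      by (intro conjI mult_nonneg_nonneg divide_nonneg_nonneg) auto
  qed (simp add: cut_zero)
  then show "0 \<le> cut1 t s" "0 \<le> cut2 t s" by auto
qed

lemma continuous_cut:
  "continuous_on (ball 0 1) (\<lambda>x::'a::euclidean_space. cut1 t (1 - x \<bullet> x))"
  "continuous_on (ball 0 1) (\<lambda>x::'a::euclidean_space. cut2 t (1 - x \<bullet> x))"
  unfolding cut1_def cut2_def by (intro continuous_intros; force simp: norm_lt_square)+

lemma cut_integrable:
  fixes f c :: "'a::euclidean_space \<Rightarrow> real"
  assumes f: "continuous_on (ball 0 1) f" and c: "continuous_on (ball 0 1) c" and z: "\<And>x. 1 - x \<bullet> x \<le> t \<Longrightarrow> c x = 0" and t: "0 < t"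
  shows "set_integrable lborel (ball 0 1) (\<lambda>x. f x * c x)"
proof -
  have "inner_supp (\<lambda>x. complex_of_real (f x * c x))" unfolding inner_supp_def
  proof (intro exI conjI ballI impI)
    show "sqrt (max 0 (1 - t)) < 1" using t by (auto simp: max_def)
    fix x :: 'a assume "sqrt (max 0 (1 - t)) < norm x"
    then have "max 0 (1 - t) < (norm x)\<^sup>2" using real_le_rsqrt[of "norm x" "max 0 (1 - t)"] by linarith
    then have "1 - x \<bullet> x \<le> t" by (simp add: power2_norm_eq_inner)
    then show "complex_of_real (f x * c x) = 0" using z by simp
  qed
  then have "set_integrable lborel (ball 0 1) (\<lambda>x. complex_of_real (f x * c x))"
    by (intro inner_supp_set_integrable continuous_on_of_real continuous_on_mult f c)
  from integrable_bounded_linear[OF bounded_linear_Re this[unfolded set_integrable_def]]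
  show ?thesis by (simp add: set_integrable_def)
qed

lemmas cut1_integrable = cut_integrable[OF _ continuous_cut(1) cut_zero(1)]
  and cut2_integrable = cut_integrable[OF _ continuous_cut(2) cut_zero(2)]

text \<open>The cutoff composed with 1 - |x|^2 has Laplacian 4 |x|^2 \<open>cut2\<close> - 2 n
  \<open>cut1\<close>. It is nonnegative, so Green's identity against the nonnegative Laplacian of f
  makes the integral of f times this expression nonnegative; then use |x|^2 <= 1 and n >= 1.\<close>

lemma subharmonic_cut:
  fixes f :: "'a::euclidean_space \<Rightarrow> real"
  assumes f: "Ck 2 (\<lambda>x. complex_of_real (f x)) (ball 0 1)" and f0: "\<And>x. x \<in> ball 0 1 \<Longrightarrow> f x \<ge> 0"
    and sub: "\<And>x. x \<in> ball 0 1 \<Longrightarrow> \<exists>r\<ge>0. laplacian (\<lambda>x. complex_of_real (f x)) x = of_real r" and t: "0 < t" "t < 1"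
  shows "(LINT x:ball 0 1|lborel. f x * cut1 t (1 - x \<bullet> x)) \<le> 2 * (LINT x:ball 0 1|lborel. f x * cut2 t (1 - x \<bullet> x))"
proof -
  let ?B = "ball (0::'a) 1"
  have pos: "1 - x \<bullet> x > 0" if "x \<in> ?B" for x using that by (simp add: norm_lt_square)
  have fc: "continuous_on ?B f"
    using continuous_on_Re[OF Ck_continuous[OF f]] by simp
  obtain r where r: "\<And>x. x \<in> ?B \<Longrightarrow> r x \<ge> 0" "\<And>x. x \<in> ?B \<Longrightarrow> laplacian (\<lambda>x. complex_of_real (f x)) x = of_real (r x)" using sub by metis
  define \<eta> where "\<eta> = (\<lambda>s. (max 0 (s - t)) ^ 3 * s powr (-2))"
  let ?\<Psi> = "\<lambda>x::'a. complex_of_real (\<eta> (1 - x \<bullet> x))"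
  have k: "?\<Psi> x = trunc_weight 3 (1 - t) x * of_real ((1 - x \<bullet> x) powr (-2))" for x :: 'a
    by (simp add: \<eta>_def trunc_weight_def algebra_simps)
  have \<Psi>2: "Ck 2 ?\<Psi> ?B" unfolding k by (intro Ck_mult Ck_trunc_weight Ck_powr Ck_radius open_ball pos) simp
  have \<Psi>c: "inner_supp ?\<Psi>" unfolding k by (intro inner_supp_mult inner_supp_trunc_weight) (use t in auto)
  have L: "laplacian ?\<Psi> x = of_real (4 * (x \<bullet> x) * cut2 t (1 - x \<bullet> x) - 2 * real DIM('a) * cut1 t (1 - x \<bullet> x))" if x: "x \<in> ?B" for x
  proof -
    have "laplacian ?\<Psi> x = of_real (cut1 t (1 - x \<bullet> x)) * laplacian (\<lambda>x. of_real (1 - x \<bullet> x)) x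
      + of_real (cut2 t (1 - x \<bullet> x)) * (\<Sum>b\<in>Basis. (dir_deriv b (\<lambda>x. of_real (1 - x \<bullet> x)) x)\<^sup>2)"
      unfolding \<eta>_def by (rule laplacian_compose_real[OF open_ball Ck_radius[OF open_ball] x DERIV_cut(1)[OF pos] DERIV_cut(2)[OF pos[OF x]]])
    also have "(\<Sum>b\<in>Basis. (dir_deriv b (\<lambda>x. complex_of_real (1 - x \<bullet> x)) x)\<^sup>2) = 4 * of_real (x \<bullet> x)"
      by (simp add: dir_deriv_radius power_mult_distrib del: of_real_diff flip: sum_distrib_left) (simp add: euclidean_inner[of x x] power2_eq_square)
    finally show ?thesis unfolding laplacian_radius by (simp add: algebra_simps)
  qed
  have g1: "ball_integral (\<lambda>x. laplacian (\<lambda>x. complex_of_real (f x)) x * ?\<Psi> x) = ball_integral (\<lambda>x. complex_of_real (f x) * laplacian ?\<Psi> x)"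
    by (rule green[OF f \<Psi>2 \<Psi>c])
  have g2: "ball_integral (\<lambda>x. laplacian (\<lambda>x. complex_of_real (f x)) x * ?\<Psi> x) = of_real (LINT x:?B|lborel. r x * \<eta> (1 - x \<bullet> x))"
  proof -
    have "ball_integral (\<lambda>x. laplacian (\<lambda>x. complex_of_real (f x)) x * ?\<Psi> x) = ball_integral (\<lambda>x. of_real (r x * \<eta> (1 - x \<bullet> x)))"
      by (intro set_lebesgue_integral_cong) (auto simp: r(2))
    then show ?thesis by (simp only: ball_integral_of_real)
  qed
  have g3: "ball_integral (\<lambda>x. complex_of_real (f x) * laplacian ?\<Psi> x) = of_real (LINT x:?B|lborel. f x * (4 * (x \<bullet> x) * cut2 t (1 - x \<bullet> x)) - 2 * real DIM('a) * (f x * cut1 t (1 - x \<bullet> x)))"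
  proof -
    have "ball_integral (\<lambda>x. complex_of_real (f x) * laplacian ?\<Psi> x) = ball_integral (\<lambda>x. of_real (f x * (4 * (x \<bullet> x) * cut2 t (1 - x \<bullet> x)) - 2 * real DIM('a) * (f x * cut1 t (1 - x \<bullet> x))))"
      by (intro set_lebesgue_integral_cong) (auto simp: L algebra_simps)
    then show ?thesis by (simp only: ball_integral_of_real)
  qed
  have eq: "(LINT x:?B|lborel. r x * \<eta> (1 - x \<bullet> x)) = (LINT x:?B|lborel. f x * (4 * (x \<bullet> x) * cut2 t (1 - x \<bullet> x)) - 2 * real DIM('a) * (f x * cut1 t (1 - x \<bullet> x)))"
    using g1 unfolding g2 g3 by (simp only: of_real_eq_iff)
  have i1: "set_integrable lborel ?B (\<lambda>x. f x * cut1 t (1 - x \<bullet> x))" by (rule cut1_integrable[OF fc _ t(1)])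
  have i2: "set_integrable lborel ?B (\<lambda>x. f x * cut2 t (1 - x \<bullet> x))" by (rule cut2_integrable[OF fc _ t(1)])
  have i3: "set_integrable lborel ?B (\<lambda>x. f x * (4 * (x \<bullet> x) * cut2 t (1 - x \<bullet> x)))"
    by (rule cut_integrable[OF fc _ _ t(1)]) (auto intro!: continuous_on_mult continuous_cut continuous_on_const continuous_on_inner continuous_on_id simp: cut_zero)
  have "0 \<le> (LINT x:?B|lborel. r x * \<eta> (1 - x \<bullet> x))"
    unfolding set_lebesgue_integral_def
    by (intro Bochner_Integration.integral_nonneg) (auto simp: indicator_def \<eta>_def r(1))
  also have "\<dots> = (LINT x:?B|lborel. f x * (4 * (x \<bullet> x) * cut2 t (1 - x \<bullet> x))) - 2 * real DIM('a) * (LINT x:?B|lborel. f x * cut1 t (1 - x \<bullet> x))"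
    unfolding eq using set_integral_diff(2)[OF i3 set_integrable_mult_right[OF i1, of "2 * real DIM('a)"]] by simp
  finally have "2 * real DIM('a) * (LINT x:?B|lborel. f x * cut1 t (1 - x \<bullet> x)) \<le> (LINT x:?B|lborel. f x * (4 * (x \<bullet> x) * cut2 t (1 - x \<bullet> x)))" by simp
  also have "\<dots> \<le> (LINT x:?B|lborel. 4 * (f x * cut2 t (1 - x \<bullet> x)))"
  proof (rule set_integral_mono[OF i3 set_integrable_mult_right[OF i2]])
    fix x :: 'a assume x: "x \<in> ?B"
    have "(x \<bullet> x) * (4 * (f x * cut2 t (1 - x \<bullet> x))) \<le> 1 * (4 * (f x * cut2 t (1 - x \<bullet> x)))"
      using pos[OF x] f0[OF x] cut_nonneg(2)[OF t(1)] by (intro mult_right_mono) auto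
    then show "f x * (4 * (x \<bullet> x) * cut2 t (1 - x \<bullet> x)) \<le> 4 * (f x * cut2 t (1 - x \<bullet> x))" by (simp add: mult_ac)
  qed
  also have "\<dots> = 4 * (LINT x:?B|lborel. f x * cut2 t (1 - x \<bullet> x))" by (rule set_integral_mult_right)
  finally have le: "2 * real DIM('a) * (LINT x:?B|lborel. f x * cut1 t (1 - x \<bullet> x)) \<le> 4 * (LINT x:?B|lborel. f x * cut2 t (1 - x \<bullet> x))" .
  have "0 \<le> (LINT x:?B|lborel. f x * cut1 t (1 - x \<bullet> x))"
    unfolding set_lebesgue_integral_def
    by (intro Bochner_Integration.integral_nonneg) (auto simp: indicator_def f0 cut_nonneg[OF t(1)])
  moreover have "2 * 1 \<le> 2 * real DIM('a)" using DIM_positive[where 'a='a] by (intro mult_left_mono) linarith+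
  ultimately have "2 * 1 * (LINT x:?B|lborel. f x * cut1 t (1 - x \<bullet> x)) \<le> 2 * real DIM('a) * (LINT x:?B|lborel. f x * cut1 t (1 - x \<bullet> x))"
    by (intro mult_right_mono) auto
  then show ?thesis using le by linarith
qed

text \<open>Where 1 - |y|^2 > 2 t the function \<open>cut1 t\<close> is at least 1/4, while
  \<open>cut2 t s\<close> is at most 6 t^\<delta> s^(-1 - \<delta>) with \<beta> <= -1 - \<delta>.
  So the right side of the cut inequality is O(t^\<delta>), and letting t tend to 0 makes the
  integral of P over a neighbourhood of x vanish.\<close>

lemma zero_of_cut:
  fixes P :: "'a::euclidean_space \<Rightarrow> real"
  assumes P: "continuous_on (ball 0 1) P" and P0: "\<And>x. x \<in> ball 0 1 \<Longrightarrow> P x \<ge> 0"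
    and cut: "\<And>t. 0 < t \<Longrightarrow> t < 1 \<Longrightarrow> (LINT x:ball 0 1|lborel. P x * cut1 t (1 - x \<bullet> x)) \<le> 2 * (LINT x:ball 0 1|lborel. P x * cut2 t (1 - x \<bullet> x))"
    and fin: "(\<integral>\<^sup>+x\<in>ball 0 1. ennreal (P x * (1 - norm x) powr \<beta>) \<partial>lborel) < \<infinity>" and \<beta>: "\<beta> < -1" and x: "x \<in> ball 0 1"
  shows "P x = 0"
proof -
  let ?B = "ball (0::'a) 1"
  define I where "I = (LINT x:?B|lborel. P x * (1 - norm x) powr \<beta>)"
  have i: "set_integrable lborel ?B (\<lambda>x. P x * (1 - norm x) powr \<beta>)"
    unfolding set_integrable_def
  proof (rule integrableI_bounded)
    show "(\<lambda>x. indicator ?B x *\<^sub>R (P x * (1 - norm x) powr \<beta>)) \<in> borel_measurable lborel"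
      using borel_measurable_continuous_on_indicator[of ?B "\<lambda>x. P x * (1 - norm x) powr \<beta>"]
      by (simp add: continuous_on_mult P continuous_dist_powr)
    have "(\<integral>\<^sup>+x. ennreal (norm (indicator ?B x *\<^sub>R (P x * (1 - norm x) powr \<beta>))) \<partial>lborel) = (\<integral>\<^sup>+x\<in>?B. ennreal (P x * (1 - norm x) powr \<beta>) \<partial>lborel)"
      by (intro nn_integral_cong) (auto simp: indicator_def P0 abs_mult)
    then show "(\<integral>\<^sup>+x. ennreal (norm (indicator ?B x *\<^sub>R (P x * (1 - norm x) powr \<beta>))) \<partial>lborel) < \<infinity>" using fin by simp
  qed
  \<comment> \<open>The bound 1 on \<delta> serves the comparison of z^2 with z^\<delta> for z <= 1
    below.\<close>
  define \<delta> where "\<delta> = min 1 (- \<beta> - 1)"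
  have \<delta>: "0 < \<delta>" "\<delta> \<le> 1" "\<beta> \<le> - 1 - \<delta>" using \<beta> by (auto simp: \<delta>_def)
  define t0 where "t0 = (1 - x \<bullet> x) / 4"
  have "1 - x \<bullet> x > 0" using x by (simp add: norm_lt_square)
  then have t0: "0 < t0" "2 * t0 < 1 - x \<bullet> x" by (auto simp: t0_def)
  have t01: "t0 < 1" using inner_ge_zero[of x] unfolding t0_def by argo
  define U where "U = {y \<in> ?B. 2 * t0 < 1 - y \<bullet> y}"
  have "open U"
  proof -
    have "open {y::'a. 2 * t0 < 1 - y \<bullet> y}" by (intro open_Collect_less continuous_intros)
    moreover have "U = ?B \<inter> {y. 2 * t0 < 1 - y \<bullet> y}" by (auto simp: U_def)
    ultimately show ?thesis by auto
  qed
  have iU: "set_integrable lborel U P"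
  proof -
    \<comment> \<open>An auxiliary continuous factor that vanishes where 1 - |x|^2 <= t0 and equals
      1 on U, so that \<open>cut_integrable\<close> yields integrability of P on U.\<close>
    have "set_integrable lborel ?B (\<lambda>x. P x * (max 0 (1 - x \<bullet> x - t0)) ^ 1 / (max (t0) (1 - x \<bullet> x - t0)))"
    proof -
      have "continuous_on ?B (\<lambda>x. (max 0 (1 - x \<bullet> x - t0)) ^ 1 / (max t0 (1 - x \<bullet> x - t0)))"
        by (intro continuous_on_divide continuous_on_power continuous_on_max continuous_on_diff continuous_on_const continuous_on_inner continuous_on_id ballI)
          (use t0 in \<open>simp add: max_def\<close>)
      from cut_integrable[OF P this _ t0(1)] show ?thesis by simp
    qed
    then have "set_integrable lborel U (\<lambda>x. P x * (max 0 (1 - x \<bullet> x - t0)) ^ 1 / (max (t0) (1 - x \<bullet> x - t0)))"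
      by (rule set_integrable_subset) (use \<open>open U\<close> in \<open>auto simp: U_def\<close>)
    moreover have "indicator U x *\<^sub>R (P x * (max 0 (1 - x \<bullet> x - t0)) ^ 1 / (max (t0) (1 - x \<bullet> x - t0))) = indicator U x *\<^sub>R P x" for x
      using t0 by (auto simp: indicator_def U_def max_def)
    ultimately show ?thesis by (simp add: set_integrable_def)
  qed
  \<comment> \<open>The constant is the product of 4 (from \<open>cut1\<close> >= 1/4 on U), 2 (from
    the cut inequality) and 6 (from the bound on \<open>cut2\<close>).\<close>
  have small: "(LINT y:U|lborel. P y) \<le> 48 * I * t powr \<delta>" if t: "0 < t" "t \<le> t0" for t
  proof -
    have i1: "set_integrable lborel ?B (\<lambda>x. P x * cut1 t (1 - x \<bullet> x))" by (rule cut1_integrable[OF P _ t(1)])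
    have i2: "set_integrable lborel ?B (\<lambda>x. P x * cut2 t (1 - x \<bullet> x))" by (rule cut2_integrable[OF P _ t(1)])
    have "(LINT y:U|lborel. P y) \<le> (LINT y:?B|lborel. 4 * (P y * cut1 t (1 - y \<bullet> y)))"
      unfolding set_lebesgue_integral_def
    proof (rule Bochner_Integration.integral_mono)
      show "integrable lborel (\<lambda>y. indicator U y *\<^sub>R P y)" using iU by (simp add: set_integrable_def)
      show "integrable lborel (\<lambda>y. indicator ?B y *\<^sub>R (4 * (P y * cut1 t (1 - y \<bullet> y))))"
        using set_integrable_mult_right[OF i1, of 4] by (simp add: set_integrable_def)
      fix y :: 'a
      show "indicator U y *\<^sub>R P y \<le> indicator ?B y *\<^sub>R (4 * (P y * cut1 t (1 - y \<bullet> y)))"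
      proof (cases "y \<in> U")
        case True
        define z where "z = t / (1 - y \<bullet> y)"
        have yB: "y \<in> ?B" and s: "2 * t < 1 - y \<bullet> y" using True t by (auto simp: U_def)
        have z: "0 < z" "z \<le> 1/2" using s t by (auto simp: z_def field_simps)
        have "cut1 t (1 - y \<bullet> y) = (1 - z)\<^sup>2 * (1 + 2 * z)" unfolding z_def by (rule cut_eq) (use s t in auto)
        moreover have "(1/2)\<^sup>2 * 1 \<le> (1 - z)\<^sup>2 * (1 + 2 * z)" using z by (intro mult_mono power_mono) auto
        ultimately have "1 \<le> 4 * cut1 t (1 - y \<bullet> y)" by (simp add: power2_eq_square)
        from mult_left_mono[OF this P0[OF yB]] show ?thesis using True yB by (simp add: mult_ac)
      next
        case False
        then show ?thesis using P0[of y] cut_nonneg(1)[OF t(1)] by (auto simp: indicator_def)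
      qed
    qed
    also have "\<dots> = 4 * (LINT y:?B|lborel. P y * cut1 t (1 - y \<bullet> y))" by (rule set_integral_mult_right)
    also have "\<dots> \<le> 8 * (LINT y:?B|lborel. P y * cut2 t (1 - y \<bullet> y))" using cut[of t] t t01 by linarith
    also have "(LINT y:?B|lborel. P y * cut2 t (1 - y \<bullet> y)) \<le> (LINT y:?B|lborel. (6 * t powr \<delta>) * (P y * (1 - norm y) powr \<beta>))"
    proof (rule set_integral_mono[OF i2 set_integrable_mult_right[OF i]])
      fix y :: 'a assume y: "y \<in> ?B"
      define s where "s = 1 - y \<bullet> y"
      have d: "0 < 1 - norm y" "1 - norm y \<le> s" using y one_minus_norm_le_radius[of y] by (auto simp: s_def)
      have "cut2 t s \<le> (6 * t powr \<delta>) * (1 - norm y) powr \<beta>"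
      proof (cases "t \<le> s")
        case True
        have s: "s > 0" using d by simp
        define z where "z = t / s"
        have z: "0 < z" "z \<le> 1" using True s t by (auto simp: z_def)
        have "cut2 t s = 6 * (1 - z) * z\<^sup>2 / s" unfolding z_def by (rule cut_eq[OF t(1) True])
        also have "\<dots> \<le> 6 * 1 * z powr \<delta> / s"
        proof (intro divide_right_mono mult_mono)
          have "z\<^sup>2 = z powr 2" using z by simp
          also have "\<dots> \<le> z powr \<delta>" using z \<delta> by (intro powr_mono') auto
          finally show "z\<^sup>2 \<le> z powr \<delta>" .
        qed (use z s in auto)
        also have "\<dots> = 6 * t powr \<delta> * s powr (- 1 - \<delta>)"
          using t s by (simp add: z_def powr_divide powr_diff powr_minus field_simps)
        also have "\<dots> \<le> 6 * t powr \<delta> * (1 - norm y) powr (- 1 - \<delta>)"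
          using d \<delta> by (intro mult_left_mono powr_mono2') auto
        also have "\<dots> \<le> 6 * t powr \<delta> * (1 - norm y) powr \<beta>"
          using d \<delta> by (intro mult_left_mono powr_mono') auto
        finally show ?thesis .
      qed (simp add: cut_zero)
      from mult_left_mono[OF this P0[OF y]] show "P y * cut2 t (1 - y \<bullet> y) \<le> (6 * t powr \<delta>) * (P y * (1 - norm y) powr \<beta>)"
        by (simp add: s_def mult_ac)
    qed
    also have "\<dots> = (6 * t powr \<delta>) * I" unfolding I_def by (rule set_integral_mult_right)
    finally show ?thesis by (simp add: mult_ac)
  qed
  have "(LINT y:U|lborel. P y) \<le> 0"
  proof (rule tendsto_lowerbound[of _ _ "at_right 0"])
    show "((\<lambda>t. 48 * I * t powr \<delta>) \<longlongrightarrow> 0) (at_right 0)" using \<delta>(1) by real_asymp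
    show "eventually (\<lambda>t. (LINT y:U|lborel. P y) \<le> 48 * I * t powr \<delta>) (at_right 0)"
      unfolding eventually_at_right_field using small t0 by (intro exI[of _ t0]) auto
  qed simp
  then show ?thesis
    by (intro set_integral_zero_ball[of U P] iU \<open>open U\<close> continuous_on_subset[OF P])
      (use P0 x t0 in \<open>auto simp: U_def\<close>)
qed

section \<open>Vanishing of harmonic functions\<close>

lemma continuous_gradsq:
  assumes "Ck 1 h S" shows "continuous_on S (gradsq h)"
  unfolding gradsq_def[abs_def]
  by (intro continuous_on_sum continuous_on_power continuous_on_Re) (use assms in auto)

lemma powr_add_le:
  fixes a b q :: real
  assumes "0 \<le> a" "0 \<le> b" "0 < q" "q \<le> 1"
  shows "(a + b) powr q \<le> a powr q + b powr q"
proof (cases "a + b = 0")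
  case False
  then have s: "a + b > 0" using assms by simp
  have *: "c / (a + b) \<le> (c / (a + b)) powr q" if "0 \<le> c" "c \<le> a + b" for c
  proof (cases "c = 0")
    case False
    then have "0 < c / (a + b)" "c / (a + b) \<le> 1" using that s by auto
    then have "(c / (a + b)) powr 1 \<le> (c / (a + b)) powr q" using assms by (intro powr_mono') auto
    then show ?thesis using that s by simp
  qed simp
  have "1 = a / (a + b) + b / (a + b)" using s by (simp add: add_divide_distrib[symmetric])
  also have "\<dots> \<le> (a / (a + b)) powr q + (b / (a + b)) powr q" by (intro add_mono *) (use assms in auto)
  also have "\<dots> = (a powr q + b powr q) / (a + b) powr q" using assms by (simp add: powr_divide add_divide_distrib)
  finally show ?thesis using s by (simp add: pos_le_divide_eq)
qed (use assms in auto)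

text \<open>The cut inequality holds for the regularised power; subadditivity of the power p/2
  splits off e^(p/2) times a finite integral, which disappears as e tends to 0.\<close>

lemma gradient_power_cut:
  fixes h :: "'a::euclidean_space \<Rightarrow> complex"
  assumes n: "DIM('a) \<ge> 2" and h: "Ck 3 h (ball 0 1)" and re: "\<And>x. h x = of_real (Re (h x))"
    and harm: "\<And>x. x \<in> ball 0 1 \<Longrightarrow> laplacian h x = 0"
    and p: "0 < p" "p \<le> 1" "(real DIM('a) - 2) / (real DIM('a) - 1) \<le> p" and t: "0 < t" "t < 1"
  shows "(LINT x:ball 0 1|lborel. gradsq h x powr (p/2) * cut1 t (1 - x \<bullet> x)) \<le> 2 * (LINT x:ball 0 1|lborel. gradsq h x powr (p/2) * cut2 t (1 - x \<bullet> x))"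
proof -
  let ?B = "ball (0::'a) 1" and ?q = "p / 2"
  have g0: "gradsq h x \<ge> 0" for x unfolding gradsq_def by (intro sum_nonneg) auto
  have gc: "continuous_on ?B (gradsq h)" by (rule continuous_gradsq[OF Ck_le[OF h]]) simp
  have Pc: "continuous_on ?B (\<lambda>x. gradsq h x powr ?q)"
    by (rule continuous_on_powr'[OF gc continuous_on_const]) (use g0 p in auto)
  have J: "set_integrable lborel ?B (\<lambda>x. 1 * cut2 t (1 - x \<bullet> x))" by (rule cut2_integrable[OF _ _ t(1)]) auto
  have i1: "set_integrable lborel ?B (\<lambda>x. gradsq h x powr ?q * cut1 t (1 - x \<bullet> x))" by (rule cut1_integrable[OF Pc _ t(1)])
  have i2: "set_integrable lborel ?B (\<lambda>x. gradsq h x powr ?q * cut2 t (1 - x \<bullet> x))" by (rule cut2_integrable[OF Pc _ t(1)])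
  have est: "(LINT x:?B|lborel. gradsq h x powr ?q * cut1 t (1 - x \<bullet> x))
      \<le> 2 * ((LINT x:?B|lborel. gradsq h x powr ?q * cut2 t (1 - x \<bullet> x)) + e powr ?q * (LINT x:?B|lborel. 1 * cut2 t (1 - x \<bullet> x)))" if e: "e > 0" for e
  proof -
    have p2: "p \<le> 2" using p by simp
    note sub = gradient_power_subharmonic[OF open_ball n h re harm p(1) p2 p(3) e]
    have ec: "continuous_on ?B (\<lambda>x. (gradsq h x + e) powr ?q)"
      by (rule continuous_on_powr'[OF continuous_on_add[OF gc continuous_on_const] continuous_on_const]) (use g0 p e in \<open>auto intro: add_nonneg_nonneg\<close>)
    have "(LINT x:?B|lborel. gradsq h x powr ?q * cut1 t (1 - x \<bullet> x)) \<le> (LINT x:?B|lborel. (gradsq h x + e) powr ?q * cut1 t (1 - x \<bullet> x))"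
      by (rule set_integral_mono[OF i1 cut1_integrable[OF ec _ t(1)]]) (use g0 e p cut_nonneg(1)[OF t(1)] in \<open>auto intro!: mult_right_mono powr_mono2\<close>)
    also have "\<dots> \<le> 2 * (LINT x:?B|lborel. (gradsq h x + e) powr ?q * cut2 t (1 - x \<bullet> x))"
      by (rule subharmonic_cut[OF sub(2)[of 0] _ _ t]) (use sub(1) in auto)
    also have "(LINT x:?B|lborel. (gradsq h x + e) powr ?q * cut2 t (1 - x \<bullet> x))
       \<le> (LINT x:?B|lborel. gradsq h x powr ?q * cut2 t (1 - x \<bullet> x) + e powr ?q * (1 * cut2 t (1 - x \<bullet> x)))"
    proof (rule set_integral_mono[OF cut2_integrable[OF ec _ t(1)] set_integral_add(1)[OF i2 set_integrable_mult_right[OF J]]])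
      fix x :: 'a
      have "(gradsq h x + e) powr ?q \<le> gradsq h x powr ?q + e powr ?q" by (rule powr_add_le) (use g0 e p in auto)
      from mult_right_mono[OF this cut_nonneg(2)[OF t(1)]]
      show "(gradsq h x + e) powr ?q * cut2 t (1 - x \<bullet> x) \<le> gradsq h x powr ?q * cut2 t (1 - x \<bullet> x) + e powr ?q * (1 * cut2 t (1 - x \<bullet> x))"
        by (simp add: distrib_right)
    qed
    also have "\<dots> = (LINT x:?B|lborel. gradsq h x powr ?q * cut2 t (1 - x \<bullet> x)) + e powr ?q * (LINT x:?B|lborel. 1 * cut2 t (1 - x \<bullet> x))"
      using set_integral_add(2)[OF i2 set_integrable_mult_right[OF J, of "e powr ?q"]] by simp
    finally show ?thesis by simp
  qed
  show ?thesis
  proof (rule tendsto_lowerbound[of _ _ "at_right 0"])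
    define X Y where "X = (LINT x:?B|lborel. gradsq h x powr ?q * cut2 t (1 - x \<bullet> x))" and "Y = (LINT x:?B|lborel. 1 * cut2 t (1 - x \<bullet> x))"
    have "((\<lambda>e. 2 * (X + e powr ?q * Y)) \<longlongrightarrow> 2 * (X + 0 * Y)) (at_right 0)"
    proof (intro tendsto_intros)
      show "((\<lambda>e. e powr ?q) \<longlongrightarrow> 0) (at_right 0)" using p(1) by real_asymp
    qed
    then show "((\<lambda>e. 2 * ((LINT x:?B|lborel. gradsq h x powr ?q * cut2 t (1 - x \<bullet> x)) + e powr ?q * (LINT x:?B|lborel. 1 * cut2 t (1 - x \<bullet> x))))
       \<longlongrightarrow> 2 * (LINT x:?B|lborel. gradsq h x powr ?q * cut2 t (1 - x \<bullet> x))) (at_right 0)" by (simp add: X_def Y_def)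
    show "eventually (\<lambda>e. (LINT x:?B|lborel. gradsq h x powr ?q * cut1 t (1 - x \<bullet> x))
      \<le> 2 * ((LINT x:?B|lborel. gradsq h x powr ?q * cut2 t (1 - x \<bullet> x)) + e powr ?q * (LINT x:?B|lborel. 1 * cut2 t (1 - x \<bullet> x)))) (at_right 0)"
      unfolding eventually_at_right_field using est by (intro exI[of _ 1]) auto
  qed simp
qed

text \<open>The gradient has its p-th power integrable against the exponent \<alpha> + p < -1, so
  the cut inequality annihilates it and h is constant. A constant is itself subharmonic, and
  \<alpha> < -1 annihilates it in the same way.\<close>

lemma harmonic_real_zero:
  fixes h :: "'a::euclidean_space \<Rightarrow> complex"
  assumes n: "DIM('a) \<ge> 2" and p: "0 < p" "p \<le> 1" "(real DIM('a) - 2) / (real DIM('a) - 1) \<le> p"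
    and h: "h \<in> polyharmonic 1" and re: "\<And>x. h x = of_real (Re (h x))" and w: "wint p \<alpha> h" and \<alpha>: "\<alpha> < - 1 - p" and x: "x \<in> ball 0 1"
  shows "h x = 0"
proof -
  let ?B = "ball (0::'a) 1"
  note hC = polyharmonic_smooth[OF h]
  have harm: "laplacian h y = 0" if "y \<in> ?B" for y using h that by (simp add: polyharmonic_def)
  have hbc: "continuous_on ?B (dir_deriv b h)" if "b \<in> Basis" for b
    using Ck_dir_deriv[OF hC[of "Suc 0"] that] Ck_continuous by blast
  have g0: "gradsq h y \<ge> 0" for y unfolding gradsq_def by (intro sum_nonneg) auto
  have gc: "continuous_on ?B (gradsq h)" by (rule continuous_gradsq[OF hC])
  \<comment> \<open>The sum norm of the gradient: it dominates the Euclidean norm, and as a sum it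
    is open to \<open>wint_sum\<close>.\<close>
  define f where "f = (\<lambda>y. \<Sum>b\<in>Basis. complex_of_real (norm (dir_deriv b h y)))"
  have fw: "wint p (\<alpha> + p) f" unfolding f_def
  proof (rule wint_sum)
    fix b :: 'a assume b: "b \<in> Basis"
    show "wint p (\<alpha> + p) (\<lambda>y. complex_of_real (norm (dir_deriv b h y)))"
      using wint_dir_deriv[OF p(1,2) h w b] by (simp add: wint_def)
    show "continuous_on ?B (\<lambda>y. complex_of_real (norm (dir_deriv b h y)))"
      by (intro continuous_on_of_real continuous_on_norm hbc b)
  qed (use p in auto)
  have gf: "gradsq h y powr (p/2) \<le> norm (f y) powr p" for y
  proof -
    have "sqrt (gradsq h y) \<le> (\<Sum>b\<in>Basis. \<bar>Re (dir_deriv b h y)\<bar>)"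
      unfolding gradsq_def using L2_set_le_sum_abs[of "\<lambda>b. Re (dir_deriv b h y)" Basis] by (simp add: L2_set_def)
    also have "\<dots> \<le> (\<Sum>b\<in>Basis. norm (dir_deriv b h y))" by (intro sum_mono abs_Re_le_cmod)
    also have "\<dots> = norm (f y)"
    proof -
      have "f y = of_real (\<Sum>b\<in>Basis. norm (dir_deriv b h y))" by (simp add: f_def)
      then have "norm (f y) = \<bar>\<Sum>b\<in>Basis. norm (dir_deriv b h y)\<bar>" by (simp only: norm_of_real)
      then show ?thesis by (simp add: sum_nonneg)
    qed
    finally have "sqrt (gradsq h y) powr p \<le> norm (f y) powr p" using p by (intro powr_mono2) (auto simp: g0)
    then show ?thesis using g0[of y] by (simp add: powr_half_sqrt[symmetric] powr_powr)
  qed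
  have "(\<integral>\<^sup>+y\<in>?B. ennreal (gradsq h y powr (p/2) * (1 - norm y) powr (\<alpha> + p)) \<partial>lborel)
     \<le> (\<integral>\<^sup>+y\<in>?B. ennreal (norm (f y) powr p * (1 - norm y) powr (\<alpha> + p)) \<partial>lborel)"
    using gf by (intro nn_integral_mono) (auto simp: indicator_def intro!: ennreal_leI mult_right_mono)
  then have fin: "(\<integral>\<^sup>+y\<in>?B. ennreal (gradsq h y powr (p/2) * (1 - norm y) powr (\<alpha> + p)) \<partial>lborel) < \<infinity>"
    using fw unfolding wint_def by (rule le_less_trans)
  have Pc: "continuous_on ?B (\<lambda>x. gradsq h x powr (p/2))"
    by (rule continuous_on_powr'[OF gc continuous_on_const]) (use g0 p in auto)
  have "gradsq h y powr (p/2) = 0" if "y \<in> ?B" for y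
    by (rule zero_of_cut[OF Pc _ gradient_power_cut[OF n hC re harm p] fin _ that]) (use \<alpha> in auto)
  then have g: "gradsq h y = 0" if "y \<in> ?B" for y using that by simp
  have d0: "dir_deriv b h y = 0" if "y \<in> ?B" "b \<in> Basis" for y b
  proof -
    have "(Re (dir_deriv b h y))\<^sup>2 \<le> gradsq h y" unfolding gradsq_def by (rule member_le_sum[OF that(2)]) auto
    then have "Re (dir_deriv b h y) = 0" using g[OF that(1)] by simp
    moreover have "dir_deriv b h y = of_real (Re (dir_deriv b h y))"
    proof -
      have "dir_deriv b h y = dir_deriv b (\<lambda>x. of_real (Re (h x))) y" using re by (metis (no_types))
      then show ?thesis using dir_deriv_Re(2)[OF Ck_differentiable[OF hC[of 1] order_refl that(1)]] by metis
    qed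
    ultimately show ?thesis by simp
  qed
  have hd: "(h has_derivative (\<lambda>v. 0)) (at y within ?B)" if "y \<in> ?B" for y
  proof -
    have df: "h differentiable at y" by (rule Ck_differentiable[OF hC[of 1] order_refl that])
    have "(\<lambda>v. dir_deriv v h y) = (\<lambda>v. 0)" using dir_deriv_linear_basis[OF df] d0[OF that] by auto
    then show ?thesis using has_derivative_at_withinI[OF dir_deriv_has[OF df]] by simp
  qed
  obtain c where c: "\<And>y. y \<in> ?B \<Longrightarrow> h y = c"
    using has_derivative_zero_constant[OF convex_ball hd] by blast
  have "norm c powr p = 0"
  proof (rule zero_of_cut[of "\<lambda>_. norm c powr p"])
    show "(LINT y:?B|lborel. norm c powr p * cut1 t (1 - y \<bullet> y)) \<le> 2 * (LINT y:?B|lborel. norm c powr p * cut2 t (1 - y \<bullet> y))" if "0 < t" "t < 1" for t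
      by (rule subharmonic_cut) (use that in \<open>auto intro!: exI[of _ 0]\<close>)
    have "(\<integral>\<^sup>+y\<in>?B. ennreal (norm c powr p * (1 - norm y) powr \<alpha>) \<partial>lborel) = (\<integral>\<^sup>+y\<in>?B. ennreal (norm (h y) powr p * (1 - norm y) powr \<alpha>) \<partial>lborel)"
      by (intro nn_integral_cong) (simp add: indicator_def c)
    then show "(\<integral>\<^sup>+y\<in>?B. ennreal (norm c powr p * (1 - norm y) powr \<alpha>) \<partial>lborel) < \<infinity>" using w by (simp add: wint_def)
    show "\<alpha> < -1" using \<alpha> p by simp
  qed (use x in auto)
  then show ?thesis using c[OF x] by simp
qed

lemma harmonic_zero:
  fixes h :: "'a::euclidean_space \<Rightarrow> complex"
  assumes n: "DIM('a) \<ge> 2" and p: "0 < p" "p \<le> 1" "(real DIM('a) - 2) / (real DIM('a) - 1) \<le> p"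
    and h: "h \<in> polyharmonic 1" and w: "wint p \<alpha> h" and \<alpha>: "\<alpha> < - 1 - p" and x: "x \<in> ball 0 1"
  shows "h x = 0"
proof -
  \<comment> \<open>Multiplication by c = 1 and c = \<i> reaches the real and, up to sign, the
    imaginary part.\<close>
  have main: "Re (c * h x) = 0" if c: "norm c = 1" for c
  proof -
    let ?g = "\<lambda>x. c * h x" and ?k = "\<lambda>x. complex_of_real (Re (c * h x))"
    have h2: "Ck 2 h (ball 0 1)" by (rule polyharmonic_smooth[OF h])
    have g2: "Ck 2 ?g (ball 0 1)" by (rule Ck_cmult[OF open_ball h2])
    have "laplacian ?k y = 0" if "y \<in> ball 0 1" for y
      using laplacian_Re[OF open_ball g2 that] laplacian_cmult[OF open_ball h2 that, of c] h that by (simp add: polyharmonic_def)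
    then have k: "?k \<in> polyharmonic 1" using Ck_Re[OF open_ball g2] by (simp add: polyharmonic_def numeral_2_eq_2)
    have "wint p \<alpha> ?k"
    proof (rule wint_bound[OF w Ck_continuous[OF h2] p(1), of 1])
      fix y :: 'a
      have "norm (?k y) = \<bar>Re (c * h y)\<bar>" by (rule norm_of_real)
      also have "\<dots> \<le> norm (c * h y)" by (rule abs_Re_le_cmod)
      finally have "norm (?k y) \<le> norm (h y)" using c by (simp add: norm_mult del: times_complex.sel)
      then have "norm (?k y) powr p \<le> norm (h y) powr p" using p by (intro powr_mono2) auto
      then show "norm (?k y) powr p * (1 - norm y) powr \<alpha> \<le> 1 * (norm (h y) powr p * (1 - norm y) powr \<alpha>)"
        by (simp add: mult_right_mono)
    qed simp
    then have "?k x = 0" by (intro harmonic_real_zero[OF n p k _ _ \<alpha> x]) auto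
    then show ?thesis by (simp only: of_real_eq_0_iff)
  qed
  show ?thesis using main[of 1] main[of "\<i>"] by (simp add: complex_eq_iff)
qed

section \<open>Descent on the order\<close>

lemma laplacian_pow_dir_deriv:
  assumes S: "open S" and f: "\<And>k. Ck k f S" and x: "x \<in> S" and b: "b \<in> Basis"
  shows "(laplacian ^^ N) (dir_deriv b f) x = dir_deriv b ((laplacian ^^ N) f) x"
  using f x
proof (induction N arbitrary: f x)
  case (Suc N)
  have "(laplacian ^^ Suc N) (dir_deriv b f) x = (laplacian ^^ N) (laplacian (dir_deriv b f)) x"
    by (simp add: funpow_Suc_right del: funpow.simps)
  also have "\<dots> = (laplacian ^^ N) (dir_deriv b (laplacian f)) x"
    by (rule laplacian_pow_cong[OF S Suc.prems(2)]) (rule laplacian_dir_deriv[OF S Suc.prems(1) _ b])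
  also have "\<dots> = dir_deriv b ((laplacian ^^ N) (laplacian f)) x"
    by (rule Suc.IH[OF Ck_laplacian[OF S Suc.prems(1)] Suc.prems(2)])
  finally show ?case by (simp add: funpow_Suc_right del: funpow.simps)
qed simp

lemma polyharmonic_dir_deriv:
  assumes u: "u \<in> polyharmonic N" and b: "b \<in> Basis"
  shows "dir_deriv b u \<in> polyharmonic N"
proof -
  note uC = polyharmonic_smooth[OF u]
  have "(laplacian ^^ N) (dir_deriv b u) x = 0" if x: "x \<in> ball 0 1" for x
  proof -
    have "(laplacian ^^ N) (dir_deriv b u) x = dir_deriv b ((laplacian ^^ N) u) x"
      by (rule laplacian_pow_dir_deriv[OF open_ball uC x b])
    also have "\<dots> = dir_deriv b (\<lambda>_. 0) x"
      by (rule dir_deriv_cong[OF open_ball x]) (use u in \<open>simp add: polyharmonic_def\<close>)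
    finally show ?thesis by simp
  qed
  then show ?thesis using Ck_dir_deriv[OF uC b] by (simp add: polyharmonic_def)
qed

lemma wint_laplacian_pow:
  fixes u :: "'a::euclidean_space \<Rightarrow> complex"
  assumes p: "0 < p" "p \<le> 1" and "u \<in> polyharmonic (N + M)" "wint p \<alpha> u"
  shows "(laplacian ^^ M) u \<in> polyharmonic N \<and> wint p (\<alpha> + 2 * real M * p) ((laplacian ^^ M) u)"
  using assms(3,4)
proof (induction M arbitrary: u \<alpha>)
  case (Suc M)
  have u: "u \<in> polyharmonic (Suc (N + M))" using Suc.prems by simp
  have "wint p (\<alpha> + p + p) (dir_deriv b (dir_deriv b u))" if "b \<in> Basis" for b
    by (intro wint_dir_deriv[OF p polyharmonic_dir_deriv[OF u that] _ that] wint_dir_deriv[OF p u Suc.prems(2) that])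
  then have w: "wint p (\<alpha> + p + p) (laplacian u)"
    unfolding laplacian_def[abs_def]
  proof (rule wint_sum)
    show "continuous_on (ball 0 1) (dir_deriv b (dir_deriv b u))" if "b \<in> Basis" for b
      using Ck_dir_deriv[OF Ck_dir_deriv[OF polyharmonic_smooth[OF u, of "Suc (Suc 0)"] that] that] by simp
  qed (use p in auto)
  from Suc.IH[OF polyharmonic_laplacian(1)[OF u] w] show ?case
    by (simp add: funpow_Suc_right algebra_simps del: funpow.simps)
qed simp

text \<open>For u of order N + 1, applying N Laplacians costs 2 N p in the exponent and leaves a
  harmonic function at \<alpha> + 2 N p < -1 - p. It vanishes, so the order of u drops by one, and
  the condition on \<alpha> for the lower order is implied.\<close>

theorem polyharmonic_zero_of_wint:
  fixes u :: "'a::euclidean_space \<Rightarrow> complex"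
  assumes n: "DIM('a) \<ge> 2" and p: "0 < p" "p \<le> 1" "(real DIM('a) - 2) / (real DIM('a) - 1) \<le> p"
    and "u \<in> polyharmonic N" "wint p \<alpha> u" "\<alpha> < - 1 - (2 * real N - 1) * p" and x: "x \<in> ball 0 1"
  shows "u x = 0"
  using assms(5-7)
proof (induction N)
  case 0 then show ?case using x by (simp add: polyharmonic_def)
next
  case (Suc N)
  have v: "(laplacian ^^ N) u \<in> polyharmonic 1" "wint p (\<alpha> + 2 * real N * p) ((laplacian ^^ N) u)"
    using wint_laplacian_pow[OF p(1,2), of u 1 N \<alpha>] Suc.prems by auto
  have "(laplacian ^^ N) u y = 0" if "y \<in> ball 0 1" for y
    by (rule harmonic_zero[OF n p v _ that]) (use Suc.prems(3) in \<open>simp add: algebra_simps\<close>)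
  then have "u \<in> polyharmonic N" using polyharmonic_smooth[OF Suc.prems(1)] by (simp add: polyharmonic_def)
  then show ?case using p(1) by (intro Suc.IH Suc.prems) (use Suc.prems(3) in \<open>auto simp: algebra_simps\<close>)
qed

section \<open>Almansi sums and the extremal functions\<close>

text \<open>The commutator of the Laplacian with the Euler operator is twice the Laplacian; hence
  \<open>euler\<close> preserves harmonicity, on which \<open>almansi_euler\<close> and
  \<open>almansi_laplacian\<close> rely.\<close>

lemma laplacian_euler:
  assumes S: "open S" and f: "Ck 3 f S" and x: "x \<in> S"
  shows "laplacian (euler f) x = 2 * laplacian f x + euler (laplacian f) x"
proof -
  have f2: "Ck 2 f S" by (rule Ck_le[OF f]) simp
  have fb: "Ck 2 (dir_deriv b f) S" if "b \<in> Basis" for b using f that by (simp add: numeral_3_eq_3 numeral_2_eq_2)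
  have fbb: "Ck 1 (dir_deriv c (dir_deriv b f)) S" if "b \<in> Basis" "c \<in> Basis" for b c
    using fb[OF that(1)] that by (simp add: numeral_2_eq_2)
  have eb: "Ck 1 (euler (dir_deriv b f)) S" if "b \<in> Basis" for b
    by (rule Ck_euler[OF S]) (use fb[OF that] in \<open>simp add: numeral_2_eq_2\<close>)
  have "dir_deriv b (dir_deriv b (euler f)) x = 2 * dir_deriv b (dir_deriv b f) x + euler (dir_deriv b (dir_deriv b f)) x"
    if b: "b \<in> Basis" for b
  proof -
    have "dir_deriv b (dir_deriv b (euler f)) x = dir_deriv b (\<lambda>x. dir_deriv b f x + euler (dir_deriv b f) x) x"
      by (rule dir_deriv_cong[OF S x]) (rule dir_deriv_euler[OF S f2 _ b])
    also have "\<dots> = dir_deriv b (dir_deriv b f) x + dir_deriv b (euler (dir_deriv b f)) x"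
      by (rule dir_deriv_add[OF Ck_differentiable[OF fb[OF b] _ x] Ck_differentiable[OF eb[OF b] _ x]]) auto
    also have "dir_deriv b (euler (dir_deriv b f)) x = dir_deriv b (dir_deriv b f) x + euler (dir_deriv b (dir_deriv b f)) x"
      by (rule dir_deriv_euler[OF S fb[OF b] x b])
    finally show ?thesis by simp
  qed
  then have "laplacian (euler f) x = 2 * laplacian f x + (\<Sum>b\<in>Basis. euler (dir_deriv b (dir_deriv b f)) x)"
    by (simp add: laplacian_def sum.distrib sum_distrib_left)
  also have "(\<Sum>b\<in>Basis. euler (dir_deriv b (dir_deriv b f)) x) = euler (laplacian f) x"
  proof -
    have "dir_deriv c (laplacian f) x = (\<Sum>b\<in>Basis. dir_deriv c (dir_deriv b (dir_deriv b f)) x)" for c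
      unfolding laplacian_def[abs_def] by (rule dir_deriv_sum) (rule Ck_differentiable[OF fbb _ x], auto)
    then show ?thesis unfolding euler_def by (simp add: sum_distrib_left) (rule sum.swap)
  qed
  finally show ?thesis .
qed

section \<open>Powers of the weight\<close>

definition wpow :: "nat \<Rightarrow> 'a::euclidean_space \<Rightarrow> complex" where
  "wpow i x = complex_of_real ((1 - x \<bullet> x) ^ i)"

lemma wpow_0 [simp]: "wpow 0 x = 1" and wpow_Suc: "wpow (Suc i) x = wt x * wpow i x"
  by (simp_all add: wpow_def)

lemma wpow_add: "wpow (i + j) x = wpow i x * wpow j x"
  by (simp add: wpow_def power_add)

lemma Ck_wpow: "open S \<Longrightarrow> Ck k (wpow i) S"
  unfolding wpow_def[abs_def] of_real_power by (intro Ck_power Ck_radius)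

lemma wt_differentiable: "(\<lambda>x. complex_of_real (1 - x \<bullet> x)) differentiable at x"
  using Ck_radius[of UNIV 1 1] by auto

lemma dir_deriv_wpow: "dir_deriv b (wpow i) x = of_nat i * wpow (i - 1) x * (- 2 * of_real (x \<bullet> b))"
proof -
  have "((\<lambda>t. t ^ i) has_real_derivative real i * (1 - x \<bullet> x) ^ (i - 1)) (at (1 - x \<bullet> x))"
    by (auto intro!: derivative_eq_intros)
  from dir_deriv_compose_real[OF wt_differentiable this, of b] show ?thesis
    by (simp add: wpow_def[abs_def] dir_deriv_radius del: of_real_diff)
qed

lemma euler_wpow: "euler (wpow i) x = of_nat i * wpow (i - 1) x * (2 * wt x - 2)"
proof -
  have "euler (wpow i) x = (\<Sum>b\<in>Basis. of_nat i * wpow (i - 1) x * (- 2 * of_real ((x \<bullet> b) * (x \<bullet> b))))"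
    unfolding euler_def dir_deriv_wpow by (intro sum.cong refl) simp
  also have "\<dots> = of_nat i * wpow (i - 1) x * (- 2 * of_real (\<Sum>b\<in>Basis. (x \<bullet> b) * (x \<bullet> b)))"
    by (simp add: sum_distrib_left)
  finally show ?thesis by (simp add: euclidean_inner[of x x, symmetric] algebra_simps)
qed

lemma laplacian_wpow:
  fixes x :: "'a::euclidean_space"
  shows "laplacian (wpow i) x = 4 * of_nat i * of_nat (i - 1) * wpow (i - 2) x * (1 - wt x) - 2 * of_nat DIM('a) * of_nat i * wpow (i - 1) x"
proof -
  have "laplacian (wpow i) x = of_real (real i * (1 - x \<bullet> x) ^ (i - 1)) * laplacian (\<lambda>x. of_real (1 - x \<bullet> x)) x
     + of_real (real i * (real (i - 1) * (1 - x \<bullet> x) ^ (i - 1 - 1))) * (\<Sum>b\<in>Basis. (dir_deriv b (\<lambda>x. of_real (1 - x \<bullet> x)) x)\<^sup>2)"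
    unfolding wpow_def[abs_def]
    by (rule laplacian_compose_real[OF open_UNIV Ck_radius[OF open_UNIV] UNIV_I, where \<phi>' = "\<lambda>t. real i * t ^ (i - 1)"])
      (auto intro!: derivative_eq_intros)
  also have "(\<Sum>b\<in>Basis. (dir_deriv b (\<lambda>x. complex_of_real (1 - x \<bullet> x)) x)\<^sup>2) = 4 * of_real (x \<bullet> x)"
    by (simp add: dir_deriv_radius power_mult_distrib del: of_real_diff flip: sum_distrib_left) (simp add: euclidean_inner[of x x] power2_eq_square)
  also have "i - 1 - 1 = i - 2" by simp
  also have "complex_of_real (real i * (1 - x \<bullet> x) ^ (i - 1)) = of_nat i * wpow (i - 1) x" by (simp only: wpow_def of_real_mult of_real_of_nat_eq)
  also have "complex_of_real (real i * (real (i - 1) * (1 - x \<bullet> x) ^ (i - 2))) = of_nat i * (of_nat (i - 1) * wpow (i - 2) x)"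
    by (simp only: wpow_def of_real_mult of_real_of_nat_eq)
  finally have "laplacian (wpow i) x = of_nat i * wpow (i - 1) x * (- 2 * of_nat DIM('a))
     + of_nat i * (of_nat (i - 1) * wpow (i - 2) x) * (4 * of_real (x \<bullet> x))"
    unfolding laplacian_radius wpow_def[abs_def] .
  moreover have "complex_of_real (x \<bullet> x) = 1 - wt x" by simp
  ultimately show ?thesis by (simp only: mult_ac diff_conv_add_uminus mult_minus_left mult_minus_right add_ac)
qed

text \<open>Almansi sums, as a class of functions rather than as expansions.\<close>

inductive almansi :: "nat \<Rightarrow> ('a::euclidean_space \<Rightarrow> complex) \<Rightarrow> bool" where
  zero: "almansi N (\<lambda>x. 0)"
| gen: "(\<And>k. Ck k h (ball 0 1)) \<Longrightarrow> (\<And>x. x \<in> ball 0 1 \<Longrightarrow> laplacian h x = 0) \<Longrightarrow> i < N \<Longrightarrow> almansi N (\<lambda>x. wpow i x * h x)"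
| add: "almansi N f \<Longrightarrow> almansi N g \<Longrightarrow> almansi N (\<lambda>x. f x + g x)"
| cong: "almansi N f \<Longrightarrow> (\<And>x. x \<in> ball 0 1 \<Longrightarrow> f x = g x) \<Longrightarrow> almansi N g"

section \<open>Operations on Almansi sums\<close>

lemma almansi_smooth: "almansi N f \<Longrightarrow> Ck k f (ball 0 1)"
proof (induction rule: almansi.induct)
  case (cong N f g) then show ?case using Ck_cong[OF open_ball] by blast
qed (auto intro: Ck_mult Ck_wpow Ck_add)

lemma almansi_scale: "almansi N f \<Longrightarrow> almansi N (\<lambda>x. c * f x)"
proof (induction rule: almansi.induct)
  case (zero N) then show ?case using almansi.zero by simp
next
  case (gen h i N)
  have "almansi N (\<lambda>x. wpow i x * (c * h x))"
    by (rule almansi.gen) (use gen Ck_cmult[OF open_ball gen(1)] laplacian_cmult[OF open_ball gen(1)] in auto)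
  then show ?case by (rule almansi.cong) simp
next
  case (add N f g) then show ?case using almansi.add[OF add.IH] by (simp add: distrib_left)
next
  case (cong N f g)
  show ?case by (rule almansi.cong[OF cong.IH]) (simp add: cong.hyps(2))
qed

lemma almansi_weight: "almansi N f \<Longrightarrow> almansi (Suc N) (\<lambda>x. wt x * f x)"
proof (induction rule: almansi.induct)
  case (zero N) then show ?case using almansi.zero by simp
next
  case (gen h i N)
  have "almansi (Suc N) (\<lambda>x. wpow (Suc i) x * h x)" by (rule almansi.gen) (use gen in auto)
  then show ?case by (rule almansi.cong) (simp add: wpow_Suc del: of_real_diff)
next
  case (add N f g)
  show ?case by (rule almansi.cong[OF almansi.add[OF add.IH]]) (simp only: distrib_left)
next
  case (cong N f g)
  show ?case by (rule almansi.cong[OF cong.IH]) (simp add: cong.hyps(2))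
qed

lemma almansi_Suc: "almansi N f \<Longrightarrow> almansi (Suc N) f"
proof (induction rule: almansi.induct)
  case (gen h i N) then show ?case by (intro almansi.gen) auto
next
  case (cong N f g) then show ?case using almansi.cong by blast
qed (auto intro: almansi.zero almansi.add)

lemma almansi_wpow: "almansi N f \<Longrightarrow> almansi (N + i) (\<lambda>x. wpow i x * f x)"
proof (induction i)
  case (Suc i)
  from almansi_weight[OF Suc.IH[OF Suc.prems]] have "almansi (N + Suc i) (\<lambda>x. wt x * (wpow i x * f x))" by simp
  then show ?case by (rule almansi.cong) (simp add: wpow_Suc mult.assoc del: of_real_diff)
qed simp

lemma harmonic_euler:
  assumes "\<And>k. Ck k h (ball 0 1)" "\<And>x. x \<in> ball 0 1 \<Longrightarrow> laplacian h x = 0"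
  shows "Ck k (euler h) (ball 0 1)" "x \<in> ball 0 1 \<Longrightarrow> laplacian (euler h) x = 0"
proof -
  show "Ck k (euler h) (ball 0 1)" by (rule Ck_euler[OF open_ball assms(1)])
  assume x: "x \<in> ball 0 1"
  have "euler (laplacian h) x = euler (\<lambda>_. 0) x" by (rule euler_cong[OF open_ball x assms(2)])
  then show "laplacian (euler h) x = 0" using laplacian_euler[OF open_ball assms(1) x] assms(2)[OF x] by simp
qed

text \<open>The Euler operator takes w^i to i w^(i - 1) (2 w - 2) and so loses a power of w; the
  extra factor w gives it back, and the summands have powers i and i + 1 with coefficients built
  from the harmonic functions h and \<open>euler h\<close>.\<close>

lemma almansi_euler: "almansi N f \<Longrightarrow> almansi (Suc N) (\<lambda>x. wt x * euler f x)"
proof (induction rule: almansi.induct)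
  case (zero N) then show ?case using almansi.zero by simp
next
  case (gen h i N)
  note E = harmonic_euler[OF gen(1,2)]
  have g: "almansi (Suc N) (\<lambda>x. wpow l x * (c * h x))" if "l < Suc N" for l c
    by (rule almansi.gen) (use gen that Ck_cmult[OF open_ball gen(1)] laplacian_cmult[OF open_ball gen(1)] in auto)
  have "almansi (Suc N) (\<lambda>x. (wpow (Suc i) x * euler h x + wpow (Suc i) x * (2 * of_nat i * h x)) + wpow i x * ((- 2 * of_nat i) * h x))"
    by (intro almansi.add g almansi.gen[OF E]) (use gen in auto)
  then show ?case
  proof (rule almansi.cong)
    fix x :: 'a assume x: "x \<in> ball 0 1"
    have hd: "h differentiable at x" by (rule Ck_differentiable[OF gen(1)[of 1] order_refl x])
    have wd: "wpow i differentiable at x" using Ck_wpow[OF open_UNIV, of 1 i] by auto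
    have "wt x * euler (\<lambda>x. wpow i x * h x) x = wt x * (wpow i x * euler h x + of_nat i * wpow (i - 1) x * (2 * wt x - 2) * h x)"
      by (simp add: euler_mult[OF wd hd] euler_wpow del: of_real_diff)
    also have "\<dots> = wpow (Suc i) x * euler h x + of_nat i * wpow i x * (2 * wt x - 2) * h x"
      by (cases i) (simp_all add: wpow_Suc algebra_simps del: of_real_diff of_nat_Suc)
    finally show "wpow (Suc i) x * euler h x + wpow (Suc i) x * (2 * of_nat i * h x) + wpow i x * (- 2 * of_nat i * h x)
       = wt x * euler (\<lambda>x. wpow i x * h x) x"
      by (simp add: wpow_Suc algebra_simps del: of_real_diff)
  qed
next
  case (add N f g)
  show ?case
  proof (rule almansi.cong[OF almansi.add[OF add.IH]])
    fix x :: 'a assume x: "x \<in> ball 0 1"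
    show "wt x * euler f x + wt x * euler g x = wt x * euler (\<lambda>x. f x + g x) x"
      by (subst euler_add[OF Ck_differentiable[OF almansi_smooth[OF add.hyps(1), of 1] order_refl x]
        Ck_differentiable[OF almansi_smooth[OF add.hyps(2), of 1] order_refl x]]) (simp only: distrib_left)
  qed
next
  case (cong N f g)
  show ?case
  proof (rule almansi.cong[OF cong.IH])
    fix x :: 'a assume x: "x \<in> ball 0 1"
    have "euler f x = euler g x" by (rule euler_cong[OF open_ball x]) (rule cong.hyps(2))
    then show "wt x * euler f x = wt x * euler g x" by simp
  qed
qed

text \<open>On w^i h the Laplacian yields powers i - 2 and i - 1 with harmonic coefficients built
  from h and \<open>euler h\<close>, using |x|^2 = 1 - w; so the highest power drops by one.\<close>

lemma almansi_laplacian: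
  assumes "almansi (Suc N) f" shows "almansi N (laplacian f)"
  using assms
proof (induction "Suc N" f rule: almansi.induct)
  case zero
  have "laplacian (\<lambda>x::'a. 0) = (\<lambda>x. 0)" by auto
  then show ?case using almansi.zero by simp
next
  case (gen h i)
  note E = harmonic_euler[OF gen(1,2)]
  let ?n = "of_nat DIM('a) :: complex"
  have lap: "laplacian (\<lambda>x. wpow i x * h x) x = 4 * of_nat i * of_nat (i - 1) * wpow (i - 2) x * (1 - wt x) * h x
     - 2 * ?n * of_nat i * wpow (i - 1) x * h x - 4 * of_nat i * wpow (i - 1) x * euler h x" if x: "x \<in> ball 0 1" for x
  proof -
    have "laplacian (\<lambda>x. wpow i x * h x) x = laplacian (wpow i) x * h x + 2 * (\<Sum>b\<in>Basis. dir_deriv b (wpow i) x * dir_deriv b h x)"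
      using laplacian_mult[OF open_ball Ck_wpow[OF open_ball] gen(1) x] gen(2)[OF x] by simp
    also have "(\<Sum>b\<in>Basis. dir_deriv b (wpow i) x * dir_deriv b h x) = - 2 * of_nat i * wpow (i - 1) x * euler h x"
      unfolding euler_def dir_deriv_wpow sum_distrib_left by (intro sum.cong refl) simp
    finally show ?thesis unfolding laplacian_wpow by (simp add: algebra_simps del: of_real_diff)
  qed
  have g: "almansi N (\<lambda>x. wpow l x * (c * k x))" if "\<And>j. Ck j k (ball 0 1)" "\<And>x. x \<in> ball 0 1 \<Longrightarrow> laplacian k x = 0" "l < N" for l c k
    by (rule almansi.gen) (use that Ck_cmult[OF open_ball that(1)] laplacian_cmult[OF open_ball that(1)] in auto)
  \<comment> \<open>Natural subtraction truncates \<open>i - 1\<close> or \<open>i - 2\<close> when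
    i <= 1; the coefficients of the truncated powers are 0 there.\<close>
  consider "i = 0" | "i = 1" | j where "i = Suc (Suc j)" by (metis One_nat_def not0_implies_Suc)
  then show ?case
  proof cases
    case 1 then show ?thesis using lap by (intro almansi.cong[OF almansi.zero]) simp
  next
    case 2
    have "almansi N (\<lambda>x. wpow 0 x * ((- 2 * ?n) * h x) + wpow 0 x * ((- 4) * euler h x))"
      by (intro almansi.add g gen E) (use 2 gen in auto)
    then show ?thesis
    proof (rule almansi.cong)
      fix x :: 'a assume x: "x \<in> ball 0 1"
      show "wpow 0 x * ((- 2 * ?n) * h x) + wpow 0 x * ((- 4) * euler h x) = laplacian (\<lambda>x. wpow i x * h x) x"
        unfolding lap[OF x] unfolding 2 by simp
    qed
  next
    case (3 j)
    have "almansi N (\<lambda>x. (wpow j x * ((4 * of_nat i * of_nat (i - 1)) * h x) + wpow (Suc j) x * ((- 4 * of_nat i * of_nat (i - 1) - 2 * ?n * of_nat i) * h x))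
        + wpow (Suc j) x * ((- 4 * of_nat i) * euler h x))"
      by (intro almansi.add g gen E) (use 3 gen in auto)
    then show ?thesis
    proof (rule almansi.cong)
      fix x :: 'a assume x: "x \<in> ball 0 1"
      define m where "m = (of_nat i :: complex)"
      define m' where "m' = (of_nat (i - 1) :: complex)"
      have 3: "i - 1 = Suc j" "i - 2 = j" using 3 by auto
      show "(wpow j x * ((4 * of_nat i * of_nat (i - 1)) * h x) + wpow (Suc j) x * ((- 4 * of_nat i * of_nat (i - 1) - 2 * ?n * of_nat i) * h x))
        + wpow (Suc j) x * ((- 4 * of_nat i) * euler h x) = laplacian (\<lambda>x. wpow i x * h x) x"
        unfolding lap[OF x] m_def[symmetric] m'_def[symmetric] unfolding 3 wpow_Suc by (simp add: algebra_simps del: of_real_diff)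
    qed
  qed
next
  case (add f g)
  show ?case by (rule almansi.cong[OF almansi.add[OF add.hyps(2,4)]])
    (use laplacian_add[OF open_ball almansi_smooth[OF add.hyps(1)] almansi_smooth[OF add.hyps(3)]] in simp)
next
  case (cong f g)
  show ?case by (rule almansi.cong[OF cong.hyps(2)]) (rule laplacian_cong[OF open_ball], assumption, rule cong.hyps(3))
qed

lemma almansi_0: "almansi 0 f \<Longrightarrow> x \<in> ball 0 1 \<Longrightarrow> f x = 0"
  by (induction "0::nat" f rule: almansi.induct) auto

lemma almansi_polyharmonic:
  assumes "almansi N f" shows "f \<in> polyharmonic N"
proof -
  have "(laplacian ^^ N) f x = 0" if "x \<in> ball 0 1" for x
    using assms
  proof (induction N arbitrary: f)
    case 0 then show ?case using almansi_0 that by simp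
  next
    case (Suc N)
    from Suc.IH[OF almansi_laplacian[OF Suc.prems]] show ?case by (simp add: funpow_Suc_right del: funpow.simps)
  qed
  then show ?thesis using almansi_smooth[OF assms] by (simp add: polyharmonic_def)
qed

section \<open>Powers |x - e|^(2 b) of the distance to a boundary point\<close>

definition pole :: "'a::euclidean_space \<Rightarrow> real \<Rightarrow> 'a \<Rightarrow> complex" where
  "pole e b x = complex_of_real (((x - e) \<bullet> (x - e)) powr b)"

context
  fixes e :: "'a::euclidean_space"
  assumes e: "norm e = 1"
begin

lemma pole_pos: "x \<in> ball 0 1 \<Longrightarrow> (x - e) \<bullet> (x - e) > 0"
  using e by auto

lemma Ck_pole: "Ck k (pole e b) (ball 0 1)"
  unfolding pole_def[abs_def] by (intro Ck_powr Ck_nsq open_ball pole_pos)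

lemma nsq_shift_differentiable: "(\<lambda>x. complex_of_real ((x - c) \<bullet> (x - c))) differentiable at x"
  using has_derivative_nsq[of c x] by (auto simp: differentiable_def)

text \<open>Through |e| = 1 the weight w enters the radial derivative of a power of |x - e|.\<close>

lemma pole_inner: "2 * (x \<bullet> (x - e)) = (x - e) \<bullet> (x - e) - (1 - x \<bullet> x)"
proof -
  have "e \<bullet> e = 1" using e by (simp add: norm_eq_1)
  then show ?thesis by (simp add: inner_diff_left inner_diff_right inner_commute)
qed

lemma dir_deriv_pole:
  assumes "x \<in> ball 0 1"
  shows "dir_deriv c (pole e b) x = of_real b * pole e (b - 1) x * (2 * (of_real (x \<bullet> c) - of_real (e \<bullet> c)))"
proof -
  have "dir_deriv c (pole e b) x = of_real (b * ((x - e) \<bullet> (x - e)) powr (b - 1)) * dir_deriv c (\<lambda>x. of_real ((x - e) \<bullet> (x - e))) x"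
    unfolding pole_def[abs_def]
    by (rule dir_deriv_compose_real[OF nsq_shift_differentiable has_real_derivative_powr[OF pole_pos[OF assms]]])
  then show ?thesis by (simp add: pole_def fun_cong[OF dir_deriv_nsq])
qed

lemma euler_pole:
  assumes "x \<in> ball 0 1"
  shows "euler (pole e b) x = of_real b * pole e (b - 1) x * of_real ((x - e) \<bullet> (x - e) - (1 - x \<bullet> x))"
proof -
  have "euler (pole e b) x = of_real b * pole e (b - 1) x * of_real (2 * (\<Sum>c\<in>Basis. (x \<bullet> c) * ((x - e) \<bullet> c)))"
    unfolding euler_def dir_deriv_pole[OF assms]
    unfolding of_real_mult of_real_sum sum_distrib_left inner_diff_left of_real_diff
    by (intro sum.cong refl) (simp add: algebra_simps)
  also have "2 * (\<Sum>c\<in>Basis. (x \<bullet> c) * ((x - e) \<bullet> c)) = (x - e) \<bullet> (x - e) - (1 - x \<bullet> x)"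
    using pole_inner[of x] by (simp only: euclidean_inner[of x "x - e", symmetric])
  finally show ?thesis .
qed

lemma pole_mult_nsq:
  assumes "x \<in> ball 0 1"
  shows "of_real ((x - e) \<bullet> (x - e)) * pole e (b - 1) x = pole e b x"
proof -
  have "((x - e) \<bullet> (x - e)) powr (b - 1) * ((x - e) \<bullet> (x - e)) ^ 1 = ((x - e) \<bullet> (x - e)) powr b"
    by (subst powr_times_power[OF pole_pos[OF assms]]) simp
  then show ?thesis unfolding pole_def of_real_mult[symmetric] by (simp only: power_one_right mult.commute)
qed

lemma euler_pole':
  assumes x: "x \<in> ball 0 1"
  shows "euler (pole e b) x = of_real b * pole e b x - of_real b * wt x * pole e (b - 1) x"
proof -
  define s where "s = (x - e) \<bullet> (x - e)"
  define w where "w = 1 - x \<bullet> x"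
  show ?thesis unfolding euler_pole[OF x] pole_mult_nsq[OF x, of b, symmetric] unfolding s_def[symmetric] w_def[symmetric]
    by (simp add: algebra_simps)
qed

lemma laplacian_pole:
  assumes x: "x \<in> ball 0 1"
  shows "laplacian (pole e b) x = of_real (b * (2 * real DIM('a) + 4 * (b - 1))) * pole e (b - 1) x"
proof -
  have "laplacian (pole e b) x = of_real (b * ((x - e) \<bullet> (x - e)) powr (b - 1)) * laplacian (\<lambda>x. of_real ((x - e) \<bullet> (x - e))) x
     + of_real (b * ((b - 1) * ((x - e) \<bullet> (x - e)) powr (b - 1 - 1))) * (\<Sum>c\<in>Basis. (dir_deriv c (\<lambda>x. of_real ((x - e) \<bullet> (x - e))) x)\<^sup>2)"
    unfolding pole_def[abs_def]
  proof (rule laplacian_compose_real[OF open_ball Ck_nsq[OF open_ball] x, where \<phi>' = "\<lambda>t. b * t powr (b - 1)"])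
    show "((\<lambda>t. t powr b) has_real_derivative b * ((y - e) \<bullet> (y - e)) powr (b - 1)) (at ((y - e) \<bullet> (y - e)))" if "y \<in> ball 0 1" for y
      by (rule has_real_derivative_powr[OF pole_pos[OF that]])
    show "((\<lambda>t. b * t powr (b - 1)) has_real_derivative b * ((b - 1) * ((x - e) \<bullet> (x - e)) powr (b - 1 - 1))) (at ((x - e) \<bullet> (x - e)))"
      by (intro DERIV_cmult has_real_derivative_powr pole_pos x)
  qed
  also have "(\<Sum>c\<in>Basis. (dir_deriv c (\<lambda>x. complex_of_real ((x - e) \<bullet> (x - e))) x)\<^sup>2) = of_real (4 * ((x - e) \<bullet> (x - e)))"
  proof -
    have "(\<Sum>c\<in>Basis. (dir_deriv c (\<lambda>x. complex_of_real ((x - e) \<bullet> (x - e))) x)\<^sup>2) = (\<Sum>c\<in>Basis. of_real (4 * (((x - e) \<bullet> c) * ((x - e) \<bullet> c))))"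
      unfolding fun_cong[OF dir_deriv_nsq] by (intro sum.cong refl) (simp add: inner_diff_left power2_eq_square algebra_simps)
    also have "\<dots> = of_real (4 * (\<Sum>c\<in>Basis. ((x - e) \<bullet> c) * ((x - e) \<bullet> c)))" by (simp add: sum_distrib_left)
    finally show ?thesis by (simp only: euclidean_inner[of "x - e" "x - e", symmetric])
  qed
  also have "of_real (b * ((b - 1) * ((x - e) \<bullet> (x - e)) powr (b - 1 - 1))) * complex_of_real (4 * ((x - e) \<bullet> (x - e)))
     = of_real (4 * b * (b - 1)) * (of_real ((x - e) \<bullet> (x - e)) * pole e (b - 1 - 1) x)"
    by (simp add: pole_def)
  also have "of_real ((x - e) \<bullet> (x - e)) * pole e (b - 1 - 1) x = pole e (b - 1) x" by (rule pole_mult_nsq[OF x])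
  finally show ?thesis unfolding laplacian_nsq by (simp add: pole_def[abs_def] algebra_simps)
qed

text \<open>The Poisson kernel w / |x - e|^n up to normalisation. With b = -n/2 the coefficient in
  \<open>laplacian_pole\<close> is -4 b and the Laplacian of w is 4 b; these cancel the two parts of
  the cross term, which is -4 \<open>euler (pole e b)\<close>.\<close>

lemma poisson_harmonic:
  assumes x: "x \<in> ball 0 1"
  shows "laplacian (\<lambda>x. wpow 1 x * pole e (- real DIM('a) / 2) x) x = 0"
proof -
  define b where "b = - real DIM('a) / 2"
  have "laplacian (\<lambda>x. wpow 1 x * pole e b x) x = wpow 1 x * laplacian (pole e b) x + laplacian (wpow 1) x * pole e b x
     + 2 * (\<Sum>c\<in>Basis. dir_deriv c (wpow 1) x * dir_deriv c (pole e b) x)"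
    by (rule laplacian_mult[OF open_ball Ck_wpow[OF open_ball] Ck_pole x])
  also have "(\<Sum>c\<in>Basis. dir_deriv c (wpow 1) x * dir_deriv c (pole e b) x) = - 2 * euler (pole e b) x"
    unfolding euler_def dir_deriv_wpow sum_distrib_left by (intro sum.cong refl) simp
  also have "euler (pole e b) x = of_real b * pole e b x - of_real b * wt x * pole e (b - 1) x"
    by (rule euler_pole'[OF x])
  also have "laplacian (pole e b) x = of_real (b * (2 * real DIM('a) + 4 * (b - 1))) * pole e (b - 1) x" by (rule laplacian_pole[OF x])
  also have "b * (2 * real DIM('a) + 4 * (b - 1)) = - 4 * b" by (simp add: b_def algebra_simps)
  also have "laplacian (wpow 1) x = of_real (4 * b)" unfolding laplacian_wpow by (simp add: b_def)
  also have "wpow 1 x = wt x" by (simp add: wpow_def)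
  finally show ?thesis unfolding b_def[symmetric] by (simp add: algebra_simps del: of_real_diff)
qed

text \<open>For R = w^a |x - e|^(2 b) the product rule gives (2 a + b) w R - 2 a R - w
  \<open>euler R\<close> = b w^(a + 2) |x - e|^(2 b - 2), and b < 0 permits division by b. The
  operations on the left raise the order by at most one, while a grows by 2 and b drops by
  1.\<close>

lemma almansi_pole: "almansi (Suc j) (\<lambda>x. wpow (2 * j + 1) x * pole e (- real DIM('a) / 2 - real j) x)"
proof (induction j)
  case 0
  have "almansi 1 (\<lambda>x. wpow 0 x * (wpow 1 x * pole e (- real DIM('a) / 2) x))"
  proof (rule almansi.gen)
    show "Ck k (\<lambda>x. wpow 1 x * pole e (- real DIM('a) / 2) x) (ball 0 1)" for k
      by (intro Ck_mult Ck_wpow Ck_pole open_ball)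
    show "laplacian (\<lambda>x. wpow 1 x * pole e (- real DIM('a) / 2) x) x = 0" if "x \<in> ball 0 1" for x
      by (rule poisson_harmonic[OF that])
  qed simp
  then show ?case by (simp add: wpow_def)
next
  case (Suc j)
  define b where "b = - real DIM('a) / 2 - real j"
  have "0 < real DIM('a)" "0 \<le> real j" by simp_all
  then have b: "b < 0" unfolding b_def by linarith
  define a where "a = 2 * j + 1"
  let ?R = "\<lambda>x. wpow a x * pole e b x"
  have R: "almansi (Suc j) ?R" using Suc by (simp add: a_def b_def)
  have "almansi (Suc (Suc j)) (\<lambda>x. (1 / of_real b) * (((2 * of_nat a + of_real b) * (wt x * ?R x) + (- 2 * of_nat a) * ?R x) + (- 1) * (wt x * euler ?R x)))"
    by (intro almansi_scale almansi.add almansi_weight almansi_euler almansi_Suc R)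
  then show ?case
  proof (rule almansi.cong)
    fix x :: 'a assume x: "x \<in> ball 0 1"
    have wd: "wpow a differentiable at x" using Ck_wpow[OF open_UNIV, of 1 a] by auto
    have pd: "pole e b differentiable at x" by (rule Ck_differentiable[OF Ck_pole[of 1] order_refl x])
    have ep: "euler (pole e b) x = of_real b * pole e b x - of_real b * wt x * pole e (b - 1) x"
      by (rule euler_pole'[OF x])
    have wa: "wt x * wpow (a - 1) x = wpow a x" by (simp add: a_def wpow_Suc del: of_real_diff)
    have "wt x * euler ?R x = wt x * (wpow a x * euler (pole e b) x) + of_nat a * (wt x * wpow (a - 1) x) * (2 * wt x - 2) * pole e b x"
      unfolding euler_mult[OF wd pd] euler_wpow by (simp only: distrib_left mult_ac)
    also have "\<dots> = of_real b * (wt x * ?R x) - of_real b * (wt x * (wt x * wpow a x) * pole e (b - 1) x) + (2 * of_nat a) * (wt x * ?R x) - (2 * of_nat a) * ?R x"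
      unfolding wa ep by (simp add: algebra_simps del: of_real_diff)
    finally have eq: "((2 * of_nat a + of_real b) * (wt x * ?R x) + (- 2 * of_nat a) * ?R x) + (- 1) * (wt x * euler ?R x)
        = of_real b * (wt x * (wt x * wpow a x) * pole e (b - 1) x)"
      by (simp add: algebra_simps del: of_real_diff)
    have eq2: "wt x * (wt x * wpow a x) = wpow (2 * Suc j + 1) x" by (simp add: a_def wpow_Suc del: of_real_diff)
    have eq3: "b - 1 = - real DIM('a) / 2 - real (Suc j)" by (simp add: b_def)
    have "complex_of_real b \<noteq> 0" using b by simp
    then show "(1 / of_real b) * (((2 * of_nat a + of_real b) * (wt x * ?R x) + (- 2 * of_nat a) * ?R x) + (- 1) * (wt x * euler ?R x))
        = wpow (2 * Suc j + 1) x * pole e (- real DIM('a) / 2 - real (Suc j)) x" unfolding eq eq2 eq3[symmetric] by (simp del: of_real_eq_0_iff)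
  qed
qed

text \<open>Start from order j and multiply by w^(N - j): the order becomes N and the power of w
  becomes (N - j) + (2 j - 1) = N + j - 1.\<close>

lemma kernel_polyharmonic:
  assumes "1 \<le> j" "j \<le> N"
  shows "(\<lambda>x. wpow (N + j - 1) x * pole e (- (real DIM('a) / 2 + real j - 1)) x) \<in> polyharmonic N"
proof -
  obtain i where i: "j = Suc i" using assms by (cases j) auto
  have "almansi (Suc i + (N - j)) (\<lambda>x. wpow (N - j) x * (wpow (2 * i + 1) x * pole e (- real DIM('a) / 2 - real i) x))"
    by (rule almansi_wpow[OF almansi_pole])
  moreover have "Suc i + (N - j) = N" using i assms by simp
  ultimately have "almansi N (\<lambda>x. wpow (N - j) x * (wpow (2 * i + 1) x * pole e (- real DIM('a) / 2 - real i) x))" by simp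
  then have "almansi N (\<lambda>x. wpow (N + j - 1) x * pole e (- (real DIM('a) / 2 + real j - 1)) x)"
  proof (rule almansi.cong)
    fix x :: 'a
    have "N + j - 1 = (N - j) + (2 * i + 1)" using i assms by simp
    moreover have "- (real DIM('a) / 2 + real j - 1) = - real DIM('a) / 2 - real i" by (simp add: i)
    ultimately show "wpow (N - j) x * (wpow (2 * i + 1) x * pole e (- real DIM('a) / 2 - real i) x) = wpow (N + j - 1) x * pole e (- (real DIM('a) / 2 + real j - 1)) x"
      by (simp only: wpow_add mult.assoc)
  qed
  then show ?thesis by (rule almansi_polyharmonic)
qed

end

lemma wpow_polyharmonic:
  assumes "N \<ge> 1" shows "wpow (N - 1) \<in> polyharmonic N"
proof -
  have "almansi N (\<lambda>x. wpow (N - 1) x * 1)" by (rule almansi.gen) (use assms in auto)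
  then show ?thesis using almansi_polyharmonic by fastforce
qed

section \<open>Integrability of the extremal functions\<close>

text \<open>A homogeneous cone about the direction e, truncated to the ball, so that dilations give
  the volume of its radial shells. The aperture 4 r is what \<open>pole_cap_measure\<close>
  requires.\<close>

definition pole_cone :: "'a::euclidean_space \<Rightarrow> real \<Rightarrow> 'a set" where
  "pole_cone e r = {x. norm x < 1 \<and> norm (x - norm x *\<^sub>R e) \<le> 4 * r * norm x}"

lemma pole_cone_sets [measurable]: "pole_cone e r \<in> sets borel"
  unfolding pole_cone_def by measurable

lemma pole_cone_subset: "pole_cone e r \<subseteq> ball 0 1"
  by (auto simp: pole_cone_def)

lemma pole_cone_finite: "S \<subseteq> pole_cone e r \<Longrightarrow> S \<in> sets borel \<Longrightarrow> emeasure lborel S < \<infinity>"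
proof -
  assume S: "S \<subseteq> pole_cone e r" "S \<in> sets borel"
  have "emeasure lborel S \<le> emeasure lborel (ball (0::'a) 1)"
    by (rule emeasure_mono) (use S pole_cone_subset in auto)
  also have "\<dots> < \<infinity>" using emeasure_bounded_finite[of "ball (0::'a) 1"] by simp
  finally show ?thesis .
qed

lemma pole_cone_scale:
  fixes e :: "'a::euclidean_space"
  assumes s: "0 < s" "s \<le> 1"
  shows "measure lborel (pole_cone e r \<inter> ball 0 s) = s ^ DIM('a) * measure lborel (pole_cone e r)"
proof -
  have mem: "s *\<^sub>R y \<in> pole_cone e r \<inter> ball 0 s \<longleftrightarrow> y \<in> pole_cone e r" for y
  proof -
    have "s *\<^sub>R y - norm (s *\<^sub>R y) *\<^sub>R e = s *\<^sub>R (y - norm y *\<^sub>R e)" using s by (simp add: scaleR_diff_right)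
    then have "norm (s *\<^sub>R y - norm (s *\<^sub>R y) *\<^sub>R e) \<le> 4 * r * norm (s *\<^sub>R y) \<longleftrightarrow> s * norm (y - norm y *\<^sub>R e) \<le> s * (4 * r * norm y)"
      using s by (simp add: mult_ac)
    moreover have "norm (s *\<^sub>R y) < s \<longleftrightarrow> norm y < 1" using s by simp
    moreover have "norm (s *\<^sub>R y) < s \<Longrightarrow> norm (s *\<^sub>R y) < 1" using s by linarith
    ultimately show ?thesis using s unfolding pole_cone_def by auto
  qed
  have "emeasure lborel (pole_cone e r \<inter> ball 0 s) = (\<integral>\<^sup>+z. indicator (pole_cone e r \<inter> ball 0 s) z \<partial>lborel)"
    by (rule nn_integral_indicator[symmetric]) simp
  also have "\<dots> = ennreal (s ^ DIM('a)) * (\<integral>\<^sup>+y. indicator (pole_cone e r \<inter> ball 0 s) (0 + s *\<^sub>R y) \<partial>lborel)"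
    by (intro nn_integral_affine borel_measurable_indicator sets.Int pole_cone_sets s) simp
  also have "(\<lambda>y. indicator (pole_cone e r \<inter> ball 0 s) (0 + s *\<^sub>R y) :: ennreal) = indicator (pole_cone e r)"
    by (rule ext) (use mem in \<open>simp add: indicator_def\<close>)
  also have "(\<integral>\<^sup>+y. indicator (pole_cone e r) y \<partial>lborel) = emeasure lborel (pole_cone e r)"
    by (rule nn_integral_indicator) simp
  finally show ?thesis using s by (simp add: measure_def enn2real_mult)
qed

lemma pole_cone_shell:
  fixes e :: "'a::euclidean_space"
  assumes s: "0 \<le> s" "s \<le> 1"
  shows "measure lborel (pole_cone e r - ball 0 s) = (1 - s ^ DIM('a)) * measure lborel (pole_cone e r)"
proof (cases "s = 0")
  case False
  have "measure lborel (pole_cone e r - (pole_cone e r \<inter> ball 0 s)) = measure lborel (pole_cone e r) - measure lborel (pole_cone e r \<inter> ball 0 s)"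
    by (rule measure_Diff) (use pole_cone_finite[of "pole_cone e r" e r] in auto)
  moreover have "pole_cone e r - (pole_cone e r \<inter> ball 0 s) = pole_cone e r - ball 0 s" by auto
  ultimately have "measure lborel (pole_cone e r - ball 0 s) = measure lborel (pole_cone e r) - measure lborel (pole_cone e r \<inter> ball 0 s)" by simp
  then show ?thesis using pole_cone_scale[of s e r] s False by (simp add: algebra_simps)
qed simp

text \<open>For r <= 1 the outer shell of thickness r carries at least the fraction r of the volume
  of the cone, and it lies in the ball of radius 4 r + r about e; so the volume is at most of order
  (5 r)^n / r.\<close>

lemma pole_cone_measure:
  fixes e :: "'a::euclidean_space"
  assumes e: "norm e = 1" and r: "0 < r"
  shows "measure lborel (pole_cone e r) \<le> unit_ball_vol (real DIM('a)) * 5 ^ DIM('a) * r ^ (DIM('a) - 1)"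
proof (cases "r \<le> 1")
  case True
  have DIM: "DIM('a) = Suc (DIM('a) - 1)" using DIM_positive[where 'a='a] by linarith
  have "r \<le> 1 - (1 - r) ^ DIM('a)" using r True power_decreasing[of 1 "DIM('a)" "1 - r"] DIM by simp
  then have "r * measure lborel (pole_cone e r) \<le> measure lborel (pole_cone e r - ball 0 (1 - r))"
    using pole_cone_shell[of "1 - r" e r] r True by (simp add: mult_right_mono)
  also have "\<dots> \<le> measure lborel (cball e (5 * r))"
  proof (rule measure_mono_fmeasurable)
    show "pole_cone e r - ball 0 (1 - r) \<subseteq> cball e (5 * r)"
    proof
      fix x assume x: "x \<in> pole_cone e r - ball 0 (1 - r)"
      have eq: "x - e = (x - norm x *\<^sub>R e) - (1 - norm x) *\<^sub>R e" by (simp add: algebra_simps)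
      have "norm (x - e) \<le> norm (x - norm x *\<^sub>R e) + (1 - norm x)"
        unfolding eq using norm_triangle_ineq4[of "x - norm x *\<^sub>R e" "(1 - norm x) *\<^sub>R e"] e x by (simp add: pole_cone_def)
      moreover have "4 * r * norm x \<le> 4 * r * 1" using x r by (intro mult_left_mono) (auto simp: pole_cone_def)
      moreover have "norm (x - norm x *\<^sub>R e) \<le> 4 * r * norm x" "1 - norm x \<le> r" using x by (simp_all add: pole_cone_def)
      ultimately have "norm (x - e) \<le> 5 * r" by linarith
      then show "x \<in> cball e (5 * r)" by (simp add: dist_norm norm_minus_commute)
    qed
    show "cball e (5 * r) \<in> fmeasurable lborel"
      using emeasure_bounded_finite[of "cball e (5 * r)"] by (simp add: fmeasurable_def)
  qed auto
  also have "\<dots> = unit_ball_vol (real DIM('a)) * (5 * r) ^ DIM('a)" using r by (simp add: content_cball)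
  also have "\<dots> = r * (unit_ball_vol (real DIM('a)) * 5 ^ DIM('a) * r ^ (DIM('a) - 1))"
  proof -
    have "r ^ DIM('a) = r * r ^ (DIM('a) - 1)" by (subst DIM) (rule power_Suc)
    then show ?thesis by (simp add: power_mult_distrib)
  qed
  finally show ?thesis using r by simp
next
  case False
  have "measure lborel (pole_cone e r) \<le> measure lborel (ball (0::'a) 1)"
  proof (rule measure_mono_fmeasurable[OF pole_cone_subset])
    show "ball (0::'a) 1 \<in> fmeasurable lborel"
      using emeasure_bounded_finite[of "ball (0::'a) 1"] by (simp add: fmeasurable_def)
  qed simp
  also have "\<dots> = unit_ball_vol (real DIM('a)) * (1 * 1)" by (simp add: content_ball)
  also have "\<dots> \<le> unit_ball_vol (real DIM('a)) * (5 ^ DIM('a) * r ^ (DIM('a) - 1))"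
    using False by (intro mult_left_mono mult_mono one_le_power) auto
  finally show ?thesis by (simp add: mult.assoc)
qed

definition pole_cap :: "'a::euclidean_space \<Rightarrow> real \<Rightarrow> real \<Rightarrow> 'a set" where
  "pole_cap e t r = {x. norm x < 1 \<and> 1 - norm x \<le> t \<and> norm (x - e) \<le> r}"

lemma pole_cap_sets [measurable]: "pole_cap e t r \<in> sets borel"
  unfolding pole_cap_def by measurable

lemma dist_pole_ge: "norm e = 1 \<Longrightarrow> 1 - norm x \<le> norm (x - e)"
  using norm_triangle_ineq2[of e x] by (simp add: norm_minus_commute)

text \<open>The cap lies in the outer shell of thickness t of the cone, whose share of the cone is 1
  - (1 - t)^n <= n t; this separates the factors t and r^(n - 1).\<close>

lemma pole_cap_measure:
  fixes e :: "'a::euclidean_space"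
  assumes e: "norm e = 1" and r: "0 < r" and t: "0 < t" "t \<le> 1"
  shows "emeasure lborel (pole_cap e t r) \<le> ennreal (real DIM('a) * unit_ball_vol (real DIM('a)) * 5 ^ DIM('a) * t * r ^ (DIM('a) - 1))"
proof -
  have sub: "pole_cap e t r \<subseteq> pole_cone e r - ball 0 (1 - t)"
  proof
    fix x assume x: "x \<in> pole_cap e t r"
    have eq: "x - norm x *\<^sub>R e = (x - e) + (1 - norm x) *\<^sub>R e" by (simp add: algebra_simps)
    have 1: "norm (x - norm x *\<^sub>R e) \<le> norm (x - e) + (1 - norm x)"
      unfolding eq using norm_triangle_ineq[of "x - e" "(1 - norm x) *\<^sub>R e"] e x by (simp add: pole_cap_def)
    \<comment> \<open>For r <= 1/2 one has |x| >= 1/2 and the left side is at most 2 r; for larger r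
      the trivial bound 2 |x| suffices. Hence the aperture 4 r.\<close>
    have "norm (x - norm x *\<^sub>R e) \<le> 4 * r * norm x"
    proof (cases "r \<le> 1 / 2")
      case True
      have "1 / 2 \<le> norm x" using dist_pole_ge[OF e, of x] x True unfolding pole_cap_def by auto
      then have "4 * r * (1 / 2) \<le> 4 * r * norm x" using r by (intro mult_left_mono) auto
      moreover have "norm (x - e) \<le> r" using x by (simp add: pole_cap_def)
      ultimately show ?thesis using 1 dist_pole_ge[OF e, of x] by linarith
    next
      case False
      have "norm (x - norm x *\<^sub>R e) \<le> norm x + norm x" using norm_triangle_ineq4[of x "norm x *\<^sub>R e"] e by simp
      also have "\<dots> = 2 * norm x" by simp
      also have "\<dots> \<le> 4 * r * norm x" using False by (intro mult_right_mono) auto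
      finally show ?thesis .
    qed
    then show "x \<in> pole_cone e r - ball 0 (1 - t)" using x by (auto simp: pole_cone_def pole_cap_def)
  qed
  have fin: "emeasure lborel (pole_cone e r - ball 0 (1 - t)) < \<infinity>" by (rule pole_cone_finite[of _ e r]) auto
  have "emeasure lborel (pole_cap e t r) \<le> emeasure lborel (pole_cone e r - ball 0 (1 - t))"
    by (rule emeasure_mono[OF sub]) simp
  also have "\<dots> = ennreal (measure lborel (pole_cone e r - ball 0 (1 - t)))"
    using fin by (intro emeasure_eq_ennreal_measure) auto
  also have "\<dots> \<le> ennreal ((real DIM('a) * t) * (unit_ball_vol (real DIM('a)) * 5 ^ DIM('a) * r ^ (DIM('a) - 1)))"
  proof (rule ennreal_leI)
    have "1 - (1 - t) ^ DIM('a) \<le> real DIM('a) * t" using Bernoulli_inequality[of "- t" "DIM('a)"] t by simp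
    then show "measure lborel (pole_cone e r - ball 0 (1 - t)) \<le> (real DIM('a) * t) * (unit_ball_vol (real DIM('a)) * 5 ^ DIM('a) * r ^ (DIM('a) - 1))"
      unfolding pole_cone_shell[of "1 - t" e r, simplified, OF t(2) less_imp_le[OF t(1)]] using t by (intro mult_mono pole_cone_measure[OF e r]) auto
  qed
  finally show ?thesis by (simp add: mult_ac)
qed

section \<open>Dyadic summation\<close>

lemma dyadic_scale:
  fixes y :: real
  assumes "0 < y" "y \<le> 1"
  shows "\<exists>i::nat. 2 powr (- (real i + 1)) \<le> y \<and> y \<le> 2 powr (- real i)"
proof -
  define i where "i = nat \<lfloor>- log 2 y\<rfloor>"
  have "0 \<le> - log 2 y" using assms by simp
  then have "real i \<le> - log 2 y" "- log 2 y \<le> real i + 1" unfolding i_def by linarith+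
  then have "2 powr (- (real i + 1)) \<le> 2 powr (log 2 y)" "2 powr (log 2 y) \<le> 2 powr (- real i)"
    by (intro powr_mono; simp)+
  then show ?thesis using assms by auto
qed

lemma le_suminf_ennreal: "(f::nat \<Rightarrow> ennreal) i \<le> (\<Sum>i. f i)"
  using sum_le_suminf[of f "{i}"] by simp

text \<open>Double dyadic decomposition: 1 - |x| of size 2^(-i) and |x - e| of size 2^(1 - l). Up to
  constants the volume bound 2^(-i) 2^(-l (n - 1)) factorises, so the double sum is a product of
  geometric series with ratios \<open>q1\<close> and \<open>q2\<close>, which are below 1 because A
  > -1 and b < n - 1.\<close>

lemma pole_integral_core:
  fixes e :: "'a::euclidean_space"
  assumes e: "norm e = 1" and A: "- 1 < A" "A \<le> 0" and b: "0 \<le> b" "b < real DIM('a) - 1"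
  shows "(\<integral>\<^sup>+x\<in>ball 0 1. ennreal ((1 - norm x) powr A * norm (x - e) powr (- b)) \<partial>lborel) < \<infinity>"
proof -
  define C where "C = real DIM('a) * unit_ball_vol (real DIM('a)) * 5 ^ DIM('a)"
  have C: "C \<ge> 0" by (simp add: C_def)
  define g :: "nat \<Rightarrow> nat \<Rightarrow> 'a \<Rightarrow> ennreal" where
    "g i l x = ennreal (2 powr (- (real i + 1) * A) * 2 powr (real l * b)) * indicator (pole_cap e (2 powr (- real i)) (2 * 2 powr (- real l))) x" for i l x
  define D where "D = C * 2 powr (- A) * 2 ^ (DIM('a) - 1)"
  define q1 where "q1 = 2 powr (- (1 + A))"
  define q2 where "q2 = 2 powr (b - (real DIM('a) - 1))"
  have q: "0 \<le> q1" "q1 < 1" "0 \<le> q2" "q2 < 1" using A b powr_less_mono[of "- (1 + A)" 0 2] powr_less_mono[of "b - (real DIM('a) - 1)" 0 2] by (simp_all add: q1_def q2_def)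
  have D: "D \<ge> 0" using C by (simp add: D_def)
  have m: "g i l \<in> borel_measurable lborel" for i l unfolding g_def by measurable
  have pt: "ennreal ((1 - norm x) powr A * norm (x - e) powr (- b)) * indicator (ball 0 1) x \<le> (\<Sum>i. \<Sum>l. g i l x)" for x
  proof (cases "x \<in> ball 0 1")
    case True
    have d: "0 < 1 - norm x" "1 - norm x \<le> 1" using True by auto
    have \<delta>: "0 < norm (x - e)" using dist_pole_ge[OF e, of x] d(1) by linarith
    have \<delta>2: "norm (x - e) \<le> 2" using norm_triangle_ineq4[of x e] e d by linarith
    obtain i :: nat where i: "2 powr (- (real i + 1)) \<le> 1 - norm x" "1 - norm x \<le> 2 powr (- real i)"
      using dyadic_scale[OF d] by blast
    obtain l :: nat where l: "2 powr (- (real l + 1)) \<le> norm (x - e) / 2" "norm (x - e) / 2 \<le> 2 powr (- real l)"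
      using dyadic_scale[of "norm (x - e) / 2"] \<delta> \<delta>2 by auto
    have l1: "2 powr (- real l) \<le> norm (x - e)" using l(1) powr_add[of 2 "- real l" "- 1"] by (simp add: powr_minus)
    have x: "x \<in> pole_cap e (2 powr (- real i)) (2 * 2 powr (- real l))" using True i l by (auto simp: pole_cap_def)
    have "(1 - norm x) powr A \<le> (2 powr (- (real i + 1))) powr A"
      by (rule powr_mono2') (use A i in auto)
    also have "\<dots> = 2 powr (- (real i + 1) * A)" by (simp add: powr_powr)
    finally have a1: "(1 - norm x) powr A \<le> 2 powr (- (real i + 1) * A)" .
    have "norm (x - e) powr (- b) \<le> (2 powr (- real l)) powr (- b)"
      by (rule powr_mono2') (use b l1 in auto)
    also have "\<dots> = 2 powr (real l * b)" by (simp add: powr_powr)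
    finally have "(1 - norm x) powr A * norm (x - e) powr (- b) \<le> 2 powr (- (real i + 1) * A) * 2 powr (real l * b)"
      using a1 by (intro mult_mono) auto
    then have "ennreal ((1 - norm x) powr A * norm (x - e) powr (- b)) \<le> g i l x"
      using x by (simp add: g_def ennreal_leI)
    also have "\<dots> \<le> (\<Sum>l. g i l x)" by (rule le_suminf_ennreal)
    also have "\<dots> \<le> (\<Sum>i. \<Sum>l. g i l x)" by (rule le_suminf_ennreal)
    finally show ?thesis using True by simp
  qed simp
  have tm: "(\<integral>\<^sup>+x. g i l x \<partial>lborel) \<le> ennreal (D * q1 ^ i) * ennreal (q2 ^ l)" for i l
  proof -
    have "(\<integral>\<^sup>+x. g i l x \<partial>lborel) = ennreal (2 powr (- (real i + 1) * A) * 2 powr (real l * b)) * emeasure lborel (pole_cap e (2 powr (- real i)) (2 * 2 powr (- real l)))"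
      unfolding g_def by (rule nn_integral_cmult_indicator) simp
    also have "\<dots> \<le> ennreal (2 powr (- (real i + 1) * A) * 2 powr (real l * b)) * ennreal (C * 2 powr (- real i) * (2 * 2 powr (- real l)) ^ (DIM('a) - 1))"
      unfolding C_def by (intro mult_left_mono pole_cap_measure e) (auto simp: powr_minus inverse_le_1_iff ge_one_powr_ge_zero)
    also have "\<dots> = ennreal ((2 powr (- (real i + 1) * A) * 2 powr (real l * b)) * (C * 2 powr (- real i) * (2 * 2 powr (- real l)) ^ (DIM('a) - 1)))"
      by (rule ennreal_mult[symmetric]) (use C in auto)
    also have "(2 powr (- (real i + 1) * A) * 2 powr (real l * b)) * (C * 2 powr (- real i) * (2 * 2 powr (- real l)) ^ (DIM('a) - 1)) = D * q1 ^ i * q2 ^ l"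
    proof -
      have "q1 ^ i = 2 powr (- (1 + A) * real i)" unfolding q1_def by (simp add: powr_realpow[symmetric] powr_powr)
      moreover have "q2 ^ l = 2 powr ((b - (real DIM('a) - 1)) * real l)" unfolding q2_def by (simp add: powr_realpow[symmetric] powr_powr)
      moreover have "(2 * 2 powr (- real l)) ^ (DIM('a) - 1) = 2 ^ (DIM('a) - 1) * 2 powr (- real l * (real DIM('a) - 1))"
        by (simp add: power_mult_distrib powr_realpow[symmetric] powr_powr of_nat_diff Suc_leI)
      ultimately have "(2 powr (- (real i + 1) * A) * 2 powr (real l * b)) * (C * 2 powr (- real i) * (2 * 2 powr (- real l)) ^ (DIM('a) - 1))
         = (C * 2 ^ (DIM('a) - 1)) * (2 powr (- (real i + 1) * A) * 2 powr (- real i)) * (2 powr (real l * b) * 2 powr (- real l * (real DIM('a) - 1)))"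
        by (simp only: mult_ac)
      also have "2 powr (- (real i + 1) * A) * 2 powr (- real i) = 2 powr (- A) * q1 ^ i"
        unfolding \<open>q1 ^ i = _\<close> powr_add[symmetric] by (simp add: algebra_simps)
      also have "2 powr (real l * b) * 2 powr (- real l * (real DIM('a) - 1)) = q2 ^ l"
        unfolding \<open>q2 ^ l = _\<close> powr_add[symmetric] by (simp add: algebra_simps)
      finally show ?thesis by (simp add: D_def mult_ac)
    qed
    also have "ennreal (D * q1 ^ i * q2 ^ l) = ennreal (D * q1 ^ i) * ennreal (q2 ^ l)"
      by (rule ennreal_mult) (use D q in auto)
    finally show ?thesis .
  qed
  have "(\<integral>\<^sup>+x\<in>ball 0 1. ennreal ((1 - norm x) powr A * norm (x - e) powr (- b)) \<partial>lborel) \<le> (\<integral>\<^sup>+x. (\<Sum>i. \<Sum>l. g i l x) \<partial>lborel)"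
    by (rule nn_integral_mono) (rule pt)
  also have "\<dots> = (\<Sum>i. \<integral>\<^sup>+x. (\<Sum>l. g i l x) \<partial>lborel)" by (rule nn_integral_suminf) (intro borel_measurable_suminf_order m)
  also have "\<dots> = (\<Sum>i. \<Sum>l. \<integral>\<^sup>+x. g i l x \<partial>lborel)" by (intro arg_cong[where f = suminf] ext nn_integral_suminf m)
  also have "\<dots> \<le> (\<Sum>i. \<Sum>l. ennreal (D * q1 ^ i) * ennreal (q2 ^ l))"
    by (intro suminf_le summableI tm)
  also have "\<dots> = (\<Sum>i. ennreal (D * q1 ^ i) * (\<Sum>l. ennreal (q2 ^ l)))" by simp
  also have "\<dots> = (\<Sum>i. ennreal (D * q1 ^ i)) * (\<Sum>l. ennreal (q2 ^ l))" by simp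
  also have "(\<Sum>i. ennreal (D * q1 ^ i)) = ennreal (\<Sum>i. D * q1 ^ i)"
    by (rule suminf_ennreal2) (use D q in \<open>auto intro!: summable_mult summable_geometric\<close>)
  also have "(\<Sum>l. ennreal (q2 ^ l)) = ennreal (\<Sum>l. q2 ^ l)"
    by (rule suminf_ennreal2) (use q in \<open>auto intro!: summable_geometric\<close>)
  also have "ennreal (\<Sum>i. D * q1 ^ i) * ennreal (\<Sum>l. q2 ^ l) < \<infinity>" by (simp add: ennreal_mult_less_top)
  finally show ?thesis .
qed

text \<open>As 1 - |x| <= |x - e|, any part b - c of the singularity at e may be charged to the
  boundary distance. The core estimate then asks for c < n - 1 and A - (b - c) > -1, and b < n + A
  leaves room for such a c.\<close>

lemma pole_integral:
  fixes e :: "'a::euclidean_space"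
  assumes e: "norm e = 1" and n: "DIM('a) \<ge> 2" and A: "- 1 < A" and b: "0 \<le> b" "b < real DIM('a) + A"
  shows "(\<integral>\<^sup>+x\<in>ball 0 1. ennreal ((1 - norm x) powr A * norm (x - e) powr (- b)) \<partial>lborel) < \<infinity>"
proof -
  have "\<exists>c. 0 \<le> c \<and> c \<le> b \<and> c < real DIM('a) - 1 \<and> b - A - 1 < c"
  proof (cases "b < real DIM('a) - 1")
    case True then show ?thesis using A b by (intro exI[of _ b]) auto
  next
    case False
    have "max 0 (b - A - 1) < real DIM('a) - 1" using n b by auto
    then obtain c where "max 0 (b - A - 1) < c" "c < real DIM('a) - 1" using dense by blast
    then show ?thesis using False by (intro exI[of _ c]) auto
  qed
  then obtain c where c: "0 \<le> c" "c \<le> b" "c < real DIM('a) - 1" "b - A - 1 < c" by blast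
  define B where "B = min 0 (A - (b - c))"
  have B: "- 1 < B" "B \<le> 0" using c by (auto simp: B_def)
  have "(1 - norm x) powr A * norm (x - e) powr (- b) \<le> (1 - norm x) powr B * norm (x - e) powr (- c)" if x: "x \<in> ball 0 1" for x
  proof -
    have d: "0 < 1 - norm x" "1 - norm x \<le> 1" using x by auto
    have \<delta>: "1 - norm x \<le> norm (x - e)" by (rule dist_pole_ge[OF e])
    have "norm (x - e) powr (- b) = norm (x - e) powr (- c) * norm (x - e) powr (- (b - c))"
      by (simp add: powr_add[symmetric])
    also have "\<dots> \<le> norm (x - e) powr (- c) * (1 - norm x) powr (- (b - c))"
      by (intro mult_left_mono powr_mono2') (use c d \<delta> in auto)
    finally have "(1 - norm x) powr A * norm (x - e) powr (- b) \<le> (1 - norm x) powr A * (norm (x - e) powr (- c) * (1 - norm x) powr (- (b - c)))"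
      by (rule mult_left_mono) simp
    also have "\<dots> = (1 - norm x) powr (A - (b - c)) * norm (x - e) powr (- c)"
      using powr_add[of "1 - norm x" A "- (b - c)"] by (simp add: algebra_simps)
    also have "\<dots> \<le> (1 - norm x) powr B * norm (x - e) powr (- c)"
      by (intro mult_right_mono powr_mono') (use d in \<open>auto simp: B_def\<close>)
    finally show ?thesis .
  qed
  then have "(\<integral>\<^sup>+x\<in>ball 0 1. ennreal ((1 - norm x) powr A * norm (x - e) powr (- b)) \<partial>lborel)
     \<le> (\<integral>\<^sup>+x\<in>ball 0 1. ennreal ((1 - norm x) powr B * norm (x - e) powr (- c)) \<partial>lborel)"
    by (intro nn_integral_mono) (auto simp: indicator_def intro!: ennreal_leI)
  also have "\<dots> < \<infinity>" by (rule pole_integral_core[OF e B c(1,3)])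
  finally show ?thesis .
qed

section \<open>Weighted integrability of the extremal functions\<close>

lemma wint_dominated:
  assumes "\<And>x. x \<in> ball 0 1 \<Longrightarrow> norm (f x) powr p * (1 - norm x) powr \<alpha> \<le> C * h x" "0 \<le> C" "\<And>x. 0 \<le> h x"
    and "continuous_on (ball 0 1) h" "(\<integral>\<^sup>+x\<in>ball 0 1. ennreal (h x) \<partial>lborel) < \<infinity>"
  shows "wint p \<alpha> f"
proof -
  have "(\<integral>\<^sup>+x\<in>ball 0 1. ennreal (norm (f x) powr p * (1 - norm x) powr \<alpha>) \<partial>lborel) \<le> (\<integral>\<^sup>+x. ennreal C * (ennreal (h x) * indicator (ball 0 1) x) \<partial>lborel)"
    using assms(1-3) by (intro nn_integral_mono) (auto simp: indicator_def ennreal_mult[symmetric] intro!: ennreal_leI)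
  also have "\<dots> = ennreal C * (\<integral>\<^sup>+x\<in>ball 0 1. ennreal (h x) \<partial>lborel)"
    by (rule nn_integral_cmult) (use ball_measurable[OF assms(4) open_ball] in simp)
  also have "\<dots> < \<infinity>" using assms(5) by (simp add: ennreal_mult_less_top)
  finally show ?thesis by (simp add: wint_def)
qed

lemma wpow_bound:
  fixes x :: "'a::euclidean_space"
  assumes "x \<in> ball 0 1" "0 < p"
  shows "norm (wpow i x) powr p \<le> 2 powr (real i * p) * (1 - norm x) powr (real i * p)"
proof -
  have d: "0 < 1 - norm x" using assms by simp
  have w: "0 \<le> 1 - x \<bullet> x" "1 - x \<bullet> x \<le> 2 * (1 - norm x)"
  proof -
    have "1 - x \<bullet> x = (1 - norm x) * (1 + norm x)" by (simp add: dot_square_norm power2_eq_square algebra_simps)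
    moreover have "(1 - norm x) * (1 + norm x) \<le> (1 - norm x) * 2" using d by (intro mult_left_mono) auto
    moreover have "0 \<le> (1 - norm x) * (1 + norm x)" using d by simp
    ultimately show "0 \<le> 1 - x \<bullet> x" "1 - x \<bullet> x \<le> 2 * (1 - norm x)" by linarith+
  qed
  have "norm (wpow i x) powr p = ((1 - x \<bullet> x) ^ i) powr p" using w by (simp add: wpow_def del: of_real_diff of_real_power)
  also have "\<dots> \<le> ((2 * (1 - norm x)) ^ i) powr p" using w assms(2) by (intro powr_mono2 power_mono) auto
  also have "\<dots> = (2 * (1 - norm x)) powr (real i * p)" using d by (simp add: powr_realpow[symmetric] powr_powr)
  also have "\<dots> = 2 powr (real i * p) * (1 - norm x) powr (real i * p)" using d by (intro powr_mult)
  finally show ?thesis .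
qed

lemma kernel_wint:
  fixes e :: "'a::euclidean_space"
  assumes e: "norm e = 1" and n: "DIM('a) \<ge> 2" and p: "0 < p" and b: "0 \<le> b"
    and 1: "- 1 < real i * p + \<alpha>" and 2: "2 * b * p < real DIM('a) + (real i * p + \<alpha>)"
  shows "wint p \<alpha> (\<lambda>x. wpow i x * pole e (- b) x)"
proof (rule wint_dominated)
  let ?h = "\<lambda>x. (1 - norm x) powr (real i * p + \<alpha>) * norm (x - e) powr (- (2 * b * p))"
  fix x :: 'a assume x: "x \<in> ball 0 1"
  have "norm (pole e (- b) x) powr p = norm (x - e) powr (- (2 * b * p))"
    by (simp add: pole_def dot_square_norm powr_powr mult_ac flip: powr_numeral)
  then have "norm (wpow i x * pole e (- b) x) powr p * (1 - norm x) powr \<alpha>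
      = norm (wpow i x) powr p * (norm (x - e) powr (- (2 * b * p)) * (1 - norm x) powr \<alpha>)"
    by (simp add: norm_mult powr_mult)
  also have "\<dots> \<le> (2 powr (real i * p) * (1 - norm x) powr (real i * p)) * (norm (x - e) powr (- (2 * b * p)) * (1 - norm x) powr \<alpha>)"
    by (rule mult_right_mono[OF wpow_bound[OF x p]]) simp
  also have "\<dots> = 2 powr (real i * p) * ?h x" by (simp add: powr_add)
  finally show "norm (wpow i x * pole e (- b) x) powr p * (1 - norm x) powr \<alpha> \<le> 2 powr (real i * p) * ?h x" .
next
  show "continuous_on (ball 0 1) (\<lambda>x. (1 - norm x) powr (real i * p + \<alpha>) * norm (x - e) powr (- (2 * b * p)))"
    by (intro continuous_on_mult continuous_dist_powr continuous_on_powr continuous_intros) (use e in auto)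
  show "(\<integral>\<^sup>+x\<in>ball 0 1. ennreal ((1 - norm x) powr (real i * p + \<alpha>) * norm (x - e) powr (- (2 * b * p))) \<partial>lborel) < \<infinity>"
    by (rule pole_integral[OF e n 1]) (use b p 2 in auto)
qed auto

lemma wpow_wint:
  assumes n: "DIM('a::euclidean_space) \<ge> 2" and p: "0 < p" and 1: "- 1 < real i * p + \<alpha>"
  shows "wint p \<alpha> (wpow i :: 'a \<Rightarrow> complex)"
proof -
  obtain e :: 'a where e: "norm e = 1" using norm_Basis SOME_Basis by blast
  \<comment> \<open>Exponent 0 makes the pole factor equal to 1 on the ball, where x differs from
    e.\<close>
  have "wint p \<alpha> (\<lambda>x. wpow i x * pole e (- 0) x)" by (rule kernel_wint[OF e n p _ 1]) (use n 1 in auto)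
  moreover have "(\<integral>\<^sup>+x\<in>ball 0 1. ennreal (norm (wpow i x * pole e (- 0) x) powr p * (1 - norm x) powr \<alpha>) \<partial>lborel)
      = (\<integral>\<^sup>+x\<in>ball (0::'a) 1. ennreal (norm (wpow i x) powr p * (1 - norm x) powr \<alpha>) \<partial>lborel)"
    by (rule nn_integral_cong) (use e in \<open>auto simp: indicator_def pole_def\<close>)
  ultimately show ?thesis by (simp only: wint_def)
qed

section \<open>The critical exponent\<close>

lemma infdist_frontier_ball:
  fixes x :: "'a::euclidean_space"
  assumes x: "x \<in> ball 0 1"
  shows "infdist x (frontier (ball 0 1)) = 1 - norm x"
proof -
  obtain b :: 'a where b: "norm b = 1" using norm_Basis SOME_Basis by blast
  have "\<exists>z. norm z = 1 \<and> dist x z = 1 - norm x"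
  proof (cases "x = 0")
    case True then show ?thesis using b by (intro exI[of _ b]) simp
  next
    case False
    have "x - x /\<^sub>R norm x = (1 - inverse (norm x)) *\<^sub>R x" by (simp add: algebra_simps)
    then have "dist x (x /\<^sub>R norm x) = \<bar>1 - inverse (norm x)\<bar> * norm x" by (simp add: dist_norm)
    also have "\<dots> = \<bar>(1 - inverse (norm x)) * norm x\<bar>" by (simp add: abs_mult)
    also have "(1 - inverse (norm x)) * norm x = norm x - 1" using False by (simp add: left_diff_distrib)
    also have "\<bar>norm x - 1\<bar> = 1 - norm x" using x by simp
    finally show ?thesis using False by (intro exI[of _ "x /\<^sub>R norm x"]) simp
  qed
  then obtain z :: 'a where z: "norm z = 1" "dist x z = 1 - norm x" by blast
  have "infdist x (sphere 0 1) \<le> 1 - norm x" using infdist_le[of z "sphere 0 1" x] z by simp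
  moreover have "1 - norm x \<le> infdist x (sphere 0 1)"
  proof -
    have ne: "sphere (0::'a) 1 \<noteq> {}" using b by (auto intro!: exI[of _ b])
    have "1 - norm x \<le> dist x y" if "y \<in> sphere 0 1" for y
      using that norm_triangle_ineq2[of y x] by (simp add: dist_norm norm_minus_commute)
    then show ?thesis unfolding infdist_notempty[OF ne] by (intro cINF_greatest[OF ne])
  qed
  ultimately show ?thesis by simp
qed

lemma weighted_Lp_iff:
  fixes u :: "'a::euclidean_space \<Rightarrow> complex"
  assumes u: "continuous_on (ball 0 1) u"
  shows "u \<in> weighted_Lp p \<alpha> \<longleftrightarrow> wint p \<alpha> u"
proof -
  have "u \<in> borel_measurable (lebesgue_on (ball 0 1))"
    by (rule continuous_imp_measurable_on_sets_lebesgue[OF u]) simp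
  moreover have "(\<integral>\<^sup>+x. ennreal (norm (u x) powr p * infdist x (frontier (ball 0 1)) powr \<alpha>) \<partial>lebesgue_on (ball 0 1))
     = (\<integral>\<^sup>+x\<in>ball 0 1. ennreal (norm (u x) powr p * infdist x (frontier (ball 0 1)) powr \<alpha>) \<partial>lborel)"
    by (subst nn_integral_restrict_space) (simp_all add: nn_integral_completion)
  moreover have "(\<integral>\<^sup>+x\<in>ball 0 1. ennreal (norm (u x) powr p * infdist x (frontier (ball 0 1)) powr \<alpha>) \<partial>lborel)
     = (\<integral>\<^sup>+x\<in>ball 0 1. ennreal (norm (u x) powr p * (1 - norm x) powr \<alpha>) \<partial>lborel)"
    by (rule nn_integral_cong) (simp add: indicator_def infdist_frontier_ball del: frontier_ball)
  ultimately show ?thesis by (simp add: weighted_Lp_def wint_def)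
qed

section \<open>Repeated division by the weight\<close>

lemma polyharmonic_continuous: "u \<in> polyharmonic N \<Longrightarrow> continuous_on (ball 0 1) u"
  using Ck_continuous unfolding polyharmonic_def by blast

lemma wint_set_integrable:
  fixes u :: "'a::euclidean_space \<Rightarrow> complex"
  assumes u: "continuous_on (ball 0 1) u" and w: "wint 1 \<gamma> u"
  shows "set_integrable lborel (ball 0 1) (\<lambda>x. norm (u x) * (1 - norm x) powr \<gamma>)"
  unfolding set_integrable_def
proof (rule integrableI_bounded)
  have "continuous_on (ball 0 1) (\<lambda>x. norm (u x) * (1 - norm x) powr \<gamma>)"
    by (intro continuous_on_mult continuous_on_norm u continuous_dist_powr)
  from borel_measurable_continuous_on_indicator[OF _ this]
  show "(\<lambda>x. indicator (ball 0 1) x *\<^sub>R (norm (u x) * (1 - norm x) powr \<gamma>)) \<in> borel_measurable lborel" by simp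
  have "(\<integral>\<^sup>+x. ennreal (norm (indicator (ball 0 1) x *\<^sub>R (norm (u x) * (1 - norm x) powr \<gamma>))) \<partial>lborel)
     = (\<integral>\<^sup>+x\<in>ball 0 1. ennreal (norm (u x) powr 1 * (1 - norm x) powr \<gamma>) \<partial>lborel)"
    by (rule nn_integral_cong) (simp add: indicator_def abs_mult)
  then show "(\<integral>\<^sup>+x. ennreal (norm (indicator (ball 0 1) x *\<^sub>R (norm (u x) * (1 - norm x) powr \<gamma>))) \<partial>lborel) < \<infinity>"
    using w by (simp add: wint_def)
qed

lemma norm_divide_weight_le:
  fixes x :: "'a::euclidean_space"
  assumes "x \<in> ball 0 1"
  shows "norm (z / wt x ^ k) \<le> norm z * (1 - norm x) powr (- real k)"
proof -
  have d: "0 < 1 - norm x" using assms by simp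
  have w: "1 - norm x \<le> 1 - x \<bullet> x" using one_minus_norm_le_radius[of x] assms by simp
  have "norm (wt x ^ k) = (1 - x \<bullet> x) ^ k" using d w by (simp add: norm_power del: of_real_diff)
  moreover have "(1 - norm x) ^ k \<le> (1 - x \<bullet> x) ^ k" by (rule power_mono[OF w]) (use d in simp)
  moreover have "0 < (1 - norm x) ^ k" using d by simp
  ultimately have "norm z / norm (wt x ^ k) \<le> norm z / (1 - norm x) ^ k" by (simp only: divide_left_mono mult_pos_pos norm_ge_zero order_less_le_trans)
  moreover have "norm z * (1 - norm x) powr (- real k) = norm z / (1 - norm x) ^ k"
    using d by (simp only: powr_minus powr_realpow divide_inverse)
  ultimately show ?thesis by (simp only: norm_divide)
qed

lemma wint_divide_weight:
  fixes u :: "'a::euclidean_space \<Rightarrow> complex"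
  assumes u: "continuous_on (ball 0 1) u" "wint p \<alpha> u" and p: "0 < p"
  shows "wint p (\<alpha> + real k * p) (\<lambda>x. u x / wt x ^ k)"
proof (rule wint_bound[OF u(2,1) p, of 1])
  fix x :: 'a assume x: "x \<in> ball 0 1"
  have "norm (u x / wt x ^ k) powr p \<le> (norm (u x) * (1 - norm x) powr (- real k)) powr p"
    by (rule powr_mono2) (use p norm_divide_weight_le[OF x] in auto)
  also have "\<dots> = norm (u x) powr p * (1 - norm x) powr (- (real k * p))" by (simp add: powr_mult powr_powr)
  finally have "norm (u x / wt x ^ k) powr p * (1 - norm x) powr (\<alpha> + real k * p)
     \<le> (norm (u x) powr p * (1 - norm x) powr (- (real k * p))) * (1 - norm x) powr (\<alpha> + real k * p)"
    by (rule mult_right_mono) simp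
  also have "\<dots> = norm (u x) powr p * (1 - norm x) powr \<alpha>"
    using powr_add[of "1 - norm x" "- (real k * p)" "\<alpha> + real k * p"] by (simp add: mult.assoc)
  finally show "norm (u x / wt x ^ k) powr p * (1 - norm x) powr (\<alpha> + real k * p) \<le> 1 * (norm (u x) powr p * (1 - norm x) powr \<alpha>)" by simp
qed simp

text \<open>The k-th division is applied to u / w^(k - 1), whose exponent has moved to \<gamma> + k
  - 1; this must lie below -1, which reads \<gamma> < -k.\<close>

lemma polyharmonic_divide_weight_power:
  fixes u :: "'a::euclidean_space \<Rightarrow> complex"
  assumes u: "u \<in> polyharmonic N" and n: "DIM('a) \<ge> 2" and w: "wint 1 \<gamma> u"
  shows "k \<le> N \<Longrightarrow> k = 0 \<or> \<gamma> < - real k \<Longrightarrow> (\<lambda>x. u x / wt x ^ k) \<in> polyharmonic (N - k)"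
proof (induction k)
  case 0 then show ?case using u by simp
next
  case (Suc k)
  then have IH: "(\<lambda>x. u x / wt x ^ k) \<in> polyharmonic (N - k)" and k: "k < N" "\<gamma> + real k < - 1" by auto
  have "wint 1 (\<gamma> + real k) (\<lambda>x. u x / wt x ^ k)"
    using wint_divide_weight[OF polyharmonic_continuous[OF u] w, of k] by simp
  then have i: "set_integrable lborel (ball 0 1) (\<lambda>x. norm (u x / wt x ^ k) * (1 - norm x) powr (\<gamma> + real k))"
    by (rule wint_set_integrable[OF polyharmonic_continuous[OF IH]])
  have "(\<lambda>x. u x / wt x ^ k / wt x) \<in> polyharmonic (N - k - 1)"
    by (rule polyharmonic_divide_weight[OF IH _ n k(2) i]) (use k in simp)
  then show ?case by (simp add: mult.commute del: of_real_diff)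
qed

text \<open>Split |u| as |u|^p |u|^(1 - p) and use the growth bound |u| = O(d^(-(n + \<alpha>)/p))
  for the second factor; the new exponent is the one for which the total power of d is again
  \<alpha>.\<close>

lemma wint_growth:
  fixes u :: "'a::euclidean_space \<Rightarrow> complex"
  assumes p: "0 < p" "p \<le> 1" and u: "u \<in> polyharmonic N" and w: "wint p \<alpha> u"
  shows "wint 1 ((\<alpha> + real DIM('a)) / p - real DIM('a)) u"
proof -
  let ?n = "real DIM('a)"
  obtain A where A: "A \<ge> 0" "\<And>x. x \<in> ball 0 1 \<Longrightarrow> norm (u x) powr p \<le> A * (1 - norm x) powr (- ?n - \<alpha>)"
    using polyharmonic_growth[OF p u w] by blast
  show ?thesis
  proof (rule wint_bound[OF w polyharmonic_continuous[OF u] p(1), of "A powr ((1 - p) / p)"])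
    fix x :: 'a assume x: "x \<in> ball 0 1"
    define d where "d = 1 - norm x"
    have d: "0 < d" using x by (simp add: d_def)
    have "norm (u x) = (norm (u x) powr p) powr (1 / p)" using p by (simp add: powr_powr)
    also have "\<dots> \<le> (A * d powr (- ?n - \<alpha>)) powr (1 / p)"
      unfolding d_def by (rule powr_mono2) (use p A(2)[OF x] in auto)
    finally have "norm (u x) \<le> norm (u x) powr p * ((A * d powr (- ?n - \<alpha>)) powr (1 / p)) powr (1 - p)"
      by (intro norm_split_powr) (use p in auto)
    also have "((A * d powr (- ?n - \<alpha>)) powr (1 / p)) powr (1 - p) = A powr ((1 - p) / p) * d powr ((- ?n - \<alpha>) * ((1 - p) / p))"
      using A(1) by (simp add: powr_powr powr_mult)
    finally have "norm (u x) * d powr ((\<alpha> + ?n) / p - ?n)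
        \<le> (norm (u x) powr p * (A powr ((1 - p) / p) * d powr ((- ?n - \<alpha>) * ((1 - p) / p)))) * d powr ((\<alpha> + ?n) / p - ?n)"
      by (rule mult_right_mono) simp
    also have "\<dots> = A powr ((1 - p) / p) * (norm (u x) powr p * (d powr ((- ?n - \<alpha>) * ((1 - p) / p)) * d powr ((\<alpha> + ?n) / p - ?n)))"
      by (simp only: mult_ac)
    also have "d powr ((- ?n - \<alpha>) * ((1 - p) / p)) * d powr ((\<alpha> + ?n) / p - ?n) = d powr \<alpha>"
    proof -
      have "(- ?n - \<alpha>) * ((1 - p) / p) + ((\<alpha> + ?n) / p - ?n) = \<alpha>" using p by (simp add: field_simps)
      then show ?thesis by (simp only: powr_add[symmetric])
    qed
    finally show "norm (u x) powr 1 * (1 - norm x) powr ((\<alpha> + ?n) / p - ?n) \<le> A powr ((1 - p) / p) * (norm (u x) powr p * (1 - norm x) powr \<alpha>)"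
      by (simp add: d_def)
  qed simp
qed

section \<open>Uniqueness below the critical exponent\<close>

lemma divide_weight_zero:
  assumes "u x / wt x ^ k = 0" "x \<in> ball 0 1" shows "u x = 0"
  using assms wt_nonzero[OF assms(2)] by (simp del: of_real_diff)

lemma uniqueness_le_1:
  fixes u :: "'a::euclidean_space \<Rightarrow> complex"
  assumes n: "DIM('a) \<ge> 2" and p: "0 < p" "p \<le> 1" "(real DIM('a) - 2) / (real DIM('a) - 1) \<le> p"
    and u: "u \<in> polyharmonic N" and w: "wint p \<alpha> u" and \<alpha>: "\<And>j. j \<le> N \<Longrightarrow> \<alpha> < b_exponent DIM('a) j N p" and x: "x \<in> ball 0 1"
  shows "u x = 0"
proof -
  let ?n = "real DIM('a)"
  define \<gamma> where "\<gamma> = (\<alpha> + ?n) / p - ?n"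
  have w1: "wint 1 \<gamma> u" unfolding \<gamma>_def by (rule wint_growth[OF p(1,2) u w])
  \<comment> \<open>\<open>P j\<close> says that \<gamma> permits N - j divisions by w; for j = N no
    division is made.\<close>
  define P where "P j \<longleftrightarrow> j = N \<or> \<gamma> < - (real N - real j)" for j
  define j where "j = (LEAST j. P j)"
  have Pj: "P j" unfolding j_def by (rule LeastI[of P N]) (simp add: P_def)
  have jN: "j \<le> N" unfolding j_def by (rule Least_le) (simp add: P_def)
  define v where "v = (\<lambda>x. u x / wt x ^ (N - j))"
  have "v \<in> polyharmonic (N - (N - j))" unfolding v_def
    by (rule polyharmonic_divide_weight_power[OF u n w1]) (use Pj jN in \<open>auto simp: P_def of_nat_diff\<close>)
  then have v: "v \<in> polyharmonic j" using jN by simp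
  have "v x = 0"
  proof (cases j)
    case 0 then show ?thesis using v x by (simp add: polyharmonic_def)
  next
    case (Suc i)
    \<comment> \<open>Minimality of j: one further division is not permitted, so \<alpha> is at
      least the second entry of the maximum in \<open>b_exponent\<close>, and being below the
      maximum it is below the first entry.\<close>
    have "\<not> P i" using not_less_Least[of i P] Suc unfolding j_def by simp
    then have "- (real N - real i) \<le> \<gamma>" by (simp add: P_def)
    then have "(?n - (real N - real i)) * p \<le> (\<alpha> + ?n) / p * p" using p by (intro mult_right_mono) (auto simp: \<gamma>_def)
    moreover have "(\<alpha> + ?n) / p * p = \<alpha> + ?n" using p by simp
    ultimately have "(?n - (real N - real i)) * p \<le> \<alpha> + ?n" by simp
    then have "- ?n - (real N - real j - ?n + 1) * p \<le> \<alpha>" using Suc by (simp add: algebra_simps)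
    then have \<alpha>': "\<alpha> < - 1 - (real N + real j - 1) * p" using \<alpha>[OF jN] Suc by (auto simp: b_exponent_def)
    have wv: "wint p (\<alpha> + real (N - j) * p) v" unfolding v_def by (rule wint_divide_weight[OF polyharmonic_continuous[OF u] w p(1)])
    have "\<alpha> + real (N - j) * p < - 1 - (2 * real j - 1) * p" using \<alpha>' jN by (simp add: of_nat_diff algebra_simps)
    then show ?thesis by (rule polyharmonic_zero_of_wint[OF n p v wv _ x])
  qed
  then show ?thesis unfolding v_def by (rule divide_weight_zero[OF _ x])
qed

text \<open>Young's inequality gives |u| d^\<gamma> <= |u|^p d^\<alpha> + d^s with s = (\<gamma> p -
  \<alpha>)/(p - 1). Integrability of d^s asks for \<gamma> > (\<alpha> - p + 1)/p and N divisions
  ask for \<gamma> < -N; the hypothesis on \<alpha> makes the two compatible.\<close>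

lemma uniqueness_gt_1:
  fixes u :: "'a::euclidean_space \<Rightarrow> complex"
  assumes n: "DIM('a) \<ge> 2" and p: "1 < p"
    and u: "u \<in> polyharmonic N" and w: "wint p \<alpha> u" and \<alpha>: "\<alpha> < - 1 - (real N - 1) * p" and x: "x \<in> ball 0 1"
  shows "u x = 0"
proof -
  define q where "q = p / (p - 1)"
  have q: "1 < q" "1 / p + 1 / q = 1" using p by (simp_all add: q_def field_simps)
  have "(\<alpha> - p + 1) / p < - real N" using \<alpha> p by (simp add: field_simps)
  then obtain \<gamma> where \<gamma>: "(\<alpha> - p + 1) / p < \<gamma>" "\<gamma> < - real N" using dense by blast
  define s where "s = (\<gamma> - \<alpha> / p) * q"
  have "\<alpha> - p + 1 < \<gamma> * p" using \<gamma>(1) p by (simp add: pos_divide_less_eq)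
  moreover have "s = (\<gamma> * p - \<alpha>) / (p - 1)" using p unfolding s_def q_def by (simp add: field_simps)
  ultimately have s: "- 1 < s" using p by (simp add: pos_less_divide_eq)
  have cu: "continuous_on (ball 0 1) u" by (rule polyharmonic_continuous[OF u])
  \<comment> \<open>The constant function \<open>wpow 0\<close> serves to express integrability of
    (1 - |x|)^s.\<close>
  have ws: "wint 1 s (wpow 0 :: 'a \<Rightarrow> complex)" by (rule wpow_wint[OF n]) (use s in simp_all)
  have "wint 1 \<gamma> u"
  proof (rule wint_dominated[where C = 1 and h = "\<lambda>x. norm (u x) powr p * (1 - norm x) powr \<alpha> + (1 - norm x) powr s"])
    fix x :: 'a assume x: "x \<in> ball 0 1"
    define d where "d = 1 - norm x"
    have d: "0 < d" using x by (simp add: d_def)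
    have "norm (u x) * d powr \<gamma> = (norm (u x) * d powr (\<alpha> / p)) * d powr (\<gamma> - \<alpha> / p)"
      using powr_add[of d "\<alpha> / p" "\<gamma> - \<alpha> / p"] by (simp add: mult.assoc)
    also have "\<dots> \<le> (norm (u x) * d powr (\<alpha> / p)) powr p / p + (d powr (\<gamma> - \<alpha> / p)) powr q / q"
      by (rule Youngs_inequality[OF p q]) auto
    also have "\<dots> \<le> (norm (u x) * d powr (\<alpha> / p)) powr p + (d powr (\<gamma> - \<alpha> / p)) powr q"
      using p q by (intro add_mono divide_le_eq[THEN iffD2]) (auto simp: mult_le_cancel_left1)
    also have "\<dots> = norm (u x) powr p * d powr \<alpha> + d powr s"
      using p by (simp add: powr_mult powr_powr s_def)
    finally show "norm (u x) powr 1 * (1 - norm x) powr \<gamma> \<le> 1 * (norm (u x) powr p * (1 - norm x) powr \<alpha> + (1 - norm x) powr s)"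
      by (simp add: d_def)
  next
    show "continuous_on (ball 0 1) (\<lambda>x. norm (u x) powr p * (1 - norm x) powr \<alpha> + (1 - norm x) powr s)"
      by (intro continuous_on_add continuous_on_mult continuous_norm_powr continuous_dist_powr cu) (use p in simp)
    have "(\<integral>\<^sup>+x\<in>ball 0 1. ennreal (norm (u x) powr p * (1 - norm x) powr \<alpha> + (1 - norm x) powr s) \<partial>lborel)
      = (\<integral>\<^sup>+x. ennreal (norm (u x) powr p * (1 - norm x) powr \<alpha>) * indicator (ball 0 1) x
          + ennreal (norm (wpow 0 x :: complex) powr 1 * (1 - norm x) powr s) * indicator (ball 0 1) x \<partial>lborel)"
      by (rule nn_integral_cong) (simp add: indicator_def ennreal_plus)
    also have "\<dots> = (\<integral>\<^sup>+x\<in>ball 0 1. ennreal (norm (u x) powr p * (1 - norm x) powr \<alpha>) \<partial>lborel)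
       + (\<integral>\<^sup>+x\<in>ball (0::'a) 1. ennreal (norm (wpow 0 x :: complex) powr 1 * (1 - norm x) powr s) \<partial>lborel)"
      by (rule nn_integral_add)
        (use wint_measurable[OF cu, of p \<alpha>] wint_measurable[OF Ck_continuous[OF Ck_wpow[OF open_ball, of 0]], of 1 0 s] p in simp_all)
    also have "\<dots> < \<infinity>" using w ws by (simp add: wint_def)
    finally show "(\<integral>\<^sup>+x\<in>ball 0 1. ennreal (norm (u x) powr p * (1 - norm x) powr \<alpha> + (1 - norm x) powr s) \<partial>lborel) < \<infinity>" .
  qed simp_all
  then have "(\<lambda>x. u x / wt x ^ N) \<in> polyharmonic (N - N)"
    by (rule polyharmonic_divide_weight_power[OF u n]) (use \<gamma> in auto)
  then have "u x / wt x ^ N = 0" using x by (simp add: polyharmonic_def del: of_real_diff divide_eq_0_iff)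
  then show ?thesis by (rule divide_weight_zero[OF _ x])
qed

text \<open>The two integrability conditions of \<open>kernel_wint\<close>, at the boundary and at
  e, are the two entries of the maximum in \<open>b_exponent\<close>; j = 0 corresponds to a power
  of w alone. The witnesses do not vanish at the origin, where w = |x - e| = 1.\<close>

lemma integrability_existence:
  assumes n: "DIM('a::euclidean_space) \<ge> 2" and N: "N \<ge> 1" and p: "0 < p" and j: "j \<le> N" and \<alpha>: "b_exponent DIM('a) j N p < \<alpha>"
  shows "\<exists>u :: 'a \<Rightarrow> complex. u \<in> polyharmonic N \<and> u 0 \<noteq> 0 \<and> wint p \<alpha> u"
proof (cases "j = 0")
  case True
  have "wint p \<alpha> (wpow (N - 1) :: 'a \<Rightarrow> complex)"
    by (rule wpow_wint[OF n p]) (use \<alpha> True N in \<open>simp add: b_exponent_def of_nat_diff\<close>)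
  then show ?thesis using wpow_polyharmonic[OF N] by (intro exI[of _ "wpow (N - 1)"]) (simp add: wpow_def)
next
  case False
  obtain e :: 'a where e: "norm e = 1" using norm_Basis SOME_Basis by blast
  have 1: "- 1 < (real N + real j - 1) * p + \<alpha>" and 2: "- real DIM('a) - (real N - real j - real DIM('a) + 1) * p < \<alpha>"
    using \<alpha> False by (auto simp: b_exponent_def)
  have i: "real (N + j - 1) = real N + real j - 1" using N by simp
  have "wint p \<alpha> (\<lambda>x. wpow (N + j - 1) x * pole e (- (real DIM('a) / 2 + real j - 1)) x)"
  proof (rule kernel_wint[OF e n p])
    show "2 * (real DIM('a) / 2 + real j - 1) * p < real DIM('a) + (real (N + j - 1) * p + \<alpha>)"
      using 2 unfolding i by (simp add: algebra_simps)
  qed (use 1 False in \<open>simp_all add: i\<close>)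
  moreover have "e \<bullet> e = 1" using e by (simp add: norm_eq_1)
  ultimately show ?thesis using kernel_polyharmonic[OF e, of j N] False j
    by (intro exI[of _ "\<lambda>x. wpow (N + j - 1) x * pole e (- (real DIM('a) / 2 + real j - 1)) x"]) (simp add: wpow_def pole_def)
qed

theorem critical_integrability_type_eq:
  assumes n: "DIM('a::euclidean_space) \<ge> 2" and N: "N \<ge> 1" and p: "0 < p" "(real DIM('a) - 2) / (real DIM('a) - 1) \<le> p"
  shows "critical_integrability_type TYPE('a) N p = ereal (MIN j\<in>{0..N}. b_exponent DIM('a) j N p)"
proof (rule antisym)
  let ?b = "\<lambda>j. b_exponent DIM('a) j N p"
  let ?B = "MIN j\<in>{0..N}. ?b j"
  show "critical_integrability_type TYPE('a) N p \<le> ereal ?B"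
  \<comment> \<open>Only exponents above \<open>?b j\<close> are known to be admissible for the
    extremal function, hence the room \<epsilon>.\<close>
  proof (rule ereal_le_epsilon2)
    fix \<epsilon> :: real assume \<epsilon>: "0 < \<epsilon>"
    have "?B \<in> ?b ` {0..N}" by (rule Min_in) auto
    then obtain j where "?B = ?b j" "j \<in> {0..N}" by (rule imageE)
    then have j: "j \<le> N" "?B = ?b j" by simp_all
    obtain u :: "'a \<Rightarrow> complex" where u: "u \<in> polyharmonic N" "u 0 \<noteq> 0" "wint p (?b j + \<epsilon>) u"
      using integrability_existence[OF n N p(1) j(1), of "?b j + \<epsilon>"] \<epsilon> by auto
    have "critical_integrability_type TYPE('a) N p \<le> integrability_type p u"
      unfolding critical_integrability_type_def using u by (intro Inf_lower imageI CollectI conjI bexI[of _ 0]) auto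
    also have "\<dots> \<le> ereal (?b j + \<epsilon>)"
      unfolding integrability_type_def using u(3) weighted_Lp_iff[OF polyharmonic_continuous[OF u(1)]]
      by (intro Inf_lower imageI CollectI) simp
    finally show "critical_integrability_type TYPE('a) N p \<le> ereal ?B + ereal \<epsilon>" by (simp add: j(2))
  qed
  show "ereal ?B \<le> critical_integrability_type TYPE('a) N p"
    unfolding critical_integrability_type_def
  proof (rule Inf_greatest, safe)
    fix u :: "'a \<Rightarrow> complex" and x :: 'a assume u: "u \<in> polyharmonic N" and x: "x \<in> ball 0 1" "u x \<noteq> 0"
    show "ereal ?B \<le> integrability_type p u"
      unfolding integrability_type_def
    proof (rule Inf_greatest, safe)
      fix \<alpha> assume "u \<in> weighted_Lp p \<alpha>"
      then have w: "wint p \<alpha> u" using weighted_Lp_iff[OF polyharmonic_continuous[OF u]] by simp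
      show "ereal ?B \<le> ereal \<alpha>"
      proof (rule ccontr)
        assume "\<not> ereal ?B \<le> ereal \<alpha>"
        then have "\<alpha> < ?B" by (simp only: ereal_less_eq not_le)
        moreover have "?B \<le> ?b j" if "j \<le> N" for j using that by (intro Min_le) auto
        ultimately have \<alpha>: "\<alpha> < ?b j" if "j \<le> N" for j using that by (meson less_le_trans)
        have "u x = 0"
        proof (cases "p \<le> 1")
          case True show ?thesis by (rule uniqueness_le_1[OF n p(1) True p(2) u w \<alpha> x(1)])
        next
          case False show ?thesis
            by (rule uniqueness_gt_1[OF n _ u w _ x(1)]) (use False \<alpha>[of 0] in \<open>simp_all add: b_exponent_def\<close>)
        qed
        then show False using x by simp
      qed
    qed
  qed
qed

text \<open>For j >= 1 the second entry of the maximum grows by p with each j, so j >= 2 never beats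
  the better of j = 0 and j = 1. The regimes are separated by the signs of n p - (n - 1), which
  decides the maximum at j = 1, and of p - 1, which decides between j = 0 and j = 1.\<close>

lemma Min_b_exponent:
  assumes n: "n \<ge> 3" and N: "N \<ge> 1" and p: "0 < p" "(real n - 2) / (real n - 1) \<le> p"
  shows "(MIN j\<in>{0..N}. b_exponent n j N p) = (if p < (real n - 1) / real n then - 1 - real N * p
            else if p < 1 then - real n - (real N - real n) * p else - 1 - (real N - 1) * p)"
proof -
  define m where "m = real n"
  define M where "M = real N"
  have m: "m \<ge> 3" using n by (simp add: m_def)
  have p2: "m - 2 \<le> p * (m - 1)" using p(2) m by (simp add: m_def[symmetric] pos_divide_le_eq)
  have b0: "b_exponent n 0 N p = - 1 - (M - 1) * p" by (simp add: b_exponent_def M_def)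
  have b1: "b_exponent n 1 N p = max (- 1 - M * p) (- m - (M - m) * p)" by (simp add: b_exponent_def M_def m_def)
  have bj: "- m - (M - m) * p + (real j - 1) * p \<le> b_exponent n j N p" if "j \<ge> 1" for j
    using that by (auto simp: b_exponent_def M_def m_def algebra_simps le_max_iff_disj)
  have mono: "c * p \<le> (real j - 1) * p" if "c \<le> real j - 1" for c j using that p by (intro mult_right_mono) auto
  have in0: "b_exponent n 0 N p \<in> (\<lambda>j. b_exponent n j N p) ` {0..N}" and in1: "b_exponent n 1 N p \<in> (\<lambda>j. b_exponent n j N p) ` {0..N}"
    using N by auto
  have MinI: "(MIN j\<in>{0..N}. b_exponent n j N p) = B"
    if "B = b_exponent n 0 N p \<or> B = b_exponent n 1 N p" "B \<le> b_exponent n 0 N p" "B \<le> b_exponent n 1 N p" "\<And>j. j \<ge> 2 \<Longrightarrow> B \<le> b_exponent n j N p" for B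
  proof (rule Min_eqI)
    show "B \<in> (\<lambda>j. b_exponent n j N p) ` {0..N}" using that(1) in0 in1 by metis
    fix y assume "y \<in> (\<lambda>j. b_exponent n j N p) ` {0..N}"
    then obtain j where y: "y = b_exponent n j N p" by auto
    consider "j = 0" | "j = 1" | "j \<ge> 2" by linarith
    then show "B \<le> y" using that(2-4) unfolding y by cases auto
  qed simp
  consider (1) "m * p < m - 1" | (2) "m - 1 \<le> m * p" "p < 1" | (3) "1 \<le> p" by linarith
  then show ?thesis
  proof cases
    case 1
    have c: "p < (real n - 1) / real n" using 1 m by (simp add: m_def pos_less_divide_eq mult.commute)
    have B: "b_exponent n 1 N p = - 1 - M * p" unfolding b1 using 1 by (simp add: algebra_simps)
    \<comment> \<open>What the comparison with j = 2 asks for. It follows from p >= (n - 2)/(n - 1),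
      because (n - 1)^2 <= (n + 1)(n - 2) for n >= 3.\<close>
    have key: "m - 1 \<le> (m + 1) * p"
    proof -
      have "(m - 1) * (m - 1) \<le> (m + 1) * (m - 2)" using m by (simp add: algebra_simps)
      also have "\<dots> \<le> (m + 1) * (p * (m - 1))" using p2 m by (intro mult_left_mono) auto
      finally have "(m - 1) * (m - 1) \<le> ((m + 1) * p) * (m - 1)" by (simp only: mult.assoc)
      then show ?thesis using m by (simp only: mult_le_cancel_right)
    qed
    have "(MIN j\<in>{0..N}. b_exponent n j N p) = - 1 - M * p"
    proof (rule MinI)
      show "- 1 - M * p \<le> b_exponent n 0 N p" unfolding b0 using p by (simp add: algebra_simps)
      show "- 1 - M * p \<le> b_exponent n j N p" if "j \<ge> 2" for j
      proof -
        have "- 1 - M * p \<le> - m - (M - m) * p + 1 * p" using key by (simp add: algebra_simps)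
        also have "\<dots> \<le> - m - (M - m) * p + (real j - 1) * p" by (intro add_left_mono mono) (use that in simp)
        also have "\<dots> \<le> b_exponent n j N p" by (rule bj) (use that in simp)
        finally show ?thesis .
      qed
    qed (use B in auto)
    then show ?thesis using c by (simp add: M_def)
  next
    case 2
    have c: "\<not> p < (real n - 1) / real n" using 2 m by (simp add: m_def pos_less_divide_eq mult.commute)
    have B: "b_exponent n 1 N p = - m - (M - m) * p" unfolding b1 using 2 by (simp add: algebra_simps)
    have "(MIN j\<in>{0..N}. b_exponent n j N p) = - m - (M - m) * p"
    proof (rule MinI)
      have "(m - 1) * p \<le> (m - 1) * 1" using m 2 by (intro mult_left_mono) auto
      then show "- m - (M - m) * p \<le> b_exponent n 0 N p" unfolding b0 by (simp add: algebra_simps)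
      show "- m - (M - m) * p \<le> b_exponent n j N p" if "j \<ge> 2" for j
        using bj[of j] mono[of 0 j] that by simp
    qed (use B in auto)
    then show ?thesis using c 2 by (simp add: M_def m_def)
  next
    case 3
    have "m - 1 < m * 1" by simp
    also have "m * 1 \<le> m * p" using m 3 by (intro mult_left_mono) auto
    finally have c: "\<not> p < (real n - 1) / real n" using m by (simp add: m_def pos_less_divide_eq mult.commute)
    have "(m - 1) * 1 \<le> (m - 1) * p" using m 3 by (intro mult_left_mono) auto
    then have base: "- 1 - (M - 1) * p \<le> - m - (M - m) * p" by (simp add: algebra_simps)
    have "(MIN j\<in>{0..N}. b_exponent n j N p) = - 1 - (M - 1) * p"
    proof (rule MinI)
      show "- 1 - (M - 1) * p \<le> b_exponent n 1 N p" unfolding b1 using base by simp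
      show "- 1 - (M - 1) * p \<le> b_exponent n j N p" if "j \<ge> 2" for j
        using bj[of j] mono[of 0 j] that base by simp
    qed (use b0 in auto)
    then show ?thesis using c 3 by (simp add: M_def)
  qed
qed

theorem theorem1p2:
  fixes N :: nat and p :: real
  assumes "CARD('n::finite) \<ge> 2"
    and "N \<ge> 1"
    and "0 < p"
    and "(real CARD('n) - 2) / (real CARD('n) - 1) \<le> p"
  shows "critical_integrability_type TYPE(real ^ 'n) N p
           = ereal (MIN j\<in>{0..N}. b_exponent CARD('n) j N p) \<and>
         (CARD('n) \<ge> 3 \<longrightarrow>
           critical_integrability_type TYPE(real ^ 'n) N p
             = ereal (if p < (real CARD('n) - 1) / real CARD('n) then - 1 - real N * p
                      else if p < 1 then - real CARD('n) - (real N - real CARD('n)) * p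
                      else - 1 - (real N - 1) * p))"
proof -
  have n: "DIM(real ^ 'n) = CARD('n)" by simp
  have eq: "critical_integrability_type TYPE(real ^ 'n) N p = ereal (MIN j\<in>{0..N}. b_exponent CARD('n) j N p)"
    using critical_integrability_type_eq[where 'a = "real ^ 'n", unfolded n, OF assms] .
  show ?thesis
  proof (intro conjI impI)
    assume n3: "CARD('n) \<ge> 3"
    show "critical_integrability_type TYPE(real ^ 'n) N p
             = ereal (if p < (real CARD('n) - 1) / real CARD('n) then - 1 - real N * p
                      else if p < 1 then - real CARD('n) - (real N - real CARD('n)) * p
                      else - 1 - (real N - 1) * p)"
      unfolding eq Min_b_exponent[OF n3 assms(2-4)] ..
  qed (rule eq)
qed

end
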